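(* For every integer $N>0$, as $x\to\infty$, \[ \mathcal R_3(x)=\frac16(\log_2x+\beta)^3+\frac{P(2)-\zeta(2)}{2}(\log_2x+\beta)+\frac{P(3)+\zeta(3)}{3}+\sum_{1\le j<N}\frac{\alpha_j(\log_2x+\beta)-r_j}{(\log x)^j}+O_N\Bigl(\frac{\log_2x}{(\log x)^N}\Bigr), \] where \[ r_j=\frac{2^{j-1}\alpha_{j,2}}{j}+\sum_{i=1}^{j-1}\Bigl(\frac{\alpha_j}{i}+i\binom{j-1}{i}\frac{\alpha_i\alpha_{j-i}}{2}\Bigr). \]
   Context: $p$ denotes primes; $\log_2x=\log\log x$. $\Omega(n)$ is the number of prime factors of $n$ counted with multiplicity, and $\mathcal R_k(x)=\sum_{n\le x,\ \Omega(n)=k}1/n$. $\zeta(s)=\sum_{n\ge1}n^{-s}$ and $P(s)=\sum_p p^{-s}$ (prime zeta function). $\beta=\gamma+\sum_p\bigl(1/p+\log(1-1/p)\bigr)$ is the Mertens constant, $\gamma$ Euler's constant. For $j\ge1$, $\alpha_j=\lim_{x\to\infty}\frac1j\bigl(\frac{(\log x)^j}{j}-\sum_{p\le x}\frac{(\log p)^j}{p}\bigr)$, and for $j\ge0$, $a>1$, $\alpha_{j,a}=\sum_p(\log p)^j/p^a$. *)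

theory Defs
  imports
    "HOL-Analysis.Analysis"
    "HOL-Computational_Algebra.Computational_Algebra"
    "HOL-Library.Landau_Symbols"
begin

definition Omega :: "nat \<Rightarrow> nat" where
  "Omega n = size (prime_factorization n)"

definition recip_sum :: "nat \<Rightarrow> real \<Rightarrow> real" where
  "recip_sum k x = (\<Sum>n | n \<ge> 1 \<and> real n \<le> x \<and> Omega n = k. 1 / real n)"

text \<open>The series below converge absolutely in the ranges where they are used (\<open>s > 1\<close>, \<open>a > 1\<close>),
  so unordered sums agree with the ordered ones.\<close>

definition zeta :: "real \<Rightarrow> real" where
  "zeta s = (\<Sum>\<^sub>\<infinity>n\<in>{1::nat..}. real n powr (-s))"

definition prime_zeta :: "real \<Rightarrow> real" where
  "prime_zeta s = (\<Sum>\<^sub>\<infinity>p\<in>{p::nat. prime p}. real p powr (-s))"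

definition mertens_const :: real where
  "mertens_const = euler_mascheroni +
     (\<Sum>\<^sub>\<infinity>p\<in>{p::nat. prime p}. 1 / real p + ln (1 - 1 / real p))"

definition alpha :: "nat \<Rightarrow> real" where
  "alpha j = Lim at_top (\<lambda>x::real. 1 / real j *
     (ln x ^ j / real j - (\<Sum>p | prime p \<and> real p \<le> x. ln (real p) ^ j / real p)))"

definition alpha_pow :: "nat \<Rightarrow> real \<Rightarrow> real" where
  "alpha_pow j a = (\<Sum>\<^sub>\<infinity>p\<in>{p::nat. prime p}. ln (real p) ^ j / real p powr a)"

definition r_coeff :: "nat \<Rightarrow> real" where
  "r_coeff j = 2 ^ (j - 1) * alpha_pow j 2 / real j +
     (\<Sum>i = 1..j - 1. alpha j / real i +
        real i * real ((j - 1) choose i) * (alpha i * alpha (j - i) / 2))"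

end

theory Submission
  imports Defs "HOL-Complex_Analysis.Complex_Analysis" "HOL-Probability.Probability" "HOL-Real_Asymp.Real_Asymp"
begin

text \<open>
  Write \<open>m(u)\<close> for the sum of \<open>1/p\<close> over the primes with \<open>ln p \<le> u\<close>, and
  \<open>m(u) = ln u + \<beta> + e(u)\<close>.  The function \<open>s \<zeta>(1 + s)\<close> continues to \<open>Re s > -1/2\<close> by an
  explicit series, and the Euler product with the 3-4-1 inequality bounds it from below up to
  \<open>Re s = 0\<close>; hence every derivative of the Laplace transform of \<open>e\<close> grows at most linearly on
  \<open>Re s > 0\<close>.  Gaussian smoothing together with the slow decrease of \<open>e\<close> turns this into
  \<open>e(u) = O(u\<^sup>-\<^sup>K)\<close> for every \<open>K\<close>, without contour integration.

  The twofold antiderivative of the sum of \<open>1/(pqr)\<close> over ordered triples with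
  \<open>pqr \<le> e\<^sup>u\<close> is the convolution \<open>m * m * m\<close>.  Expanding \<open>m = (ln + \<beta>) + e\<close>, the powers of the
  main part are Beta-type integrals, which produce \<open>\<zeta>(2)\<close> and \<open>\<zeta>(3)\<close>, while Taylor expansion of
  the main part against the rapidly decaying \<open>e\<close> produces the moments of \<open>e\<close>, that is, the
  \<open>\<alpha>\<^sub>j\<close>.  Second differences recover the sum itself by monotonicity.  Finally
  \<open>h\<^sub>3 = p\<^sub>1\<^sup>3/6 + p\<^sub>1 p\<^sub>2/2 + p\<^sub>3/3\<close> passes from ordered triples to integers with three prime
  factors.
\<close>

section \<open>Continuation of \<open>s \<zeta>(1 + s)\<close>\<close>

text \<open>The obstacle is the logarithmic singularity at \<open>s = 0\<close>: the Laplace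
  transform of \<open>err\<close> is (P(1+s) + log s + gamma - beta)/s, where P(1+s) is the sum of
  p^(-1-s). The numerator tends to 0 at the origin and has derivative \<open>Vfun\<close>, so the
  transform is the mean of \<open>Vfun\<close> over the segment from 0 to s. No branch of the
  logarithm and no division by s remain, and bounds for derivatives of \<open>Vfun\<close> carry
  over. The k-th derivative belongs to v^k \<open>err\<close>. A Gaussian window of width h turns
  linear growth into C/h, uniformly in its centre, so decay comes from the factor v^k alone: k =
  3N+2 and h = u^(-N-1) give u^(-N). Because \<open>msum\<close> increases, \<open>err\<close> falls
  no faster than \<open>ln\<close> rises; a large value therefore fills a whole window. Convolving
  functions instead of measures keeps everything locally square integrable, a class that contains
  \<open>ln\<close> near 0. The price is the second difference: with step h = u^(-N) its error is
  divided by h^2, so the double antiderivative must be known up to u^(-3N). The sums of 1/i in r_j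
  are harmonic numbers from the higher derivatives of x (ln x)^2.\<close>

lemma holomorphic_on_suminf:
  fixes f :: "nat \<Rightarrow> complex \<Rightarrow> complex"
  assumes "open S"
    and hol: "\<And>n. f n holomorphic_on S"
    and M: "\<And>x. x \<in> S \<Longrightarrow> \<exists>d>0. cball x d \<subseteq> S \<and>
              (\<exists>M. summable M \<and> (\<forall>n. \<forall>y\<in>cball x d. norm (f n y) \<le> M n))"
  shows "(\<lambda>x. \<Sum>n. f n x) holomorphic_on S"
proof (rule holomorphic_uniform_sequence[OF \<open>open S\<close>, where f = "\<lambda>n x. \<Sum>i<n. f i x"])
  show "(\<lambda>x. \<Sum>i<n. f i x) holomorphic_on S" for n
    by (intro holomorphic_intros hol)
next
  fix x assume "x \<in> S"
  then obtain d M where d: "d > 0" "cball x d \<subseteq> S"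
    "summable M" "\<And>n y. y \<in> cball x d \<Longrightarrow> norm (f n y) \<le> M n"
    using M by metis
  have "uniform_limit (cball x d) (\<lambda>n x. \<Sum>i<n. f i x) (\<lambda>x. \<Sum>n. f n x) sequentially"
    by (rule Weierstrass_m_test[OF d(4) d(3)]) auto
  then show "\<exists>d>0. cball x d \<subseteq> S \<and>
      uniform_limit (cball x d) (\<lambda>n x. \<Sum>i<n. f i x) (\<lambda>x. \<Sum>n. f n x) sequentially"
    using d by blast
qed

text \<open>The terms are those of \<open>s \<zeta>(1 + s) - 1\<close>, with the telescoping series for \<open>1\<close>
  inserted to gain convergence to the left of \<open>Re s = 0\<close>.\<close>

definition zterm :: "nat \<Rightarrow> complex \<Rightarrow> complex" where
  "zterm n s = s * of_nat (Suc n) powr (- 1 - s) - of_nat (Suc n) powr (- s)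
     + of_nat (Suc (Suc n)) powr (- s)"

definition szeta :: "complex \<Rightarrow> complex" where
  "szeta s = 1 + (\<Sum>n. zterm n s)"

lemma zterm_holomorphic: "zterm n holomorphic_on A"
  unfolding zterm_def by (intro holomorphic_intros)

lemma norm_of_nat_powr: "norm (of_nat (Suc n) powr s :: complex) = real (Suc n) powr Re s"
  by (subst norm_powr_real_powr) auto

lemma has_vector_derivative_powr_real:
  fixes s :: complex
  assumes "x > 0"
  shows "((\<lambda>x. complex_of_real x powr s) has_vector_derivative s * of_real x powr (s - 1)) (at x within A)"
proof -
  have "((\<lambda>z. z powr s) has_field_derivative s * of_real x powr (s - 1)) (at (of_real x))"
    using assms by (intro has_field_derivative_powr) (auto simp: complex_nonpos_Reals_iff)
  then show ?thesis
    by (rule has_vector_derivative_real_field)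
qed

text \<open>Mean value bound; \<open>Re s \<le> 1\<close> makes the derivative largest at the left
  end \<open>a\<close>.\<close>

lemma norm_powr_diff_le:
  fixes s :: complex
  assumes "a > 0" "a \<le> b" "Re s \<le> 1"
  shows "norm (of_real b powr s - of_real a powr s) \<le> norm s * a powr (Re s - 1) * (b - a)"
proof -
  have "norm (of_real b powr s - of_real a powr s) \<le> (norm s * a powr (Re s - 1)) * norm (b - a)"
  proof (rule differentiable_bound[where S = "{a..b}" and f = "\<lambda>x. complex_of_real x powr s"
          and f' = "\<lambda>x h. h *\<^sub>R (s * of_real x powr (s - 1))"])
    fix x assume x: "x \<in> {a..b}"
    show "((\<lambda>x. complex_of_real x powr s) has_derivative (\<lambda>h. h *\<^sub>R (s * of_real x powr (s - 1)))) (at x within {a..b})"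
      using has_vector_derivative_powr_real[of x s "{a..b}"] x assms
      by (simp add: has_vector_derivative_def)
    have "x powr (Re s - 1) \<le> a powr (Re s - 1)"
      using x assms by (intro powr_mono2') auto
    then have "norm (s * of_real x powr (s - 1)) \<le> norm s * a powr (Re s - 1)"
      using x assms by (simp add: norm_mult norm_powr_real_powr mult_left_mono)
    then show "onorm (\<lambda>h::real. h *\<^sub>R (s * of_real x powr (s - 1))) \<le> norm s * a powr (Re s - 1)"
      by (simp add: onorm_scaleR_left onorm_id)
  qed (use assms in auto)
  then show ?thesis using assms by simp
qed

text \<open>First-order estimate: the power and the difference are treated separately. It is linear
  in |s|, but summable only for \<open>Re s > 0\<close>.\<close>

lemma norm_zterm_le1:
  assumes "Re s \<ge> - 1"
  shows "norm (zterm n s) \<le> 2 * norm s * real (Suc n) powr (- 1 - Re s)"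
proof -
  have "norm (of_real (real (Suc (Suc n))) powr (-s) - of_real (real (Suc n)) powr (-s) :: complex)
      \<le> norm (-s) * real (Suc n) powr (Re (-s) - 1) * (real (Suc (Suc n)) - real (Suc n))"
    by (rule norm_powr_diff_le) (use assms in auto)
  then have "norm (of_nat (Suc (Suc n)) powr (-s) - of_nat (Suc n) powr (-s) :: complex)
      \<le> norm s * real (Suc n) powr (- 1 - Re s)"
    by (simp add: minus_diff_commute)
  moreover have "norm (s * of_nat (Suc n) powr (- 1 - s)) = norm s * real (Suc n) powr (- 1 - Re s)"
    by (simp add: norm_mult norm_of_nat_powr del: of_nat_Suc)
  moreover have "norm (zterm n s) \<le> norm (s * of_nat (Suc n) powr (- 1 - s)) +
     norm (of_nat (Suc (Suc n)) powr (-s) - of_nat (Suc n) powr (-s) :: complex)"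
    unfolding zterm_def by (rule order_trans[OF _ norm_triangle_ineq]) (simp add: algebra_simps)
  ultimately show ?thesis by (simp del: of_nat_Suc)
qed

text \<open>Second-order estimate, exploiting the cancellation between the power and the difference.
  It is summable for \<open>Re s > - 1\<close>, but quadratic in s.\<close>

lemma norm_zterm_le2:
  assumes "Re s \<ge> - 1"
  shows "norm (zterm n s) \<le> norm s * norm (1 + s) * real (Suc n) powr (- 2 - Re s)"
proof -
  define a where "a = real (Suc n)"
  have a: "a > 0" "a \<ge> 1" by (auto simp: a_def)
  \<comment> \<open>The term is the increment of \<open>?f\<close> over \<open>{a..a+1}\<close>; the
    linear part is chosen so that \<open>?f'\<close> vanishes at \<open>x = a\<close>.\<close>
  let ?f = "\<lambda>x. of_real x * (s * of_real a powr (-1-s)) + complex_of_real x powr (-s)"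
  let ?f' = "\<lambda>x. s * of_real a powr (-1-s) + (-s) * of_real x powr (-s-1)"
  have "norm (?f (a+1) - ?f a) \<le> (norm s * norm (1 + s) * a powr (- 2 - Re s)) * norm (a + 1 - a)"
  proof (rule differentiable_bound[where S = "{a..a+1}" and f' = "\<lambda>x h. h *\<^sub>R ?f' x"])
    fix x assume x: "x \<in> {a..a+1}"
    have "(?f has_vector_derivative ?f' x) (at x within {a..a+1})"
      using has_vector_derivative_powr_real[of x "-s" "{a..a+1}"] x a
      by (auto intro!: derivative_eq_intros)
    then show "(?f has_derivative (\<lambda>h. h *\<^sub>R ?f' x)) (at x within {a..a+1})"
      by (simp add: has_vector_derivative_def)
    have "norm (of_real x powr (-1-s) - of_real a powr (-1-s) :: complex)
        \<le> norm (-1-s) * a powr (Re (-1-s) - 1) * (x - a)"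
      by (rule norm_powr_diff_le) (use assms a x in auto)
    also have "\<dots> \<le> norm (-1-s) * a powr (Re (-1-s) - 1) * 1"
      by (intro mult_left_mono) (use x a in auto)
    also have "norm (-1-s) = norm (1 + s)"
      by (metis minus_add_distrib norm_minus_cancel uminus_add_conv_diff add.commute)
    finally have *: "norm (of_real x powr (-1-s) - of_real a powr (-1-s) :: complex)
        \<le> norm (1 + s) * a powr (- 2 - Re s)" by simp
    have "?f' x = s * (of_real a powr (-1-s) - of_real x powr (-1-s))"
      by (simp add: algebra_simps minus_diff_commute)
    then have "norm (?f' x) = norm s * norm (of_real x powr (-1-s) - of_real a powr (-1-s) :: complex)"
      by (simp add: norm_mult norm_minus_commute)
    also have "\<dots> \<le> norm s * (norm (1 + s) * a powr (- 2 - Re s))"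
      by (intro mult_left_mono *) auto
    finally show "onorm (\<lambda>h::real. h *\<^sub>R ?f' x) \<le> norm s * norm (1 + s) * a powr (- 2 - Re s)"
      by (simp add: onorm_scaleR_left onorm_id mult.assoc)
  qed (use a in auto)
  moreover have "?f (a+1) - ?f a = zterm n s"
    by (simp add: zterm_def a_def algebra_simps)
  ultimately show ?thesis by (simp add: a_def)
qed

text \<open>Interpolation of the two preceding bounds, which read \<open>A\<close> and
  \<open>A * q\<close>, through min(1, q) \<le> q^(2d). A factor (1+|s|)^(2d) buys the decay
  n^(-2d), enough for convergence up to \<open>Re s = - d\<close>.\<close>

lemma norm_zterm_le:
  assumes "0 < d" "d \<le> 1/2" "Re s \<ge> - d"
  shows "norm (zterm n s) \<le> 2 * norm s * (1 + norm s) powr (2 * d) * real (Suc n) powr (- 1 - d)"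
proof (cases "s = 0")
  case True
  then show ?thesis by (simp add: zterm_def del: of_nat_Suc)
next
  case False
  define a where "a = real (Suc n)"
  have a: "a \<ge> 1" by (simp add: a_def)
  define x where "x = norm (zterm n s)"
  define A where "A = 2 * norm s * a powr (- 1 - Re s)"
  define q where "q = (1 + norm s) / a"
  have q: "q > 0" using a by (auto simp: q_def add_pos_nonneg)
  have A0: "A > 0" using False a by (auto simp: A_def)
  have x1: "x \<le> A"
    unfolding x_def A_def a_def by (rule norm_zterm_le1) (use assms in auto)
  have "x \<le> norm s * norm (1 + s) * a powr (- 2 - Re s)"
    unfolding x_def a_def by (rule norm_zterm_le2) (use assms in auto)
  also have "\<dots> \<le> norm s * (1 + norm s) * a powr (- 2 - Re s)"
    using norm_triangle_ineq[of 1 s] by (intro mult_right_mono mult_left_mono) auto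
  also have "\<dots> \<le> 2 * \<dots>" using a by simp
  also have "\<dots> = A * q"
  proof -
    have "a powr (- 2 - Re s) = a powr (- 1 - Re s) / a"
      using a by (simp add: powr_diff powr_minus field_simps power2_eq_square)
    then show ?thesis unfolding A_def q_def by simp
  qed
  finally have x2: "x \<le> A * q" .
  have "x \<le> A * q powr (2 * d)"
  proof (cases "q \<ge> 1")
    case True
    then have "1 \<le> q powr (2 * d)" using assms by (simp add: ge_one_powr_ge_zero)
    then have "A * 1 \<le> A * q powr (2 * d)" using A0 by (intro mult_left_mono) auto
    with x1 show ?thesis by simp
  next
    case F: False
    then have "q powr 1 \<le> q powr (2 * d)" using assms q by (intro powr_mono') auto
    then have "A * q \<le> A * q powr (2 * d)" using A0 q by (intro mult_left_mono) auto
    with x2 show ?thesis by simp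
  qed
  also have "A * q powr (2 * d) = 2 * norm s * (1 + norm s) powr (2 * d) * a powr (- 1 - Re s - 2 * d)"
    using a by (simp add: A_def q_def powr_divide powr_diff)
  also have "\<dots> \<le> 2 * norm s * (1 + norm s) powr (2 * d) * a powr (- 1 - d)"
    using a assms by (intro mult_left_mono powr_mono) auto
  finally show ?thesis by (simp add: x_def a_def)
qed

lemma summable_Suc_powr: "d > 0 \<Longrightarrow> summable (\<lambda>n. real (Suc n) powr (- 1 - d))"
  by (subst summable_Suc_iff) (auto simp: summable_real_powr_iff)

definition powsum :: "real \<Rightarrow> real" where
  "powsum d = (\<Sum>n. real (Suc n) powr (- 1 - d))"

lemma summable_zterm:
  assumes "0 < d" "d \<le> 1/2" "Re s \<ge> - d"
  shows "summable (\<lambda>n. norm (zterm n s))"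
  by (rule summable_comparison_test[OF _ summable_mult[OF summable_Suc_powr[of d]]])
     (use norm_zterm_le[OF assms] assms in auto)

text \<open>Growth only slightly faster than linear. The excess exponent \<open>2 * d\<close> is at
  free disposal, which later lets all losses together fit into one power of |s|.\<close>

lemma norm_szeta_le:
  assumes "0 < d" "d \<le> 1/2" "Re s \<ge> - d"
  shows "norm (szeta s) \<le> 1 + 2 * powsum d * norm s * (1 + norm s) powr (2 * d)"
proof -
  have "norm (\<Sum>n. zterm n s) \<le> (\<Sum>n. norm (zterm n s))"
    by (intro summable_norm summable_zterm[OF assms])
  also have "\<dots> \<le> (\<Sum>n. 2 * norm s * (1 + norm s) powr (2 * d) * real (Suc n) powr (- 1 - d))"
    by (intro suminf_le norm_zterm_le assms summable_zterm[OF assms] summable_mult summable_Suc_powr)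
  also have "\<dots> = 2 * norm s * (1 + norm s) powr (2 * d) * powsum d"
    unfolding powsum_def by (intro suminf_mult summable_Suc_powr assms)
  finally show ?thesis
    unfolding szeta_def using norm_triangle_ineq[of 1 "\<Sum>n. zterm n s"] by (simp add: algebra_simps)
qed

lemma szeta_holomorphic: "szeta holomorphic_on {s. Re s > - 1/2}"
proof -
  have "(\<lambda>s. \<Sum>n. zterm n s) holomorphic_on {s. Re s > - 1/2}"
  proof (rule holomorphic_on_suminf[OF open_halfspace_Re_gt zterm_holomorphic])
    fix x assume x: "x \<in> {s. Re s > - 1/2}"
    define d where "d = (Re x + 1/2) / 2"
    have d: "d > 0" using x by (simp add: d_def)
    have sub: "Re y > - 1/2" if "y \<in> cball x d" for y
    proof -
      have "\<bar>Re x - Re y\<bar> \<le> d"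
        using that abs_Re_le_cmod[of "x - y"] by (simp add: dist_norm)
      then have "Re x - Re y \<le> (Re x + 1/2) / 2" unfolding d_def by linarith
      then show ?thesis using x by simp
    qed
    show "\<exists>d>0. cball x d \<subseteq> {s. - 1/2 < Re s} \<and>
      (\<exists>M. summable M \<and> (\<forall>n. \<forall>y\<in>cball x d. norm (zterm n y) \<le> M n))"
    proof (intro exI[of _ d] conjI exI[of _ "\<lambda>n. (2 * (norm x + d) * (1 + (norm x + d)) powr (2 * (1/2))) * real (Suc n) powr (- 1 - 1/2)"] allI ballI)
      show "summable (\<lambda>n. (2 * (norm x + d) * (1 + (norm x + d)) powr (2 * (1/2))) * real (Suc n) powr (- 1 - 1/2))"
        by (intro summable_mult summable_Suc_powr) auto
      fix n y assume y: "y \<in> cball x d"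
      have ny: "norm y \<le> norm x + d"
        using y norm_triangle_ineq2[of y x] by (simp add: dist_norm norm_minus_commute)
      have "norm (zterm n y) \<le> 2 * norm y * (1 + norm y) powr (2 * (1/2)) * real (Suc n) powr (- 1 - 1/2)"
        using sub[OF y] by (intro norm_zterm_le) auto
      also have "\<dots> \<le> (2 * (norm x + d) * (1 + (norm x + d)) powr (2 * (1/2))) * real (Suc n) powr (- 1 - 1/2)"
        using ny d by (intro mult_right_mono mult_mono powr_mono2) auto
      finally show "norm (zterm n y) \<le> \<dots>" .
    qed (use d sub in auto)
  qed
  then show ?thesis unfolding szeta_def [abs_def] by (intro holomorphic_intros)
qed

lemma szeta_0: "szeta 0 = 1"
  by (simp add: szeta_def zterm_def del: of_nat_Suc)

lemma summable_zeta_real: "a > 1 \<Longrightarrow> summable (\<lambda>n. real (Suc n) powr (- a))"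
  using summable_Suc_powr[of "a - 1"] by simp

lemma summable_norm_zeta:
  assumes "Re s > 1"
  shows "summable (\<lambda>n. norm (of_nat (Suc n) powr (- s) :: complex))"
  using summable_zeta_real[OF assms] by (simp add: norm_of_nat_powr del: of_nat_Suc)

text \<open>For \<open>Re s > 0\<close> the inserted differences telescope to -1, which cancels the
  leading 1 of \<open>szeta\<close>.\<close>

lemma szeta_eq:
  assumes "Re s > 0"
  shows "szeta s = s * (\<Sum>n. of_nat (Suc n) powr (- 1 - s))"
proof -
  have sm: "summable (\<lambda>n. of_nat (Suc n) powr (- 1 - s) :: complex)"
    using summable_norm_cancel[OF summable_norm_zeta[of "1 + s"]] assms by simp
  have lim: "(\<lambda>n. of_nat (Suc n) powr (- s) :: complex) \<longlonglongrightarrow> 0"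
  proof (rule tendsto_norm_zero_cancel)
    have "(\<lambda>n. real (Suc n) powr (- Re s)) \<longlonglongrightarrow> 0"
      using assms by real_asymp
    then show "(\<lambda>n. norm (of_nat (Suc n) powr (- s) :: complex)) \<longlonglongrightarrow> 0"
      by (simp add: norm_of_nat_powr del: of_nat_Suc)
  qed
  have "(\<lambda>n. of_nat (Suc (Suc n)) powr (- s) - of_nat (Suc n) powr (- s) :: complex) sums (0 - of_nat (Suc 0) powr (-s))"
    by (rule telescope_sums[OF lim])
  then have "(\<lambda>n. s * of_nat (Suc n) powr (- 1 - s) + (of_nat (Suc (Suc n)) powr (- s) - of_nat (Suc n) powr (- s)))
     sums (s * (\<Sum>n. of_nat (Suc n) powr (- 1 - s)) + (0 - of_nat (Suc 0) powr (-s)))"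
    by (intro sums_add sums_mult summable_sums sm)
  moreover have "(\<lambda>n. s * of_nat (Suc n) powr (- 1 - s) + (of_nat (Suc (Suc n)) powr (- s) - of_nat (Suc n) powr (- s)))
       = (\<lambda>n. zterm n s)"
    unfolding zterm_def by (intro ext) (simp only: algebra_simps)
  ultimately have "(\<lambda>n. zterm n s) sums (s * (\<Sum>n. of_nat (Suc n) powr (- 1 - s)) - 1)"
    by simp
  then show ?thesis unfolding szeta_def by (simp add: sums_iff)
qed

section \<open>The Euler product and the 3-4-1 inequality\<close>

text \<open>The index 0 contributes \<open>0 powr _ = 0\<close>, so this is the usual series,
  indexed so that a prime is its own index.\<close>

definition zetac :: "complex \<Rightarrow> complex" where
  "zetac s = (\<Sum>n. of_nat n powr (- s))"

lemma norm_nat_powr: "norm (of_nat n powr s :: complex) = real n powr Re s"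
  by (cases n) (simp_all add: norm_of_nat_powr del: of_nat_Suc)

lemma summable_nat_powr:
  assumes "Re s > 1"
  shows "summable (\<lambda>n. norm (of_nat n powr (- s) :: complex))"
  using assms by (simp add: norm_nat_powr summable_real_powr_iff)

lemma szeta_eq_zetac:
  assumes "Re s > 0"
  shows "szeta s = s * zetac (1 + s)"
proof -
  have "summable (\<lambda>n. of_nat n powr (- (1 + s)) :: complex)"
    by (rule summable_norm_cancel[OF summable_nat_powr]) (use assms in auto)
  from suminf_split_head[OF this] have "zetac (1 + s) = (\<Sum>n. of_nat (Suc n) powr (- 1 - s))"
    by (simp add: zetac_def del: of_nat_Suc)
  then show ?thesis using szeta_eq[OF assms] by simp
qed

lemma has_sum_zetac:
  assumes "Re s > 1"
  shows "((\<lambda>n. of_nat n powr (- s)) has_sum zetac s) UNIV"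
  unfolding zetac_def
  by (rule norm_summable_imp_has_sum[OF summable_nat_powr[OF assms]])
     (use summable_norm_cancel[OF summable_nat_powr[OF assms]] in auto)

definition coprimes_to :: "nat set \<Rightarrow> nat set" where
  "coprimes_to A = {n. n > 0 \<and> (\<forall>p\<in>A. \<not> p dvd n)}"

text \<open>Sieve of Eratosthenes with weights n^(-s): among the numbers free of \<open>A\<close>,
  the multiples of \<open>p\<close> are exactly p k with k free of \<open>A\<close>, so striking
  them out multiplies the sum by 1 - p^(-s).\<close>

lemma sieve_step:
  assumes "Re s > 1" "prime p" "p \<notin> A" "\<And>q. q \<in> A \<Longrightarrow> prime q"
  shows "(\<Sum>\<^sub>\<infinity>n\<in>coprimes_to (insert p A). of_nat n powr (- s)) =
         (1 - of_nat p powr (- s)) * (\<Sum>\<^sub>\<infinity>n\<in>coprimes_to A. of_nat n powr (- s) :: complex)"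
proof -
  let ?f = "\<lambda>n::nat. of_nat n powr (- s) :: complex"
  have summ: "?f summable_on X" for X
    using has_sum_zetac[OF assms(1)] summable_on_subset_banach[of ?f UNIV X]
    by (auto simp: summable_on_def)
  have dec: "coprimes_to A = coprimes_to (insert p A) \<union> (\<lambda>n. p * n) ` coprimes_to A"
  proof (intro equalityI subsetI)
    fix n assume n: "n \<in> coprimes_to A"
    show "n \<in> coprimes_to (insert p A) \<union> (\<lambda>n. p * n) ` coprimes_to A"
    proof (cases "p dvd n")
      case True
      then obtain k where k: "n = p * k" by auto
      then have "k \<in> coprimes_to A" using n by (auto simp: coprimes_to_def)
      then show ?thesis using k by auto
    next
      case False
      then show ?thesis using n by (auto simp: coprimes_to_def)
    qed
  next
    fix n assume "n \<in> coprimes_to (insert p A) \<union> (\<lambda>n. p * n) ` coprimes_to A"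
    then show "n \<in> coprimes_to A"
    proof
      assume "n \<in> (\<lambda>n. p * n) ` coprimes_to A"
      then obtain k where k: "k \<in> coprimes_to A" "n = p * k" by auto
      have "\<not> q dvd n" if "q \<in> A" for q
      proof
        assume "q dvd n"
        then have "q dvd p \<or> q dvd k"
          using k assms(4)[OF that] by (simp add: prime_dvd_mult_iff)
        then have "q = p" using k that assms(2) assms(4)[OF that]
          by (auto simp: coprimes_to_def primes_dvd_imp_eq)
        then show False using that assms by auto
      qed
      then show ?thesis using k assms(2) by (auto simp: coprimes_to_def prime_gt_0_nat)
    qed (auto simp: coprimes_to_def)
  qed
  have inj: "inj_on (\<lambda>n. p * n) (coprimes_to A)"
    using assms(2) by (auto simp: inj_on_def)
  have "infsum ?f (coprimes_to A) = infsum ?f (coprimes_to (insert p A)) + infsum ?f ((\<lambda>n. p * n) ` coprimes_to A)"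
    by (subst dec, rule infsum_Un_disjoint[OF summ summ]) (auto simp: coprimes_to_def)
  also have "infsum ?f ((\<lambda>n. p * n) ` coprimes_to A) = infsum (\<lambda>n. of_nat p powr (- s) * ?f n) (coprimes_to A)"
    unfolding infsum_reindex[OF inj] o_def
    by (intro infsum_cong) (simp add: powr_times_real)
  also have "\<dots> = of_nat p powr (- s) * infsum ?f (coprimes_to A)"
    by (rule infsum_cmult_right) (use summ in auto)
  finally show ?thesis by (simp add: algebra_simps)
qed

lemma sieve_prod:
  assumes "Re s > 1" "finite A" "\<And>q. q \<in> A \<Longrightarrow> prime q"
  shows "(\<Sum>\<^sub>\<infinity>n\<in>coprimes_to A. of_nat n powr (- s) :: complex) =
         (\<Prod>p\<in>A. 1 - of_nat p powr (- s)) * zetac s"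
  using assms(2,3)
proof (induction A)
  case empty
  have "(\<Sum>\<^sub>\<infinity>n\<in>coprimes_to {}. of_nat n powr (- s) :: complex) = (\<Sum>\<^sub>\<infinity>n. of_nat n powr (- s))"
    by (rule infsum_cong_neutral) (auto simp: coprimes_to_def)
  then show ?case using infsumI[OF has_sum_zetac[OF assms(1)]] by simp
next
  case (insert p A)
  then show ?case by (subst sieve_step) (auto simp: assms(1))
qed

text \<open>The Euler product. After sieving by all primes below N, every survivor other than 1 is
  at least N, so the distance to 1 is bounded by a tail of the convergent series.\<close>

lemma sieve_limit:
  assumes "Re s > 1"
  shows "(\<lambda>N. (\<Prod>p | prime p \<and> p < N. 1 - of_nat p powr (- s)) * zetac s) \<longlonglongrightarrow> 1"
proof -
  let ?f = "\<lambda>n::nat. of_nat n powr (- s) :: complex"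
  let ?g = "\<lambda>n::nat. real n powr (- Re s)"
  have summ: "?f summable_on X" for X
    using has_sum_zetac[OF assms(1)] summable_on_subset_banach[of ?f UNIV X]
    by (auto simp: summable_on_def)
  have sg: "summable ?g" using assms by (simp add: summable_real_powr_iff)
  have hg: "(?g has_sum suminf ?g) UNIV"
    by (rule norm_summable_imp_has_sum) (use sg in auto)
  have tail: "(?g has_sum (suminf ?g - (\<Sum>n<N. ?g n))) (UNIV - {..<N})" for N
    by (intro has_sum_Diff hg has_sum_finite) auto
  have bound: "norm ((\<Prod>p | prime p \<and> p < N. 1 - of_nat p powr (- s)) * zetac s - 1)
      \<le> suminf ?g - (\<Sum>n<N. ?g n)" if N: "N \<ge> 2" for N
  proof -
    let ?A = "{p. prime p \<and> p < N}"
    have one: "1 \<in> coprimes_to ?A" by (auto simp: coprimes_to_def)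
    have sub: "coprimes_to ?A - {1} \<subseteq> UNIV - {..<N}"
    proof
      fix n assume n: "n \<in> coprimes_to ?A - {1}"
      then have "n \<noteq> 1" "n > 0" by (auto simp: coprimes_to_def)
      then obtain p where p: "prime p" "p dvd n" using prime_factor_nat by blast
      then have "\<not> p < N" using n by (auto simp: coprimes_to_def)
      moreover have "p \<le> n" using p \<open>n > 0\<close> by (simp add: dvd_imp_le)
      ultimately show "n \<in> UNIV - {..<N}" by auto
    qed
    have "(\<Prod>p\<in>?A. 1 - of_nat p powr (- s)) * zetac s = infsum ?f (coprimes_to ?A)"
      by (rule sieve_prod[OF assms, symmetric]) auto
    also have "\<dots> = infsum ?f ({1} \<union> (coprimes_to ?A - {1}))"
      using one by (simp add: insert_absorb)
    also have "\<dots> = infsum ?f {1} + infsum ?f (coprimes_to ?A - {1})"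
      by (rule infsum_Un_disjoint[OF summ summ]) auto
    finally have "(\<Prod>p\<in>?A. 1 - of_nat p powr (- s)) * zetac s - 1 = infsum ?f (coprimes_to ?A - {1})"
      by simp
    also have "infsum ?f (coprimes_to ?A - {1}) = infsum (\<lambda>n. if n \<in> coprimes_to ?A - {1} then ?f n else 0) (UNIV - {..<N})"
      by (rule infsum_cong_neutral) (use sub in auto)
    also have "norm \<dots> \<le> suminf ?g - (\<Sum>n<N. ?g n)"
    proof (rule norm_infsum_le[OF has_sum_infsum tail])
      show "norm (if n \<in> coprimes_to ?A - {1} then ?f n else 0) \<le> ?g n" for n
        by (auto simp: norm_nat_powr)
      then show "(\<lambda>n. if n \<in> coprimes_to ?A - {1} then ?f n else 0) summable_on UNIV - {..<N}"
        by (rule abs_summable_summable[OF Infinite_Sum.abs_summable_on_comparison_test'[OF has_sum_imp_summable[OF tail[of N]]]])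
    qed
    finally show ?thesis .
  qed
  have "(\<lambda>N. suminf ?g - (\<Sum>n<N. ?g n)) \<longlonglongrightarrow> suminf ?g - suminf ?g"
    by (intro tendsto_intros summable_LIMSEQ sg)
  then have lim0: "(\<lambda>N. suminf ?g - (\<Sum>n<N. ?g n)) \<longlonglongrightarrow> 0"
    by (simp only: diff_self)
  have "(\<lambda>N. (\<Prod>p | prime p \<and> p < N. 1 - of_nat p powr (- s)) * zetac s - 1) \<longlonglongrightarrow> 0"
    by (rule Lim_null_comparison[OF eventually_sequentiallyI[OF bound] lim0])
  then show ?thesis by (simp add: LIM_zero_iff)
qed

definition lterm :: "nat \<Rightarrow> complex \<Rightarrow> complex" where
  "lterm n s = (if prime n then - Ln (1 - of_nat n powr (- s)) else 0)"

lemma prime_powr_le: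
  assumes "prime p" "a > 0"
  shows "real p powr (- a) \<le> 2 powr (- a)"
  using assms prime_ge_2_nat[OF assms(1)] by (intro powr_mono2') auto

lemma norm_lterm_le:
  assumes "Re s > 1"
  shows "norm (lterm n s) \<le> 2 * real n powr (- Re s)"
proof (cases "prime n")
  case True
  let ?z = "- (of_nat n powr (- s)) :: complex"
  have "real n powr (- Re s) \<le> 2 powr (- Re s)"
    using True assms by (intro prime_powr_le) auto
  also have "\<dots> < 2 powr (- 1)" using assms by (intro powr_less_mono) auto
  also have "\<dots> = 1 / 2" by (simp add: powr_minus)
  finally have "norm ?z < 1/2" by (simp add: norm_nat_powr)
  from norm_Ln_le[OF this] show ?thesis using True by (simp add: lterm_def norm_nat_powr)
qed (auto simp: lterm_def)

lemma summable_lterm: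
  assumes "Re s > 1"
  shows "summable (\<lambda>n. norm (lterm n s))"
proof (rule summable_comparison_test[OF _ summable_mult[of "\<lambda>n. real n powr (- Re s)" 2]])
  show "\<exists>N. \<forall>n\<ge>N. norm (norm (lterm n s)) \<le> 2 * real n powr (- Re s)"
    using norm_lterm_le[OF assms] by auto
  show "summable (\<lambda>n. real n powr (- Re s))" using assms by (simp add: summable_real_powr_iff)
qed

text \<open>A logarithm of zeta given as a sum of principal logarithms of Euler factors, each close
  to 1, so that no branch has to be followed along a domain.\<close>

definition logzeta :: "complex \<Rightarrow> complex" where
  "logzeta s = (\<Sum>n. lterm n s)"

lemma exp_logzeta:
  assumes "Re s > 1"
  shows "exp (logzeta s) = zetac s"
proof -
  have nz: "1 - of_nat p powr (- s) \<noteq> (0 :: complex)" if "prime p" for p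
  proof -
    have "norm (of_nat p powr (- s) :: complex) \<le> 2 powr (- Re s)"
      using prime_powr_le[of p "Re s"] that assms by (simp add: norm_nat_powr)
    also have "\<dots> < 2 powr 0" using assms by (intro powr_less_mono) auto
    finally show ?thesis by auto
  qed
  have prod: "exp (- (\<Sum>n<N. lterm n s)) = (\<Prod>p | prime p \<and> p < N. 1 - of_nat p powr (- s))" for N
  proof -
    have "exp (- (\<Sum>n<N. lterm n s)) = (\<Prod>n<N. exp (- lterm n s))"
      by (simp add: exp_sum sum_negf[symmetric])
    also have "\<dots> = (\<Prod>p | prime p \<and> p < N. exp (- lterm p s))"
      by (rule prod.mono_neutral_right) (auto simp: lterm_def)
    also have "\<dots> = (\<Prod>p | prime p \<and> p < N. 1 - of_nat p powr (- s))"
      by (rule prod.cong) (use nz in \<open>auto simp: lterm_def exp_Ln\<close>)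
    finally show ?thesis .
  qed
  have "(\<lambda>N. exp (- (\<Sum>n<N. lterm n s)) * zetac s) \<longlonglongrightarrow> exp (- logzeta s) * zetac s"
    unfolding logzeta_def
    by (intro tendsto_intros summable_LIMSEQ summable_norm_cancel[OF summable_lterm[OF assms]])
  with sieve_limit[OF assms] have "exp (- logzeta s) * zetac s = 1"
    unfolding prod using LIMSEQ_unique by blast
  then show ?thesis by (simp add: exp_minus field_simps)
qed

text \<open>In the power series the coefficient of r^n/n is 3 + 4 cos t + cos 2t = 2 (1 + cos t)^2,
  where cos t is the real part of \<open>w ^ n\<close>.\<close>

lemma Re_neg_Ln_341:
  fixes w :: complex and r :: real
  assumes "norm w = 1" "0 \<le> r" "r < 1"
  shows "Re (3 * (- Ln (1 - of_real r)) + 4 * (- Ln (1 - of_real r * w)) + (- Ln (1 - of_real r * w ^ 2))) \<ge> 0"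
proof -
  have ser: "(\<lambda>n. Re (z ^ n / of_nat n)) sums Re (- Ln (1 - z))" if "norm z < 1" for z :: complex
  proof -
    have "(\<lambda>n. - ((- (- z)) ^ n) / of_nat n) sums ln (1 + (- z))"
      by (rule Ln_series') (use that in auto)
    from sums_minus[OF this] have "(\<lambda>n. z ^ n / of_nat n) sums (- Ln (1 - z))" by simp
    then show ?thesis by (rule sums_Re)
  qed
  have n2: "norm (of_real r * w ^ 2) < 1" "norm (of_real r * w) < 1" "norm (of_real r :: complex) < 1"
    using assms by (auto simp: norm_mult norm_power)
  have "(\<lambda>n. 3 * Re (of_real r ^ n / of_nat n) + 4 * Re ((of_real r * w) ^ n / of_nat n)
       + Re ((of_real r * w ^ 2) ^ n / of_nat n)) sums
     (3 * Re (- Ln (1 - of_real r)) + 4 * Re (- Ln (1 - of_real r * w)) + Re (- Ln (1 - of_real r * w ^ 2)))"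
    by (intro sums_add sums_mult ser n2)
  moreover have "3 * Re (of_real r ^ n / of_nat n) + 4 * Re ((of_real r * w) ^ n / of_nat n)
       + Re ((of_real r * w ^ 2) ^ n / of_nat n) \<ge> 0" for n
  proof -
    define c where "c = Re (w ^ n)"
    have nw: "(Re (w ^ n))\<^sup>2 + (Im (w ^ n))\<^sup>2 = 1"
      using assms(1) by (metis cmod_power2 norm_power one_power2 power_one)
    have "Re ((w ^ 2) ^ n) = Re ((w ^ n) ^ 2)" by (simp flip: power_mult add: mult.commute)
    also have "\<dots> = c\<^sup>2 - (Im (w ^ n))\<^sup>2" by (simp add: power2_eq_square c_def)
    also have "\<dots> = 2 * c\<^sup>2 - 1" using nw by (simp add: c_def)
    finally have c2: "Re ((w ^ 2) ^ n) = 2 * c\<^sup>2 - 1" .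
    have e1: "Re (of_real r ^ n / of_nat n) = r ^ n / n"
      by (metis Re_complex_of_real of_real_divide of_real_of_nat_eq of_real_power)
    have e2: "Re ((of_real r * z) ^ n / of_nat n) = r ^ n / n * Re (z ^ n)" for z
    proof -
      have "(of_real r * z) ^ n / of_nat n = of_real (r ^ n / n) * z ^ n"
        by (simp add: power_mult_distrib)
      then show ?thesis by (simp only: Re_complex_of_real times_complex.sel Im_complex_of_real)
    qed
    have "3 * Re (of_real r ^ n / of_nat n) + 4 * Re ((of_real r * w) ^ n / of_nat n)
       + Re ((of_real r * w ^ 2) ^ n / of_nat n) = r ^ n / n * (2 * (1 + c)\<^sup>2)"
      unfolding e1 e2 c2 by (simp add: c_def algebra_simps power2_eq_square)
    also have "\<dots> \<ge> 0" using assms by simp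
    finally show ?thesis .
  qed
  ultimately have "0 \<le> 3 * Re (- Ln (1 - of_real r)) + 4 * Re (- Ln (1 - of_real r * w)) + Re (- Ln (1 - of_real r * w ^ 2))"
    by (rule sums_le[OF _ sums_zero, rotated])
  then show ?thesis by simp
qed

text \<open>\<open>Re_neg_Ln_341\<close> is summed over the primes, with r = p^(-a) and w = p^(-it)
  separating modulus and rotation, and then exponentiated.\<close>

lemma zetac_341:
  fixes a t :: real
  assumes "a > 1"
  shows "norm (zetac a) ^ 3 * norm (zetac (Complex a t)) ^ 4 * norm (zetac (Complex a (2 * t))) \<ge> 1"
proof -
  let ?s0 = "complex_of_real a" and ?s1 = "Complex a t" and ?s2 = "Complex a (2 * t)"
  have R: "Re ?s0 > 1" "Re ?s1 > 1" "Re ?s2 > 1" using assms by auto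
  have tm: "Re (3 * lterm n ?s0 + 4 * lterm n ?s1 + lterm n ?s2) \<ge> 0" for n
  proof (cases "prime n")
    case True
    define r where "r = real n powr (- a)"
    define w where "w = complex_of_real (real n) powr (- (\<i> * of_real t))"
    have n: "real n > 0" using True by (auto simp: prime_gt_0_nat)
    have w: "norm w = 1" unfolding w_def using n by (simp add: norm_powr_real_powr)
    have "r \<le> 2 powr (- a)" unfolding r_def using True assms by (intro prime_powr_le) auto
    also have "\<dots> < 2 powr 0" using assms by (intro powr_less_mono) auto
    finally have r: "0 \<le> r" "r < 1" by (auto simp: r_def)
    have rc: "of_real r = complex_of_real (real n) powr (- of_real a)"
      unfolding r_def using powr_of_real[of "real n" "- a"] n by (simp only: of_real_minus less_imp_le)
    have z0: "of_nat n powr (- ?s0) = of_real r" by (simp only: rc of_real_of_nat_eq)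
    have "- ?s1 = - of_real a + - (\<i> * of_real t)" by (simp add: complex_eq_iff)
    then have z1: "of_nat n powr (- ?s1) = of_real r * w"
      unfolding rc w_def by (simp only: of_real_of_nat_eq powr_add)
    have "- ?s2 = - of_real a + (- (\<i> * of_real t) + - (\<i> * of_real t))" by (simp add: complex_eq_iff)
    then have z2: "of_nat n powr (- ?s2) = of_real r * w ^ 2"
      unfolding rc w_def by (simp only: of_real_of_nat_eq powr_add power2_eq_square)
    show ?thesis using Re_neg_Ln_341[OF w r] True by (simp only: lterm_def z0 z1 z2 if_True)
  qed (auto simp: lterm_def)
  have sm: "(\<lambda>n. lterm n s) sums logzeta s" if "Re s > 1" for s
    unfolding logzeta_def by (intro summable_sums summable_norm_cancel[OF summable_lterm[OF that]])
  have "(\<lambda>n. Re (3 * lterm n ?s0 + 4 * lterm n ?s1 + lterm n ?s2)) sums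
     Re (3 * logzeta ?s0 + 4 * logzeta ?s1 + logzeta ?s2)"
    by (intro sums_Re sums_add sums_mult sm R)
  then have "Re (3 * logzeta ?s0 + 4 * logzeta ?s1 + logzeta ?s2) \<ge> 0"
    by (rule sums_le[OF tm sums_zero])
  then have "1 \<le> exp (Re (3 * logzeta ?s0 + 4 * logzeta ?s1 + logzeta ?s2))" by simp
  also have "\<dots> = norm (exp (3 * logzeta ?s0 + 4 * logzeta ?s1 + logzeta ?s2))" by simp
  also have "exp (3 * logzeta ?s0 + 4 * logzeta ?s1 + logzeta ?s2)
     = zetac ?s0 ^ 3 * zetac ?s1 ^ 4 * zetac ?s2"
  proof -
    have "exp (3 * logzeta ?s0) = zetac ?s0 ^ 3"
      using exp_of_nat_mult[of 3 "logzeta ?s0"] by (simp only: of_nat_numeral exp_logzeta[OF R(1)])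
    moreover have "exp (4 * logzeta ?s1) = zetac ?s1 ^ 4"
      using exp_of_nat_mult[of 4 "logzeta ?s1"] by (simp only: of_nat_numeral exp_logzeta[OF R(2)])
    ultimately show ?thesis by (simp only: exp_add exp_logzeta[OF R(3)])
  qed
  finally show ?thesis by (simp add: norm_mult norm_power)
qed

section \<open>Lower bounds near the line \<open>Re s = 0\<close>\<close>

text \<open>Dividing by \<open>1 + s\<close> gives \<open>\<zeta>(1 + s)\<close> with its pole removed but its size at infinity kept.\<close>

definition Yfun :: "complex \<Rightarrow> complex" where
  "Yfun s = szeta s / (1 + s)"

lemma one_plus_norm_le:
  assumes "Re s \<ge> - 1/2"
  shows "1 + norm s \<le> 5 * norm (1 + s)"
proof -
  have "1 / 2 \<le> norm (1 + s)"
    using abs_Re_le_cmod[of "1 + s"] assms by simp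
  moreover have "norm s \<le> norm (1 + s) + 1"
    using norm_triangle_ineq4[of "1 + s" 1] by simp
  ultimately show ?thesis by linarith
qed

lemma one_plus_nonzero: "Re s > - 1/2 \<Longrightarrow> 1 + s \<noteq> 0"
  using one_plus_norm_le[of s] norm_ge_zero[of s] by (auto simp del: norm_ge_zero)

lemma Yfun_holomorphic: "Yfun holomorphic_on {s. Re s > - 1/2}"
  unfolding Yfun_def [abs_def]
  by (intro holomorphic_intros szeta_holomorphic) (use one_plus_nonzero in auto)

lemma norm_Yfun_le:
  assumes "0 < d" "d \<le> 1/2"
  obtains C where "C > 0" "\<And>s. Re s \<ge> - d \<Longrightarrow> norm (Yfun s) \<le> C * (1 + norm s) powr (2 * d)"
proof -
  define K where "K = powsum d"
  have K: "K \<ge> 0" unfolding K_def powsum_def by (intro suminf_nonneg summable_Suc_powr assms) auto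
  show ?thesis
  proof
    show "5 * (1 + 2 * K) > 0" using K by simp
  next
    fix s assume s: "Re s \<ge> - d"
    define T where "T = 1 + norm s"
    have T: "T \<ge> 1" "norm s \<le> T" by (auto simp: T_def)
    have T1: "T powr (2 * d) \<ge> 1" using T assms by (intro ge_one_powr_ge_zero) auto
    have "norm (szeta s) \<le> 1 + 2 * K * norm s * T powr (2 * d)"
      unfolding K_def T_def using assms s by (rule norm_szeta_le)
    also have "\<dots> \<le> T * T powr (2 * d) + 2 * K * T * T powr (2 * d)"
      using T T1 K mult_mono[of 1 T 1 "T powr (2 * d)"] by (intro add_mono mult_right_mono mult_left_mono) auto
    also have "\<dots> = (1 + 2 * K) * T powr (2 * d) * T" by (simp add: algebra_simps)
    finally have 1: "norm (szeta s) \<le> (1 + 2 * K) * T powr (2 * d) * T" .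
    have 2: "T \<le> 5 * norm (1 + s)" unfolding T_def using s assms by (intro one_plus_norm_le) auto
    have "norm (szeta s) \<le> (1 + 2 * K) * T powr (2 * d) * (5 * norm (1 + s))"
      by (rule order_trans[OF 1]) (intro mult_left_mono 2, use K in auto)
    moreover have "norm (1 + s) > 0" using 2 T by linarith
    ultimately show "norm (Yfun s) \<le> 5 * (1 + 2 * K) * (1 + norm s) powr (2 * d)"
      by (simp add: Yfun_def norm_divide T_def field_simps)
  qed
qed

lemma Re_ge_of_cball: "w \<in> cball s r \<Longrightarrow> Re w \<ge> Re s - r"
  using abs_Re_le_cmod[of "s - w"] by (simp add: dist_norm)

lemma norm_le_of_cball: "w \<in> cball (s::complex) r \<Longrightarrow> norm w \<le> norm s + r"
  using norm_triangle_ineq2[of w s] by (simp add: dist_norm norm_minus_commute)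

lemma Cauchy_bound_cball:
  assumes "f holomorphic_on S" "open S" "cball z r \<subseteq> S" "r > 0"
    "\<And>w. w \<in> cball z r \<Longrightarrow> norm (f w) \<le> B"
  shows "norm ((deriv ^^ n) f z) \<le> fact n * B / r ^ n"
proof (rule Cauchy_inequality[OF _ _ \<open>r > 0\<close>])
  show "f holomorphic_on ball z r"
    using assms ball_subset_cball holomorphic_on_subset by blast
  show "continuous_on (cball z r) f"
    using assms holomorphic_on_imp_continuous_on continuous_on_subset by blast
qed (use assms in \<open>auto simp: dist_norm\<close>)

text \<open>Cauchy's inequality on discs of fixed radius e/4, which stay in
  \<open>Re s \<ge> - e / 2\<close>, where the growth bound has exponent e.\<close>

lemma norm_deriv_Yfun_le:
  assumes "0 < e" "e \<le> 1/2"
  obtains C where "C > 0" "\<And>s. Re s > - e / 4 \<Longrightarrow> norm (deriv Yfun s) \<le> C * (1 + norm s) powr e"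
proof -
  obtain C where C: "C > 0" "\<And>s. Re s \<ge> - (e / 2) \<Longrightarrow> norm (Yfun s) \<le> C * (1 + norm s) powr (2 * (e / 2))"
    using norm_Yfun_le[of "e / 2"] assms by auto
  show ?thesis
  proof
    show "C * 2 / (e / 4) > 0" using C assms by simp
  next
    fix s assume s: "Re s > - e / 4"
    have "norm ((deriv ^^ 1) Yfun s) \<le> fact 1 * (C * (2 * (1 + norm s) powr e)) / (e / 4) ^ 1"
    proof (rule Cauchy_bound_cball[OF Yfun_holomorphic])
      show "cball s (e / 4) \<subseteq> {s. - 1 / 2 < Re s}"
        using s assms Re_ge_of_cball[of _ s "e/4"] by force
      fix w assume w: "w \<in> cball s (e / 4)"
      have "norm (Yfun w) \<le> C * (1 + norm w) powr (2 * (e / 2))"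
        using s Re_ge_of_cball[OF w] by (intro C) auto
      also have "\<dots> \<le> C * (2 * (1 + norm s) powr e)"
      proof (intro mult_left_mono)
        have le: "1 + norm w \<le> 2 * (1 + norm s)"
        proof -
          have arith: "1 + x \<le> 2 * (1 + y)" if "x \<le> y + r" "0 \<le> y" "r \<le> 1" for x y r :: real
            using that by (simp add: distrib_left)
          show ?thesis by (rule arith[OF norm_le_of_cball[OF w] norm_ge_zero]) (use assms in simp)
        qed
        have ee: "2 * (e / 2) = e" by simp
        have "(1 + norm w) powr (2 * (e / 2)) \<le> (2 * (1 + norm s)) powr e"
          unfolding ee by (rule powr_mono2) (use le assms in auto)
        also have "\<dots> = 2 powr e * (1 + norm s) powr e" by (rule powr_mult)
        also have "\<dots> \<le> 2 powr 1 * (1 + norm s) powr e"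
          using assms by (intro mult_right_mono powr_mono) auto
        finally show "(1 + norm w) powr (2 * (e / 2)) \<le> 2 * (1 + norm s) powr e" by simp
      qed (use C in auto)
      finally show "norm (Yfun w) \<le> C * (2 * (1 + norm s) powr e)" .
    qed (use assms open_halfspace_Re_gt in auto)
    then show "norm (deriv Yfun s) \<le> C * 2 / (e / 4) * (1 + norm s) powr e"
      by simp
  qed
qed

lemma norm_Yfun_diff_le:
  assumes "convex S" "S \<subseteq> {s. Re s > - 1/2}" "\<And>z. z \<in> S \<Longrightarrow> norm (deriv Yfun z) \<le> B" "a \<in> S" "b \<in> S"
  shows "norm (Yfun a - Yfun b) \<le> B * norm (a - b)"
proof (rule field_differentiable_bound[OF assms(1) _ assms(3) assms(4,5)])
  fix z assume "z \<in> S"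
  then have "Re z > - 1/2" using assms(2) by auto
  then show "(Yfun has_field_derivative deriv Yfun z) (at z within S)"
    by (intro has_field_derivative_at_within[OF holomorphic_derivI[OF Yfun_holomorphic open_halfspace_Re_gt]]) simp
qed

text \<open>The 3-4-1 inequality solved for its fourth power. Away from the origin (1+z)/z is
  bounded, so zeta(1+z) is controlled by \<open>Yfun z\<close> at s and at the point of doubled
  height. Only the factor at the real point keeps its pole, and this produces the cube of Re s/(1 +
  Re s).\<close>

lemma Yfun_lower_341:
  assumes "0 < e" "e \<le> 1/2" "r0 > 0"
  obtains b where "b > 0" "\<And>s. Re s > 0 \<Longrightarrow> norm s \<ge> r0 \<Longrightarrow>
     norm (Yfun s) ^ 4 \<ge> b * (Re s / (1 + Re s)) ^ 3 * ((1 + norm s) powr (- e)) ^ 4"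
proof -
  obtain C where C: "C > 0" "\<And>s. Re s \<ge> - (e / 2) \<Longrightarrow> norm (Yfun s) \<le> C * (1 + norm s) powr (2 * (e / 2))"
    using norm_Yfun_le[of "e / 2"] assms by auto
  \<comment> \<open>A bound for |(1+z)/z| when |z| \<ge> r0.\<close>
  define q where "q = 1 + 1 / r0"
  have q: "q > 0" using assms by (auto simp: q_def add_pos_pos)
  have zY: "zetac (1 + z) = (1 + z) / z * Yfun z" if "Re z > 0" for z
  proof -
    have "z \<noteq> 0" "1 + z \<noteq> 0" using that one_plus_nonzero[of z] by auto
    then show ?thesis using szeta_eq_zetac[OF that] by (simp add: Yfun_def)
  qed
  have nz: "norm (zetac (1 + z)) \<le> q * norm (Yfun z)" if "Re z > 0" "norm z \<ge> r0" for z
  proof -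
    have "norm ((1 + z) / z) \<le> q"
    proof -
      have "norm (1 + z) \<le> 1 + norm z" using norm_triangle_ineq[of 1 z] by simp
      then have "norm ((1 + z) / z) \<le> (1 + norm z) / norm z"
        unfolding norm_divide by (rule divide_right_mono) simp
      also have "\<dots> = 1 + 1 / norm z"
      proof -
        have "norm z \<noteq> 0" using that assms by linarith
        then show ?thesis by (simp add: add_divide_distrib)
      qed
      also have "\<dots> \<le> q" unfolding q_def using that assms by (intro add_mono divide_left_mono mult_pos_pos) linarith+
      finally show ?thesis .
    qed
    then show ?thesis unfolding zY[OF that(1)] norm_mult by (rule mult_right_mono) auto
  qed
  define b where "b = 1 / (C ^ 3 * q ^ 4 * (q * (2 * C)))"
  show ?thesis
  proof
    show "b > 0" using C q by (simp add: b_def)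
  next
    fix s assume s: "Re s > 0" "norm s \<ge> r0"
    define T where "T = 1 + norm s"
    define sg where "sg = Re s"
    have sg: "sg > 0" using s by (simp add: sg_def)
    have T: "T \<ge> 1" by (simp add: T_def)
    have sgT: "1 + sg \<le> T" unfolding T_def sg_def using complex_Re_le_cmod[of s] by simp
    let ?s2 = "Complex sg (2 * Im s)"
    have n2: "norm ?s2 \<le> 2 * norm s"
    proof -
      have "norm ?s2 \<le> norm (2 * s)" unfolding cmod_def sg_def
        by (rule real_sqrt_le_mono) (auto simp: power_mult_distrib power2_eq_square)
      then show ?thesis by (simp add: norm_mult)
    qed
    have n2': "norm ?s2 \<ge> r0"
    proof -
      have "norm s \<le> norm ?s2" unfolding cmod_def sg_def
        by (rule real_sqrt_le_mono) (auto simp: power_mult_distrib)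
      then show ?thesis using s by simp
    qed
    have A: "norm (zetac (of_real (1 + sg))) \<le> (1 + sg) / sg * (C * T powr e)"
    proof -
      have "norm (Yfun (of_real sg)) \<le> C * (1 + norm (complex_of_real sg)) powr (2 * (e / 2))"
        by (rule C(2)) (use sg assms in auto)
      also have "\<dots> \<le> C * T powr e"
        using sg sgT C assms by (simp, intro powr_mono2) auto
      finally have "(1 + sg) / sg * norm (Yfun (of_real sg)) \<le> (1 + sg) / sg * (C * T powr e)"
        using sg by (intro mult_left_mono) auto
      moreover have "norm ((1 + complex_of_real sg) / of_real sg) = (1 + sg) / sg"
        using sg norm_of_real[of "1 + sg", where 'a = complex] by (simp add: norm_divide)
      moreover have "norm (zetac (of_real (1 + sg))) =
          norm ((1 + complex_of_real sg) / of_real sg) * norm (Yfun (of_real sg))"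
        using zY[of "of_real sg"] sg by (simp only: of_real_add of_real_1 norm_mult Re_complex_of_real)
      ultimately show ?thesis by simp
    qed
    have "Complex (1 + sg) (Im s) = 1 + s" "Complex (1 + sg) (2 * Im s) = 1 + ?s2"
      by (auto simp: complex_eq_iff sg_def)
    then have "1 \<le> norm (zetac (of_real (1 + sg))) ^ 3 * norm (zetac (1 + s)) ^ 4 * norm (zetac (1 + ?s2))"
      using zetac_341[of "1 + sg" "Im s"] sg by simp
    also have "\<dots> \<le> ((1 + sg) / sg * (C * T powr e)) ^ 3 * (q * norm (Yfun s)) ^ 4 * (q * (C * (2 * T powr e)))"
    proof (intro mult_mono power_mono A nz s norm_ge_zero zero_le_power mult_nonneg_nonneg)
      have "norm (zetac (1 + ?s2)) \<le> q * norm (Yfun ?s2)" by (rule nz) (use sg n2' in auto)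
      also have "norm (Yfun ?s2) \<le> C * (1 + norm ?s2) powr (2 * (e / 2))" by (rule C) (use sg assms in auto)
      also have "(1 + norm ?s2) powr (2 * (e / 2)) \<le> (2 * T) powr e"
        using n2 assms by (simp, intro powr_mono2) (auto simp: T_def)
      also have "\<dots> = 2 powr e * T powr e" by (rule powr_mult)
      also have "\<dots> \<le> 2 powr 1 * T powr e" using assms by (intro mult_right_mono powr_mono) auto
      finally show "norm (zetac (1 + ?s2)) \<le> q * (C * (2 * T powr e))" using q C by (simp add: mult_left_mono)
    qed (use sg C q in auto)
    also have "\<dots> = (C ^ 3 * q ^ 4 * (q * (2 * C))) * ((1 + sg) / sg) ^ 3 * (T powr e) ^ 4 * norm (Yfun s) ^ 4"
      by (simp add: power_mult_distrib power_divide algebra_simps eval_nat_numeral)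
    finally have *: "1 \<le> (C ^ 3 * q ^ 4 * (q * (2 * C))) * ((1 + sg) / sg) ^ 3 * (T powr e) ^ 4 * norm (Yfun s) ^ 4" .
    define D where "D = C ^ 3 * q ^ 4 * (q * (2 * C))"
    define E where "E = ((1 + sg) / sg) ^ 3"
    define G where "G = (T powr e) ^ 4"
    have pos: "D > 0" "E > 0" "G > 0" using C q sg T by (auto simp: D_def E_def G_def)
    have "b * (sg / (1 + sg)) ^ 3 * (T powr (- e)) ^ 4 = 1 / (D * E * G)"
      using sg T by (simp add: b_def D_def E_def G_def powr_minus power_inverse power_divide field_simps)
    also have "\<dots> \<le> norm (Yfun s) ^ 4"
      using * pos unfolding D_def[symmetric] E_def[symmetric] G_def[symmetric]
      by (simp add: pos_divide_le_eq mult_ac)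
    finally show "b * (Re s / (1 + Re s)) ^ 3 * ((1 + norm s) powr (- e)) ^ 4 \<le> norm (Yfun s) ^ 4"
      by (simp add: sg_def T_def)
  qed
qed

text \<open>Covers the disc around the origin that \<open>Yfun_lower_341\<close> has to
  avoid.\<close>

lemma Yfun_lower_near_0: obtains r0 where "r0 > 0" "\<And>s. norm s \<le> r0 \<Longrightarrow> norm (Yfun s) \<ge> 1/2"
proof -
  have "isCont Yfun 0"
    using Yfun_holomorphic open_halfspace_Re_gt[of "-1/2"] holomorphic_on_imp_continuous_on
      continuous_on_eq_continuous_at by fastforce
  then obtain d where d: "d > 0" "\<And>s. dist s 0 < d \<Longrightarrow> dist (Yfun s) (Yfun 0) < 1/2"
    unfolding continuous_at_eps_delta by (metis half_gt_zero_iff zero_less_one)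
  have Y0: "Yfun 0 = 1" by (simp add: Yfun_def szeta_0)
  show ?thesis
  proof
    show "d / 2 > 0" using d by simp
    fix s :: complex assume "norm s \<le> d / 2"
    then have "dist (Yfun s) 1 < 1 / 2" using d Y0 by auto
    then show "norm (Yfun s) \<ge> 1/2"
      using norm_triangle_ineq2[of 1 "Yfun s"] by (simp add: dist_norm norm_minus_commute)
  qed
qed

text \<open>A point too close to the line is moved right by d. At the new point the 3-4-1 bound is
  of order d^(3/4), while moving back changes \<open>Yfun\<close> by at most its derivative bound
  times d, which is less for small d. With T = 1 + |s| and d = k^4 T^(-8e) the two quantities are
  k^3 T^(-7e) and k^4 T^(-7e) up to constants.\<close>

lemma Yfun_lower_pos:
  assumes "0 < e" "e \<le> 1/2"
  obtains c where "c > 0" "\<And>s. Re s > 0 \<Longrightarrow> norm (Yfun s) \<ge> c * (1 + norm s) powr (- 7 * e)"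
proof -
  obtain r0 where r0: "r0 > 0" "\<And>s. norm s \<le> r0 \<Longrightarrow> norm (Yfun s) \<ge> 1/2"
    using Yfun_lower_near_0 by blast
  obtain b where b: "b > 0" "\<And>s. Re s > 0 \<Longrightarrow> norm s \<ge> r0 \<Longrightarrow>
     norm (Yfun s) ^ 4 \<ge> b * (Re s / (1 + Re s)) ^ 3 * ((1 + norm s) powr (- e)) ^ 4"
    using Yfun_lower_341[OF assms r0(1)] by blast
  obtain C where C: "C > 0" "\<And>s. Re s > - e / 4 \<Longrightarrow> norm (deriv Yfun s) \<le> C * (1 + norm s) powr e"
    using norm_deriv_Yfun_le[OF assms] by blast
  \<comment> \<open>128 = 2^3 * 2^4 pays for the halves in the lower bounds d/2 for Re s1/(1 + Re
    s1) and T^(-e)/2 for (1 + |s1|)^(-e).\<close>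
  define a where "a = root 4 (b / 128)"
  have a: "a > 0" "a ^ 4 = b / 128" using b by (auto simp: a_def)
  \<comment> \<open>Makes the loss from moving back at most half of the lower bound at the moved
    point.\<close>
  define k where "k = min 1 (a / (4 * C))"
  have k: "k > 0" "k \<le> 1" "2 * C * k \<le> a / 2" using a C by (auto simp: k_def field_simps min_def)
  define c where "c = min (1/2) (a * k ^ 3 / 2)"
  show ?thesis
  proof
    show "c > 0" using a k by (simp add: c_def)
  next
    fix s assume s: "Re s > 0"
    define T where "T = 1 + norm s"
    have T: "T \<ge> 1" by (simp add: T_def)
    have Tn: "T powr (- (x * e)) \<le> 1" if "x \<ge> 0" for x
    proof -
      have "T powr (- (x * e)) \<le> T powr 0" using T assms that by (intro powr_mono) auto
      then show ?thesis using T by simp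
    qed
    show "c * (1 + norm s) powr (- 7 * e) \<le> norm (Yfun s)"
    proof (cases "norm s \<le> r0")
      case True
      have "c * T powr (- 7 * e) \<le> 1/2 * 1"
        using Tn[of 7] a k by (intro mult_mono) (auto simp: c_def)
      then show ?thesis using r0(2)[OF True] by (simp add: T_def)
    next
      case False
      define d where "d = k ^ 4 * T powr (- (8 * e))"
      have d: "d > 0" "d \<le> 1" using k T Tn[of 8] by (auto simp: d_def intro!: mult_le_one power_le_one)
      \<comment> \<open>Points whose distance from the line is already at least d stay where they
        are.\<close>
      define s1 where "s1 = s + of_real (max 0 (d - Re s))"
      have R1: "Re s1 \<ge> d" "Re s1 > 0" using s by (auto simp: s1_def)
      have dist1: "norm (s - s1) \<le> d" using s d by (auto simp: s1_def)
      have n1: "norm s1 \<le> norm s + d"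
        using dist1 norm_triangle_ineq2[of s1 s] by (simp add: norm_minus_commute)
      have "norm s \<le> norm s1"
        unfolding cmod_def s1_def using s by (intro real_sqrt_le_mono add_mono) (auto intro: power_mono)
      then have n1': "norm s1 \<ge> r0" using False by simp
      have "norm s = T - 1" by (simp add: T_def)
      then have T1: "1 + norm s1 \<le> 2 * T" using n1 d T by linarith
      have low: "a * k ^ 3 * T powr (- (7 * e)) \<le> norm (Yfun s1)"
      proof (rule power_le_imp_le_base[of _ 3])
        have h1: "d / 2 \<le> Re s1 / (1 + Re s1)"
        proof -
          have "d / 2 \<le> d / (1 + d)" using d by (intro divide_left_mono) auto
          also have "\<dots> \<le> Re s1 / (1 + Re s1)" using R1 d by (simp add: field_simps)
          finally show ?thesis .
        qed
        have h2: "T powr (- e) / 2 \<le> (1 + norm s1) powr (- e)"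
        proof -
          have "T powr (- e) / 2 = 2 powr (-1) * T powr (- e)" by (simp add: powr_minus)
          also have "\<dots> \<le> 2 powr (- e) * T powr (- e)"
            using assms by (intro mult_right_mono powr_mono) auto
          also have "\<dots> = (2 * T) powr (- e)" by (rule powr_mult[symmetric])
          also have "\<dots> \<le> (1 + norm s1) powr (- e)" using T1 assms by (intro powr_mono2') (auto simp: add_pos_nonneg)
          finally show ?thesis .
        qed
        have "(a * k ^ 3 * T powr (- (7 * e))) ^ Suc 3 = b * (d / 2) ^ 3 * (T powr (- e) / 2) ^ 4"
        proof -
          have e1: "(T powr (- (7 * e))) ^ 4 = T powr (- (28 * e))"
            using T by (simp add: powr_power)
          have e2: "(T powr (- (8 * e))) ^ 3 * (T powr (- e)) ^ 4 = T powr (- (28 * e))"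
            using T by (simp add: powr_power flip: powr_add)
          have "(a * k ^ 3 * T powr (- (7 * e))) ^ Suc 3 = a ^ 4 * k ^ 12 * (T powr (- (7 * e))) ^ 4"
            by (simp add: power_mult_distrib flip: power_mult)
          also have "\<dots> = b / 128 * k ^ 12 * ((T powr (- (8 * e))) ^ 3 * (T powr (- e)) ^ 4)"
            unfolding a e1 e2 ..
          also have "\<dots> = b * (d / 2) ^ 3 * (T powr (- e) / 2) ^ 4"
            unfolding d_def by (simp add: power_mult_distrib power_divide flip: power_mult)
          finally show ?thesis .
        qed
        also have "\<dots> \<le> b * (Re s1 / (1 + Re s1)) ^ 3 * ((1 + norm s1) powr (- e)) ^ 4"
          using h1 h2 b(1) d R1 by (intro mult_mono power_mono mult_left_mono) (auto intro!: mult_nonneg_nonneg)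
        also have "\<dots> \<le> norm (Yfun s1) ^ 4" by (rule b(2)[OF R1(2) n1'])
        finally show "(a * k ^ 3 * T powr (- (7 * e))) ^ Suc 3 \<le> norm (Yfun s1) ^ Suc 3" by simp
      qed auto
      have "norm (Yfun s - Yfun s1) \<le> (2 * C * T powr e) * norm (s - s1)"
      proof (rule norm_Yfun_diff_le[of "cball s d \<inter> {s. Re s > 0}"])
        show "convex (cball s d \<inter> {s. 0 < Re s})"
          by (intro convex_Int convex_cball convex_halfspace_Re_gt)
        fix z assume z: "z \<in> cball s d \<inter> {s. 0 < Re s}"
        have dz: "norm (deriv Yfun z) \<le> C * (1 + norm z) powr e" by (rule C) (use z assms in auto)
        have "1 + norm z \<le> 2 * T"
          using norm_le_of_cball[of z s d] z d \<open>norm s = T - 1\<close> T by auto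
        then have "(1 + norm z) powr e \<le> (2 * T) powr e"
          using assms by (intro powr_mono2) auto
        also have "\<dots> = 2 powr e * T powr e" by (rule powr_mult)
        also have "\<dots> \<le> 2 powr 1 * T powr e" using assms by (intro mult_right_mono powr_mono) auto
        finally have "C * (1 + norm z) powr e \<le> C * (2 * T powr e)" using C by (intro mult_left_mono) auto
        then show "norm (deriv Yfun z) \<le> 2 * C * T powr e" using dz by simp
      qed (use s dist1 d R1 in \<open>auto simp: dist_norm\<close>)
      also have "\<dots> \<le> (2 * C * T powr e) * d" using dist1 C by (intro mult_left_mono) auto
      also have "\<dots> = 2 * C * k * k ^ 3 * (T powr e * T powr (- (8 * e)))"
        by (simp add: d_def eval_nat_numeral)
      also have "T powr e * T powr (- (8 * e)) = T powr (- (7 * e))" by (simp flip: powr_add)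
      also have "2 * C * k * k ^ 3 * T powr (- (7 * e)) \<le> a / 2 * k ^ 3 * T powr (- (7 * e))"
        using k by (intro mult_right_mono) auto
      finally have df: "norm (Yfun s - Yfun s1) \<le> a / 2 * k ^ 3 * T powr (- (7 * e))" .
      have "c * T powr (- (7 * e)) \<le> a * k ^ 3 / 2 * T powr (- (7 * e))"
        by (intro mult_right_mono) (auto simp: c_def)
      also have "\<dots> = a * k ^ 3 * T powr (- (7 * e)) - a / 2 * k ^ 3 * T powr (- (7 * e))" by simp
      also have "\<dots> \<le> norm (Yfun s1) - norm (Yfun s - Yfun s1)" using low df by linarith
      also have "\<dots> \<le> norm (Yfun s)"
        using norm_triangle_ineq2[of "Yfun s1" "Yfun s"] norm_minus_commute[of "Yfun s" "Yfun s1"] by linarith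
      finally show ?thesis by (simp add: T_def)
    qed
  qed
qed

text \<open>Continuity carries the bound to the line \<open>Re s = 0\<close>; in particular zeta has
  no zero there.\<close>

lemma Yfun_lower:
  assumes "0 < e" "e \<le> 1/2"
  obtains c where "c > 0" "\<And>s. Re s \<ge> 0 \<Longrightarrow> norm (Yfun s) \<ge> c * (1 + norm s) powr (- e)"
proof -
  obtain c where c: "c > 0" "\<And>s. Re s > 0 \<Longrightarrow> norm (Yfun s) \<ge> c * (1 + norm s) powr (- 7 * (e / 7))"
    using Yfun_lower_pos[of "e / 7"] assms by auto
  have "norm (Yfun s) \<ge> c * (1 + norm s) powr (- e)" if s: "Re s \<ge> 0" for s
  proof -
    have cont: "isCont Yfun s"
      using Yfun_holomorphic open_halfspace_Re_gt[of "-1/2"] holomorphic_on_imp_continuous_on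
        continuous_on_eq_continuous_at s by fastforce
    have lim: "(\<lambda>n. s + of_real (inverse (real (Suc n)))) \<longlonglongrightarrow> s + of_real 0"
      by (intro tendsto_intros LIMSEQ_inverse_real_of_nat)
    have "(\<lambda>n. norm (Yfun (s + of_real (inverse (real (Suc n)))))) \<longlonglongrightarrow> norm (Yfun s)"
      using lim by (intro tendsto_norm isCont_tendsto_compose[OF cont]) simp
    moreover have "(\<lambda>n. c * (1 + norm (s + of_real (inverse (real (Suc n))))) powr (- e)) \<longlonglongrightarrow> c * (1 + norm (s + of_real 0)) powr (- e)"
      by (rule tendsto_mult[OF tendsto_const tendsto_powr[OF tendsto_add[OF tendsto_const tendsto_norm[OF lim]] tendsto_const]])
         (use norm_ge_zero[of "s + of_real 0"] in linarith)
    moreover have "c * (1 + norm (s + of_real (inverse (real (Suc n))))) powr (- e)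
          \<le> norm (Yfun (s + of_real (inverse (real (Suc n)))))" for n
    proof -
      have "Re (s + of_real (inverse (real (Suc n)))) > 0"
        using s by (simp add: add_nonneg_pos)
      from c(2)[OF this] show ?thesis by simp
    qed
    ultimately have "c * (1 + norm (s + of_real 0)) powr (- e) \<le> norm (Yfun s)"
      by (intro LIMSEQ_le) auto
    then show ?thesis by simp
  qed
  with c show ?thesis using that by blast
qed

section \<open>The logarithmic derivative\<close>

text \<open>The part of the logarithm of an Euler factor that comes from proper prime powers. It is
  of order p^(-2 - 2 Re s), so its sum continues past the line and the whole singularity sits in
  \<open>primeP\<close>.\<close>

definition qterm :: "nat \<Rightarrow> complex \<Rightarrow> complex" where
  "qterm n s = (if prime n then - Ln (1 - of_nat n powr (- 1 - s)) - of_nat n powr (- 1 - s) else 0)"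

definition primeQ :: "complex \<Rightarrow> complex" where
  "primeQ s = (\<Sum>n. qterm n s)"

definition pterm :: "nat \<Rightarrow> complex \<Rightarrow> complex" where
  "pterm n s = (if prime n then of_nat n powr (- 1 - s) else 0)"

definition primeP :: "complex \<Rightarrow> complex" where
  "primeP s = (\<Sum>n. pterm n s)"

text \<open>3/5 is a round upper bound for 2^(-3/4). Staying below 1 keeps \<open>Ln (1 - z)\<close>
  off its cut to the left of the line as well.\<close>

lemma norm_prime_powr_le:
  assumes "prime n" "Re s > - 1/4"
  shows "norm (of_nat n powr (- 1 - s) :: complex) \<le> 3 / 5"
proof -
  have "norm (of_nat n powr (- 1 - s) :: complex) = real n powr (- (1 + Re s))"
    by (simp add: norm_nat_powr)
  also have "\<dots> \<le> 2 powr (- (1 + Re s))" using assms by (intro prime_powr_le) auto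
  also have "\<dots> \<le> 2 powr (- (3/4))"
  proof (rule powr_mono)
    show "- (1 + Re s) \<le> - (3/4)" using assms by (simp add: field_simps)
  qed simp
  also have "\<dots> \<le> 3 / 5"
  proof (rule power_le_imp_le_base[of _ 3])
    have "(2 powr (- (3/4)) :: real) ^ Suc 3 = 2 powr (- 3)"
      by (simp add: powr_power)
    also have "\<dots> = 1 / 8" by (simp add: powr_minus)
    finally show "(2 powr (- (3/4)) :: real) ^ Suc 3 \<le> (3/5) ^ Suc 3" by (simp add: field_simps)
  qed auto
  finally show ?thesis .
qed

lemma norm_qterm_le:
  assumes "Re s > - 1/4"
  shows "norm (qterm n s) \<le> 5 / 2 * real n powr (- 3/2)"
proof (cases "prime n")
  case True
  define z where "z = (of_nat n powr (- 1 - s) :: complex)"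
  have z: "norm z \<le> 3/5" unfolding z_def using True assms by (rule norm_prime_powr_le)
  have n: "real n \<ge> 1" using prime_ge_1_nat[OF True] by simp
  have "norm (qterm n s) = norm (ln (1 + (- z)) - (- z))"
    using True by (simp add: qterm_def z_def norm_minus_commute add.commute)
  also have "\<dots> \<le> norm (- z) ^ 2 / (1 - norm (- z))"
    by (rule Ln_approx_linear) (use z in auto)
  also have "\<dots> \<le> norm z ^ 2 / (2/5)"
    using z by (simp only: norm_minus_cancel, intro divide_left_mono) auto
  also have "norm z ^ 2 = real n powr (2 * (- 1 - Re s))"
    using n by (simp add: z_def norm_nat_powr powr_power)
  also have "\<dots> \<le> real n powr (- 3/2)"
  proof (rule powr_mono)
    show "2 * (- 1 - Re s) \<le> - 3/2" using assms by (simp add: field_simps)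
  qed (use n in simp)
  finally show ?thesis by simp
qed (simp add: qterm_def)

lemma summable_three_halves: "summable (\<lambda>n. 5 / 2 * real n powr (- 3/2))"
  by (intro summable_mult) (simp add: summable_real_powr_iff)

lemma norm_primeQ_le:
  assumes "Re s > - 1/4"
  shows "norm (primeQ s) \<le> (\<Sum>n. 5 / 2 * real n powr (- 3/2))"
proof -
  have sm: "summable (\<lambda>n. norm (qterm n s))"
    by (rule summable_comparison_test[OF _ summable_three_halves]) (use norm_qterm_le[OF assms] in auto)
  have "norm (primeQ s) \<le> (\<Sum>n. norm (qterm n s))"
    unfolding primeQ_def by (rule summable_norm[OF sm])
  also have "\<dots> \<le> (\<Sum>n. 5 / 2 * real n powr (- 3/2))"
    by (rule suminf_le[OF norm_qterm_le[OF assms] sm summable_three_halves])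
  finally show ?thesis .
qed

lemma summable_qterm:
  assumes "Re s > - 1/4"
  shows "summable (\<lambda>n. qterm n s)"
  by (rule summable_comparison_test[OF _ summable_three_halves]) (use norm_qterm_le[OF assms] in blast)

lemma qterm_holomorphic: "qterm n holomorphic_on {s. Re s > - 1/4}"
proof (cases "prime n")
  case True
  have nn: "1 - of_nat n powr (- 1 - s) \<notin> \<real>\<^sub>\<le>\<^sub>0" if "Re s > - 1/4" for s :: complex
  proof -
    have "Re (of_nat n powr (- 1 - s)) \<le> 3/5"
      using norm_prime_powr_le[OF True that] complex_Re_le_cmod order_trans by blast
    then show ?thesis by (auto simp: complex_nonpos_Reals_iff)
  qed
  then show ?thesis using True unfolding qterm_def [abs_def]
    by (auto intro!: holomorphic_intros)
qed (simp add: qterm_def [abs_def])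

lemma primeQ_holomorphic: "primeQ holomorphic_on {s. Re s > - 1/4}"
  unfolding primeQ_def [abs_def]
proof (rule holomorphic_on_suminf[OF open_halfspace_Re_gt qterm_holomorphic])
  fix x assume x: "x \<in> {s. Re s > - 1/4}"
  then obtain d where d: "d > 0" "cball x d \<subseteq> {s. Re s > - 1/4}"
    using open_halfspace_Re_gt[of "-1/4"] open_contains_cball by blast
  have "norm (qterm n y) \<le> 5 / 2 * real n powr (- 3/2)" if "y \<in> cball x d" for n y
    using d that by (intro norm_qterm_le) blast
  then show "\<exists>d>0. cball x d \<subseteq> {s. Re s > - 1/4} \<and>
      (\<exists>M. summable M \<and> (\<forall>n. \<forall>y\<in>cball x d. norm (qterm n y) \<le> M n))"
    using d summable_three_halves by blast
qed

lemma norm_pterm_le: "norm (pterm n s) \<le> real n powr (- 1 - Re s)"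
  by (simp add: pterm_def norm_nat_powr)

lemma summable_pterm:
  assumes "Re s > 0"
  shows "summable (\<lambda>n. norm (pterm n s))"
  by (rule summable_comparison_test[of _ "\<lambda>n. real n powr (- 1 - Re s)"])
     (use norm_pterm_le assms in \<open>auto simp: summable_real_powr_iff\<close>)

lemma primeP_holomorphic: "primeP holomorphic_on {s. Re s > 0}"
  unfolding primeP_def [abs_def]
proof (rule holomorphic_on_suminf[OF open_halfspace_Re_gt])
  show "pterm n holomorphic_on {s. 0 < Re s}" for n
    unfolding pterm_def [abs_def] by (cases "prime n") (auto intro!: holomorphic_intros)
  fix x :: complex assume x: "x \<in> {s. Re s > 0}"
  have "norm (pterm n y) \<le> real n powr (- 1 - Re x / 2)" if "y \<in> cball x (Re x / 2)" for n y
  proof (cases "n = 0")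
    case False
    have "real n powr (- 1 - Re y) \<le> real n powr (- 1 - Re x / 2)"
      using False Re_ge_of_cball[OF that] by (intro powr_mono) auto
    then show ?thesis using norm_pterm_le order_trans by blast
  qed (simp add: pterm_def)
  moreover have "summable (\<lambda>n. real n powr (- 1 - Re x / 2))" using x by (simp add: summable_real_powr_iff)
  moreover have "cball x (Re x / 2) \<subseteq> {s. Re s > 0}" using Re_ge_of_cball[of _ x "Re x / 2"] x by fastforce
  moreover have "Re x / 2 > 0" using x by simp
  ultimately show "\<exists>d>0. cball x d \<subseteq> {s. Re s > 0} \<and>
      (\<exists>M. summable M \<and> (\<forall>n. \<forall>y\<in>cball x d. norm (pterm n y) \<le> M n))"
    by blast
qed

lemma exp_primeP_primeQ:
  assumes "Re s > 0"
  shows "s * exp (primeP s + primeQ s) = szeta s"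
proof -
  have "(\<lambda>n. pterm n s + qterm n s) sums (primeP s + primeQ s)"
    unfolding primeP_def primeQ_def
    by (intro sums_add summable_sums summable_norm_cancel[OF summable_pterm] summable_qterm)
       (use assms in auto)
  moreover have "pterm n s + qterm n s = lterm n (1 + s)" for n
    by (simp add: pterm_def qterm_def lterm_def)
  ultimately have "logzeta (1 + s) = primeP s + primeQ s"
    unfolding logzeta_def by (simp add: sums_iff)
  then show ?thesis using exp_logzeta[of "1 + s"] szeta_eq_zetac[OF assms] assms by simp
qed

lemma szeta_nonzero:
  assumes "Re s \<ge> 0"
  shows "szeta s \<noteq> 0"
proof -
  obtain c where c: "c > 0" "\<And>s. Re s \<ge> 0 \<Longrightarrow> norm (Yfun s) \<ge> c * (1 + norm s) powr (- (1/2))"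
    using Yfun_lower[of "1/2"] by auto
  have "c * (1 + norm s) powr (- (1/2)) > 0"
    using c by (intro mult_pos_pos) (auto simp: add_nonneg_eq_0_iff)
  with c(2)[OF assms] show ?thesis by (auto simp: Yfun_def)
qed

text \<open>\<open>V(s) = P'(1 + s) + 1/s\<close> for the prime zeta function \<open>P\<close>: the logarithmic singularity of
  \<open>P\<close> at \<open>1\<close> is removed.\<close>

definition Vfun :: "complex \<Rightarrow> complex" where
  "Vfun s = deriv szeta s / szeta s - deriv primeQ s"

text \<open>An open set containing the closed half-plane \<open>Re s \<ge> 0\<close>, so that
  derivatives of \<open>Vfun\<close> make sense on the line itself.\<close>

definition Vdom :: "complex set" where
  "Vdom = {s. Re s > - 1/4 \<and> szeta s \<noteq> 0}"

lemma open_Vdom: "open Vdom"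
proof -
  have "continuous_on {s. Re s > - 1/4} szeta"
    by (rule holomorphic_on_imp_continuous_on[OF holomorphic_on_subset[OF szeta_holomorphic]]) auto
  then have "open ({s. Re s > - 1/4} \<inter> szeta -` (- {0}))"
    by (intro continuous_open_preimage open_halfspace_Re_gt) auto
  moreover have "{s. Re s > - 1/4} \<inter> szeta -` (- {0}) = Vdom"
    by (auto simp: Vdom_def)
  ultimately show ?thesis by simp
qed

lemma Re_nonneg_subset_Vdom: "{s. Re s \<ge> 0} \<subseteq> Vdom"
  using szeta_nonzero by (auto simp: Vdom_def)

lemma Vfun_holomorphic: "Vfun holomorphic_on Vdom"
proof -
  have "deriv szeta holomorphic_on {s. Re s > - 1/2}" "deriv primeQ holomorphic_on {s. Re s > - 1/4}"
    by (intro holomorphic_deriv szeta_holomorphic primeQ_holomorphic open_halfspace_Re_gt)+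
  then have "deriv szeta holomorphic_on Vdom" "deriv primeQ holomorphic_on Vdom" "szeta holomorphic_on Vdom"
    using szeta_holomorphic by (auto elim!: holomorphic_on_subset simp: Vdom_def)
  then show ?thesis unfolding Vfun_def [abs_def]
    by (intro holomorphic_on_diff holomorphic_on_divide) (auto simp: Vdom_def)
qed

text \<open>Logarithmic differentiation of \<open>exp_primeP_primeQ\<close>; the factor s
  contributes 1/s.\<close>

lemma primeP_deriv:
  assumes "Re s > 0"
  shows "(primeP has_field_derivative (Vfun s - 1 / s)) (at s)"
proof -
  let ?H = "{s. Re s > 0}"
  have dP: "(primeP has_field_derivative deriv primeP s) (at s)"
    by (rule holomorphic_derivI[OF primeP_holomorphic open_halfspace_Re_gt]) (use assms in auto)
  have dQ: "(primeQ has_field_derivative deriv primeQ s) (at s)"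
    by (rule holomorphic_derivI[OF primeQ_holomorphic open_halfspace_Re_gt]) (use assms in auto)
  have dZ: "(szeta has_field_derivative deriv szeta s) (at s)"
    by (rule holomorphic_derivI[OF szeta_holomorphic open_halfspace_Re_gt]) (use assms in auto)
  let ?e = "exp (primeP s + primeQ s)"
  have "((\<lambda>s. s * exp (primeP s + primeQ s)) has_field_derivative
      (?e + s * (?e * (deriv primeP s + deriv primeQ s)))) (at s)"
    by (auto intro!: derivative_eq_intros dP dQ)
  then have "(szeta has_field_derivative (?e + s * (?e * (deriv primeP s + deriv primeQ s)))) (at s)"
    by (rule DERIV_cong_ev[THEN iffD1, OF refl _ refl, rotated])
       (use assms in \<open>auto intro!: eventually_mono[OF eventually_nhds_in_open[OF open_halfspace_Re_gt[of 0]]] exp_primeP_primeQ\<close>)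
  with dZ have eq: "deriv szeta s = ?e + s * (?e * (deriv primeP s + deriv primeQ s))"
    using DERIV_unique by blast
  have nz: "s \<noteq> 0" "?e \<noteq> 0" using assms by auto
  have "deriv szeta s / szeta s = 1 / s + (deriv primeP s + deriv primeQ s)"
    unfolding eq exp_primeP_primeQ[OF assms, symmetric] using nz by (simp add: field_simps)
  then have "Vfun s - 1 / s = deriv primeP s" by (simp add: Vfun_def)
  then show ?thesis using dP by simp
qed

lemma deriv_primeQ_bound: obtains K where "K > 0" "\<And>s. Re s > - 1/8 \<Longrightarrow> norm (deriv primeQ s) \<le> K"
proof -
  define B where "B = (\<Sum>n. 5 / 2 * real n powr (- 3/2))"
  have "norm (deriv primeQ s) \<le> 16 * B + 1" if s: "Re s > - 1/8" for s
  proof -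
    have "norm ((deriv ^^ 1) primeQ s) \<le> fact 1 * B / (1/16) ^ 1"
    proof (rule Cauchy_bound_cball[OF primeQ_holomorphic open_halfspace_Re_gt])
      show sub: "cball s (1/16) \<subseteq> {s. - 1 / 4 < Re s}"
        using s Re_ge_of_cball[of _ s "1/16"] by force
      show "norm (primeQ w) \<le> B" if "w \<in> cball s (1/16)" for w
        unfolding B_def using sub that by (intro norm_primeQ_le) auto
    qed auto
    then show ?thesis by simp
  qed
  moreover have "B \<ge> 0" unfolding B_def by (intro suminf_nonneg summable_three_halves) auto
  ultimately show ?thesis using that[of "16 * B + 1"] by auto
qed

text \<open>Cauchy's inequality on a disc that shrinks with height. On radius r T^(-2e), T = 1 +
  |s|, \<open>Yfun\<close> keeps half of the lower bound known for \<open>Re s \<ge> 0\<close>, even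
  to the left of the line; hence Y'/Y is O(T^(2e)) on the disc, and k derivatives cost another
  T^(2ek).\<close>

lemma higher_deriv_Vfun_bound:
  obtains C where "C > 0" "\<And>s. Re s \<ge> 0 \<Longrightarrow> norm ((deriv ^^ k) Vfun s) \<le> C * (1 + norm s)"
proof -
  \<comment> \<open>The total exponent 2 e (k + 1) becomes exactly 1.\<close>
  define e where "e = 1 / (2 * (real k + 1))"
  have e: "0 < e" "e \<le> 1/2" by (auto simp: e_def field_simps)
  obtain C where C: "C > 0" "\<And>s. Re s > - e / 4 \<Longrightarrow> norm (deriv Yfun s) \<le> C * (1 + norm s) powr e"
    using norm_deriv_Yfun_le[OF e] by blast
  obtain c where c: "c > 0" "\<And>s. Re s \<ge> 0 \<Longrightarrow> norm (Yfun s) \<ge> c * (1 + norm s) powr (- e)"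
    using Yfun_lower[OF e] by blast
  obtain K where K: "K > 0" "\<And>s. Re s > - 1/8 \<Longrightarrow> norm (deriv primeQ s) \<le> K"
    using deriv_primeQ_bound by blast
  \<comment> \<open>The first bound keeps the disc where the derivative of \<open>Yfun\<close> is
    controlled; the second limits the variation of \<open>Yfun\<close> on it to half of its lower
    bound.\<close>
  define r where "r = min (e / 8) (c / (4 * C))"
  have r: "r > 0" "r \<le> e / 8" "2 * C * r \<le> c / 2"
  proof -
    show "r > 0" "r \<le> e / 8" using e c C by (auto simp: r_def)
    have "2 * C * r \<le> 2 * C * (c / (4 * C))" using C by (intro mult_left_mono) (auto simp: r_def)
    also have "\<dots> = c / 2" using C by simp
    finally show "2 * C * r \<le> c / 2" .
  qed
  \<comment> \<open>One summand each for Y'/Y, for 1/(1+w) and for the derivative of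
    \<open>primeQ\<close>.\<close>
  define B where "B = 4 * C / c + 2 + K"
  show ?thesis
  proof
    show "fact k * B / r ^ k > 0" using C c K r by (auto simp: B_def intro!: divide_pos_pos mult_pos_pos add_pos_pos)
  next
    fix s assume s: "Re s \<ge> 0"
    define T where "T = 1 + norm s"
    have T: "T \<ge> 1" by (simp add: T_def)
    define \<rho> where "\<rho> = r * T powr (- (2 * e))"
    have "T powr (- (2 * e)) \<le> T powr 0" using T e by (intro powr_mono) auto
    then have T1: "T powr (- (2 * e)) \<le> 1" using T by simp
    have \<rho>: "\<rho> > 0" "\<rho> \<le> r" using r T T1 by (auto simp: \<rho>_def mult_le_cancel_left1)
    have \<rho>8: "\<rho> \<le> e / 8" "\<rho> \<le> 1" using \<rho> r e by auto
    have near: "Re w > - e / 4 \<and> Re w > - 1/8 \<and> norm (deriv Yfun w) \<le> 2 * C * T powr e" if w: "w \<in> cball s \<rho>" for w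
    proof -
      have "Re w \<ge> - (e / 8)" using Re_ge_of_cball[OF w] s \<rho>8 by linarith
      then have R: "Re w > - e / 4" "Re w > - 1/8" using e by auto
      have "norm s = T - 1" by (simp add: T_def)
      then have "1 + norm w \<le> 2 * T"
        using norm_le_of_cball[OF w] \<rho>8(2) T by linarith
      then have "(1 + norm w) powr e \<le> (2 * T) powr e" using e by (intro powr_mono2) auto
      also have "\<dots> = 2 powr e * T powr e" by (rule powr_mult)
      also have "\<dots> \<le> 2 powr 1 * T powr e" using e by (intro mult_right_mono powr_mono) auto
      finally have "C * (1 + norm w) powr e \<le> C * (2 * T powr e)" using C by (intro mult_left_mono) auto
      then show ?thesis using C(2)[OF R(1)] R by simp
    qed
    have low: "c / 2 * T powr (- e) \<le> norm (Yfun w)" if w: "w \<in> cball s \<rho>" for w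
    proof -
      have "norm (Yfun s - Yfun w) \<le> (2 * C * T powr e) * norm (s - w)"
      proof (rule norm_Yfun_diff_le[OF convex_cball[of s \<rho>]])
        show "cball s \<rho> \<subseteq> {s. - 1 / 2 < Re s}" using near by fastforce
      qed (use near w \<rho> in auto)
      also have "\<dots> \<le> (2 * C * T powr e) * \<rho>" using w C by (intro mult_left_mono) (auto simp: dist_norm)
      also have "\<dots> = 2 * C * r * (T powr e * T powr (- (2 * e)))" by (simp add: \<rho>_def)
      also have "T powr e * T powr (- (2 * e)) = T powr (- e)" by (simp flip: powr_add)
      also have "2 * C * r * T powr (- e) \<le> c / 2 * T powr (- e)" using r by (intro mult_right_mono) auto
      finally have "norm (Yfun s - Yfun w) \<le> c / 2 * T powr (- e)" .
      moreover have "c * T powr (- e) \<le> norm (Yfun s)" using c(2)[OF s] by (simp add: T_def)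
      ultimately show ?thesis using norm_triangle_ineq2[of "Yfun s" "Yfun w"] by linarith
    qed
    have sub: "cball s \<rho> \<subseteq> Vdom"
    proof
      fix w assume w: "w \<in> cball s \<rho>"
      have "0 < c / 2 * T powr (- e)" using c T by simp
      then have "Yfun w \<noteq> 0" using low[OF w] by auto
      then show "w \<in> Vdom" using near[OF w] by (auto simp: Yfun_def Vdom_def)
    qed
    have "norm ((deriv ^^ k) Vfun s) \<le> fact k * (B * T powr (2 * e)) / \<rho> ^ k"
    proof (rule Cauchy_bound_cball[OF Vfun_holomorphic open_Vdom sub \<rho>(1)])
      fix w assume w: "w \<in> cball s \<rho>"
      have Rw: "Re w > - 1/8" using near[OF w] by auto
      have nz: "1 + w \<noteq> 0" "szeta w \<noteq> 0" "Yfun w \<noteq> 0"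
        using one_plus_nonzero[of w] Rw sub w by (auto simp: Vdom_def Yfun_def)
      have dZ: "(szeta has_field_derivative deriv szeta w) (at w)"
        by (rule holomorphic_derivI[OF szeta_holomorphic open_halfspace_Re_gt]) (use Rw in auto)
      have "(Yfun has_field_derivative (deriv szeta w * (1 + w) - szeta w) / ((1 + w) * (1 + w))) (at w)"
        unfolding Yfun_def [abs_def] using nz
        by (auto intro!: derivative_eq_intros dZ)
      then have "deriv Yfun w = (deriv szeta w * (1 + w) - szeta w) / ((1 + w) * (1 + w))"
        by (rule DERIV_imp_deriv)
      moreover have "a / z = ((a * u - z) / (u * u)) / (z / u) + 1 / u" if "u \<noteq> 0" "z \<noteq> 0" for a z u :: complex
      proof -
        have "((a * u - z) / (u * u)) / (z / u) = (a * u - z) / (u * z)" using that by simp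
        also have "\<dots> = a / z - 1 / u" using that by (simp add: diff_divide_distrib)
        finally show ?thesis by simp
      qed
      ultimately have "deriv szeta w / szeta w = deriv Yfun w / Yfun w + 1 / (1 + w)"
        unfolding Yfun_def[of w] using nz(1,2) by metis
      then have "norm (Vfun w) \<le> norm (deriv Yfun w / Yfun w) + norm (1 / (1 + w)) + norm (deriv primeQ w)"
        unfolding Vfun_def using norm_triangle_ineq4[of "deriv Yfun w / Yfun w + 1 / (1 + w)" "deriv primeQ w"]
          norm_triangle_ineq[of "deriv Yfun w / Yfun w" "1 / (1 + w)"] by (simp only:)
      also have "norm (deriv Yfun w / Yfun w) \<le> (2 * C * T powr e) / (c / 2 * T powr (- e))"
        unfolding norm_divide using near[OF w] low[OF w] c(1) C(1) T by (intro frac_le) auto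
      also have "\<dots> = 4 * C / c * (T powr e * T powr e)" using T c(1) by (simp add: powr_minus field_simps)
      also have "T powr e * T powr e = T powr (2 * e)" by (simp flip: powr_add)
      also have "norm (1 / (1 + w)) \<le> 2 * T powr (2 * e)"
      proof -
        have "1 / 2 \<le> norm (1 + w)" using abs_Re_le_cmod[of "1 + w"] Rw by simp
        then have "norm (1 / (1 + w)) \<le> 2" using nz by (simp add: norm_divide field_simps)
        also have "2 \<le> 2 * T powr (2 * e)" using T e by (simp add: ge_one_powr_ge_zero)
        finally show ?thesis .
      qed
      also have "norm (deriv primeQ w) \<le> K * T powr (2 * e)"
      proof -
        have "K * 1 \<le> K * T powr (2 * e)" using T e K by (intro mult_left_mono) (auto simp: ge_one_powr_ge_zero)
        then show ?thesis using K(2)[OF Rw] by simp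
      qed
      finally show "norm (Vfun w) \<le> B * T powr (2 * e)" by (simp add: B_def algebra_simps)
    qed
    also have "\<dots> = fact k * B / r ^ k * (T powr (2 * e) / (T powr (- (2 * e))) ^ k)"
      by (simp add: \<rho>_def power_mult_distrib)
    also have "T powr (2 * e) / (T powr (- (2 * e))) ^ k = T powr (2 * e + 2 * e * real k)"
    proof -
      have "(T powr (- (2 * e))) ^ k = T powr (- (2 * e) * real k)"
        using T by (simp add: powr_power mult_ac)
      then show ?thesis using T by (simp flip: powr_diff)
    qed
    also have "2 * e + 2 * e * real k = 1"
    proof -
      have "real k + 1 \<noteq> 0" by linarith
      then have "2 * e * (real k + 1) = 1" by (simp add: e_def)
      then show ?thesis by (simp add: distrib_left)
    qed
    finally show "norm ((deriv ^^ k) Vfun s) \<le> fact k * B / r ^ k * (1 + norm s)"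
      using T by (simp add: T_def)
  qed
qed

lemma primeP_of_real:
  fixes s :: real
  assumes "s > 0"
  shows "primeP (of_real s) = of_real (\<Sum>n. if prime n then real n powr (- 1 - s) else 0)"
proof -
  have "pterm n (of_real s) = of_real (if prime n then real n powr (- 1 - s) else 0)" for n
    using powr_of_real[of "real n" "- 1 - s"] by (simp add: pterm_def)
  moreover have "summable (\<lambda>n. if prime n then real n powr (- 1 - s) else 0)"
    by (rule summable_comparison_test[of _ "\<lambda>n. real n powr (- 1 - s)"])
       (use assms in \<open>auto simp: summable_real_powr_iff\<close>)
  ultimately show ?thesis unfolding primeP_def by (simp add: suminf_of_real)
qed

text \<open>The prime sum in the definition of the constant is, up to sign, the contribution of
  proper prime powers at \<open>s = 0\<close>; this is how the constant meets the behaviour of zeta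
  at its pole.\<close>

lemma mertens_const_eq: "of_real mertens_const = of_real euler_mascheroni - primeQ 0"
proof -
  define q where "q = (\<lambda>n::nat. if prime n then 1 / real n + ln (1 - 1 / real n) else 0)"
  have qq: "qterm n 0 = - of_real (q n)" for n
  proof (cases "prime n")
    case True
    then have n: "real n \<ge> 2" using prime_ge_2_nat[OF True] by simp
    have "of_nat n powr (- 1) = complex_of_real (1 / real n)"
      using n by (simp add: powr_minus divide_inverse)
    moreover have "Ln (1 - complex_of_real (1 / real n)) = of_real (ln (1 - 1 / real n))"
    proof -
      have "1 - complex_of_real (1 / real n) = of_real (1 - 1 / real n)" by simp
      then show ?thesis using Ln_of_real[of "1 - 1 / real n"] n by (simp only:) simp
    qed
    ultimately show ?thesis using True by (simp add: qterm_def q_def)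
  qed (simp add: qterm_def q_def)
  have nq: "norm (q n) \<le> 5 / 2 * real n powr (- 3/2)" for n
    using norm_qterm_le[of 0 n] by (simp add: qq)
  have sm: "summable (\<lambda>n. norm (q n))"
    by (rule summable_comparison_test[OF _ summable_three_halves]) (use nq in auto)
  have "(q has_sum suminf q) UNIV"
    by (rule norm_summable_imp_has_sum[OF sm]) (use summable_norm_cancel[OF sm] in auto)
  then have "suminf q = infsum q UNIV" by (simp add: infsumI)
  also have "\<dots> = (\<Sum>\<^sub>\<infinity>p\<in>{p::nat. prime p}. 1 / real p + ln (1 - 1 / real p))"
    by (rule infsum_cong_neutral) (auto simp: q_def)
  finally have m1: "mertens_const = euler_mascheroni + suminf q" by (simp add: mertens_const_def)
  have m2: "primeQ 0 = - of_real (suminf q)"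
    unfolding primeQ_def qq using summable_norm_cancel[OF sm]
    by (simp add: suminf_minus suminf_of_real summable_of_real)
  show ?thesis unfolding m1 m2 of_real_add diff_minus_eq_add ..
qed

text \<open>Take logarithms of moduli in \<open>exp_primeP_primeQ\<close> for small s > 0 and use
  \<open>szeta 0 = 1\<close>.\<close>

lemma primeP_limit:
  "((\<lambda>s::real. primeP (of_real s) + of_real (ln s)) \<longlongrightarrow> of_real (mertens_const - euler_mascheroni)) (at_right 0)"
proof -
  define p where "p = (\<lambda>s. \<Sum>n. if prime n then real n powr (- 1 - s) else 0)"
  have eq: "p s + ln s = ln (norm (szeta (of_real s))) - Re (primeQ (of_real s))" if "s > 0" for s
  proof -
    have "of_real s * exp (of_real (p s) + primeQ (of_real s)) = szeta (of_real s)"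
      using exp_primeP_primeQ[of "of_real s"] that primeP_of_real[OF that] by (simp add: p_def)
    then have "norm (szeta (of_real s)) = s * exp (p s + Re (primeQ (of_real s)))"
      using that by (metis abs_of_pos norm_mult norm_of_real norm_exp_eq_Re plus_complex.sel(1) Re_complex_of_real)
    then show ?thesis using that by (simp add: ln_mult)
  qed
  have cont: "isCont szeta 0" "isCont primeQ 0"
    using holomorphic_on_imp_continuous_on[OF szeta_holomorphic] holomorphic_on_imp_continuous_on[OF primeQ_holomorphic]
      open_halfspace_Re_gt[of "- 1/2"] open_halfspace_Re_gt[of "- 1/4"]
    by (simp_all add: continuous_on_eq_continuous_at)
  have of0: "((\<lambda>s::real. complex_of_real s) \<longlongrightarrow> 0) (at_right 0)"
    using tendsto_of_real[OF tendsto_ident_at[of 0 "{0<..}"], where 'a = complex] by simp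
  have "((\<lambda>s::real. ln (norm (szeta (of_real s))) - Re (primeQ (of_real s))) \<longlongrightarrow>
      ln (norm (szeta 0)) - Re (primeQ 0)) (at_right 0)"
    by (intro tendsto_diff tendsto_ln tendsto_norm tendsto_Re isCont_tendsto_compose[OF cont(1) of0]
          isCont_tendsto_compose[OF cont(2) of0]) (simp add: szeta_0)
  moreover have "ln (norm (szeta 0)) - Re (primeQ 0) = mertens_const - euler_mascheroni"
  proof -
    have "mertens_const = euler_mascheroni - Re (primeQ 0)"
      using arg_cong[OF mertens_const_eq, of Re] by (simp only: Re_complex_of_real minus_complex.sel)
    then show ?thesis by (simp add: szeta_0)
  qed
  ultimately have "((\<lambda>s::real. ln (norm (szeta (of_real s))) - Re (primeQ (of_real s))) \<longlongrightarrow> mertens_const - euler_mascheroni) (at_right 0)"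
    by simp
  then have "((\<lambda>s. p s + ln s) \<longlongrightarrow> mertens_const - euler_mascheroni) (at_right 0)"
    by (rule Lim_transform_eventually) (auto simp: eq eventually_at_filter)
  then have "((\<lambda>s. of_real (p s + ln s)) \<longlongrightarrow> complex_of_real (mertens_const - euler_mascheroni)) (at_right 0)"
    by (rule tendsto_of_real)
  then show ?thesis
    by (rule Lim_transform_eventually) (auto simp: primeP_of_real p_def eventually_at_filter)
qed

section \<open>Laplace transforms\<close>

lemma has_bochner_integral_of_has_integral:
  fixes f :: "real \<Rightarrow> real"
  assumes [measurable]: "f \<in> borel_measurable borel" "S \<in> sets borel"
    and nn: "\<And>x. x \<in> S \<Longrightarrow> 0 \<le> f x" and I: "(f has_integral I) S"
  shows "has_bochner_integral lborel (\<lambda>x. indicator S x * f x) I"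
proof (rule has_bochner_integral_nn_integral)
  have hi: "((\<lambda>x. indicator S x * f x) has_integral I) UNIV"
  proof -
    have "(\<lambda>x. indicator S x * f x) = (\<lambda>x. if x \<in> S then f x else 0)" by (auto simp: fun_eq_iff)
    then show ?thesis using I has_integral_restrict_UNIV[of S f I] by simp
  qed
  show "integral\<^sup>N lborel (\<lambda>x. ennreal (indicator S x * f x)) = ennreal I"
    by (rule nn_integral_has_integral_lborel[OF _ _ hi]) (auto simp: nn indicator_def)
  show "0 \<le> I" using has_integral_nonneg[OF I] nn by auto
qed (auto simp: nn indicator_def)

text \<open>Differentiation under the integral sign for exponential integrals; both the Laplace
  transform (exponent \<open>-v\<close>) and the Gamma integral (exponent \<open>ln u\<close>) are of this form.\<close>

lemma abs_le_exp_sum: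
  fixes y d :: real
  assumes "d > 0"
  shows "\<bar>y\<bar> \<le> (exp (d * y) + exp (- d * y)) / d"
    "y\<^sup>2 * exp (d * \<bar>y\<bar>) \<le> 2 / d\<^sup>2 * (exp (2 * d * y) + exp (- 2 * d * y))"
proof -
  have e1: "exp (c * \<bar>y\<bar>) \<le> exp (c * y) + exp (- c * y)" for c :: real
    by (cases "y \<ge> 0") auto
  have "d * \<bar>y\<bar> \<le> exp (d * \<bar>y\<bar>)" using exp_ge_add_one_self[of "d * \<bar>y\<bar>"] by linarith
  also have "\<dots> \<le> exp (d * y) + exp (- d * y)" by (rule e1)
  finally show "\<bar>y\<bar> \<le> (exp (d * y) + exp (- d * y)) / d"
    using assms by (simp add: pos_le_divide_eq mult.commute)
  have q: "(d * \<bar>y\<bar>)\<^sup>2 / 2 \<le> exp (d * \<bar>y\<bar>)"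
  proof -
    have nn: "0 \<le> d * \<bar>y\<bar>" using assms by simp
    show ?thesis using exp_lower_Taylor_quadratic[OF nn] nn by linarith
  qed
  have "y\<^sup>2 = 2 / d\<^sup>2 * ((d * \<bar>y\<bar>)\<^sup>2 / 2)" using assms by (simp add: power_mult_distrib)
  also have "\<dots> \<le> 2 / d\<^sup>2 * exp (d * \<bar>y\<bar>)" by (rule mult_left_mono[OF q]) simp
  finally have "y\<^sup>2 \<le> 2 / d\<^sup>2 * exp (d * \<bar>y\<bar>)" .
  then have "y\<^sup>2 * exp (d * \<bar>y\<bar>) \<le> 2 / d\<^sup>2 * exp (d * \<bar>y\<bar>) * exp (d * \<bar>y\<bar>)"
    by (intro mult_right_mono) auto
  also have "\<dots> = 2 / d\<^sup>2 * exp ((2 * d) * \<bar>y\<bar>)" by (simp only: mult.assoc exp_add[symmetric] mult_2 distrib_right)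
  also have "\<dots> \<le> 2 / d\<^sup>2 * (exp ((2 * d) * y) + exp (- (2 * d) * y))"
    by (intro mult_left_mono e1) auto
  finally show "y\<^sup>2 * exp (d * \<bar>y\<bar>) \<le> 2 / d\<^sup>2 * (exp (2 * d * y) + exp (- 2 * d * y))" by simp
qed

text \<open>The range of exponents is an open interval with extended real ends, so that (-1,
  infinity) for Gamma and (0, infinity) for the Laplace transform are both instances.\<close>

locale exp_integral =
  fixes M :: "'x measure" and g \<phi> :: "'x \<Rightarrow> real" and a b :: ereal
  assumes g_meas [measurable]: "g \<in> borel_measurable M"
    and phi_meas [measurable]: "\<phi> \<in> borel_measurable M"
    and int_real: "\<And>c. a < ereal c \<Longrightarrow> ereal c < b \<Longrightarrow> integrable M (\<lambda>x. g x * exp (c * \<phi> x))"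
begin

definition Phi :: "nat \<Rightarrow> complex \<Rightarrow> complex" where
  "Phi k s = (\<integral>x. of_real (g x * \<phi> x ^ k) * exp (s * of_real (\<phi> x)) \<partial>M)"

definition strip :: "complex set" where
  "strip = {s. a < ereal (Re s) \<and> ereal (Re s) < b}"

text \<open>An extra factor \<open>\<phi>\<close> is absorbed by shifting the exponent slightly to
  either side, which is possible because the range is open.\<close>

lemma step: "exp_integral M (\<lambda>x. g x * \<phi> x) \<phi> a b"
proof
  fix c :: real assume c: "a < ereal c" "ereal c < b"
  obtain c1 where c1: "a < ereal c1" "ereal c1 < ereal c" using ereal_dense2[OF c(1)] by blast
  obtain c2 where c2: "ereal c < ereal c2" "ereal c2 < b" using ereal_dense2[OF c(2)] by blast
  define d where "d = min (c - c1) (c2 - c)"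
  have d: "d > 0" "c1 \<le> c - d" "c + d \<le> c2" using c1 c2 by (auto simp: d_def)
  have i: "integrable M (\<lambda>x. g x * exp ((c + d) * \<phi> x))" "integrable M (\<lambda>x. g x * exp ((c - d) * \<phi> x))"
  proof -
    have "a < ereal (c + d)" "a < ereal (c - d)" "ereal (c + d) < b" "ereal (c - d) < b"
      using less_le_trans[OF c(1), of "ereal (c + d)"] less_le_trans[OF c1(1), of "ereal (c - d)"]
        le_less_trans[OF _ c2(2), of "ereal (c + d)"] le_less_trans[OF _ c(2), of "ereal (c - d)"] d by auto
    then show "integrable M (\<lambda>x. g x * exp ((c + d) * \<phi> x))" "integrable M (\<lambda>x. g x * exp ((c - d) * \<phi> x))"
      using int_real by blast+
  qed
  show "integrable M (\<lambda>x. g x * \<phi> x * exp (c * \<phi> x))"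
  proof (rule Bochner_Integration.integrable_bound[OF integrable_mult_right[OF Bochner_Integration.integrable_add[OF integrable_abs[OF i(1)] integrable_abs[OF i(2)]], of "1 / d"]])
    show "AE x in M. norm (g x * \<phi> x * exp (c * \<phi> x)) \<le>
       norm (1 / d * (\<bar>g x * exp ((c + d) * \<phi> x)\<bar> + \<bar>g x * exp ((c - d) * \<phi> x)\<bar>))"
    proof (rule AE_I2)
      fix x
      have "\<bar>g x\<bar> * exp (c * \<phi> x) * \<bar>\<phi> x\<bar> \<le> \<bar>g x\<bar> * exp (c * \<phi> x) * ((exp (d * \<phi> x) + exp (- d * \<phi> x)) / d)"
        by (intro mult_left_mono abs_le_exp_sum d) auto
      also have "\<dots> = 1 / d * (\<bar>g x * exp ((c + d) * \<phi> x)\<bar> + \<bar>g x * exp ((c - d) * \<phi> x)\<bar>)"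
        by (simp add: abs_mult distrib_right left_diff_distrib exp_add exp_diff exp_minus distrib_left add_divide_distrib divide_inverse)
      finally show "norm (g x * \<phi> x * exp (c * \<phi> x)) \<le>
       norm (1 / d * (\<bar>g x * exp ((c + d) * \<phi> x)\<bar> + \<bar>g x * exp ((c - d) * \<phi> x)\<bar>))"
        using d by (simp add: abs_mult mult_ac)
    qed
  qed measurable
qed measurable

lemma step_power: "exp_integral M (\<lambda>x. g x * \<phi> x ^ k) \<phi> a b"
proof (induction k)
  case 0
  show ?case using exp_integral_axioms by simp
next
  case (Suc k)
  from exp_integral.step[OF this] show ?case by (simp add: mult_ac)
qed

lemma integrable_Phi:
  assumes "s \<in> strip"
  shows "integrable M (\<lambda>x. complex_of_real (g x * \<phi> x ^ k) * exp (s * of_real (\<phi> x)))"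
proof -
  have "integrable M (\<lambda>x. (g x * \<phi> x ^ k) * exp (Re s * \<phi> x))"
    using assms by (intro exp_integral.int_real[OF step_power]) (auto simp: strip_def)
  then show ?thesis
    by (rule Bochner_Integration.integrable_bound) (auto simp: norm_mult abs_mult norm_power power_abs)
qed

lemma open_strip: "open strip"
proof -
  have "strip = (\<lambda>s. ereal (Re s)) -` {a<..<b}" by (auto simp: strip_def)
  moreover have "continuous_on UNIV (\<lambda>s. ereal (Re s))"
    by (intro continuous_intros)
  ultimately show ?thesis
    by (metis continuous_on_open_vimage open_UNIV open_greaterThanLessThan Int_UNIV_right)
qed

text \<open>The second-order remainder of the exponential is at most |h|^2 times one integrable
  function for all small h, so the difference quotient converges with error O(|h|).\<close>

lemma Phi_deriv:
  assumes s: "s \<in> strip"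
  shows "(Phi k has_field_derivative Phi (Suc k) s) (at s)"
proof -
  obtain r where r: "r > 0" "cball s r \<subseteq> strip"
    using open_strip s open_contains_cball by blast
  define d where "d = r / 2"
  have d: "d > 0" using r by (simp add: d_def)
  define G where "G = (\<lambda>x. g x * \<phi> x ^ k)"
  have [measurable]: "G \<in> borel_measurable M" unfolding G_def by measurable
  have in_strip: "s + of_real t \<in> strip" if "\<bar>t\<bar> \<le> r" for t
    using r(2) that by (auto simp: dist_norm)
  have int: "integrable M (\<lambda>x. G x * exp ((Re s + t) * \<phi> x))" if "\<bar>t\<bar> \<le> r" for t
    using in_strip[OF that] unfolding G_def by (intro exp_integral.int_real[OF step_power]) (auto simp: strip_def)
  \<comment> \<open>The majorant involves the exponents Re s + 2d and Re s - 2d; with d = r/2 both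
    still lie in the strip.\<close>
  define K where "K = (\<lambda>x. 2 / d\<^sup>2 * (\<bar>G x * exp ((Re s + 2 * d) * \<phi> x)\<bar> + \<bar>G x * exp ((Re s + (- 2 * d)) * \<phi> x)\<bar>))"
  have intK: "integrable M K"
    unfolding K_def by (intro integrable_mult_right Bochner_Integration.integrable_add integrable_abs int) (use r in \<open>auto simp: d_def\<close>)
  have Kbound: "norm (of_real (G x) * (exp ((s + h) * of_real (\<phi> x)) - exp (s * of_real (\<phi> x)) - h * of_real (\<phi> x) * exp (s * of_real (\<phi> x))))
      \<le> norm h ^ 2 * K x" if h: "norm h \<le> d" for h x
  proof -
    let ?p = "complex_of_real (\<phi> x)"
    have "exp ((s + h) * ?p) - exp (s * ?p) - h * ?p * exp (s * ?p) = exp (s * ?p) * (exp (h * ?p) - (\<Sum>i\<le>1. (h * ?p) ^ i / fact i))"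
      by (simp add: algebra_simps exp_add)
    then have "norm (of_real (G x) * (exp ((s + h) * ?p) - exp (s * ?p) - h * ?p * exp (s * ?p))) =
       \<bar>G x\<bar> * exp (Re s * \<phi> x) * norm (exp (h * ?p) - (\<Sum>i\<le>1. (h * ?p) ^ i / fact i))"
      by (simp add: norm_mult)
    also have "\<dots> \<le> \<bar>G x\<bar> * exp (Re s * \<phi> x) * (exp (norm (h * ?p)) * norm (h * ?p) ^ Suc 1 / fact 1)"
      by (intro mult_left_mono Taylor_exp_field) auto
    also have "\<dots> = \<bar>G x\<bar> * exp (Re s * \<phi> x) * norm h ^ 2 * ((\<phi> x)\<^sup>2 * exp (norm h * \<bar>\<phi> x\<bar>))"
      by (simp add: norm_mult power_mult_distrib power2_eq_square)
    also have "\<dots> \<le> \<bar>G x\<bar> * exp (Re s * \<phi> x) * norm h ^ 2 * ((\<phi> x)\<^sup>2 * exp (d * \<bar>\<phi> x\<bar>))"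
      using h by (intro mult_left_mono) (auto intro!: mult_right_mono)
    also have "\<dots> \<le> \<bar>G x\<bar> * exp (Re s * \<phi> x) * norm h ^ 2 * (2 / d\<^sup>2 * (exp (2 * d * \<phi> x) + exp (- 2 * d * \<phi> x)))"
      by (intro mult_left_mono abs_le_exp_sum d) auto
    also have "\<dots> = norm h ^ 2 * K x"
      by (simp add: K_def abs_mult distrib_right distrib_left left_diff_distrib exp_add exp_diff exp_minus divide_inverse)
    finally show ?thesis .
  qed
  have main: "norm (Phi k (s + h) - Phi k s - h * Phi (Suc k) s) \<le> norm h ^ 2 * integral\<^sup>L M K" if h: "norm h \<le> d" for h
  proof -
    have sh: "s + h \<in> strip" using r(2) h d by (auto simp: dist_norm d_def)
    have eq: "Phi k (s + h) - Phi k s - h * Phi (Suc k) s =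
       (\<integral>x. of_real (G x) * (exp ((s + h) * of_real (\<phi> x)) - exp (s * of_real (\<phi> x)) - h * of_real (\<phi> x) * exp (s * of_real (\<phi> x))) \<partial>M)"
    proof -
      have "Phi k (s + h) - Phi k s - h * Phi (Suc k) s = (\<integral>x. of_real (g x * \<phi> x ^ k) * exp ((s + h) * of_real (\<phi> x)) - of_real (g x * \<phi> x ^ k) * exp (s * of_real (\<phi> x)) - h * (of_real (g x * \<phi> x ^ Suc k) * exp (s * of_real (\<phi> x))) \<partial>M)"
        unfolding Phi_def by (simp only: Bochner_Integration.integral_diff integral_mult_right_zero integrable_Phi[OF sh] integrable_Phi[OF s] integrable_mult_right Bochner_Integration.integrable_diff)
      then show ?thesis by (simp add: G_def algebra_simps)
    qed
    have iK: "integrable M (\<lambda>x. norm h ^ 2 * K x)" using intK by simp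
    let ?f = "\<lambda>x. of_real (G x) * (exp ((s + h) * of_real (\<phi> x)) - exp (s * of_real (\<phi> x)) - h * of_real (\<phi> x) * exp (s * of_real (\<phi> x)))"
    have "integrable M ?f"
    proof (rule Bochner_Integration.integrable_bound[OF iK])
      show "AE x in M. norm (?f x) \<le> norm (norm h ^ 2 * K x)"
        using Kbound[OF h] by (intro AE_I2) (metis abs_ge_self order_trans real_norm_def)
    qed measurable
    then have "(\<integral>x. norm (?f x) \<partial>M) \<le> (\<integral>x. norm h ^ 2 * K x \<partial>M)"
      by (intro integral_mono integrable_norm iK Kbound[OF h])
    then show ?thesis unfolding eq integral_mult_right_zero[symmetric]
      by (rule order_trans[OF integral_norm_bound])
  qed
  show ?thesis
    unfolding DERIV_def
  proof (rule LIM_zero_cancel, rule Lim_null_comparison)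
    show "((\<lambda>h. norm h * integral\<^sup>L M K) \<longlongrightarrow> 0) (at (0::complex))"
      by (auto intro!: tendsto_eq_intros)
    have "\<forall>\<^sub>F h in at 0. h \<noteq> 0 \<and> norm (h::complex) \<le> d"
      using eventually_at[of "\<lambda>h. h \<noteq> 0 \<and> norm (h::complex) \<le> d" 0 UNIV] d by (auto intro!: exI[of _ d])
    then show "\<forall>\<^sub>F h in at 0. norm ((Phi k (s + h) - Phi k s) / h - Phi (Suc k) s) \<le> norm h * integral\<^sup>L M K"
    proof eventually_elim
      case (elim h)
      have "(Phi k (s + h) - Phi k s) / h - Phi (Suc k) s = (Phi k (s + h) - Phi k s - h * Phi (Suc k) s) / h"
        using elim by (simp add: diff_divide_distrib)
      then have "norm ((Phi k (s + h) - Phi k s) / h - Phi (Suc k) s) = norm (Phi k (s + h) - Phi k s - h * Phi (Suc k) s) / norm h"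
        by (simp only: norm_divide)
      also have "\<dots> \<le> norm h ^ 2 * integral\<^sup>L M K / norm h"
        by (intro divide_right_mono main) (use elim in auto)
      finally show ?case using elim by (simp add: power2_eq_square)
    qed
  qed
qed

end

section \<open>The Gamma integral and Euler's constant\<close>

lemma Gamma_has_bochner_integral:
  assumes "x > (0::real)"
  shows "has_bochner_integral lborel (\<lambda>t. indicator {0<..} t * exp (- t) * exp ((x - 1) * ln t)) (Gamma x)"
proof -
  have "has_bochner_integral lborel (\<lambda>t. indicator {0..} t * (t powr (x - 1) / exp t)) (Gamma x)"
    by (rule has_bochner_integral_of_has_integral[OF _ _ _ Gamma_integral_real[OF assms]]) auto
  moreover have "indicator {0..} t * (t powr (x - 1) / exp t) = indicator {0<..} t * exp (- t) * exp ((x - 1) * ln t)" for t :: real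
    by (auto simp: powr_def exp_minus divide_inverse indicator_def)
  ultimately show ?thesis by simp
qed

lemma exp_integral_Gamma:
  "exp_integral lborel (\<lambda>t. indicator {0<..} t * exp (- t)) ln (ereal (- 1)) \<infinity>"
proof
  fix c :: real assume "ereal (- 1) < ereal c"
  then show "integrable lborel (\<lambda>t. indicator {0<..} t * exp (- t) * exp (c * ln t))"
    using Gamma_has_bochner_integral[of "c + 1"] by (auto simp: has_bochner_integral_iff)
qed measurable

text \<open>The value is Gamma'(1): the derivative under the integral sign is compared with the
  known derivative of Gamma.\<close>

lemma integral_ln_exp:
  "has_bochner_integral lborel (\<lambda>t::real. indicator {0<..} t * (exp (- t) * ln t)) (- euler_mascheroni)"
proof -
  interpret G: exp_integral lborel "\<lambda>t. indicator {0<..} t * exp (- t)" ln "ereal (- 1)" \<infinity>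
    by (rule exp_integral_Gamma)
  have s0: "0 \<in> G.strip" by (simp add: G.strip_def)
  have Phi0: "G.Phi 0 (of_real x) = of_real (Gamma (x + 1))" if "x > - 1" for x
  proof -
    have "G.Phi 0 (of_real x) = (\<integral>t. complex_of_real (indicator {0<..} t * exp (- t) * exp (x * ln t)) \<partial>lborel)"
      unfolding G.Phi_def by (rule Bochner_Integration.integral_cong) (auto simp flip: exp_of_real)
    also have "\<dots> = of_real (Gamma (x + 1))"
      using Gamma_has_bochner_integral[of "x + 1"] that
      by (subst integral_complex_of_real) (simp add: has_bochner_integral_iff)
    finally show ?thesis .
  qed
  have "((\<lambda>x::real. G.Phi 0 (of_real x)) has_vector_derivative G.Phi (Suc 0) 0) (at 0)"
    using has_vector_derivative_real_field[of "G.Phi 0" "G.Phi (Suc 0) 0" 0 UNIV] G.Phi_deriv[OF s0, of 0] by simp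
  moreover have "((\<lambda>x::real. G.Phi 0 (of_real x)) has_vector_derivative of_real (- euler_mascheroni)) (at 0)"
  proof -
    have "((\<lambda>x::real. Gamma (x + 1)) has_field_derivative (Gamma 1 * Digamma 1 * 1)) (at 0)"
      by (rule DERIV_chain'[of "\<lambda>x. x + 1"]) (auto intro!: derivative_eq_intros has_field_derivative_Gamma)
    then have "((\<lambda>x::real. Gamma (x + 1)) has_field_derivative - euler_mascheroni) (at 0)"
      by simp
    then have "((\<lambda>x::real. complex_of_real (Gamma (x + 1))) has_vector_derivative of_real (- euler_mascheroni)) (at 0)"
      by (rule has_vector_derivative_of_real)
    then show ?thesis
      by (rule has_vector_derivative_transform_within_open[of _ _ _ "{-1<..}"]) (auto simp: Phi0)
  qed
  ultimately have "G.Phi (Suc 0) 0 = of_real (- euler_mascheroni)"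
    by (rule vector_derivative_unique_at)
  moreover have "G.Phi (Suc 0) 0 = (\<integral>t. complex_of_real (indicator {0<..} t * (exp (- t) * ln t)) \<partial>lborel)"
    unfolding G.Phi_def by (rule Bochner_Integration.integral_cong) auto
  ultimately have "complex_of_real (\<integral>t. indicator {0<..} t * (exp (- t) * ln t) \<partial>lborel) = of_real (- euler_mascheroni)"
    by (simp only: integral_complex_of_real)
  moreover have "integrable lborel (\<lambda>t::real. indicator {0<..} t * (exp (- t) * ln t))"
    using exp_integral.int_real[OF exp_integral.step[OF exp_integral_Gamma], of 0] by (simp add: mult.assoc)
  ultimately show ?thesis
    by (simp only: of_real_eq_iff has_bochner_integral_iff simp_thms)
qed

section \<open>Laplace transforms of the prime sum, the logarithm and their difference\<close>

definition msum :: "real \<Rightarrow> real" where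
  "msum v = (\<Sum>p | prime p \<and> ln (real p) \<le> v. 1 / real p)"

text \<open>Zero on the nonpositive half-line, so that integrals over the whole line are Laplace
  transforms and convolutions run over [0, u] only.\<close>

definition err :: "real \<Rightarrow> real" where
  "err v = (if v > 0 then msum v - ln v - mertens_const else 0)"

lemma finite_primes_ln_le: "finite {p. prime p \<and> ln (real p) \<le> v}"
proof (rule finite_subset)
  show "{p. prime p \<and> ln (real p) \<le> v} \<subseteq> {..nat \<lceil>exp v\<rceil>}"
  proof
    fix p assume "p \<in> {p. prime p \<and> ln (real p) \<le> v}"
    then have "real p > 0" "ln (real p) \<le> v" by (auto simp: prime_gt_0_nat)
    then have "real p \<le> exp v" by (metis exp_le_cancel_iff exp_ln)
    then show "p \<in> {..nat \<lceil>exp v\<rceil>}" by (simp add: le_nat_iff) linarith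
  qed
qed simp

lemma msum_mono: "v \<le> w \<Longrightarrow> msum v \<le> msum w"
  unfolding msum_def by (intro sum_mono2 finite_primes_ln_le) auto

lemma msum_nonneg: "0 \<le> msum v"
  unfolding msum_def by (intro sum_nonneg) auto

lemma msum_measurable [measurable]: "msum \<in> borel_measurable borel"
  by (rule borel_measurable_mono) (auto simp: mono_def msum_mono)

lemma err_measurable [measurable]: "err \<in> borel_measurable borel"
  unfolding err_def [abs_def] by measurable

lemma ln_prime_pos: "prime p \<Longrightarrow> ln (real p) > 0"
  using prime_gt_1_nat[of p] by simp

lemma msum_nonpos: "v \<le> 0 \<Longrightarrow> msum v = 0"
proof -
  assume "v \<le> 0"
  then have "\<not> ln (real p) \<le> v" if "prime p" for p
    using ln_prime_pos[OF that] by linarith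
  then have "{p. prime p \<and> ln (real p) \<le> v} = {}" by blast
  then show ?thesis by (simp only: msum_def sum.empty)
qed

definition pcoef :: "nat \<Rightarrow> real" where "pcoef n = (if prime n then 1 / real n else 0)"

lemma msum_suminf:
  "(\<lambda>n. pcoef n * indicator {ln (real n)..} v) sums msum v"
proof -
  have "(\<lambda>n. if n \<in> {p. prime p \<and> ln (real p) \<le> v} then 1 / real n else 0) sums msum v"
    unfolding msum_def by (rule sums_If_finite_set[OF finite_primes_ln_le])
  moreover have "(\<lambda>n. if n \<in> {p. prime p \<and> ln (real p) \<le> v} then 1 / real n else 0) =
      (\<lambda>n. pcoef n * indicator {ln (real n)..} v)"
    by (auto simp: pcoef_def fun_eq_iff indicator_def)
  ultimately show ?thesis by simp
qed

text \<open>Each prime contributes a step at ln p of height 1/p, with transform p^(-1-s)/s; all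
  terms are nonnegative, so sum and integral may be exchanged.\<close>

lemma msum_laplace:
  assumes s: "s > (0::real)"
  shows "has_bochner_integral lborel (\<lambda>v. msum v * exp (- s * v)) ((\<Sum>n. if prime n then real n powr (- 1 - s) else 0) / s)"
proof -
  let ?f = "\<lambda>n v. pcoef n * (indicator {ln (real n)..} v * exp (- s * v))"
  have hb: "has_bochner_integral lborel (\<lambda>v. indicator {c..} v * exp (- s * v)) (exp (- s * c) / s)" for c
    by (rule has_bochner_integral_of_has_integral[OF _ _ _ has_integral_exp_minus_to_infinity[OF s]]) auto
  have val: "has_bochner_integral lborel (?f n) ((if prime n then real n powr (- 1 - s) else 0) / s)" for n
  proof (cases "prime n")
    case True
    have n: "real n > 0" using True by (simp add: prime_gt_0_nat)
    have val: "pcoef n * (exp (- s * ln (real n)) / s) = real n powr (- 1 - s) / s"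
    proof -
      have 1: "exp (- s * ln (real n)) = real n powr (- s)" using n by (simp add: powr_def)
      have 2: "real n powr (- 1 - s) = real n powr (- 1) * real n powr (- s)" by (subst powr_add[symmetric]) simp
      have 3: "real n powr (- 1) = 1 / real n" using n by (simp add: powr_minus_divide)
      show ?thesis unfolding 1 2 3 using True by (simp add: pcoef_def)
    qed
    show ?thesis
      using has_bochner_integral_mult_right[OF hb, of "pcoef n" "ln (real n)"] by (simp only: val True if_True)
  next
    case False
    then show ?thesis by (simp add: pcoef_def has_bochner_integral_zero)
  qed
  have nf: "norm (?f n v) = ?f n v" for n v by (simp add: pcoef_def)
  have smp: "summable (\<lambda>n. if prime n then real n powr (- 1 - s) else 0)"
    by (rule summable_comparison_test[of _ "\<lambda>n. real n powr (- 1 - s)"])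
       (use s in \<open>auto simp: summable_real_powr_iff\<close>)
  have sums_v: "(\<lambda>n. ?f n v) sums (msum v * exp (- s * v))" for v
    using sums_mult2[OF msum_suminf, of v "exp (- s * v)"] by (simp add: mult.assoc)
  have A1: "integrable lborel (?f n)" for n using val[of n] by (simp add: has_bochner_integral_iff)
  have A2: "AE v in lborel. summable (\<lambda>n. norm (?f n v))"
    unfolding nf by (rule AE_I2) (rule sums_summable[OF sums_v])
  have A3: "summable (\<lambda>n. \<integral>v. norm (?f n v) \<partial>lborel)"
  proof -
    have "(\<integral>v. norm (?f n v) \<partial>lborel) = (if prime n then real n powr (- 1 - s) else 0) / s" for n
      unfolding nf by (rule has_bochner_integral_integral_eq[OF val])
    then show ?thesis by (simp only: summable_divide[OF smp])
  qed
  have eq: "(\<Sum>n. ?f n v) = msum v * exp (- s * v)" for v using sums_v[of v] by (simp add: sums_iff)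
  have "integrable lborel (\<lambda>v. msum v * exp (- s * v))"
    using integrable_suminf[OF A1 A2 A3] unfolding eq .
  moreover have "(\<integral>v. msum v * exp (- s * v) \<partial>lborel) = (\<Sum>n. integral\<^sup>L lborel (?f n))"
    using integral_suminf[OF A1 A2 A3] unfolding eq .
  moreover have "\<dots> = (\<Sum>n. (if prime n then real n powr (- 1 - s) else 0) / s)"
    by (simp only: has_bochner_integral_integral_eq[OF val])
  moreover have "\<dots> = (\<Sum>n. if prime n then real n powr (- 1 - s) else 0) / s"
    by (rule suminf_divide[OF smp])
  ultimately show ?thesis by (simp add: has_bochner_integral_iff)
qed

text \<open>The substitution t = s v reduces this to \<open>integral_ln_exp\<close>.\<close>

lemma ln_laplace:
  assumes s: "s > (0::real)"
  shows "has_bochner_integral lborel (\<lambda>v. indicator {0<..} v * (exp (- s * v) * ln v)) ((- ln s - euler_mascheroni) / s)"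
proof -
  have e1: "has_bochner_integral lborel (\<lambda>t::real. indicator {0<..} t * exp (- t)) 1"
    using Gamma_has_bochner_integral[of 1] by simp
  have "has_bochner_integral lborel (\<lambda>t. indicator {0<..} t * (exp (- t) * ln t) - ln s * (indicator {0<..} t * exp (- t))) (- euler_mascheroni - ln s * 1)"
    by (intro has_bochner_integral_diff integral_ln_exp has_bochner_integral_mult_right e1)
  from lborel_has_bochner_integral_real_affine_iff[THEN iffD1, OF _ this, of s 0] s
  have "has_bochner_integral lborel (\<lambda>x. indicator {0<..} (s * x) * (exp (- (s * x)) * ln (s * x)) - ln s * (indicator {0<..} (s * x) * exp (- (s * x))))
     ((- euler_mascheroni - ln s) /\<^sub>R \<bar>s\<bar>)" by simp
  moreover have "indicator {0<..} (s * x) * (exp (- (s * x)) * ln (s * x)) - ln s * (indicator {0<..} (s * x) * exp (- (s * x))) =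
     indicator {0<..} x * (exp (- s * x) * ln x)" for x
    using s by (cases "x > 0") (auto simp: ln_mult zero_less_mult_iff algebra_simps)
  moreover have "(- euler_mascheroni - ln s) /\<^sub>R \<bar>s\<bar> = (- ln s - euler_mascheroni) / s"
    using s by (simp add: divide_inverse minus_diff_commute mult.commute)
  ultimately show ?thesis by (simp only:)
qed

text \<open>The constants are arranged so that the numerator tends to 0 as s tends to 0, by
  \<open>primeP_limit\<close>, although P(1+s) and ln s separately do not converge.\<close>

lemma err_laplace_real:
  assumes s: "s > (0::real)"
  shows "has_bochner_integral lborel (\<lambda>v. err v * exp (- s * v))
    (((\<Sum>n. if prime n then real n powr (- 1 - s) else 0) + ln s + euler_mascheroni - mertens_const) / s)"
proof -
  have c: "has_bochner_integral lborel (\<lambda>v. indicator {0..} v * exp (- s * v)) (exp (- s * 0) / s)"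
    by (rule has_bochner_integral_of_has_integral[OF _ _ _ has_integral_exp_minus_to_infinity[OF s]]) auto
  have "has_bochner_integral lborel (\<lambda>v. msum v * exp (- s * v) - indicator {0<..} v * (exp (- s * v) * ln v) - mertens_const * (indicator {0..} v * exp (- s * v)))
     ((\<Sum>n. if prime n then real n powr (- 1 - s) else 0) / s - (- ln s - euler_mascheroni) / s - mertens_const * (exp (- s * 0) / s))"
    by (intro has_bochner_integral_diff msum_laplace ln_laplace has_bochner_integral_mult_right c s)
  also have "(\<Sum>n. if prime n then real n powr (- 1 - s) else 0) / s - (- ln s - euler_mascheroni) / s - mertens_const * (exp (- s * 0) / s) =
     ((\<Sum>n. if prime n then real n powr (- 1 - s) else 0) + ln s + euler_mascheroni - mertens_const) / s"
    using s by (simp add: diff_divide_distrib add_divide_distrib)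
  finally have hb: "has_bochner_integral lborel (\<lambda>v. msum v * exp (- s * v) - indicator {0<..} v * (exp (- s * v) * ln v) - mertens_const * (indicator {0..} v * exp (- s * v)))
     (((\<Sum>n. if prime n then real n powr (- 1 - s) else 0) + ln s + euler_mascheroni - mertens_const) / s)" .
  have ae: "AE v in lborel. msum v * exp (- s * v) - indicator {0<..} v * (exp (- s * v) * ln v) - mertens_const * (indicator {0..} v * exp (- s * v))
     = err v * exp (- s * v)"
    using AE_lborel_singleton[of "0::real"]
    by eventually_elim (auto simp: err_def indicator_def msum_nonpos algebra_simps)
  show ?thesis
    by (rule has_bochner_integral_cong_AE[THEN iffD1, OF _ _ ae hb]) measurable
qed

section \<open>The transform of \<open>err\<close> as a mean of \<open>Vfun\<close>\<close>

lemma exp_integral_err: "exp_integral lborel err (\<lambda>v. - v) 0 \<infinity>"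
proof
  fix c :: real assume "(0::ereal) < ereal c"
  then show "integrable lborel (\<lambda>v. err v * exp (c * - v))"
    using err_laplace_real[of c] by (auto simp: has_bochner_integral_iff)
qed measurable

interpretation L: exp_integral lborel err "\<lambda>v. - v" 0 \<infinity>
  by (rule exp_integral_err)

lemma L_strip: "L.strip = {s. Re s > 0}"
  by (simp add: L.strip_def)

text \<open>For \<open>k = 0\<close> this is the mean of \<open>Vfun\<close> over the segment from 0
  to s; the general case is its k-th derivative in s, the power of \<open>\<tau>\<close> coming from
  the chain rule. The endpoint 0 lies on the line, which is why bounds on the closed half-plane are
  required.\<close>

definition Uint :: "nat \<Rightarrow> complex \<Rightarrow> complex" where
  "Uint k s = integral {0..1} (\<lambda>\<tau>::real. of_real (\<tau> ^ k) * (deriv ^^ k) Vfun (of_real \<tau> * s))"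

lemma scale_in_Vdom:
  assumes "Re s > 0" "\<tau> \<in> {0..1::real}"
  shows "of_real \<tau> * s \<in> Vdom"
  using Re_nonneg_subset_Vdom assms by (auto simp: subset_iff)

lemma higher_deriv_Vfun_deriv:
  assumes "z \<in> Vdom"
  shows "((deriv ^^ k) Vfun has_field_derivative (deriv ^^ Suc k) Vfun z) (at z)"
  using holomorphic_derivI[OF holomorphic_higher_deriv[OF Vfun_holomorphic open_Vdom] open_Vdom assms, of k] by simp

lemma higher_deriv_Vfun_cont: "continuous_on Vdom ((deriv ^^ k) Vfun)"
  by (intro holomorphic_on_imp_continuous_on holomorphic_higher_deriv Vfun_holomorphic open_Vdom)

lemma Uint_integrand_cont:
  assumes "Re s > 0"
  shows "continuous_on {0..1::real} (\<lambda>\<tau>. of_real (\<tau> ^ k) * (deriv ^^ k) Vfun (of_real \<tau> * s))"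
  by (intro continuous_intros continuous_on_compose2[OF higher_deriv_Vfun_cont])
     (use scale_in_Vdom[OF assms] in auto)

lemma Uint_deriv:
  assumes s: "Re s > 0"
  shows "(Uint k has_field_derivative Uint (Suc k) s) (at s)"
proof -
  let ?H = "{s. Re s > 0}"
  let ?fx = "\<lambda>s \<tau>. of_real (\<tau> ^ Suc k) * (deriv ^^ Suc k) Vfun (of_real \<tau> * s)"
  have "((\<lambda>s. integral (cbox 0 1) (\<lambda>\<tau>::real. of_real (\<tau> ^ k) * (deriv ^^ k) Vfun (of_real \<tau> * s)))
     has_field_derivative integral (cbox 0 1) (?fx s)) (at s within ?H)"
  proof (rule leibniz_rule_field_derivative)
    fix x :: complex and \<tau> :: real assume x: "x \<in> ?H" and t: "\<tau> \<in> cbox 0 1"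
    have "of_real \<tau> * x \<in> Vdom" using x t by (intro scale_in_Vdom) auto
    from DERIV_chain2[OF higher_deriv_Vfun_deriv[OF this, of k] DERIV_cmult[OF DERIV_ident, of "of_real \<tau>" x ?H]]
    have "((\<lambda>x. (deriv ^^ k) Vfun (of_real \<tau> * x)) has_field_derivative (deriv ^^ Suc k) Vfun (of_real \<tau> * x) * (of_real \<tau> * 1)) (at x within ?H)"
      by blast
    from DERIV_cmult[OF this, of "of_real (\<tau> ^ k)"]
    show "((\<lambda>x. of_real (\<tau> ^ k) * (deriv ^^ k) Vfun (of_real \<tau> * x)) has_field_derivative ?fx x \<tau>) (at x within ?H)"
      by (simp add: mult_ac)
  next
    fix x :: complex assume "x \<in> ?H"
    then show "(\<lambda>\<tau>::real. of_real (\<tau> ^ k) * (deriv ^^ k) Vfun (of_real \<tau> * x)) integrable_on cbox 0 1"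
      using Uint_integrand_cont[of x k] by (auto intro: integrable_continuous_interval)
  next
    show "continuous_on (?H \<times> cbox 0 1) (\<lambda>(x, \<tau>). ?fx x \<tau>)"
      unfolding split_beta
      by (intro continuous_intros continuous_on_compose2[OF higher_deriv_Vfun_cont])
         (auto intro!: scale_in_Vdom)
  qed (use s convex_halfspace_Re_gt in auto)
  moreover have "(at s within ?H) = at s" using s by (intro at_within_open open_halfspace_Re_gt) auto
  ultimately show ?thesis unfolding Uint_def [abs_def] by (simp only: cbox_interval)
qed

text \<open>The segment stays in \<open>Re s \<ge> 0\<close> and its points are no larger than s, so
  the mean inherits the linear bound.\<close>

lemma Uint_bound:
  obtains C where "C > 0" "\<And>s. Re s > 0 \<Longrightarrow> norm (Uint k s) \<le> C * (1 + norm s)"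
proof -
  obtain C where C: "C > 0" "\<And>s. Re s \<ge> 0 \<Longrightarrow> norm ((deriv ^^ k) Vfun s) \<le> C * (1 + norm s)"
    using higher_deriv_Vfun_bound[of k] by blast
  have "norm (Uint k s) \<le> C * (1 + norm s)" if s: "Re s > 0" for s
  proof -
    have "norm (integral {0..1} (\<lambda>\<tau>::real. of_real (\<tau> ^ k) * (deriv ^^ k) Vfun (of_real \<tau> * s))) \<le> C * (1 + norm s) * (1 - 0)"
    proof (rule integral_bound[OF _ Uint_integrand_cont[OF s]])
      fix \<tau> :: real assume t: "\<tau> \<in> {0..1}"
      have "norm (of_real (\<tau> ^ k) * (deriv ^^ k) Vfun (of_real \<tau> * s)) \<le> 1 * (C * (1 + norm s))"
        unfolding norm_mult
      proof (rule mult_mono)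
        show "norm (complex_of_real (\<tau> ^ k)) \<le> 1" using t by (simp add: norm_power power_le_one)
        have "norm ((deriv ^^ k) Vfun (of_real \<tau> * s)) \<le> C * (1 + norm (of_real \<tau> * s))"
          using t s by (intro C) auto
        also have "\<dots> \<le> C * (1 + norm s)"
          using t C by (intro mult_left_mono add_left_mono) (auto simp: norm_mult mult_left_le_one_le)
        finally show "norm ((deriv ^^ k) Vfun (of_real \<tau> * s)) \<le> C * (1 + norm s)" .
      qed (use C in auto)
      then show "norm (of_real (\<tau> ^ k) * (deriv ^^ k) Vfun (of_real \<tau> * s)) \<le> C * (1 + norm s)" by simp
    qed auto
    then show ?thesis by (simp add: Uint_def)
  qed
  then show ?thesis using C(1) that by blast
qed

text \<open>On the positive axis the transform is w(s)/s, where w tends to 0 at 0 and has derivative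
  \<open>Vfun\<close>; the fundamental theorem of calculus turns this quotient into the
  mean.\<close>

lemma Phi_eq_Uint_real:
  assumes s: "s > (0::real)"
  shows "L.Phi 0 (of_real s) = Uint 0 (of_real s)"
proof -
  define D where "D = complex_of_real (euler_mascheroni - mertens_const)"
  define w where "w = (\<lambda>t::real. primeP (of_real t) + of_real (ln t) + D)"
  have "L.Phi 0 (of_real s) = (\<integral>v. complex_of_real (err v * exp (- s * v)) \<partial>lborel)"
    unfolding L.Phi_def by (rule Bochner_Integration.integral_cong) (auto simp flip: exp_of_real)
  also have "\<dots> = of_real (((\<Sum>n. if prime n then real n powr (- 1 - s) else 0) + ln s + euler_mascheroni - mertens_const) / s)"
    using has_bochner_integral_integral_eq[OF err_laplace_real[OF s]] by (simp only: integral_complex_of_real)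
  also have "\<dots> = w s / of_real s"
    unfolding w_def D_def primeP_of_real[OF s] by (simp only: of_real_divide of_real_add of_real_diff add_diff_eq)
  finally have 1: "L.Phi 0 (of_real s) = w s / of_real s" .
  have wd: "(w has_vector_derivative Vfun (of_real t)) (at t)" if t: "t > 0" for t
  proof -
    have "((\<lambda>t::real. primeP (of_real t)) has_vector_derivative (Vfun (of_real t) - 1 / of_real t)) (at t)"
      by (rule has_vector_derivative_real_field[OF primeP_deriv]) (use t in auto)
    moreover have "((\<lambda>t::real. complex_of_real (ln t)) has_vector_derivative of_real (1 / t)) (at t)"
      by (rule has_vector_derivative_of_real) (use t in \<open>auto intro!: derivative_eq_intros\<close>)
    ultimately have "(w has_vector_derivative (Vfun (of_real t) - 1 / of_real t + of_real (1 / t) + 0)) (at t)"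
      unfolding w_def by (intro has_vector_derivative_add has_vector_derivative_const)
    then show ?thesis by simp
  qed
  have w0: "(w \<longlongrightarrow> 0) (at_right 0)"
    using tendsto_add[OF primeP_limit tendsto_const[of D]] unfolding w_def D_def
    by (simp flip: of_real_add)
  \<comment> \<open>Replaces the meaningless value of \<open>w\<close> at 0 by its limit, to obtain
    continuity on the closed interval.\<close>
  define wf where "wf = (\<lambda>\<tau>. if \<tau> = 0 then 0 else w (\<tau> * s))"
  have wfd: "(wf has_vector_derivative of_real s * Vfun (of_real \<tau> * of_real s)) (at \<tau>)" if t: "\<tau> > 0" for \<tau>
  proof -
    have "((\<lambda>\<tau>. \<tau> * s) has_vector_derivative s) (at \<tau>)" by (auto intro!: derivative_eq_intros)
    from vector_diff_chain_at[OF this wd] have "((w \<circ> (\<lambda>\<tau>. \<tau> * s)) has_vector_derivative s *\<^sub>R Vfun (of_real (\<tau> * s))) (at \<tau>)"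
      using t s by simp
    then have "((\<lambda>\<tau>. w (\<tau> * s)) has_vector_derivative of_real s * Vfun (of_real \<tau> * of_real s)) (at \<tau>)"
      by (simp add: o_def scaleR_conv_of_real)
    then show ?thesis
      by (rule has_vector_derivative_transform_within_open[of _ _ _ "{0<..}"]) (use t in \<open>auto simp: wf_def\<close>)
  qed
  have cont: "continuous_on {0..1} wf"
    unfolding continuous_on_eq_continuous_within
  proof
    fix x :: real assume x: "x \<in> {0..1}"
    show "continuous (at x within {0..1}) wf"
    proof (cases "x = 0")
      case False
      then have "isCont wf x" using wfd[of x] x has_vector_derivative_continuous by fastforce
      then show ?thesis by (rule continuous_at_imp_continuous_at_within)
    next
      case True
      have "filterlim (\<lambda>\<tau>. \<tau> * s) (at_right 0) (at_right 0)"
        unfolding filterlim_at using s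
        by (auto simp: eventually_at_filter intro!: tendsto_eq_intros)
      from filterlim_compose[OF w0 this] have "((\<lambda>\<tau>. w (\<tau> * s)) \<longlongrightarrow> 0) (at_right 0)" .
      then have "(wf \<longlongrightarrow> 0) (at_right 0)"
        by (rule Lim_transform_eventually) (auto simp: wf_def eventually_at_filter)
      then have "(wf \<longlongrightarrow> 0) (at 0 within {0..1})"
        by (rule tendsto_mono[rotated]) (auto simp: at_within_Icc_at_right)
      then show ?thesis using True by (simp add: continuous_within wf_def)
    qed
  qed
  have "((\<lambda>\<tau>. of_real s * Vfun (of_real \<tau> * of_real s)) has_integral wf 1 - wf 0) {0..1}"
    by (rule fundamental_theorem_of_calculus_interior[OF _ cont]) (use wfd in auto)
  then have "((\<lambda>\<tau>. Vfun (of_real \<tau> * of_real s)) has_integral (1 / of_real s) * (w s)) {0..1}"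
    using has_integral_mult_right[of "\<lambda>\<tau>. of_real s * Vfun (of_real \<tau> * of_real s)" "w s" "{0..1::real}" "1 / of_real s"] s
    by (simp add: wf_def)
  then show ?thesis unfolding 1 Uint_def by (simp add: integral_unique)
qed

text \<open>For \<open>k = 0\<close> by analytic continuation from the positive axis. Each family
  consists of successive derivatives, so the remaining cases follow by induction.\<close>

lemma Phi_eq_Uint:
  assumes "Re s > 0"
  shows "L.Phi k s = Uint k s"
  using assms
proof (induction k arbitrary: s)
  case 0
  have "L.Phi 0 s - Uint 0 s = 0"
  proof (rule analytic_continuation[where f = "\<lambda>s. L.Phi 0 s - Uint 0 s" and S = "{s. Re s > 0}" and U = "of_real ` {0<..}" and \<xi> = 1])
    show "(\<lambda>s. L.Phi 0 s - Uint 0 s) holomorphic_on {s. Re s > 0}"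
    proof (rule holomorphic_on_diff)
      show "L.Phi 0 holomorphic_on {s. Re s > 0}"
        unfolding holomorphic_on_open[OF open_halfspace_Re_gt]
      proof
        fix x :: complex assume "x \<in> {s. Re s > 0}"
        then show "\<exists>f'. (L.Phi 0 has_field_derivative f') (at x)" using L.Phi_deriv[of x 0] unfolding L_strip by blast
      qed
      show "Uint 0 holomorphic_on {s. Re s > 0}"
        unfolding holomorphic_on_open[OF open_halfspace_Re_gt]
      proof
        fix x :: complex assume "x \<in> {s. Re s > 0}"
        then show "\<exists>f'. (Uint 0 has_field_derivative f') (at x)" using Uint_deriv[of x 0] by blast
      qed
    qed
    show "(1::complex) islimpt of_real ` {0<..}"
      unfolding islimpt_approachable
    proof (intro allI impI)
      fix e :: real assume e: "e > 0"
      show "\<exists>x'\<in>complex_of_real ` {0<..}. x' \<noteq> 1 \<and> dist x' 1 < e"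
      proof (intro bexI[of _ "complex_of_real (1 + e / 2)"] conjI)
        show "complex_of_real (1 + e / 2) \<noteq> 1"
          using e by (metis add_cancel_left_right half_gt_zero less_irrefl of_real_1 of_real_eq_iff)
        show "dist (complex_of_real (1 + e / 2)) 1 < e"
          using e by (simp add: dist_norm)
      qed (rule imageI, use e in simp)
    qed
    show "connected {s. Re s > 0}" by (rule convex_connected[OF convex_halfspace_Re_gt])
    show "open {s. Re s > 0}" by (rule open_halfspace_Re_gt)
    show "L.Phi 0 z - Uint 0 z = 0" if "z \<in> of_real ` {0<..}" for z
      using that Phi_eq_Uint_real by fastforce
  qed (use 0 in auto)
  then show ?case by simp
next
  case (Suc k)
  have "(L.Phi k has_field_derivative L.Phi (Suc k) s) (at s)"
    using L.Phi_deriv[of s k] Suc.prems by (simp add: L_strip)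
  then have "(Uint k has_field_derivative L.Phi (Suc k) s) (at s)"
    by (rule has_field_derivative_transform_within_open[OF _ open_halfspace_Re_gt[of 0]]) (use Suc in auto)
  with Uint_deriv[OF Suc.prems, of k] show ?case by (simp add: DERIV_unique)
qed

text \<open>The bound for the k-th derivative read as one for the transform of v^k
  \<open>err\<close>; the sign (-1)^k of the exponent -v is removed.\<close>

lemma err_laplace_bound:
  obtains C where "C > 0"
    "\<And>s. Re s > 0 \<Longrightarrow> norm (\<integral>v. of_real (v ^ k * err v) * exp (- (s * of_real v)) \<partial>lborel) \<le> C * (1 + norm s)"
proof -
  obtain C where C: "C > 0" "\<And>s. Re s > 0 \<Longrightarrow> norm (Uint k s) \<le> C * (1 + norm s)"
    using Uint_bound[of k] by blast
  have "norm (\<integral>v. of_real (v ^ k * err v) * exp (- (s * of_real v)) \<partial>lborel) \<le> C * (1 + norm s)" if s: "Re s > 0" for s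
  proof -
    have "L.Phi k s = (\<integral>v. (-1) ^ k * (of_real (v ^ k * err v) * exp (- (s * of_real v))) \<partial>lborel)"
      unfolding L.Phi_def
    proof (rule Bochner_Integration.integral_cong[OF refl])
      fix v :: real
      show "of_real (err v * (- v) ^ k) * exp (s * of_real (- v)) = (-1) ^ k * (of_real (v ^ k * err v) * exp (- (s * of_real v)))"
        unfolding power_minus[of v k] by simp
    qed
    also have "\<dots> = (-1) ^ k * (\<integral>v. of_real (v ^ k * err v) * exp (- (s * of_real v)) \<partial>lborel)"
      by (rule integral_mult_right_zero)
    finally show ?thesis using C(2)[OF s] Phi_eq_Uint[OF s, of k] by (simp add: norm_mult norm_power)
  qed
  with C(1) that show ?thesis by blast
qed

lemma err_exp_integrable:
  assumes "c > 0"
  shows "integrable lborel (\<lambda>v. v ^ k * err v * exp (- c * v))"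
proof -
  have "integrable lborel (\<lambda>v. err v * (- v) ^ k * exp (c * - v))"
    by (rule exp_integral.int_real[OF L.step_power]) (use assms in auto)
  then have "integrable lborel (\<lambda>v. (-1) ^ k * (err v * (- v) ^ k * exp (c * - v)))"
    by (rule integrable_mult_right)
  moreover have "(-1) ^ k * (err v * (- v) ^ k * exp (c * - v)) = v ^ k * err v * exp (- c * v)" for v
    unfolding power_minus[of v k] by simp
  ultimately show ?thesis by (simp only:)
qed

section \<open>Gaussian smoothing and the Tauberian argument\<close>

lemma prob_space_std_normal: "prob_space std_normal_distribution"
  by (rule prob_space_normal_density) simp

lemma gaussian_fourier:
  fixes y :: real
  shows "(\<integral>x. exp (\<i> * of_real (y * x)) \<partial>std_normal_distribution) = of_real (exp (- y\<^sup>2 / 2))"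
  using fun_cong[OF char_std_normal_distribution, of y] by (simp add: char_def)

text \<open>The Gaussian is the characteristic function of the normal law, so by Fubini the smoothed
  value is a normal average of the Laplace transform over the points of a vertical line at heights
  x/h.\<close>

lemma gauss_smooth_fourier:
  fixes f :: "real \<Rightarrow> real"
  assumes f: "integrable lborel (\<lambda>v. f v * exp (- \<sigma> * v))" and [measurable]: "f \<in> borel_measurable borel" and h: "h > 0"
  shows "of_real (\<integral>v. f v * exp (- \<sigma> * v) * exp (- ((u - v) / h)\<^sup>2 / 2) \<partial>lborel) =
    (\<integral>x. exp (\<i> * of_real (u * x / h)) * (\<integral>v. of_real (f v) * exp (- (Complex \<sigma> (x / h) * of_real v)) \<partial>lborel) \<partial>std_normal_distribution)"
proof -
  interpret N: prob_space std_normal_distribution by (rule prob_space_std_normal)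
  have Np: "N.prob UNIV = 1" using N.prob_space by simp
  interpret P: pair_sigma_finite lborel std_normal_distribution ..
  define A where "A = (\<lambda>v. complex_of_real (f v * exp (- \<sigma> * v)))"
  define c where "c = (\<lambda>v x. exp (\<i> * of_real ((u - v) / h * x)))"
  have [measurable]: "A \<in> borel_measurable borel" unfolding A_def by measurable
  have cm [measurable]: "(\<lambda>(v, x). c v x) \<in> borel_measurable (lborel \<Otimes>\<^sub>M std_normal_distribution)"
    unfolding c_def by measurable
  have nc: "norm (c v x) = 1" for v x unfolding c_def by simp
  have iA: "integrable lborel A" unfolding A_def by (rule integrable_of_real[OF f])
  have prod: "integrable (lborel \<Otimes>\<^sub>M std_normal_distribution) (\<lambda>(v, x). A v * c v x)"
  proof (rule P.Fubini_integrable)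
    show "(\<lambda>(v, x). A v * c v x) \<in> borel_measurable (lborel \<Otimes>\<^sub>M std_normal_distribution)"
      using cm unfolding split_beta' by measurable
    have "(\<integral>x. norm (case (v, x) of (v, x) \<Rightarrow> A v * c v x) \<partial>std_normal_distribution) = norm (A v)" for v
      by (simp add: norm_mult nc Np)
    then show "integrable lborel (\<lambda>v. \<integral>x. norm (case (v, x) of (v, x) \<Rightarrow> A v * c v x) \<partial>std_normal_distribution)"
      using iA by simp
    show "AE v in lborel. integrable std_normal_distribution (\<lambda>x. case (v, x) of (v, x) \<Rightarrow> A v * c v x)"
    proof (rule AE_I2)
      fix v :: real
      have "integrable std_normal_distribution (\<lambda>x. c v x)"
      proof (rule N.integrable_const_bound[where B = 1])
        show "c v \<in> borel_measurable std_normal_distribution" unfolding c_def by measurable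
      qed (simp add: nc)
      then show "integrable std_normal_distribution (\<lambda>x. case (v, x) of (v, x) \<Rightarrow> A v * c v x)" by simp
    qed
  qed
  have "of_real (\<integral>v. f v * exp (- \<sigma> * v) * exp (- ((u - v) / h)\<^sup>2 / 2) \<partial>lborel) = (\<integral>v. A v * (\<integral>x. c v x \<partial>std_normal_distribution) \<partial>lborel)"
    unfolding integral_complex_of_real[symmetric] A_def c_def gaussian_fourier by simp
  also have "\<dots> = (\<integral>v. (\<integral>x. A v * c v x \<partial>std_normal_distribution) \<partial>lborel)" by simp
  also have "\<dots> = (\<integral>x. (\<integral>v. A v * c v x \<partial>lborel) \<partial>std_normal_distribution)"
    by (rule P.Fubini_integral[OF prod, symmetric])
  also have "\<dots> = (\<integral>x. exp (\<i> * of_real (u * x / h)) * (\<integral>v. of_real (f v) * exp (- (Complex \<sigma> (x / h) * of_real v)) \<partial>lborel) \<partial>std_normal_distribution)"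
  proof (rule Bochner_Integration.integral_cong[OF refl])
    fix x :: real
    have "A v * c v x = exp (\<i> * of_real (u * x / h)) * (of_real (f v) * exp (- (Complex \<sigma> (x / h) * of_real v)))" for v
    proof -
      have "complex_of_real (exp (- \<sigma> * v)) * exp (\<i> * of_real ((u - v) / h * x)) = exp (\<i> * of_real (u * x / h)) * exp (- (Complex \<sigma> (x / h) * of_real v))"
        unfolding exp_of_real[symmetric] exp_add[symmetric]
        by (rule arg_cong[of _ _ exp]) (simp add: complex_eq_iff diff_divide_distrib left_diff_distrib)
      then show ?thesis unfolding A_def c_def by (simp only: of_real_mult mult.assoc mult.left_commute)
    qed
    then show "(\<integral>v. A v * c v x \<partial>lborel) = exp (\<i> * of_real (u * x / h)) * (\<integral>v. of_real (f v) * exp (- (Complex \<sigma> (x / h) * of_real v)) \<partial>lborel)"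
      by simp
  qed
  finally show ?thesis .
qed

text \<open>The transform grows linearly and |s| is at most 1 + |x|/h, with x distributed normally;
  the finite second moment gives C/h, independently of the centre u and of
  \<open>\<sigma>\<close>.\<close>

lemma err_smooth_bound_pos:
  obtains C where "C > 0" "\<And>u h \<sigma>. 0 < h \<Longrightarrow> h \<le> 1 \<Longrightarrow> 0 < \<sigma> \<Longrightarrow> \<sigma> \<le> 1 \<Longrightarrow>
    \<bar>\<integral>v. v ^ k * err v * exp (- \<sigma> * v) * exp (- ((u - v) / h)\<^sup>2 / 2) \<partial>lborel\<bar> \<le> C / h"
proof -
  interpret N: prob_space std_normal_distribution by (rule prob_space_std_normal)
  obtain C where C: "C > 0"
    "\<And>s. Re s > 0 \<Longrightarrow> norm (\<integral>v. of_real (v ^ k * err v) * exp (- (s * of_real v)) \<partial>lborel) \<le> C * (1 + norm s)"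
    using err_laplace_bound[of k] by blast
  have "\<bar>\<integral>v. v ^ k * err v * exp (- \<sigma> * v) * exp (- ((u - v) / h)\<^sup>2 / 2) \<partial>lborel\<bar> \<le> (4 * C) / h"
    if h: "0 < h" "h \<le> 1" and sg: "0 < \<sigma>" "\<sigma> \<le> 1" for u h \<sigma>
  proof -
    let ?I = "\<integral>v. v ^ k * err v * exp (- \<sigma> * v) * exp (- ((u - v) / h)\<^sup>2 / 2) \<partial>lborel"
    let ?G = "\<lambda>x. exp (\<i> * of_real (u * x / h)) * (\<integral>v. of_real (v ^ k * err v) * exp (- (Complex \<sigma> (x / h) * of_real v)) \<partial>lborel)"
    have m2: "integrable std_normal_distribution (\<lambda>x. x\<^sup>2)" by (rule integrable_std_normal_distribution_moment)
    have m2v: "(\<integral>x. x\<^sup>2 \<partial>std_normal_distribution) = 1"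
      using std_normal_distribution_even_moments(1)[of 1] by simp
    have bnd: "norm (?G x) \<le> C * (2 + (1 + x\<^sup>2) / h)" for x
    proof -
      have "norm (?G x) \<le> C * (1 + norm (Complex \<sigma> (x / h)))"
        using C(2)[of "Complex \<sigma> (x / h)"] sg by (simp add: norm_mult)
      also have "norm (Complex \<sigma> (x / h)) \<le> 1 + (1 + x\<^sup>2) / h"
      proof -
        have "norm (Complex \<sigma> (x / h)) \<le> \<bar>\<sigma>\<bar> + \<bar>x / h\<bar>" using cmod_le[of "Complex \<sigma> (x / h)"] by simp
        moreover have "\<bar>x\<bar> \<le> 1 + x\<^sup>2"
        proof -
          have "0 \<le> (\<bar>x\<bar> - 1 / 2)\<^sup>2" by simp
          then show ?thesis by (simp add: power2_diff power_divide)
        qed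
        then have "\<bar>x / h\<bar> \<le> (1 + x\<^sup>2) / h" using h by (simp add: divide_right_mono)
        ultimately show ?thesis using sg by linarith
      qed
      finally show ?thesis using C(1) by (simp add: mult_left_mono)
    qed
    have "\<bar>?I\<bar> = norm (complex_of_real ?I)" by simp
    also have "complex_of_real ?I = (\<integral>x. ?G x \<partial>std_normal_distribution)"
      by (rule gauss_smooth_fourier) (use err_exp_integrable[OF sg(1), of k] h in auto)
    also have "norm \<dots> \<le> (\<integral>x. norm (?G x) \<partial>std_normal_distribution)" by (rule integral_norm_bound)
    also have "\<dots> \<le> (\<integral>x. C * (2 + (1 + x\<^sup>2) / h) \<partial>std_normal_distribution)"
      by (rule integral_mono') (use m2 bnd C h in auto)
    also have "\<dots> = C * (2 + (1 + 1) / h)"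
    proof -
      have Np: "N.prob UNIV = 1" using N.prob_space by simp
      show ?thesis using m2 by (simp add: m2v Np add_divide_distrib)
    qed
    also have "\<dots> \<le> 4 * C / h"
    proof -
      have "2 \<le> 2 / h" using h by (simp add: pos_le_divide_eq)
      then have "2 + (1 + 1) / h \<le> 4 / h" by (simp add: add_divide_distrib[symmetric])
      from mult_left_mono[OF this, of C] C show ?thesis by simp
    qed
    finally show ?thesis .
  qed
  then show ?thesis using that[of "4 * C"] C(1) by simp
qed

text \<open>The square of (u - v)/h + h is nonnegative.\<close>

lemma gauss_le_exp:
  fixes u v h :: real
  assumes "0 < h"
  shows "exp (- ((u - v) / h)\<^sup>2 / 2) \<le> exp (u + h\<^sup>2 / 2) * exp (- v)"
proof -
  have "0 \<le> ((u - v) / h + h)\<^sup>2 / 2" by simp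
  also have "((u - v) / h + h)\<^sup>2 / 2 = ((u - v) / h)\<^sup>2 / 2 + (u - v) + h\<^sup>2 / 2"
    using assms by (simp add: power2_sum add_divide_distrib)
  finally have "- (((u - v) / h)\<^sup>2) / 2 \<le> (u + h\<^sup>2 / 2) + (- v)" by simp
  then show ?thesis unfolding exp_add[symmetric] by simp
qed

text \<open>The convergence factor is removed by letting \<open>\<sigma>\<close> tend to 0; the
  Gaussian alone supplies a dominating function, by \<open>gauss_le_exp\<close>.\<close>

lemma err_smooth_bound:
  obtains C where "C > 0" "\<And>u h. 0 < h \<Longrightarrow> h \<le> 1 \<Longrightarrow>
    integrable lborel (\<lambda>v. v ^ k * err v * exp (- ((u - v) / h)\<^sup>2 / 2)) \<and>
    \<bar>\<integral>v. v ^ k * err v * exp (- ((u - v) / h)\<^sup>2 / 2) \<partial>lborel\<bar> \<le> C / h"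
proof -
  obtain C where C: "C > 0" "\<And>u h \<sigma>. 0 < h \<Longrightarrow> h \<le> 1 \<Longrightarrow> 0 < \<sigma> \<Longrightarrow> \<sigma> \<le> 1 \<Longrightarrow>
    \<bar>\<integral>v. v ^ k * err v * exp (- \<sigma> * v) * exp (- ((u - v) / h)\<^sup>2 / 2) \<partial>lborel\<bar> \<le> C / h"
    using err_smooth_bound_pos[of k] by blast
  have "integrable lborel (\<lambda>v. v ^ k * err v * exp (- ((u - v) / h)\<^sup>2 / 2)) \<and>
    \<bar>\<integral>v. v ^ k * err v * exp (- ((u - v) / h)\<^sup>2 / 2) \<partial>lborel\<bar> \<le> C / h" if h: "0 < h" "h \<le> 1" for u h
  proof -
    let ?g = "\<lambda>v. exp (- ((u - v) / h)\<^sup>2 / 2)"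
    define w where "w = (\<lambda>v. exp (u + h\<^sup>2 / 2) * \<bar>v ^ k * err v * exp (- 1 * v)\<bar>)"
    have iw: "integrable lborel w" unfolding w_def by (intro integrable_mult_right integrable_abs err_exp_integrable) simp
    have dom: "norm (v ^ k * err v * ?g v) \<le> w v" for v
    proof -
      have "norm (v ^ k * err v * ?g v) = \<bar>v ^ k * err v\<bar> * ?g v" by (simp add: abs_mult)
      also have "\<dots> \<le> \<bar>v ^ k * err v\<bar> * (exp (u + h\<^sup>2 / 2) * exp (- v))"
        using gauss_le_exp[OF h(1)] by (intro mult_left_mono) auto
      finally show ?thesis by (simp add: w_def abs_mult mult_ac)
    qed
    have lim: "(\<lambda>n. \<integral>v. v ^ k * err v * exp (- inverse (real (Suc n)) * v) * ?g v \<partial>lborel) \<longlonglongrightarrow> (\<integral>v. v ^ k * err v * ?g v \<partial>lborel)"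
    proof (rule integral_dominated_convergence[where w = w])
      show "AE v in lborel. (\<lambda>n. v ^ k * err v * exp (- inverse (real (Suc n)) * v) * ?g v) \<longlonglongrightarrow> v ^ k * err v * ?g v"
      proof (rule AE_I2)
        fix v :: real
        have "(\<lambda>n. v ^ k * err v * exp (- inverse (real (Suc n)) * v) * ?g v) \<longlonglongrightarrow> v ^ k * err v * exp (- 0 * v) * ?g v"
          by (intro tendsto_mult tendsto_const tendsto_exp tendsto_minus LIMSEQ_inverse_real_of_nat)
        then show "(\<lambda>n. v ^ k * err v * exp (- inverse (real (Suc n)) * v) * ?g v) \<longlonglongrightarrow> v ^ k * err v * ?g v" by simp
      qed
      fix n
      show "AE v in lborel. norm (v ^ k * err v * exp (- inverse (real (Suc n)) * v) * ?g v) \<le> w v"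
      proof (rule AE_I2)
        fix v :: real
        show "norm (v ^ k * err v * exp (- inverse (real (Suc n)) * v) * ?g v) \<le> w v"
        proof (cases "v > 0")
          case True
          have "exp (- inverse (real (Suc n)) * v) \<le> 1" using True by simp
          then have "norm (v ^ k * err v * ?g v) * exp (- inverse (real (Suc n)) * v) \<le> norm (v ^ k * err v * ?g v) * 1"
            by (intro mult_left_mono) auto
          then show ?thesis using dom[of v] by (simp add: abs_mult mult_ac)
        next
          case False
          then show ?thesis by (simp add: err_def w_def)
        qed
      qed
    qed (use iw in \<open>auto simp: w_def\<close>)
    have "\<bar>\<integral>v. v ^ k * err v * ?g v \<partial>lborel\<bar> \<le> C / h"
    proof (rule LIMSEQ_le_const2[OF tendsto_rabs[OF lim]], intro exI[of _ 0] allI impI)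
      fix n
      show "\<bar>\<integral>v. v ^ k * err v * exp (- inverse (real (Suc n)) * v) * ?g v \<partial>lborel\<bar> \<le> C / h"
        by (rule C(2)[OF h]) (auto simp: inverse_le_1_iff)
    qed
    moreover have "integrable lborel (\<lambda>v. v ^ k * err v * ?g v)"
    proof (rule Bochner_Integration.integrable_bound[OF iw])
      show "AE v in lborel. norm (v ^ k * err v * ?g v) \<le> norm (w v)"
        by (rule AE_I2, rule order_trans[OF dom]) simp
    qed measurable
    ultimately show ?thesis by simp
  qed
  with C(1) that show ?thesis by blast
qed

text \<open>One-sided regularity for the Tauberian step: \<open>msum\<close> increases, so only the
  logarithm can make \<open>err\<close> fall.\<close>

lemma err_slow:
  assumes "0 < v" "v \<le> v'"
  shows "err v - (v' - v) / v \<le> err v'"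
proof -
  have "ln v' - ln v \<le> (v' - v) / v" using assms by (intro ln_diff_le) auto
  moreover have "msum v \<le> msum v'" using assms by (intro msum_mono)
  ultimately show ?thesis using assms by (simp add: err_def)
qed

text \<open>If \<open>err\<close> keeps its sign and size on a stretch around w, the Gaussian
  average at w is at least of order \<eta> a^k h, while \<open>err_smooth_bound\<close> keeps it
  below C/h; outside the stretch the Gaussian is negligible. The sign \<open>e\<close> handles large
  positive and large negative values together.\<close>

lemma tauberian_core:
  obtains C K where "C > 0" "K > 0"
    "\<And>e w r h \<eta> a. \<lbrakk>e = 1 \<or> e = - 1; 0 < a; a \<le> w - r; 0 < h; h \<le> r; h \<le> 1; 0 \<le> \<eta>;
       \<And>v. v \<in> {w - r..w + r} \<Longrightarrow> \<eta> \<le> e * err v\<rbrakk> \<Longrightarrow>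
       \<eta> * a ^ k * h \<le> C / h + K * exp (w + 1 - r\<^sup>2 / (4 * h\<^sup>2))"
proof -
  obtain C where C: "C > 0" "\<And>u h. 0 < h \<Longrightarrow> h \<le> 1 \<Longrightarrow>
    integrable lborel (\<lambda>v. v ^ k * err v * exp (- ((u - v) / h)\<^sup>2 / 2)) \<and>
    \<bar>\<integral>v. v ^ k * err v * exp (- ((u - v) / h)\<^sup>2 / 2) \<partial>lborel\<bar> \<le> C / h"
    using err_smooth_bound[of k] by blast
  define K where "K = (\<integral>v. \<bar>v ^ k * err v * exp (- 1 * v)\<bar> \<partial>lborel)"
  have iK: "integrable lborel (\<lambda>v. \<bar>v ^ k * err v * exp (- 1 * v)\<bar>)"
    by (intro integrable_abs err_exp_integrable) simp
  have K0: "K \<ge> 0" unfolding K_def by (intro integral_nonneg_AE AE_I2) simp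
  have main: "\<eta> * a ^ k * h \<le> C / h + K * exp (w + 1 - r\<^sup>2 / (4 * h\<^sup>2))"
    if e: "e = 1 \<or> e = - 1" and a: "0 < a" "a \<le> w - r" and h: "0 < h" "h \<le> r" "h \<le> 1" and \<eta>: "0 \<le> \<eta>"
      and low: "\<And>v. v \<in> {w - r..w + r} \<Longrightarrow> \<eta> \<le> e * err v" for e w r h \<eta> a
  proof -
    let ?g = "\<lambda>v. exp (- ((w - v) / h)\<^sup>2 / 2)"
    \<comment> \<open>Outside the stretch the Gaussian is at most B e^(-v): half of its exponent
      gives r^2/(4h^2), the other half absorbs the factor e^v by completing a square, using h \<le>
      1.\<close>
    define B where "B = exp (w + 1 - r\<^sup>2 / (4 * h\<^sup>2))"
    have fi: "integrable lborel (\<lambda>v. v ^ k * err v * ?g v)" and fb: "\<bar>\<integral>v. v ^ k * err v * ?g v \<partial>lborel\<bar> \<le> C / h"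
      using C(2)[OF h(1) h(3), of w] by auto
    have pt: "\<eta> * a ^ k * exp (- 1/2) * indicator {w - h..w + h} v - B * \<bar>v ^ k * err v * exp (- 1 * v)\<bar> \<le> e * (v ^ k * err v * ?g v)" for v
    proof (cases "v \<in> {w - r..w + r}")
      case True
      then have va: "a \<le> v" using a by simp
      have pos: "0 \<le> v ^ k * (e * err v) * ?g v" using low[OF True] \<eta> va a by simp
      have B0: "0 \<le> B * \<bar>v ^ k * err v * exp (- 1 * v)\<bar>" by (simp add: B_def)
      have "\<eta> * a ^ k * exp (- 1/2) * indicator {w - h..w + h} v \<le> v ^ k * (e * err v) * ?g v"
      proof (cases "v \<in> {w - h..w + h}")
        case in_h: True
        have "\<bar>w - v\<bar> \<le> h" using in_h by auto
        then have "\<bar>(w - v) / h\<bar> \<le> 1" using h by simp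
        then have "((w - v) / h)\<^sup>2 \<le> 1" by (simp add: abs_square_le_1)
        then have g1: "exp (- 1/2) \<le> ?g v" by simp
        have "a ^ k * \<eta> * exp (- 1/2) \<le> v ^ k * (e * err v) * ?g v"
          using va a \<eta> low[OF True] g1 by (intro mult_mono power_mono) auto
        then show ?thesis using in_h by (simp add: mult_ac)
      qed (use pos in simp)
      then show ?thesis using B0 by (simp add: mult_ac)
    next
      case False
      have far: "r\<^sup>2 \<le> (w - v)\<^sup>2"
      proof -
        have "r \<le> \<bar>w - v\<bar>" using False by auto
        then show ?thesis using h by (metis abs_le_square_iff abs_of_nonneg less_imp_le order_trans abs_ge_zero)
      qed
      have z: "indicator {w - h..w + h} v = (0::real)" using False h by (auto simp: indicator_def)
      have "?g v \<le> B * exp (- v)"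
      proof -
        have "(w - v)\<^sup>2 * 1 \<le> (w - v)\<^sup>2 * (1 / h\<^sup>2)"
          using h by (intro mult_left_mono) (auto simp: power_le_one)
        moreover have "0 \<le> (w - v)\<^sup>2 / 4 + (w - v) + 1"
        proof -
          have "0 \<le> t\<^sup>2 / 4 + t + 1" for t :: real
            using zero_le_power2[of "t / 2 + 1"] by (simp add: power2_sum power_divide)
          then show ?thesis .
        qed
        ultimately have 1: "0 \<le> ((w - v)\<^sup>2 / h\<^sup>2) / 4 + (w - v) + 1" by simp
        have 2: "r\<^sup>2 / h\<^sup>2 \<le> (w - v)\<^sup>2 / h\<^sup>2" using far by (intro divide_right_mono) auto
        have "- X / 2 \<le> (w + 1 - R / 4) + (- v)" if "0 \<le> X / 4 + (w - v) + 1" "R \<le> X" for X R :: real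
          using that by (simp add: field_simps)
        from this[OF 1 2] have "- (((w - v) / h)\<^sup>2) / 2 \<le> (w + 1 - r\<^sup>2 / (4 * h\<^sup>2)) + (- v)"
          by (simp add: power_divide)
        then show ?thesis unfolding B_def exp_add[symmetric] by simp
      qed
      then have "\<bar>v ^ k * err v\<bar> * ?g v \<le> \<bar>v ^ k * err v\<bar> * (B * exp (- v))" by (intro mult_left_mono) auto
      moreover have "- (\<bar>v ^ k * err v\<bar> * ?g v) \<le> e * (v ^ k * err v * ?g v)"
      proof -
        have "\<bar>e * (v ^ k * err v * ?g v)\<bar> = \<bar>v ^ k * err v\<bar> * ?g v" using e by (auto simp: abs_mult)
        then show ?thesis by linarith
      qed
      moreover have "B * \<bar>v ^ k * err v * exp (- 1 * v)\<bar> = \<bar>v ^ k * err v\<bar> * (B * exp (- v))"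
        by (simp add: abs_mult mult_ac)
      ultimately show ?thesis unfolding z mult_zero_right by linarith
    qed
    have li: "integrable lborel (\<lambda>v. \<eta> * a ^ k * exp (- 1/2) * indicator {w - h..w + h} v - B * \<bar>v ^ k * err v * exp (- 1 * v)\<bar>)"
      by (intro Bochner_Integration.integrable_diff integrable_mult_right iK) (auto simp: emeasure_lborel_Icc_eq)
    have "\<eta> * a ^ k * exp (- 1/2) * (2 * h) - B * K = (\<integral>v. \<eta> * a ^ k * exp (- 1/2) * indicator {w - h..w + h} v - B * \<bar>v ^ k * err v * exp (- 1 * v)\<bar> \<partial>lborel)"
    proof -
      have "integrable lborel (indicator {w - h..w + h} :: real \<Rightarrow> real)" by (simp add: emeasure_lborel_Icc_eq)
      then show ?thesis unfolding K_def using iK h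
        by (subst Bochner_Integration.integral_diff) auto
    qed
    also have "\<dots> \<le> (\<integral>v. e * (v ^ k * err v * ?g v) \<partial>lborel)"
      by (rule integral_mono[OF li integrable_mult_right[OF fi] pt])
    also have "\<dots> = e * (\<integral>v. v ^ k * err v * ?g v \<partial>lborel)" by (rule integral_mult_right_zero)
    also have "\<dots> \<le> C / h" using fb e by auto
    finally have 1: "\<eta> * a ^ k * exp (- 1/2) * (2 * h) \<le> C / h + K * B" by (simp add: mult.commute)
    \<comment> \<open>The central part 2 h exp(-1/2) is therefore at least h.\<close>
    have e2: "1 / 2 \<le> exp (- 1/2 :: real)" using exp_ge_add_one_self[of "- 1/2 :: real"] by simp
    have "\<eta> * a ^ k * h * 1 \<le> \<eta> * a ^ k * h * (2 * exp (- 1/2))"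
      by (intro mult_left_mono) (use e2 \<eta> a h in auto)
    then show ?thesis using 1 unfolding B_def by (simp add: mult_ac)
  qed
  show ?thesis
  proof (rule that[OF C(1), of "K + 1"])
    fix e w r h \<eta> a :: real
    assume *: "e = 1 \<or> e = - 1" "0 < a" "a \<le> w - r" "0 < h" "h \<le> r" "h \<le> 1" "0 \<le> \<eta>"
       "\<And>v. v \<in> {w - r..w + r} \<Longrightarrow> \<eta> \<le> e * err v"
    have "\<eta> * a ^ k * h \<le> C / h + K * exp (w + 1 - r\<^sup>2 / (4 * h\<^sup>2))" by (rule main[OF *])
    also have "\<dots> \<le> C / h + (K + 1) * exp (w + 1 - r\<^sup>2 / (4 * h\<^sup>2))" by (simp add: distrib_right)
    finally show "\<eta> * a ^ k * h \<le> C / h + (K + 1) * exp (w + 1 - r\<^sup>2 / (4 * h\<^sup>2))" .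
  qed (use K0 in simp)
qed

text \<open>With r = u^(-N) and h = u^(-N-1) the exponent r^2/(4h^2) = u^2/4 defeats the growth e^w,
  and \<eta> u^k h^2 = O(1) remains. Extending a value at u to a whole stretch costs at most 2r,
  which has the permitted order u^(-N).\<close>

lemma err_bound:
  obtains C where "C > 0" "\<And>u. u \<ge> 4 \<Longrightarrow> \<bar>err u\<bar> \<le> C / u ^ N"
proof -
  \<comment> \<open>3N + 2 = N + 2(N + 1): the desired decay plus the two factors h.\<close>
  define k where "k = 3 * N + 2"
  obtain C K where CK: "C > 0" "K > 0"
    "\<And>e w r h \<eta> a. \<lbrakk>e = 1 \<or> e = - 1; 0 < a; a \<le> w - r; 0 < h; h \<le> r; h \<le> 1; 0 \<le> \<eta>;
       \<And>v. v \<in> {w - r..w + r} \<Longrightarrow> \<eta> \<le> e * err v\<rbrakk> \<Longrightarrow>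
       \<eta> * a ^ k * h \<le> C / h + K * exp (w + 1 - r\<^sup>2 / (4 * h\<^sup>2))"
    using tauberian_core[of k] by blast
  define D where "D = 2 + 2 ^ k * (C + K * exp 3)"
  have "\<bar>err u\<bar> \<le> D / u ^ N" if u: "u \<ge> 4" for u
  proof -
    define r where "r = 1 / u ^ N"
    define h where "h = 1 / u ^ (N + 1)"
    have u1: "u \<ge> 1" "u > 0" using u by auto
    have r: "0 < r" "r \<le> 1" using u1 by (auto simp: r_def one_le_power)
    have h: "0 < h" "h \<le> r" "h \<le> 1" using u1
      by (auto simp: h_def r_def one_le_power frac_le mult_le_cancel_right1 intro!: divide_le_eq_1_pos[THEN iffD2] mult_ge1_I)
    have rh: "r\<^sup>2 / (4 * h\<^sup>2) = u\<^sup>2 / 4"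
      using u1 by (simp add: r_def h_def power_divide power_mult_distrib)
    have fin: "\<eta> \<le> (D - 2) / u ^ N" if core: "\<eta> * (u / 2) ^ k * h \<le> C / h + K * exp (w + 1 - r\<^sup>2 / (4 * h\<^sup>2))" and w: "w \<le> u + 1" for \<eta> w
    proof -
      have "w + 1 - u\<^sup>2 / 4 \<le> 3"
      proof -
        have "0 \<le> (u / 2 - 1)\<^sup>2" by simp
        then have "u \<le> u\<^sup>2 / 4 + 1" by (simp add: power2_diff power_divide)
        then show ?thesis using w by linarith
      qed
      then have "K * exp (w + 1 - r\<^sup>2 / (4 * h\<^sup>2)) \<le> K * exp 3" unfolding rh using CK by simp
      also have "\<dots> \<le> K * exp 3 / h" using h CK by (simp add: pos_le_divide_eq)
      finally have "\<eta> * (u / 2) ^ k * h \<le> (C + K * exp 3) / h" using core by (simp add: add_divide_distrib)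
      then have "\<eta> * (u / 2) ^ k * h * h \<le> C + K * exp 3" using h by (simp add: pos_le_divide_eq)
      moreover have "\<eta> * (u / 2) ^ k * h * h = \<eta> * u ^ N / 2 ^ k"
        using u1 by (simp add: h_def k_def power_divide power_add power_mult power2_eq_square eval_nat_numeral power_mult_distrib mult_ac)
      ultimately have "\<eta> * u ^ N \<le> 2 ^ k * (C + K * exp 3)" by (simp add: pos_divide_le_eq mult.commute)
      then show ?thesis using u1 by (simp add: D_def pos_le_divide_eq)
    qed
    have D0: "(D - 2) / u ^ N \<ge> 0" using CK u1 by (simp add: D_def)
    have two: "D / u ^ N = (D - 2) / u ^ N + 2 * r" by (simp add: r_def diff_divide_distrib)
    \<comment> \<open>\<open>err\<close> falls slowly, so a large positive value at u persists to
      the right: the stretch is [u, u + 2r].\<close>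
    have up: "err u - 2 * r \<le> (D - 2) / u ^ N"
    proof (cases "err u - 2 * r \<ge> 0")
      case True
      show ?thesis
      proof (rule fin)
        show "(err u - 2 * r) * (u / 2) ^ k * h \<le> C / h + K * exp ((u + r) + 1 - r\<^sup>2 / (4 * h\<^sup>2))"
        proof (rule CK(3)[of 1])
          fix v assume v: "v \<in> {u + r - r..u + r + r}"
          have "(v - u) / u \<le> (2 * r) / 1" using v u1 r by (intro frac_le) auto
          moreover have "err u - (v - u) / u \<le> err v" using v u1 r by (intro err_slow) auto
          ultimately show "err u - 2 * r \<le> 1 * err v" by simp
        qed (use True u h r in auto)
      qed (use r in auto)
    qed (use D0 in linarith)
    \<comment> \<open>By the same slow decrease a very negative value at u was already negative
      before: the stretch is [u - 2r, u].\<close>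
    have dn: "- err u - 2 * r \<le> (D - 2) / u ^ N"
    proof (cases "- err u - 2 * r \<ge> 0")
      case True
      show ?thesis
      proof (rule fin)
        show "(- err u - 2 * r) * (u / 2) ^ k * h \<le> C / h + K * exp ((u - r) + 1 - r\<^sup>2 / (4 * h\<^sup>2))"
        proof (rule CK(3)[of "- 1"])
          fix v assume v: "v \<in> {u - r - r..u - r + r}"
          have v1: "v \<ge> 1" using v u r by auto
          have "(u - v) / v \<le> (2 * r) / 1" using v v1 r by (intro frac_le) auto
          moreover have "err v - (u - v) / v \<le> err u" using v v1 by (intro err_slow) auto
          ultimately show "- err u - 2 * r \<le> - 1 * err v" by simp
        qed (use True u h r in auto)
      qed (use r in auto)
    qed (use D0 in linarith)
    show ?thesis using up dn unfolding two by linarith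
  qed
  moreover have "D > 0" using CK by (auto simp: D_def intro!: add_pos_nonneg)
  ultimately show ?thesis using that by blast
qed

section \<open>Convolution on the half line\<close>

text \<open>A class that contains \<open>ln\<close> near 0 and in which convolutions exist at every
  point and belong to the class again.\<close>

definition loc2 :: "(real \<Rightarrow> real) \<Rightarrow> bool" where
  "loc2 f \<longleftrightarrow> f \<in> borel_measurable borel \<and> (\<forall>v\<le>0. f v = 0) \<and>
     (\<forall>U. integrable lborel (\<lambda>v. indicator {..U} v * (f v)\<^sup>2))"

definition conv :: "(real \<Rightarrow> real) \<Rightarrow> (real \<Rightarrow> real) \<Rightarrow> real \<Rightarrow> real" where
  "conv f g u = (\<integral>v. f (u - v) * g v \<partial>lborel)"

lemma loc2_measurable: "loc2 f \<Longrightarrow> f \<in> borel_measurable borel"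
  by (simp add: loc2_def)

lemma loc2_nonpos: "loc2 f \<Longrightarrow> v \<le> 0 \<Longrightarrow> f v = 0"
  by (simp add: loc2_def)

lemma loc2_square: "loc2 f \<Longrightarrow> integrable lborel (\<lambda>v. indicator {..U} v * (f v)\<^sup>2)"
  by (simp add: loc2_def)

lemma loc2_abs: "loc2 f \<Longrightarrow> loc2 (\<lambda>v. \<bar>f v\<bar>)"
  by (auto simp: loc2_def)

lemma loc2_cmult: "loc2 f \<Longrightarrow> loc2 (\<lambda>v. c * f v)"
proof -
  assume f: "loc2 f"
  have "integrable lborel (\<lambda>v. c\<^sup>2 * (indicator {..U} v * (f v)\<^sup>2))" for U
    by (intro integrable_mult_right loc2_square f)
  moreover have "(\<lambda>v. c\<^sup>2 * (indicator {..U} v * (f v)\<^sup>2)) = (\<lambda>v. indicator {..U} v * (c * f v)\<^sup>2)" for U :: real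
    by (simp add: fun_eq_iff power_mult_distrib)
  ultimately have "integrable lborel (\<lambda>v. indicator {..U} v * (c * f v)\<^sup>2)" for U by (simp only:)
  then show ?thesis using f by (auto simp: loc2_def)
qed

lemma loc2_add:
  assumes f: "loc2 f" and g: "loc2 g"
  shows "loc2 (\<lambda>v. f v + g v)"
  unfolding loc2_def
proof (intro conjI allI impI)
  note [measurable] = loc2_measurable[OF f] loc2_measurable[OF g]
  show "(\<lambda>v. f v + g v) \<in> borel_measurable borel" by measurable
  show "f v + g v = 0" if "v \<le> 0" for v using that f g by (simp add: loc2_nonpos)
  fix U
  show "integrable lborel (\<lambda>v. indicator {..U} v * (f v + g v)\<^sup>2)"
  proof (rule Bochner_Integration.integrable_bound)
    show "integrable lborel (\<lambda>v. 2 * (indicator {..U} v * (f v)\<^sup>2) + 2 * (indicator {..U} v * (g v)\<^sup>2))"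
      by (intro Bochner_Integration.integrable_add integrable_mult_right loc2_square f g)
    show "AE v in lborel. norm (indicator {..U} v * (f v + g v)\<^sup>2) \<le> norm (2 * (indicator {..U} v * (f v)\<^sup>2) + 2 * (indicator {..U} v * (g v)\<^sup>2))"
    proof (rule AE_I2)
      fix v :: real
      have "0 \<le> (f v - g v)\<^sup>2" by simp
      then have "(f v + g v)\<^sup>2 \<le> 2 * (f v)\<^sup>2 + 2 * (g v)\<^sup>2" by (simp add: power2_sum power2_diff)
      then show "norm (indicator {..U} v * (f v + g v)\<^sup>2) \<le> norm (2 * (indicator {..U} v * (f v)\<^sup>2) + 2 * (indicator {..U} v * (g v)\<^sup>2))"
        by (auto simp: indicator_def)
    qed
  qed measurable
qed

lemma loc2_bounded:
  assumes [measurable]: "f \<in> borel_measurable borel" and z: "\<And>v. v \<le> 0 \<Longrightarrow> f v = 0"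
    and b: "\<And>U. \<exists>B. \<forall>v\<le>U. \<bar>f v\<bar> \<le> B"
  shows "loc2 f"
  unfolding loc2_def
proof (intro conjI allI impI)
  fix U
  obtain B where B: "\<And>v. v \<le> U \<Longrightarrow> \<bar>f v\<bar> \<le> B" using b[of U] by blast
  show "integrable lborel (\<lambda>v. indicator {..U} v * (f v)\<^sup>2)"
  proof (rule Bochner_Integration.integrable_bound)
    show "integrable lborel (\<lambda>v. B\<^sup>2 * indicator {0..U} v)"
      by (intro integrable_mult_right) (simp add: emeasure_lborel_Icc_eq)
    show "AE v in lborel. norm (indicator {..U} v * (f v)\<^sup>2) \<le> norm (B\<^sup>2 * indicator {0..U} v)"
    proof (rule AE_I2)
      fix v :: real
      show "norm (indicator {..U} v * (f v)\<^sup>2) \<le> norm (B\<^sup>2 * indicator {0..U} v)"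
      proof (cases "v \<le> U \<and> v > 0")
        case True
        then have "(f v)\<^sup>2 \<le> B\<^sup>2" using B[of v] by (metis abs_le_square_iff abs_ge_self order_trans)
        then show ?thesis using True by simp
      next
        case False
        then show ?thesis using z[of v] by (cases "v \<le> 0") (auto simp: indicator_def)
      qed
    qed
  qed measurable
qed (use z in auto)

text \<open>2|ab| \<le> a^2 + b^2 on 0 < v < u, where both arguments lie below \<open>U\<close>,
  together with the reflection of v to u - v. The bound does not depend on u, so convolutions are
  locally bounded.\<close>

lemma loc2_conv_bound:
  assumes f: "loc2 f" and g: "loc2 g" and u: "u \<le> U"
  shows "integrable lborel (\<lambda>v. f (u - v) * g v)"
    "\<bar>conv f g u\<bar> \<le> (\<integral>v. indicator {..U} v * (f v)\<^sup>2 \<partial>lborel) + (\<integral>v. indicator {..U} v * (g v)\<^sup>2 \<partial>lborel)"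
proof -
  note [measurable] = loc2_measurable[OF f] loc2_measurable[OF g]
  let ?D = "\<lambda>v. indicator {..U} (u + (- 1) * v) * (f (u + (- 1) * v))\<^sup>2 + indicator {..U} v * (g v)\<^sup>2"
  have if1: "integrable lborel (\<lambda>v. indicator {..U} (u + (- 1) * v) * (f (u + (- 1) * v))\<^sup>2)"
    by (rule lborel_integrable_real_affine[OF loc2_square[OF f]]) simp
  have val: "(\<integral>v. indicator {..U} v * (f v)\<^sup>2 \<partial>lborel) = (\<integral>v. indicator {..U} (u + (- 1) * v) * (f (u + (- 1) * v))\<^sup>2 \<partial>lborel)"
    using lborel_integral_real_affine[of "- 1" "\<lambda>v. indicator {..U} v * (f v)\<^sup>2" u] by simp
  have iD: "integrable lborel ?D" by (intro Bochner_Integration.integrable_add if1 loc2_square g)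
  have bnd: "\<bar>f (u - v) * g v\<bar> \<le> ?D v" for v
  proof (cases "0 < v \<and> v < u")
    case True
    have "2 * (\<bar>f (u - v)\<bar> * \<bar>g v\<bar>) \<le> (f (u - v))\<^sup>2 + (g v)\<^sup>2"
      using zero_le_power2[of "\<bar>f (u - v)\<bar> - \<bar>g v\<bar>"] by (simp add: power2_diff)
    moreover have "0 \<le> \<bar>f (u - v)\<bar> * \<bar>g v\<bar>" by simp
    ultimately have "\<bar>f (u - v) * g v\<bar> \<le> (f (u - v))\<^sup>2 + (g v)\<^sup>2" unfolding abs_mult by linarith
    then show ?thesis using True u by (simp add: indicator_def)
  next
    case False
    then have "f (u - v) * g v = 0" using loc2_nonpos[OF f, of "u - v"] loc2_nonpos[OF g, of v] by auto
    moreover have "0 \<le> ?D v" by (intro add_nonneg_nonneg mult_nonneg_nonneg) auto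
    ultimately show ?thesis by (simp only: abs_zero)
  qed
  show i: "integrable lborel (\<lambda>v. f (u - v) * g v)"
  proof (rule Bochner_Integration.integrable_bound[OF iD])
    show "AE v in lborel. norm (f (u - v) * g v) \<le> norm (?D v)"
    proof (rule AE_I2)
      fix v show "norm (f (u - v) * g v) \<le> norm (?D v)"
        using bnd[of v] abs_ge_self[of "?D v"] by (simp only: real_norm_def)
    qed
  qed measurable
  have "\<bar>conv f g u\<bar> \<le> (\<integral>v. \<bar>f (u - v) * g v\<bar> \<partial>lborel)"
    unfolding conv_def using integral_norm_bound[of lborel "\<lambda>v. f (u - v) * g v"] by simp
  also have "\<dots> \<le> (\<integral>v. ?D v \<partial>lborel)"
    by (rule integral_mono[OF integrable_abs[OF i] iD bnd])
  also have "\<dots> = (\<integral>v. indicator {..U} v * (f v)\<^sup>2 \<partial>lborel) + (\<integral>v. indicator {..U} v * (g v)\<^sup>2 \<partial>lborel)"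
    unfolding val by (rule Bochner_Integration.integral_add[OF if1 loc2_square[OF g]])
  finally show "\<bar>conv f g u\<bar> \<le> (\<integral>v. indicator {..U} v * (f v)\<^sup>2 \<partial>lborel) + (\<integral>v. indicator {..U} v * (g v)\<^sup>2 \<partial>lborel)" .
qed

lemma conv_integrable: "loc2 f \<Longrightarrow> loc2 g \<Longrightarrow> integrable lborel (\<lambda>v. f (u - v) * g v)"
  by (rule loc2_conv_bound(1)[OF _ _ order_refl])

lemma conv_commute: "conv f g u = conv g f u"
  unfolding conv_def using lborel_integral_real_affine[of "- 1" "\<lambda>v. f (u - v) * g v" u]
  by (simp add: mult.commute)

lemma conv_nonpos:
  assumes "loc2 f" "loc2 g" "u \<le> 0"
  shows "conv f g u = 0"
proof -
  have "f (u - v) * g v = 0" for v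
    using loc2_nonpos[OF assms(1), of "u - v"] loc2_nonpos[OF assms(2), of v] assms(3) by (cases "v \<le> 0") auto
  then have "(\<lambda>v. f (u - v) * g v) = (\<lambda>_. 0)" by (rule ext)
  then show ?thesis by (simp only: conv_def Bochner_Integration.integral_zero)
qed

lemma conv_measurable:
  assumes f: "loc2 f" and g: "loc2 g"
  shows "conv f g \<in> borel_measurable borel"
proof -
  note [measurable] = loc2_measurable[OF f] loc2_measurable[OF g]
  have "(\<lambda>u. \<integral>v. f (u - v) * g v \<partial>lborel) \<in> borel_measurable borel"
    by (rule lborel.borel_measurable_lebesgue_integral) measurable
  then show ?thesis by (simp add: conv_def [abs_def])
qed

lemma loc2_conv:
  assumes f: "loc2 f" and g: "loc2 g"
  shows "loc2 (conv f g)"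
  by (rule loc2_bounded[OF conv_measurable[OF f g] conv_nonpos[OF f g]])
     (use loc2_conv_bound(2)[OF f g] in blast)+

lemma conv_add_left:
  assumes "loc2 f1" "loc2 f2" "loc2 g"
  shows "conv (\<lambda>v. f1 v + f2 v) g u = conv f1 g u + conv f2 g u"
  unfolding conv_def distrib_right by (intro Bochner_Integration.integral_add conv_integrable assms)

lemma conv_add_right:
  assumes "loc2 f1" "loc2 f2" "loc2 g"
  shows "conv g (\<lambda>v. f1 v + f2 v) u = conv g f1 u + conv g f2 u"
  using conv_add_left[OF assms] by (simp add: conv_commute[of g])

lemma conv_cmult_left: "conv (\<lambda>v. c * f v) g u = c * conv f g u"
  unfolding conv_def by (simp add: mult.assoc)

text \<open>Fubini; absolute integrability holds because |g| convolved with |h| is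
  \<open>loc2\<close> and can be convolved with |f|.\<close>

lemma conv_assoc:
  assumes f: "loc2 f" and g: "loc2 g" and h: "loc2 h"
  shows "conv (conv f g) h u = conv f (conv g h) u"
proof -
  note [measurable] = loc2_measurable[OF f] loc2_measurable[OF g] loc2_measurable[OF h]
  have prod: "integrable (lborel \<Otimes>\<^sub>M lborel) (\<lambda>(x, v). f (u - x) * (g (x - v) * h v))"
  proof (rule lborel_pair.Fubini_integrable)
    have "(\<integral>v. norm (case (x, v) of (x, v) \<Rightarrow> f (u - x) * (g (x - v) * h v)) \<partial>lborel)
       = \<bar>f (u - x)\<bar> * conv (\<lambda>v. \<bar>g v\<bar>) (\<lambda>v. \<bar>h v\<bar>) x" for x
      by (simp add: conv_def abs_mult)
    then show "integrable lborel (\<lambda>x. \<integral>v. norm (case (x, v) of (x, v) \<Rightarrow> f (u - x) * (g (x - v) * h v)) \<partial>lborel)"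
      using conv_integrable[OF loc2_abs[OF f] loc2_conv[OF loc2_abs[OF g] loc2_abs[OF h]], of u] by simp
    show "AE x in lborel. integrable lborel (\<lambda>v. case (x, v) of (x, v) \<Rightarrow> f (u - x) * (g (x - v) * h v))"
      using conv_integrable[OF g h] by simp
  qed measurable
  have "conv (conv f g) h u = (\<integral>v. (\<integral>x. f (u - x) * (g (x - v) * h v) \<partial>lborel) \<partial>lborel)"
  proof -
    have "conv f g (u - v) * h v = (\<integral>x. f (u - x) * (g (x - v) * h v) \<partial>lborel)" for v
    proof -
      have "conv f g (u - v) = (\<integral>x. f (u - x) * g (x - v) \<partial>lborel)"
        unfolding conv_def using lborel_integral_real_affine[of 1 "\<lambda>w. f (u - v - w) * g w" "- v"]
        by (simp add: algebra_simps)
      then show ?thesis by (simp add: mult.assoc[symmetric])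
    qed
    then show ?thesis unfolding conv_def[of "conv f g"] by simp
  qed
  also have "\<dots> = (\<integral>x. (\<integral>v. f (u - x) * (g (x - v) * h v) \<partial>lborel) \<partial>lborel)"
    by (rule lborel_pair.Fubini_integral[OF prod])
  also have "\<dots> = conv f (conv g h) u"
    by (simp add: conv_def)
  finally show ?thesis .
qed

text \<open>Binomial expansion in a commutative and associative product. The cross terms are grouped
  so that each is a power of \<open>q\<close> against a power of \<open>e\<close>, the form in which
  a smooth factor can be Taylor expanded against a decaying one.\<close>

lemma conv_cube:
  assumes q: "loc2 q" and e: "loc2 e"
  shows "conv (conv (\<lambda>v. q v + e v) (\<lambda>v. q v + e v)) (\<lambda>v. q v + e v) u =
    conv (conv q q) q u + 3 * conv (conv q q) e u + 3 * conv q (conv e e) u + conv (conv e e) e u"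
proof -
  let ?m = "\<lambda>v. q v + e v"
  have m: "loc2 ?m" by (rule loc2_add[OF q e])
  have mm: "conv ?m ?m = (\<lambda>u. (conv q q u + 2 * conv q e u) + conv e e u)"
    using conv_commute[of e q] by (auto simp: fun_eq_iff conv_add_left[OF q e m] conv_add_right[OF q e q] conv_add_right[OF q e e])
  have qq: "loc2 (conv q q)" and qe: "loc2 (\<lambda>u. 2 * conv q e u)" and ee: "loc2 (conv e e)"
    by (intro loc2_cmult loc2_conv q e)+
  have "conv (\<lambda>u. (conv q q u + 2 * conv q e u) + conv e e u) r u = conv (conv q q) r u + 2 * conv (conv q e) r u + conv (conv e e) r u"
    if r: "loc2 r" for r
    using conv_add_left[OF loc2_add[OF qq qe] ee r, of u] conv_add_left[OF qq qe r, of u] conv_cmult_left[of 2 "conv q e" r u] by simp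
  then have "conv (conv ?m ?m) ?m u = (conv (conv q q) q u + 2 * conv (conv q e) q u + conv (conv e e) q u)
      + (conv (conv q q) e u + 2 * conv (conv q e) e u + conv (conv e e) e u)"
    unfolding mm using q e conv_add_right[OF q e loc2_add[OF loc2_add[OF qq qe] ee], of u] by simp
  moreover have "conv (conv q e) q u = conv (conv q q) e u"
    using conv_commute[of "conv q e" q u] conv_assoc[OF q q e, of u] by simp
  moreover have "conv (conv q e) e u = conv q (conv e e) u" by (rule conv_assoc[OF q e e])
  moreover have "conv (conv e e) q u = conv q (conv e e) u" by (rule conv_commute)
  ultimately show ?thesis by simp
qed

section \<open>The prime sum as main term plus error\<close>

definition qfun :: "real \<Rightarrow> real" where
  "qfun v = (if v > 0 then ln v + mertens_const else 0)"

lemma msum_eq: "msum = (\<lambda>v. qfun v + err v)"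
  by (auto simp: fun_eq_iff qfun_def err_def msum_nonpos)

lemma loc2_msum: "loc2 msum"
  by (rule loc2_bounded) (auto simp: msum_nonpos intro!: exI[of _ "msum _"] msum_mono simp: abs_of_nonneg msum_nonneg)

text \<open>Up to U the square of \<open>ln\<close> is dominated by exp U times e^(-t) (ln t)^2, the
  integrand of Gamma''(1).\<close>

lemma loc2_qfun: "loc2 qfun"
proof -
  define L where "L = (\<lambda>v::real. indicator {0<..} v * ln v)"
  have "loc2 L"
    unfolding loc2_def
  proof (intro conjI allI impI)
    show "L \<in> borel_measurable borel" unfolding L_def by measurable
    show "L v = 0" if "v \<le> 0" for v using that by (simp add: L_def)
    fix U
    have i: "integrable lborel (\<lambda>t::real. exp U * (indicator {0<..} t * exp (- t) * (ln t)\<^sup>2))"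
      using exp_integral.int_real[OF exp_integral.step_power[OF exp_integral_Gamma, of 2], of 0]
      by (intro integrable_mult_right) simp
    show "integrable lborel (\<lambda>v. indicator {..U} v * (L v)\<^sup>2)"
    proof (rule Bochner_Integration.integrable_bound[OF i])
      show "AE v in lborel. norm (indicator {..U} v * (L v)\<^sup>2) \<le> norm (exp U * (indicator {0<..} v * exp (- v) * (ln v)\<^sup>2))"
      proof (rule AE_I2)
        fix v :: real
        show "norm (indicator {..U} v * (L v)\<^sup>2) \<le> norm (exp U * (indicator {0<..} v * exp (- v) * (ln v)\<^sup>2))"
        proof (cases "0 < v \<and> v \<le> U")
          case True
          have "1 * (ln v)\<^sup>2 \<le> exp (U - v) * (ln v)\<^sup>2" using True by (intro mult_right_mono) auto
          then show ?thesis using True by (simp add: L_def exp_diff exp_minus divide_inverse mult_ac)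
        qed (auto simp: L_def indicator_def)
      qed
    qed (simp add: L_def)
  qed
  moreover have "loc2 (\<lambda>v. mertens_const * indicator {0<..} v)"
    by (rule loc2_bounded) (auto simp: indicator_def intro!: exI[of _ "\<bar>mertens_const\<bar>"])
  ultimately have "loc2 (\<lambda>v. L v + mertens_const * indicator {0<..} v)" by (rule loc2_add)
  moreover have "(\<lambda>v. L v + mertens_const * indicator {0<..} v) = qfun"
    by (auto simp: fun_eq_iff L_def qfun_def)
  ultimately show ?thesis by simp
qed

lemma loc2_err: "loc2 err"
proof -
  have "err = (\<lambda>v. msum v + (- 1) * qfun v)" by (auto simp: msum_eq fun_eq_iff)
  then show ?thesis using loc2_add[OF loc2_msum loc2_cmult[OF loc2_qfun, of "- 1"]] by simp
qed

section \<open>Logarithmic Beta integrals\<close>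

lemma tendsto_powr_ln_0:
  "((\<lambda>w::real. w ^ Suc n * (- ln w) ^ k) \<longlongrightarrow> 0) (at_right 0)"
proof -
  have "filterlim (\<lambda>w::real. - ln w) at_top (at_right 0)"
    by (rule filterlim_uminus_at_top[THEN iffD2]) (use ln_at_0 in simp)
  from filterlim_compose[OF tendsto_power_div_exp_0[of k] this]
  have "((\<lambda>w::real. (- ln w) ^ k / exp (- ln w)) \<longlongrightarrow> 0) (at_right 0)" .
  then have "((\<lambda>w::real. w ^ n * ((- ln w) ^ k / exp (- ln w))) \<longlongrightarrow> 0 ^ n * 0) (at_right 0)"
    by (intro tendsto_mult tendsto_power tendsto_ident_at)
  then have "((\<lambda>w::real. w ^ n * ((- ln w) ^ k / exp (- ln w))) \<longlongrightarrow> 0) (at_right 0)" by simp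
  then show ?thesis
    by (rule Lim_transform_eventually) (auto simp: eventually_at_filter exp_minus field_simps)
qed

text \<open>Induction on k by integration by parts; the boundary function \<open>G\<close> vanishes
  at both ends.\<close>

lemma has_integral_power_ln:
  "((\<lambda>w::real. w ^ n * (- ln w) ^ k) has_integral fact k / real (n + 1) ^ (k + 1)) {0..1}"
proof (induction k)
  case 0
  have "((\<lambda>w::real. w ^ n) has_integral 1 ^ Suc n / real (Suc n) - 0 ^ Suc n / real (Suc n)) {0..1}"
  proof (rule fundamental_theorem_of_calculus)
    fix x :: real
    have "((\<lambda>w. w ^ Suc n / real (Suc n)) has_real_derivative (real (Suc n) * x ^ (Suc n - Suc 0)) / real (Suc n)) (at x within {0..1})"
      by (intro DERIV_cdivide DERIV_pow)
    then show "((\<lambda>w. w ^ Suc n / real (Suc n)) has_vector_derivative x ^ n) (at x within {0..1})"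
      by (simp add: has_real_derivative_iff_has_vector_derivative del: of_nat_Suc)
  qed simp
  then show ?case by simp
next
  case (Suc k)
  define G where "G = (\<lambda>w::real. w ^ Suc n * (- ln w) ^ Suc k / real (n + 1))"
  have "((\<lambda>w. w ^ n * (- ln w) ^ Suc k - real (k + 1) / real (n + 1) * (w ^ n * (- ln w) ^ k)) has_integral G 1 - G 0) {0..1}"
  proof (rule fundamental_theorem_of_calculus_interior)
    show "continuous_on {0..1} G"
      unfolding continuous_on_eq_continuous_within
    proof
      fix x :: real assume x: "x \<in> {0..1}"
      show "continuous (at x within {0..1}) G"
      proof (cases "x = 0")
        case False
        then have "isCont G x" unfolding G_def using x by (intro continuous_intros) auto
        then show ?thesis by (rule continuous_at_imp_continuous_at_within)
      next
        case True
        have "(G \<longlongrightarrow> 0 / real (n + 1)) (at_right 0)"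
          unfolding G_def by (intro tendsto_divide tendsto_powr_ln_0 tendsto_const) auto
        then have "(G \<longlongrightarrow> 0) (at 0 within {0..1})"
          by (simp add: at_within_Icc_at_right)
        then show ?thesis using True by (simp add: continuous_within G_def)
      qed
    qed
    fix x :: real assume x: "x \<in> {0<..<1}"
    have "(G has_real_derivative ((real (Suc n) * x ^ n) * (- ln x) ^ Suc k + (real (Suc k) * (- ln x) ^ k * (- (1 / x))) * x ^ Suc n) / real (n + 1)) (at x)"
      unfolding G_def using x
      by (intro DERIV_cdivide DERIV_mult DERIV_power_Suc[THEN DERIV_cong] ) (auto intro!: derivative_eq_intros simp: divide_inverse)
    moreover have "((real (Suc n) * x ^ n) * (- ln x) ^ Suc k + (real (Suc k) * (- ln x) ^ k * (- (1 / x))) * x ^ Suc n) / real (n + 1)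
       = x ^ n * (- ln x) ^ Suc k - real (k + 1) / real (n + 1) * (x ^ n * (- ln x) ^ k)"
    proof -
      have gen: "(N * a * L + (K * l * (- (1 / x))) * (x * a)) / N = a * L - K / N * (a * l)"
        if "N \<noteq> 0" for N a L K l :: real
        using that x by (simp add: field_simps)
      show ?thesis using gen[of "real (n + 1)" "x ^ n" "(- ln x) ^ Suc k" "real (k + 1)" "(- ln x) ^ k"] by simp
    qed
    ultimately show "(G has_vector_derivative x ^ n * (- ln x) ^ Suc k - real (k + 1) / real (n + 1) * (x ^ n * (- ln x) ^ k)) (at x)"
      by (simp only: has_real_derivative_iff_has_vector_derivative)
  qed simp
  moreover have "G 1 - G 0 = 0" by (simp add: G_def)
  ultimately have "((\<lambda>w. (w ^ n * (- ln w) ^ Suc k - real (k + 1) / real (n + 1) * (w ^ n * (- ln w) ^ k)) + real (k + 1) / real (n + 1) * (w ^ n * (- ln w) ^ k)) has_integral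
     0 + real (k + 1) / real (n + 1) * (fact k / real (n + 1) ^ (k + 1))) {0..1}"
    by (intro has_integral_add has_integral_mult_right Suc.IH) simp
  then show ?case by (simp add: mult.commute)
qed

lemma integral_power_ln:
  "has_bochner_integral lborel (\<lambda>w::real. indicator {0..1} w * (w ^ n * (- ln w) ^ k)) (fact k / real (n + 1) ^ (k + 1))"
  by (rule has_bochner_integral_of_has_integral[OF _ _ _ has_integral_power_ln])
     (auto intro!: mult_nonneg_nonneg simp: ln_le_zero_iff intro: zero_le_power, metis less_eq_real_def ln_0 ln_le_zero_iff neg_0_le_iff_le zero_le_power order_refl)

text \<open>In the following series the term for \<open>n = 0\<close> is a division by zero and hence vanishes.\<close>

lemma integral_power_ln_ln:
  "has_bochner_integral lborel (\<lambda>w::real. indicator {0..1} w * (w ^ a * (- ln w) ^ k * (- ln (1 - w))))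
     (\<Sum>n. fact k / (real n * real (n + a + 1) ^ (k + 1)))"
proof -
  let ?f = "\<lambda>n w::real. (1 / real n) * (indicator {0..1} w * (w ^ (n + a) * (- ln w) ^ k))"
  have val: "has_bochner_integral lborel (?f n) (1 / real n * (fact k / real (n + a + 1) ^ (k + 1)))" for n
    by (intro has_bochner_integral_mult_right integral_power_ln)
  have nn: "0 \<le> ?f n w" for n w
  proof (cases "w \<in> {0..1}")
    case True
    then have "0 \<le> - ln w" by (cases "w = 0") auto
    then show ?thesis using True by simp
  qed simp
  have nf: "norm (?f n w) = ?f n w" for n w by (simp only: real_norm_def abs_of_nonneg[OF nn])
  have sm: "summable (\<lambda>n. 1 / real n * (fact k / real (n + a + 1) ^ (k + 1)))"
  proof (rule summable_comparison_test[OF _ summable_mult[OF inverse_power_summable[of 2, where 'a = real], of "fact k"]])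
    have "1 / real n * (fact k / real (n + a + 1) ^ (k + 1)) \<le> fact k * inverse (real n ^ 2)" for n
    proof (cases "n = 0")
      case False
      have "real n ^ 1 \<le> real (n + a + 1) ^ 1" by simp
      also have "\<dots> \<le> real (n + a + 1) ^ (k + 1)" by (rule power_increasing) auto
      finally have "fact k / real (n + a + 1) ^ (k + 1) \<le> fact k / real n"
        using False by (intro divide_left_mono) auto
      then have "1 / real n * (fact k / real (n + a + 1) ^ (k + 1)) \<le> 1 / real n * (fact k / real n)"
        by (intro mult_left_mono) auto
      then show ?thesis by (simp add: power2_eq_square divide_inverse mult_ac)
    qed simp
    then show "\<exists>N. \<forall>n\<ge>N. norm (1 / real n * (fact k / real (n + a + 1) ^ (k + 1))) \<le> fact k * inverse (real n ^ 2)"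
      by (auto simp: abs_mult)
  qed simp
  \<comment> \<open>The point w = 1, where the logarithmic series may diverge, is a null
    set.\<close>
  have ser: "(\<lambda>n. ?f n w) sums (indicator {0..1} w * (w ^ a * (- ln w) ^ k * (- ln (1 - w))))" if "w \<noteq> 1" for w
  proof (cases "w \<in> {0..1}")
    case True
    have "(\<lambda>n. - ((- (- w)) ^ n) / real n) sums ln (1 + (- w))"
      by (rule ln_series') (use True that in auto)
    from sums_mult[OF sums_minus[OF this], of "w ^ a * (- ln w) ^ k"]
    have "(\<lambda>n. w ^ a * (- ln w) ^ k * (w ^ n / real n)) sums (w ^ a * (- ln w) ^ k * (- ln (1 - w)))" by simp
    then show ?thesis using True by (simp add: power_add mult_ac)
  next
    case False
    then show ?thesis by simp
  qed
  have ae1: "AE w in lborel. w \<noteq> (1::real)" by (rule AE_lborel_singleton)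
  have A1: "integrable lborel (?f n)" for n using val[of n] by (simp only: has_bochner_integral_iff)
  have A2: "AE w in lborel. summable (\<lambda>n. norm (?f n w))"
    unfolding nf using ae1 by eventually_elim (rule sums_summable[OF ser])
  have A3: "summable (\<lambda>n. \<integral>w. norm (?f n w) \<partial>lborel)"
    unfolding nf has_bochner_integral_integral_eq[OF val] by (rule sm)
  have "has_bochner_integral lborel (\<lambda>w. \<Sum>n. ?f n w) (\<Sum>n. 1 / real n * (fact k / real (n + a + 1) ^ (k + 1)))"
    unfolding has_bochner_integral_iff using integrable_suminf[OF A1 A2 A3] integral_suminf[OF A1 A2 A3]
    by (simp only: has_bochner_integral_integral_eq[OF val] simp_thms)
  moreover have "AE w in lborel. (\<Sum>n. ?f n w) = indicator {0..1} w * (w ^ a * (- ln w) ^ k * (- ln (1 - w)))"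
    using ae1 by eventually_elim (rule sums_unique[OF ser, symmetric])
  moreover have "(\<lambda>w. \<Sum>n. ?f n w) \<in> borel_measurable lborel" by measurable
  ultimately show ?thesis
    using has_bochner_integral_cong_AE[of "\<lambda>w. \<Sum>n. ?f n w" lborel "\<lambda>w. indicator {0..1} w * (w ^ a * (- ln w) ^ k * (- ln (1 - w)))"]
    by simp
qed

lemma zeta_sums:
  assumes "s \<ge> 2"
  shows "(\<lambda>n. 1 / real (Suc n) ^ s) sums zeta (real s)"
proof -
  have sm: "summable (\<lambda>n. norm (1 / real (Suc n) ^ s))"
    using summable_Suc_iff[of "\<lambda>n. inverse (real n ^ s)"] inverse_power_summable[of s, where 'a = real] assms
    by (simp add: divide_inverse)
  have "((\<lambda>n. 1 / real (Suc n) ^ s) has_sum (\<Sum>n. 1 / real (Suc n) ^ s)) UNIV"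
    by (rule norm_summable_imp_has_sum[OF sm]) (use summable_norm_cancel[OF sm] in auto)
  then have "(\<Sum>n. 1 / real (Suc n) ^ s) = (\<Sum>\<^sub>\<infinity>n. 1 / real (Suc n) ^ s)" by (simp add: infsumI)
  also have "\<dots> = (\<Sum>\<^sub>\<infinity>n\<in>range Suc. real n powr (- real s))"
    by (subst infsum_reindex) (auto simp: o_def powr_minus powr_realpow divide_inverse simp del: of_nat_Suc)
  also have "range Suc = {1..}" by (auto simp: image_iff Suc_le_eq gr0_conv_Suc)
  finally have "(\<Sum>n. 1 / real (Suc n) ^ s) = zeta (real s)" by (simp add: zeta_def)
  then show ?thesis using summable_sums[OF summable_norm_cancel[OF sm]] by simp
qed

text \<open>Partial fractions: differences of reciprocals telescope, and the higher powers are tails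
  of the series for zeta.\<close>

lemma sum_inverse_products:
  "(\<lambda>n. 1 / (real n * real (n + 1))) sums 1"
  "(\<lambda>n. 1 / (real n * real (n + 1) ^ 2)) sums (2 - zeta 2)"
  "(\<lambda>n. 1 / (real n * real (n + 2))) sums (3 / 4)"
  "(\<lambda>n. 1 / (real n * real (n + 2) ^ 2)) sums (1 - zeta 2 / 2)"
  "(\<lambda>n. 2 / (real n * real (n + 2) ^ 3)) sums (1 - zeta 2 / 2 - (zeta 3 - 9 / 8))"
proof -
  have drop0: "f sums c" if "(\<lambda>n. f (Suc n)) sums c" "f 0 = 0" for f :: "nat \<Rightarrow> real" and c
    using that sums_Suc_iff[of f c] by simp
  have z2: "(\<lambda>n. 1 / real (Suc n) ^ 2) sums zeta 2" using zeta_sums[of 2] by simp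
  have z3: "(\<lambda>n. 1 / real (Suc n) ^ 3) sums zeta 3" using zeta_sums[of 3] by simp
  have z2': "(\<lambda>n. 1 / real (Suc (Suc n)) ^ 2) sums (zeta 2 - 1)"
    using z2 sums_Suc_iff[of "\<lambda>n. 1 / real (Suc n) ^ 2" "zeta 2 - 1"] by simp
  \<comment> \<open>5/4 and, below, 9/8 are the sums of the first two terms of the series for
    \<open>zeta 2\<close> and \<open>zeta 3\<close>.\<close>
  have z2'': "(\<lambda>n. 1 / real (Suc (Suc (Suc n))) ^ 2) sums (zeta 2 - 5 / 4)"
    using z2' sums_Suc_iff[of "\<lambda>n. 1 / real (Suc (Suc n)) ^ 2" "zeta 2 - 5 / 4"] by (simp add: power2_eq_square)
  have z3': "(\<lambda>n. 1 / real (Suc (Suc n)) ^ 3) sums (zeta 3 - 1)"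
    using z3 sums_Suc_iff[of "\<lambda>n. 1 / real (Suc n) ^ 3" "zeta 3 - 1"] by simp
  have z3'': "(\<lambda>n. 1 / real (Suc (Suc (Suc n))) ^ 3) sums (zeta 3 - 9 / 8)"
    using z3' sums_Suc_iff[of "\<lambda>n. 1 / real (Suc (Suc n)) ^ 3" "zeta 3 - 9 / 8"] by (simp add: power3_eq_cube)
  have t0: "(\<lambda>n. 1 / real (Suc n)) \<longlonglongrightarrow> 0" using LIMSEQ_inverse_real_of_nat by (simp add: divide_inverse)
  have t1: "(\<lambda>n. 1 / real (Suc n) - 1 / real (Suc (Suc n))) sums (1 / real (Suc 0) - 0)"
    by (rule telescope_sums'[OF t0])
  have t2: "(\<lambda>n. 1 / real (Suc (Suc n)) - 1 / real (Suc (Suc (Suc n)))) sums (1 / real (Suc (Suc 0)) - 0)"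
    by (rule telescope_sums'[OF LIMSEQ_Suc[OF t0]])
  have nz: "x \<noteq> 0" "x + 1 \<noteq> 0" "x + 2 \<noteq> 0" if "x > 0" for x :: real using that by auto
  have pf1: "1 / (x * (x + 1)) = 1 / x - 1 / (x + 1)" if "x > 0" for x :: real
    using nz[OF that] by (simp add: divide_simps)
  have pf2: "1 / (x * (x + 1) ^ 2) = 1 / (x * (x + 1)) - 1 / (x + 1) ^ 2" if "x > 0" for x :: real
    using nz[OF that] by (simp add: divide_simps) (simp add: algebra_simps power2_eq_square)
  have pf3: "1 / (x * (x + 2)) = 1 / 2 * ((1 / x - 1 / (x + 1)) + (1 / (x + 1) - 1 / (x + 2)))" if "x > 0" for x :: real
    using nz[OF that] by (simp add: divide_simps)
  have pf4: "1 / (x * (x + 2) ^ 2) = 1 / 2 * (1 / (x * (x + 2)) - 1 / (x + 2) ^ 2)" if "x > 0" for x :: real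
    using nz[OF that] by (simp add: divide_simps) (simp add: algebra_simps power2_eq_square)
  have pf5: "2 / (x * (x + 2) ^ 3) = 1 / (x * (x + 2) ^ 2) - 1 / (x + 2) ^ 3" if "x > 0" for x :: real
    using nz[OF that] by (simp add: divide_simps) (simp add: algebra_simps power2_eq_square power3_eq_cube eval_nat_numeral)
  have S: "real (Suc n + 1) = real (Suc (Suc n))" "real (Suc n + 2) = real (Suc (Suc (Suc n)))"
    "real (Suc n) + 1 = real (Suc (Suc n))" "real (Suc n) + 2 = real (Suc (Suc (Suc n)))" "0 < real (Suc n)" for n by simp_all
  have s1: "(\<lambda>n. 1 / (real (Suc n) * real (Suc n + 1))) sums 1"
    using t1 pf1[OF S(5)] unfolding S by simp
  show a1: "(\<lambda>n. 1 / (real n * real (n + 1))) sums 1" by (rule drop0[OF s1]) simp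
  have s2: "(\<lambda>n. 1 / (real (Suc n) * real (Suc n + 1) ^ 2)) sums (1 - (zeta 2 - 1))"
    using sums_diff[OF s1 z2'] pf2[OF S(5)] unfolding S by (simp only: S)
  show "(\<lambda>n. 1 / (real n * real (n + 1) ^ 2)) sums (2 - zeta 2)" using drop0[of "\<lambda>n. 1 / (real n * real (n + 1) ^ 2)"] s2 by simp
  have s3: "(\<lambda>n. 1 / (real (Suc n) * real (Suc n + 2))) sums (1 / 2 * ((1 / real (Suc 0) - 0) + (1 / real (Suc (Suc 0)) - 0)))"
    using sums_mult[OF sums_add[OF t1 t2], of "1 / 2"] pf3[OF S(5)] unfolding S by (simp only: S)
  show "(\<lambda>n. 1 / (real n * real (n + 2))) sums (3 / 4)" using drop0[of "\<lambda>n. 1 / (real n * real (n + 2))"] s3 by simp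
  have s4: "(\<lambda>n. 1 / (real (Suc n) * real (Suc n + 2) ^ 2)) sums (1 / 2 * (1 / 2 * ((1 / real (Suc 0) - 0) + (1 / real (Suc (Suc 0)) - 0)) - (zeta 2 - 5 / 4)))"
    using sums_mult[OF sums_diff[OF s3 z2''], of "1 / 2"] pf4[OF S(5)] unfolding S by (simp only: S)
  have v4: "1 / 2 * (1 / 2 * ((1 / real (Suc 0) - 0) + (1 / real (Suc (Suc 0)) - 0)) - (zeta 2 - 5 / 4)) = 1 - zeta 2 / 2" by simp
  show "(\<lambda>n. 1 / (real n * real (n + 2) ^ 2)) sums (1 - zeta 2 / 2)"
    by (rule drop0[OF s4[unfolded v4]]) simp
  have s5: "(\<lambda>n. 2 / (real (Suc n) * real (Suc n + 2) ^ 3)) sums (1 - zeta 2 / 2 - (zeta 3 - 9 / 8))"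
    using sums_diff[OF s4[unfolded v4] z3''] pf5[OF S(5)] unfolding S by (simp only: S)
  show "(\<lambda>n. 2 / (real n * real (n + 2) ^ 3)) sums (1 - zeta 2 / 2 - (zeta 3 - 9 / 8))"
    by (rule drop0[OF s5]) simp
qed

section \<open>Convolution powers of the main term\<close>

text \<open>The convolution square of \<open>qfun\<close>; \<zeta>(2) comes from the integral of ln
  w ln (1 - w) over the unit interval, which is 2 - \<zeta>(2).\<close>

definition p2fun :: "real \<Rightarrow> real" where
  "p2fun u = (if u > 0 then u * ((ln u + mertens_const)\<^sup>2 - 2 * (ln u + mertens_const) + 2 - zeta 2) else 0)"

text \<open>The convolution cube of \<open>qfun\<close>, as a formula meant for u > 0 only.\<close>

definition p3fun :: "real \<Rightarrow> real" where
  "p3fun u = u\<^sup>2 * ((ln u + mertens_const) ^ 3 / 2 - 9 / 4 * (ln u + mertens_const)\<^sup>2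
     + (21 / 4 - 3 / 2 * zeta 2) * (ln u + mertens_const) - 45 / 8 + 9 / 4 * zeta 2 + zeta 3)"

lemma conv_scale:
  assumes "u > 0"
  shows "conv f g u = u * (\<integral>w. f (u * (1 - w)) * g (u * w) \<partial>lborel)"
  unfolding conv_def using lborel_integral_real_affine[of u "\<lambda>v. f (u - v) * g v" 0] assms
  by (simp add: algebra_simps)

text \<open>Scaling v = u w brings the convolution to the unit interval, where ln (u (1 - w)) = ln u
  + ln (1 - w). The form \<open>l - (- ln (1 - w))\<close> fits the integrals above, which are
  stated for the nonnegative functions - ln.\<close>

lemma conv_qfun_eq:
  assumes u: "u > 0"
    and hb: "has_bochner_integral lborel (\<lambda>w. indicator {0..1} w * ((l - (- ln (1 - w))) * G w)) I"
    and l: "l = ln u + mertens_const"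
    and g: "\<And>w. 0 < w \<Longrightarrow> w < 1 \<Longrightarrow> g (u * w) = G w" and g0: "\<And>v. v \<le> 0 \<Longrightarrow> g v = 0"
    and [measurable]: "g \<in> borel_measurable borel"
  shows "conv qfun g u = u * I"
proof -
  have [measurable]: "qfun \<in> borel_measurable borel" unfolding qfun_def [abs_def] by measurable
  have "AE w in lborel. w \<noteq> (0::real) \<and> w \<noteq> 1"
    using AE_lborel_singleton[of "0::real"] AE_lborel_singleton[of "1::real"] by eventually_elim simp
  then have "AE w in lborel. qfun (u * (1 - w)) * g (u * w) = indicator {0..1} w * ((l - (- ln (1 - w))) * G w)"
  proof eventually_elim
    case (elim w)
    consider "w < 0" | "0 < w" "w < 1" | "w > 1" using elim by linarith
    then show ?case
    proof cases
      case 1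
      then have "u * w \<le> 0" using u by (simp add: mult_le_0_iff)
      then show ?thesis using 1 g0 by simp
    next
      case 2
      then show ?thesis using g[of w] u l by (simp add: qfun_def ln_mult)
    next
      case 3
      then have "u * (1 - w) \<le> 0" using u by (simp add: mult_le_0_iff)
      then show ?thesis using 3 by (simp add: qfun_def)
    qed
  qed
  then have "(\<integral>w. qfun (u * (1 - w)) * g (u * w) \<partial>lborel) = (\<integral>w. indicator {0..1} w * ((l - (- ln (1 - w))) * G w) \<partial>lborel)"
    by (intro integral_cong_AE borel_measurable_has_bochner_integral[OF hb]) auto
  then show ?thesis using conv_scale[OF u] has_bochner_integral_integral_eq[OF hb] by simp
qed

lemma int_basic:
  "has_bochner_integral lborel (\<lambda>w::real. indicator {0..1} w * (w ^ 0 * (- ln w) ^ 0)) 1"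
  "has_bochner_integral lborel (\<lambda>w::real. indicator {0..1} w * (w ^ 0 * (- ln w) ^ 1)) 1"
  "has_bochner_integral lborel (\<lambda>w::real. indicator {0..1} w * (w ^ 1 * (- ln w) ^ 0)) (1/2)"
  "has_bochner_integral lborel (\<lambda>w::real. indicator {0..1} w * (w ^ 1 * (- ln w) ^ 1)) (1/4)"
  "has_bochner_integral lborel (\<lambda>w::real. indicator {0..1} w * (w ^ 1 * (- ln w) ^ 2)) (1/4)"
  using integral_power_ln[of 0 0] integral_power_ln[of 0 1] integral_power_ln[of 1 0] integral_power_ln[of 1 1] integral_power_ln[of 1 2]
  by (simp_all add: power2_eq_square power3_eq_cube numeral_3_eq_3)

lemma int_basic_ln:
  "has_bochner_integral lborel (\<lambda>w::real. indicator {0..1} w * (w ^ 0 * (- ln w) ^ 0 * (- ln (1 - w)))) 1"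
  "has_bochner_integral lborel (\<lambda>w::real. indicator {0..1} w * (w ^ 0 * (- ln w) ^ 1 * (- ln (1 - w)))) (2 - zeta 2)"
  "has_bochner_integral lborel (\<lambda>w::real. indicator {0..1} w * (w ^ 1 * (- ln w) ^ 0 * (- ln (1 - w)))) (3/4)"
  "has_bochner_integral lborel (\<lambda>w::real. indicator {0..1} w * (w ^ 1 * (- ln w) ^ 1 * (- ln (1 - w)))) (1 - zeta 2 / 2)"
  "has_bochner_integral lborel (\<lambda>w::real. indicator {0..1} w * (w ^ 1 * (- ln w) ^ 2 * (- ln (1 - w)))) (1 - zeta 2 / 2 - (zeta 3 - 9 / 8))"
proof -
  have e: "(\<Sum>n. fact 0 / (real n * real (n + 0 + 1) ^ (0 + 1))) = 1"
    "(\<Sum>n. fact 1 / (real n * real (n + 0 + 1) ^ (1 + 1))) = 2 - zeta 2"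
    "(\<Sum>n. fact 0 / (real n * real (n + 1 + 1) ^ (0 + 1))) = 3 / 4"
    "(\<Sum>n. fact 1 / (real n * real (n + 1 + 1) ^ (1 + 1))) = 1 - zeta 2 / 2"
    "(\<Sum>n. fact 2 / (real n * real (n + 1 + 1) ^ (2 + 1))) = 1 - zeta 2 / 2 - (zeta 3 - 9 / 8)"
    using sum_inverse_products[THEN sums_unique] by (simp_all add: numeral_2_eq_2 numeral_3_eq_3)
  show "has_bochner_integral lborel (\<lambda>w::real. indicator {0..1} w * (w ^ 0 * (- ln w) ^ 0 * (- ln (1 - w)))) 1"
    using integral_power_ln_ln[of 0 0] unfolding e(1) .
  show "has_bochner_integral lborel (\<lambda>w::real. indicator {0..1} w * (w ^ 0 * (- ln w) ^ 1 * (- ln (1 - w)))) (2 - zeta 2)"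
    using integral_power_ln_ln[of 0 1] unfolding e(2) .
  show "has_bochner_integral lborel (\<lambda>w::real. indicator {0..1} w * (w ^ 1 * (- ln w) ^ 0 * (- ln (1 - w)))) (3/4)"
    using integral_power_ln_ln[of 1 0] unfolding e(3) .
  show "has_bochner_integral lborel (\<lambda>w::real. indicator {0..1} w * (w ^ 1 * (- ln w) ^ 1 * (- ln (1 - w)))) (1 - zeta 2 / 2)"
    using integral_power_ln_ln[of 1 1] unfolding e(4) .
  show "has_bochner_integral lborel (\<lambda>w::real. indicator {0..1} w * (w ^ 1 * (- ln w) ^ 2 * (- ln (1 - w)))) (1 - zeta 2 / 2 - (zeta 3 - 9 / 8))"
    using integral_power_ln_ln[of 1 2] unfolding e(5) .
qed

lemma conv_qfun_qfun: "conv qfun qfun = p2fun"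
proof
  fix u :: real
  show "conv qfun qfun u = p2fun u"
  proof (cases "u > 0")
    case False
    then show ?thesis using conv_nonpos[OF loc2_qfun loc2_qfun, of u] by (simp add: p2fun_def)
  next
    case True
    define l where "l = ln u + mertens_const"
    have "has_bochner_integral lborel (\<lambda>w::real. ((l\<^sup>2 * (indicator {0..1} w * (w ^ 0 * (- ln w) ^ 0))
        - l * (indicator {0..1} w * (w ^ 0 * (- ln w) ^ 1)))
        - l * (indicator {0..1} w * (w ^ 0 * (- ln w) ^ 0 * (- ln (1 - w)))))
        + indicator {0..1} w * (w ^ 0 * (- ln w) ^ 1 * (- ln (1 - w))))
       (((l\<^sup>2 * 1 - l * 1) - l * 1) + (2 - zeta 2))"
      by (intro has_bochner_integral_add has_bochner_integral_diff has_bochner_integral_mult_right int_basic int_basic_ln)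
    moreover have "(\<lambda>w::real. ((l\<^sup>2 * (indicator {0..1} w * (w ^ 0 * (- ln w) ^ 0))
        - l * (indicator {0..1} w * (w ^ 0 * (- ln w) ^ 1)))
        - l * (indicator {0..1} w * (w ^ 0 * (- ln w) ^ 0 * (- ln (1 - w)))))
        + indicator {0..1} w * (w ^ 0 * (- ln w) ^ 1 * (- ln (1 - w)))) =
       (\<lambda>w. indicator {0..1} w * ((l - (- ln (1 - w))) * (l + ln w)))"
      by (auto simp: fun_eq_iff algebra_simps power2_eq_square)
    ultimately have hb: "has_bochner_integral lborel (\<lambda>w. indicator {0..1} w * ((l - (- ln (1 - w))) * (l + ln w))) (((l\<^sup>2 * 1 - l * 1) - l * 1) + (2 - zeta 2))"
      by (simp only:)
    have "conv qfun qfun u = u * (((l\<^sup>2 * 1 - l * 1) - l * 1) + (2 - zeta 2))"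
      by (rule conv_qfun_eq[OF True hb l_def]) (use True loc2_measurable[OF loc2_qfun] in \<open>auto simp: qfun_def ln_mult l_def\<close>)
    then show ?thesis using True by (simp add: p2fun_def l_def)
  qed
qed

lemma loc2_p2fun: "loc2 p2fun"
  using loc2_conv[OF loc2_qfun loc2_qfun] by (simp add: conv_qfun_qfun)

lemma conv_qfun_p2fun:
  assumes u: "u > 0"
  shows "conv qfun p2fun u = p3fun u"
proof -
  define l where "l = ln u + mertens_const"
  define c0 where "c0 = l\<^sup>2 - 2 * l + 2 - zeta 2"
  define c1 where "c1 = 2 * l - 2"
  define I where "I = l * (c0 * (1/2)) - l * (c1 * (1/4)) + l * (1/4)
     - c0 * (3/4) + c1 * (1 - zeta 2 / 2) - (1 - zeta 2 / 2 - (zeta 3 - 9 / 8))"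
  let ?J = "\<lambda>k w::real. indicator {0..1} w * (w ^ 1 * (- ln w) ^ k)"
  let ?B = "\<lambda>k w::real. indicator {0..1} w * (w ^ 1 * (- ln w) ^ k * (- ln (1 - w)))"
  have "has_bochner_integral lborel (\<lambda>w::real. u * (l * (c0 * ?J 0 w) - l * (c1 * ?J 1 w) + l * ?J 2 w - c0 * ?B 0 w + c1 * ?B 1 w - ?B 2 w)) (u * I)"
    unfolding I_def
    by (intro has_bochner_integral_add has_bochner_integral_diff has_bochner_integral_mult_right int_basic int_basic_ln)
  moreover have "(\<lambda>w::real. u * (l * (c0 * ?J 0 w) - l * (c1 * ?J 1 w) + l * ?J 2 w - c0 * ?B 0 w + c1 * ?B 1 w - ?B 2 w)) =
     (\<lambda>w. indicator {0..1} w * ((l - (- ln (1 - w))) * (u * w * ((l + ln w)\<^sup>2 - 2 * (l + ln w) + 2 - zeta 2))))"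
    by (auto simp: fun_eq_iff c0_def c1_def algebra_simps power2_eq_square indicator_def)
  ultimately have hb: "has_bochner_integral lborel (\<lambda>w. indicator {0..1} w * ((l - (- ln (1 - w))) * (u * w * ((l + ln w)\<^sup>2 - 2 * (l + ln w) + 2 - zeta 2)))) (u * I)"
    by (simp only:)
  have "conv qfun p2fun u = u * (u * I)"
    by (rule conv_qfun_eq[OF u hb l_def]) (use u loc2_measurable[OF loc2_p2fun] in \<open>auto simp: p2fun_def ln_mult l_def algebra_simps\<close>)
  also have "\<dots> = p3fun u"
    unfolding p3fun_def l_def[symmetric] I_def c0_def c1_def
    by (simp add: field_simps power2_eq_square power3_eq_cube)
  finally show ?thesis .
qed

section \<open>Ordered triples of primes\<close>

definition pset :: "real \<Rightarrow> nat set" where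
  "pset U = {p. prime p \<and> ln (real p) \<le> U}"

lemma finite_pset: "finite (pset U)"
  unfolding pset_def by (rule finite_primes_ln_le)

lemma msum_pset: "v \<le> U \<Longrightarrow> msum v = (\<Sum>p\<in>pset U. 1 / real p * indicator {ln (real p)..} v)"
proof -
  assume v: "v \<le> U"
  have "(\<Sum>p\<in>pset U. 1 / real p * indicator {ln (real p)..} v) = (\<Sum>p\<in>{p. prime p \<and> ln (real p) \<le> v}. 1 / real p * indicator {ln (real p)..} v)"
    by (rule sum.mono_neutral_right[OF finite_pset]) (use v in \<open>auto simp: pset_def\<close>)
  also have "\<dots> = msum v" unfolding msum_def by (intro sum.cong) auto
  finally show ?thesis by simp
qed

text \<open>\<^term>\<open>ramp k\<close> is the \<open>k\<close>-fold antiderivative of the unit step.\<close>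

definition ramp :: "nat \<Rightarrow> real \<Rightarrow> real" where
  "ramp k y = (if y \<ge> 0 then y ^ k / fact k else 0)"

lemma integral_ramp:
  "has_bochner_integral lborel (\<lambda>v. indicator {..x} v * ramp k (v - a)) (ramp (Suc k) (x - a))"
proof (cases "a \<le> x")
  case True
  have "((\<lambda>v. (v - a) ^ k / fact k) has_integral (x - a) ^ Suc k / fact (Suc k) - (a - a) ^ Suc k / fact (Suc k)) {a..x}"
  proof (rule fundamental_theorem_of_calculus[OF True])
    fix v :: real
    have "((\<lambda>v. (v - a) ^ Suc k / fact (Suc k)) has_real_derivative (real (Suc k) * (v - a) ^ k * 1) / fact (Suc k)) (at v within {a..x})"
    proof (rule DERIV_cdivide)
      have "((\<lambda>v. v - a) has_real_derivative 1) (at v within {a..x})" by (auto intro!: derivative_eq_intros)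
      from DERIV_power_Suc[OF this, of k]
      show "((\<lambda>v. (v - a) ^ Suc k) has_real_derivative (real (Suc k) * (v - a) ^ k * 1)) (at v within {a..x})"
        by (simp add: algebra_simps)
    qed
    moreover have "(real (Suc k) * (v - a) ^ k * 1) / fact (Suc k) = (v - a) ^ k / fact k"
      by (simp del: of_nat_Suc)
    ultimately show "((\<lambda>v. (v - a) ^ Suc k / fact (Suc k)) has_vector_derivative (v - a) ^ k / fact k) (at v within {a..x})"
      by (simp only: has_real_derivative_iff_has_vector_derivative)
  qed
  then have "has_bochner_integral lborel (\<lambda>v. indicator {a..x} v * ((v - a) ^ k / fact k)) ((x - a) ^ Suc k / fact (Suc k))"
    by (intro has_bochner_integral_of_has_integral) auto
  moreover have "(\<lambda>v. indicator {a..x} v * ((v - a) ^ k / fact k)) = (\<lambda>v. indicator {..x} v * ramp k (v - a))"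
    by (auto simp: fun_eq_iff ramp_def indicator_def)
  ultimately show ?thesis using True by (simp add: ramp_def)
next
  case False
  then have "(\<lambda>v. indicator {..x} v * ramp k (v - a)) = (\<lambda>_. 0)" by (auto simp: fun_eq_iff ramp_def indicator_def)
  then show ?thesis using False by (simp only:) (simp add: ramp_def has_bochner_integral_zero)
qed

text \<open>Below U the function \<open>msum\<close> is a finite sum of steps, and convolution with
  a step at ln p is the antiderivative \<open>G\<close> shifted by ln p.\<close>

lemma conv_msum_step:
  assumes u: "u \<le> U" and gz: "\<And>v. v \<le> 0 \<Longrightarrow> g v = 0"
    and hb: "\<And>x. x \<le> U \<Longrightarrow> has_bochner_integral lborel (\<lambda>v. indicator {..x} v * g v) (G x)"
  shows "conv msum g u = (\<Sum>p\<in>pset U. 1 / real p * G (u - ln (real p)))"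
proof -
  have "msum (u - v) * g v = (\<Sum>p\<in>pset U. 1 / real p * (indicator {..u - ln (real p)} v * g v))" for v
  proof (cases "v \<le> 0")
    case True
    then show ?thesis by (simp add: gz)
  next
    case False
    then have "msum (u - v) = (\<Sum>p\<in>pset U. 1 / real p * indicator {ln (real p)..} (u - v))"
      using u by (intro msum_pset) auto
    moreover have "indicator {ln (real p)..} (u - v) = (indicator {..u - ln (real p)} v :: real)" for p
      by (auto simp: indicator_def)
    ultimately show ?thesis by (simp add: sum_distrib_right)
  qed
  moreover have "has_bochner_integral lborel (\<lambda>v. \<Sum>p\<in>pset U. 1 / real p * (indicator {..u - ln (real p)} v * g v)) (\<Sum>p\<in>pset U. 1 / real p * G (u - ln (real p)))"
  proof (intro has_bochner_integral_sum has_bochner_integral_mult_right hb)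
    fix p assume "p \<in> pset U"
    then show "u - ln (real p) \<le> U" using u ln_prime_pos[of p] by (auto simp: pset_def)
  qed
  ultimately show ?thesis unfolding conv_def using has_bochner_integral_integral_eq by (simp only:)
qed

definition S3 :: "real \<Rightarrow> real" where
  "S3 u = (\<Sum>p\<in>pset u. \<Sum>q\<in>pset u. \<Sum>r\<in>pset u. 1 / (real p * real q * real r) * ramp 0 (u - ln (real p) - ln (real q) - ln (real r)))"

definition M3 :: "real \<Rightarrow> real" where
  "M3 = conv (conv msum msum) msum"

text \<open>\<open>msum\<close> is a combination of shifted copies of \<open>ramp 0\<close>, and
  each further convolution raises the order by one. The cutoff U is free, so that values at several
  points can share one index set.\<close>

lemma M3_eq:
  assumes u: "u \<le> U"
  shows "M3 u = (\<Sum>p\<in>pset U. \<Sum>q\<in>pset U. \<Sum>r\<in>pset U. 1 / (real p * real q * real r) * ramp 2 (u - ln (real p) - ln (real q) - ln (real r)))"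
proof -
  have i0: "has_bochner_integral lborel (\<lambda>v. indicator {..x} v * msum v) (\<Sum>r\<in>pset U. 1 / real r * ramp 1 (x - ln (real r)))" if "x \<le> U" for x
  proof -
    have "indicator {..x} v * msum v = (\<Sum>r\<in>pset U. 1 / real r * (indicator {..x} v * ramp 0 (v - ln (real r))))" for v
    proof (cases "v \<le> x")
      case True
      then have "msum v = (\<Sum>p\<in>pset U. 1 / real p * indicator {ln (real p)..} v)" using that by (intro msum_pset) auto
      moreover have "indicator {ln (real p)..} v = ramp 0 (v - ln (real p))" for p by (auto simp: ramp_def indicator_def)
      ultimately show ?thesis using True by simp
    qed simp
    moreover have "has_bochner_integral lborel (\<lambda>v. \<Sum>r\<in>pset U. 1 / real r * (indicator {..x} v * ramp 0 (v - ln (real r)))) (\<Sum>r\<in>pset U. 1 / real r * ramp (Suc 0) (x - ln (real r)))"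
      by (intro has_bochner_integral_sum has_bochner_integral_mult_right integral_ramp)
    ultimately show ?thesis by (simp only: One_nat_def)
  qed
  have c2: "conv msum msum v = (\<Sum>q\<in>pset U. 1 / real q * (\<Sum>r\<in>pset U. 1 / real r * ramp 1 (v - ln (real q) - ln (real r))))" if "v \<le> U" for v
    by (rule conv_msum_step[OF that msum_nonpos i0])
  have i1: "has_bochner_integral lborel (\<lambda>v. indicator {..x} v * conv msum msum v) (\<Sum>q\<in>pset U. 1 / real q * (\<Sum>r\<in>pset U. 1 / real r * ramp 2 (x - (ln (real q) + ln (real r)))))" if "x \<le> U" for x
  proof -
    have "indicator {..x} v * conv msum msum v = (\<Sum>q\<in>pset U. 1 / real q * (\<Sum>r\<in>pset U. 1 / real r * (indicator {..x} v * ramp 1 (v - (ln (real q) + ln (real r))))))" for v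
    proof (cases "v \<le> x")
      case True
      then show ?thesis using that c2[of v] by (simp add: diff_diff_eq)
    qed simp
    moreover have "has_bochner_integral lborel (\<lambda>v. \<Sum>q\<in>pset U. 1 / real q * (\<Sum>r\<in>pset U. 1 / real r * (indicator {..x} v * ramp 1 (v - (ln (real q) + ln (real r))))))
       (\<Sum>q\<in>pset U. 1 / real q * (\<Sum>r\<in>pset U. 1 / real r * ramp (Suc 1) (x - (ln (real q) + ln (real r)))))"
      by (intro has_bochner_integral_sum has_bochner_integral_mult_right integral_ramp)
    ultimately show ?thesis by (simp only: numeral_2_eq_2 One_nat_def)
  qed
  have "M3 u = conv msum (conv msum msum) u" unfolding M3_def by (rule conv_commute)
  also have "\<dots> = (\<Sum>p\<in>pset U. 1 / real p * (\<Sum>q\<in>pset U. 1 / real q * (\<Sum>r\<in>pset U. 1 / real r * ramp 2 (u - ln (real p) - (ln (real q) + ln (real r))))))"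
    by (rule conv_msum_step[OF u conv_nonpos[OF loc2_msum loc2_msum] i1])
  also have "\<dots> = (\<Sum>p\<in>pset U. \<Sum>q\<in>pset U. \<Sum>r\<in>pset U. 1 / (real p * real q * real r) * ramp 2 (u - ln (real p) - ln (real q) - ln (real r)))"
    by (simp add: sum_distrib_left diff_diff_eq add.assoc mult.assoc)
  finally show ?thesis .
qed

text \<open>Divided by h^2, the second difference of the quadratic ramp is a smoothed step: 0 below
  -2h, 1 above 0, and between 0 and 1 otherwise.\<close>

lemma ramp2_second_diff:
  assumes "h > 0"
  shows "h\<^sup>2 * ramp 0 y \<le> ramp 2 (y + 2 * h) - 2 * ramp 2 (y + h) + ramp 2 y"
    "ramp 2 (y + 2 * h) - 2 * ramp 2 (y + h) + ramp 2 y \<le> h\<^sup>2 * ramp 0 (y + 2 * h)"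
proof -
  have f2: "(fact 2 :: real) = 2" by (simp add: fact_2)
  consider "y \<ge> 0" | "- h \<le> y" "y < 0" | "- 2 * h \<le> y" "y < - h" | "y < - 2 * h" by linarith
  then have "h\<^sup>2 * ramp 0 y \<le> ramp 2 (y + 2 * h) - 2 * ramp 2 (y + h) + ramp 2 y \<and>
    ramp 2 (y + 2 * h) - 2 * ramp 2 (y + h) + ramp 2 y \<le> h\<^sup>2 * ramp 0 (y + 2 * h)"
  proof cases
    case 1
    have eq: "(y + 2 * h)\<^sup>2 / 2 - 2 * ((y + h)\<^sup>2 / 2) + y\<^sup>2 / 2 = h\<^sup>2"
      by (simp add: power2_eq_square algebra_simps add_divide_distrib)
    have "ramp 2 (y + 2 * h) = (y + 2 * h)\<^sup>2 / 2" "ramp 2 (y + h) = (y + h)\<^sup>2 / 2" "ramp 2 y = y\<^sup>2 / 2" "ramp 0 y = 1" "ramp 0 (y + 2 * h) = 1"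
      using 1 assms by (simp_all add: ramp_def f2)
    then show ?thesis using eq by simp
  next
    case 2
    have eq: "(y + 2 * h)\<^sup>2 / 2 - 2 * ((y + h)\<^sup>2 / 2) + 0 = h\<^sup>2 - y\<^sup>2 / 2"
      by (simp add: power2_eq_square algebra_simps add_divide_distrib)
    have r: "ramp 2 (y + 2 * h) = (y + 2 * h)\<^sup>2 / 2" "ramp 2 (y + h) = (y + h)\<^sup>2 / 2" "ramp 2 y = 0" "ramp 0 y = 0" "ramp 0 (y + 2 * h) = 1"
      using 2 assms by (simp_all add: ramp_def f2)
    have "(- y)\<^sup>2 \<le> h\<^sup>2" using 2 assms by (intro power_mono) auto
    then have yh: "y\<^sup>2 \<le> h\<^sup>2" by simp
    have "0 \<le> b - a / 2" "b - a / 2 \<le> b" if "a \<le> b" "0 \<le> a" for a b :: real using that by linarith+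
    from this[OF yh] show ?thesis unfolding r eq by simp
  next
    case 3
    have le: "(y + 2 * h)\<^sup>2 \<le> h\<^sup>2" using 3 assms by (intro power_mono) auto
    have r: "ramp 2 (y + 2 * h) = (y + 2 * h)\<^sup>2 / 2" "ramp 2 (y + h) = 0" "ramp 2 y = 0" "ramp 0 y = 0" "ramp 0 (y + 2 * h) = 1"
      using 3 assms by (simp_all add: ramp_def f2)
    have "0 \<le> a / 2" "a / 2 \<le> b" if "a \<le> b" "0 \<le> a" for a b :: real using that by linarith+
    from this[OF le] show ?thesis unfolding r by simp
  next
    case 4
    then show ?thesis using assms by (simp add: ramp_def)
  qed
  then show "h\<^sup>2 * ramp 0 y \<le> ramp 2 (y + 2 * h) - 2 * ramp 2 (y + h) + ramp 2 y"
    "ramp 2 (y + 2 * h) - 2 * ramp 2 (y + h) + ramp 2 y \<le> h\<^sup>2 * ramp 0 (y + 2 * h)" by auto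
qed

text \<open>Logarithms of primes are positive, so a triple with one member beyond the cutoff u
  already violates the condition on the product.\<close>

lemma S3_eq:
  assumes "u \<le> U"
  shows "S3 u = (\<Sum>p\<in>pset U. \<Sum>q\<in>pset U. \<Sum>r\<in>pset U. 1 / (real p * real q * real r) * ramp 0 (u - ln (real p) - ln (real q) - ln (real r)))"
proof -
  have sub: "pset u \<subseteq> pset U" using assms by (auto simp: pset_def)
  have z: "ramp 0 (u - ln (real p) - ln (real q) - ln (real r)) = 0"
    if "p \<in> pset U" "q \<in> pset U" "r \<in> pset U" "p \<notin> pset u \<or> q \<notin> pset u \<or> r \<notin> pset u" for p q r
    using that ln_prime_pos[of p] ln_prime_pos[of q] ln_prime_pos[of r] by (auto simp: ramp_def pset_def)
  show ?thesis unfolding S3_def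
  proof (rule sum.mono_neutral_cong_left[OF finite_pset sub])
    show "\<forall>p\<in>pset U - pset u. (\<Sum>q\<in>pset U. \<Sum>r\<in>pset U. 1 / (real p * real q * real r) * ramp 0 (u - ln (real p) - ln (real q) - ln (real r))) = 0"
      using z by (intro ballI sum.neutral) auto
    fix p assume p: "p \<in> pset u"
    then have pU: "p \<in> pset U" using sub by auto
    show "(\<Sum>q\<in>pset u. \<Sum>r\<in>pset u. 1 / (real p * real q * real r) * ramp 0 (u - ln (real p) - ln (real q) - ln (real r))) =
      (\<Sum>q\<in>pset U. \<Sum>r\<in>pset U. 1 / (real p * real q * real r) * ramp 0 (u - ln (real p) - ln (real q) - ln (real r)))"
    proof (rule sum.mono_neutral_cong_left[OF finite_pset sub])
      show "\<forall>q\<in>pset U - pset u. (\<Sum>r\<in>pset U. 1 / (real p * real q * real r) * ramp 0 (u - ln (real p) - ln (real q) - ln (real r))) = 0"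
        using z[OF pU] by (intro ballI sum.neutral) auto
      fix q assume q: "q \<in> pset u"
      then have qU: "q \<in> pset U" using sub by auto
      show "(\<Sum>r\<in>pset u. 1 / (real p * real q * real r) * ramp 0 (u - ln (real p) - ln (real q) - ln (real r))) =
        (\<Sum>r\<in>pset U. 1 / (real p * real q * real r) * ramp 0 (u - ln (real p) - ln (real q) - ln (real r)))"
        by (rule sum.mono_neutral_left[OF finite_pset sub]) (use z[OF pU qU] in auto)
    qed
  qed
qed

text \<open>\<open>ramp2_second_diff\<close> summed with nonnegative weights over all triples. This
  recovers \<open>S3\<close> from its double antiderivative by a one-sided squeeze, no
  differentiation being available.\<close>

lemma S3_M3:
  assumes h: "h > 0"
  shows "h\<^sup>2 * S3 u \<le> M3 (u + 2 * h) - 2 * M3 (u + h) + M3 u"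
    "M3 (u + 2 * h) - 2 * M3 (u + h) + M3 u \<le> h\<^sup>2 * S3 (u + 2 * h)"
proof -
  define U where "U = u + 2 * h"
  let ?W = "\<lambda>f. \<Sum>p\<in>pset U. \<Sum>q\<in>pset U. \<Sum>r\<in>pset U. 1 / (real p * real q * real r) * f (u - ln (real p) - ln (real q) - ln (real r)) :: real"
  have W: "?W f \<le> ?W g" if "\<And>y. f y \<le> g y" for f g
    by (intro sum_mono mult_left_mono that) auto
  have shift: "u + t - a - b - c = (u - a - b - c) + t" for t a b c :: real by simp
  have Wm: "M3 (u + t) = ?W (\<lambda>y. ramp 2 (y + t))" if "t \<le> 2 * h" for t
    using M3_eq[of "u + t" U] that by (simp add: U_def shift)
  have lin: "M3 (u + 2 * h) - 2 * M3 (u + h) + M3 u = ?W (\<lambda>y. ramp 2 (y + 2 * h) - 2 * ramp 2 (y + h) + ramp 2 y)"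
    using Wm[of "2 * h"] Wm[of h] Wm[of 0] h
    by (simp add: sum_distrib_left sum.distrib sum_subtractf right_diff_distrib distrib_left mult.left_commute[of 2])
  have "h\<^sup>2 * S3 u = ?W (\<lambda>y. h\<^sup>2 * ramp 0 y)"
    using S3_eq[of u U] h by (simp add: U_def sum_distrib_left mult.left_commute[of "h\<^sup>2"])
  also have "\<dots> \<le> ?W (\<lambda>y. ramp 2 (y + 2 * h) - 2 * ramp 2 (y + h) + ramp 2 y)"
    by (intro W ramp2_second_diff h)
  finally show "h\<^sup>2 * S3 u \<le> M3 (u + 2 * h) - 2 * M3 (u + h) + M3 u" unfolding lin .
  have "?W (\<lambda>y. ramp 2 (y + 2 * h) - 2 * ramp 2 (y + h) + ramp 2 y) \<le> ?W (\<lambda>y. h\<^sup>2 * ramp 0 (y + 2 * h))"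
    by (intro W ramp2_second_diff h)
  also have "\<dots> = h\<^sup>2 * S3 (u + 2 * h)"
    using S3_eq[of "u + 2 * h" U] by (simp add: U_def shift sum_distrib_left mult.left_commute[of "h\<^sup>2"])
  finally show "M3 (u + 2 * h) - 2 * M3 (u + h) + M3 u \<le> h\<^sup>2 * S3 (u + 2 * h)" unfolding lin .
qed

section \<open>Rapidly decreasing functions and their moments\<close>

text \<open>Decay faster than every power at infinity; near 0 only local square integrability is
  demanded, since \<open>err\<close> has a logarithmic singularity there.\<close>

definition rapid :: "(real \<Rightarrow> real) \<Rightarrow> bool" where
  "rapid g \<longleftrightarrow> loc2 g \<and> (\<forall>K. \<exists>C U. 0 \<le> C \<and> 1 \<le> U \<and> (\<forall>v\<ge>U. \<bar>g v\<bar> \<le> C / v ^ K))"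

definition mom :: "(real \<Rightarrow> real) \<Rightarrow> nat \<Rightarrow> real" where
  "mom g j = (\<integral>v. v ^ j * g v \<partial>lborel)"

lemma rapid_loc2: "rapid g \<Longrightarrow> loc2 g" by (simp add: rapid_def)

lemma rapidE:
  assumes "rapid g"
  obtains C U where "0 \<le> C" "1 \<le> U" "\<And>v. v \<ge> U \<Longrightarrow> \<bar>g v\<bar> \<le> C / v ^ K"
  using assms unfolding rapid_def by metis

lemma rapid_err: "rapid err"
  unfolding rapid_def
proof (intro conjI allI loc2_err)
  fix K
  obtain C where "C > 0" "\<And>u. u \<ge> 4 \<Longrightarrow> \<bar>err u\<bar> \<le> C / u ^ K" using err_bound[of K] by blast
  then show "\<exists>C U. 0 \<le> C \<and> 1 \<le> U \<and> (\<forall>v\<ge>U. \<bar>err v\<bar> \<le> C / v ^ K)"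
    by (intro exI[of _ C] exI[of _ 4]) auto
qed

lemma rapid_abs: "rapid g \<Longrightarrow> rapid (\<lambda>v. \<bar>g v\<bar>)"
  by (simp add: rapid_def loc2_abs)

lemma loc2_local_integrable:
  assumes f: "loc2 f"
  shows "integrable lborel (\<lambda>v. indicator {..U} v * f v)"
proof (rule Bochner_Integration.integrable_bound)
  note [measurable] = loc2_measurable[OF f]
  show "integrable lborel (\<lambda>v. indicator {0..U} v + indicator {..U} v * (f v)\<^sup>2)"
    by (intro Bochner_Integration.integrable_add loc2_square f) (simp add: emeasure_lborel_Icc_eq)
  show "(\<lambda>v. indicator {..U} v * f v) \<in> borel_measurable lborel" by measurable
  show "AE v in lborel. norm (indicator {..U} v * f v) \<le> norm (indicator {0..U} v + indicator {..U} v * (f v)\<^sup>2)"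
  proof (rule AE_I2)
    fix v :: real
    have "\<bar>x\<bar> \<le> 1 + x\<^sup>2" for x :: real
    proof -
      have "0 \<le> (\<bar>x\<bar> - 1 / 2)\<^sup>2" by simp
      then show ?thesis by (simp add: power2_diff power_divide)
    qed
    from this[of "f v"] show "norm (indicator {..U} v * f v) \<le> norm (indicator {0..U} v + indicator {..U} v * (f v)\<^sup>2)"
      using loc2_nonpos[OF f, of v] by (auto simp: indicator_def)
  qed
qed

text \<open>Below U local integrability suffices; above U the bound C/v^(j+2) leaves the integrable
  v^(-2).\<close>

lemma rapid_moment_integrable:
  assumes g: "rapid g"
  shows "integrable lborel (\<lambda>v. v ^ j * g v)"
proof -
  note l2 = rapid_loc2[OF g]
  note [measurable] = loc2_measurable[OF l2]
  obtain C U where CU: "0 \<le> C" "1 \<le> U" "\<And>v. v \<ge> U \<Longrightarrow> \<bar>g v\<bar> \<le> C / v ^ (j + 2)"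
    using rapidE[OF g] by blast
  have "((\<lambda>x. x powr (- 2)) has_integral - (U powr (- 2 + 1)) / (- 2 + 1)) {U..}"
    using CU(2) by (intro has_integral_powr_to_inf) auto
  then have i2: "integrable lborel (\<lambda>v. indicator {U..} v * v powr (- 2))"
    using has_bochner_integral_of_has_integral[of "\<lambda>x. x powr (- 2)" "{U..}"] by (auto simp: has_bochner_integral_iff)
  show ?thesis
  proof (rule Bochner_Integration.integrable_bound)
    show "integrable lborel (\<lambda>v. U ^ j * \<bar>indicator {..U} v * g v\<bar> + C * (indicator {U..} v * v powr (- 2)))"
      by (intro Bochner_Integration.integrable_add integrable_mult_right integrable_abs loc2_local_integrable l2 i2)
    show "AE v in lborel. norm (v ^ j * g v) \<le> norm (U ^ j * \<bar>indicator {..U} v * g v\<bar> + C * (indicator {U..} v * v powr (- 2)))"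
    proof (rule AE_I2)
      fix v :: real
      consider "v \<le> 0" | "0 < v" "v < U" | "v \<ge> U" by linarith
      then show "norm (v ^ j * g v) \<le> norm (U ^ j * \<bar>indicator {..U} v * g v\<bar> + C * (indicator {U..} v * v powr (- 2)))"
      proof cases
        case 1
        then show ?thesis by (simp add: loc2_nonpos[OF l2])
      next
        case 2
        have "\<bar>v ^ j * g v\<bar> \<le> U ^ j * \<bar>g v\<bar>" unfolding abs_mult using 2 by (intro mult_right_mono) (auto intro: power_mono)
        then show ?thesis using 2 CU by simp
      next
        case 3
        have v: "v > 0" using 3 CU(2) by linarith
        have "\<bar>v ^ j * g v\<bar> \<le> v ^ j * (C / v ^ (j + 2))"
          unfolding abs_mult using CU(3)[OF 3] v by (intro mult_mono) auto
        also have "\<dots> = C * v powr (- 2)"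
        proof -
          have "v powr (- 2) = 1 / v ^ 2" using v by (simp add: powr_minus_divide powr_numeral)
          then show ?thesis using v by (simp add: power_add power2_eq_square)
        qed
        finally have "\<bar>v ^ j * g v\<bar> \<le> C * v powr (- 2)" .
        moreover have "0 \<le> U ^ j * \<bar>indicator {..U} v * g v\<bar>" using CU by simp
        moreover have "0 \<le> C * v powr (- 2)" using CU by simp
        ultimately have "\<bar>v ^ j * g v\<bar> \<le> \<bar>U ^ j * \<bar>indicator {..U} v * g v\<bar> + C * v powr (- 2)\<bar>" by linarith
        then show ?thesis using 3 by (simp only: real_norm_def) simp
      qed
    qed
  qed measurable
qed

lemma rapid_integrable: "rapid g \<Longrightarrow> integrable lborel g"
  using rapid_moment_integrable[of g 0] by simp

text \<open>Split at u/2: in each half one factor has an argument of at least u/2, and the other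
  factor is integrable.\<close>

lemma rapid_conv:
  assumes g1: "rapid g1" and g2: "rapid g2"
  shows "rapid (conv g1 g2)"
  unfolding rapid_def
proof (intro conjI allI)
  note l1 = rapid_loc2[OF g1] and l2 = rapid_loc2[OF g2]
  show "loc2 (conv g1 g2)" by (intro loc2_conv l1 l2)
  fix K
  obtain C1 U1 where 1: "0 \<le> C1" "1 \<le> U1" "\<And>v. v \<ge> U1 \<Longrightarrow> \<bar>g1 v\<bar> \<le> C1 / v ^ K" using rapidE[OF g1] by blast
  obtain C2 U2 where 2: "0 \<le> C2" "1 \<le> U2" "\<And>v. v \<ge> U2 \<Longrightarrow> \<bar>g2 v\<bar> \<le> C2 / v ^ K" using rapidE[OF g2] by blast
  define I1 where "I1 = (\<integral>v. \<bar>g1 v\<bar> \<partial>lborel)"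
  define I2 where "I2 = (\<integral>v. \<bar>g2 v\<bar> \<partial>lborel)"
  have I: "I1 \<ge> 0" "I2 \<ge> 0" by (auto simp: I1_def I2_def)
  have "\<bar>conv g1 g2 u\<bar> \<le> (2 ^ K * (C1 * I2 + C2 * I1)) / u ^ K" if u: "u \<ge> 2 * max U1 U2" for u
  proof -
    have u0: "u > 0" "u / 2 \<ge> U1" "u / 2 \<ge> U2" using u 1(2) 2(2) by auto
    let ?D = "\<lambda>v. C1 / (u / 2) ^ K * \<bar>g2 v\<bar> + C2 / (u / 2) ^ K * \<bar>g1 (u + (- 1) * v)\<bar>"
    have ir: "integrable lborel (\<lambda>v. \<bar>g1 (u + (- 1) * v)\<bar>)"
      by (rule lborel_integrable_real_affine[OF integrable_abs[OF rapid_integrable[OF g1]]]) simp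
    have i2: "integrable lborel (\<lambda>v. \<bar>g2 v\<bar>)" by (rule integrable_abs[OF rapid_integrable[OF g2]])
    have "(\<integral>v. \<bar>g1 (u + (- 1) * v)\<bar> \<partial>lborel) = I1"
      unfolding I1_def using lborel_integral_real_affine[of "- 1" "\<lambda>v. \<bar>g1 v\<bar>" u] by simp
    then have vD: "(\<integral>v. ?D v \<partial>lborel) = C1 / (u / 2) ^ K * I2 + C2 / (u / 2) ^ K * I1"
      unfolding I2_def using ir i2 by (subst Bochner_Integration.integral_add) auto
    have iD: "integrable lborel ?D"
      by (intro Bochner_Integration.integrable_add integrable_mult_right ir i2)
    have bnd: "\<bar>g1 (u - v) * g2 v\<bar> \<le> ?D v" for v
    proof (cases "v \<le> u / 2")
      case True
      then have "u - v \<ge> u / 2" by (simp add: field_simps)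
      then have "\<bar>g1 (u - v)\<bar> \<le> C1 / (u - v) ^ K" using u0 by (intro 1(3)) auto
      also have "\<dots> \<le> C1 / (u / 2) ^ K" using True u0 1 \<open>u - v \<ge> u / 2\<close> by (intro divide_left_mono power_mono mult_pos_pos zero_less_power) auto
      finally have "\<bar>g1 (u - v)\<bar> * \<bar>g2 v\<bar> \<le> C1 / (u / 2) ^ K * \<bar>g2 v\<bar>" by (intro mult_right_mono) auto
      moreover have "0 \<le> C2 / (u / 2) ^ K * \<bar>g1 (u + (- 1) * v)\<bar>" using 2(1) u0 by simp
      ultimately show ?thesis unfolding abs_mult by linarith
    next
      case False
      then have "\<bar>g2 v\<bar> \<le> C2 / v ^ K" using u0 by (intro 2(3)) auto
      also have "\<dots> \<le> C2 / (u / 2) ^ K" using False u0 2 by (intro divide_left_mono power_mono mult_pos_pos zero_less_power) auto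
      finally have "\<bar>g1 (u - v)\<bar> * \<bar>g2 v\<bar> \<le> \<bar>g1 (u - v)\<bar> * (C2 / (u / 2) ^ K)" by (intro mult_left_mono) auto
      moreover have "0 \<le> C1 / (u / 2) ^ K * \<bar>g2 v\<bar>" using 1(1) u0 by simp
      ultimately show ?thesis unfolding abs_mult by (simp add: mult.commute)
    qed
    have "\<bar>conv g1 g2 u\<bar> \<le> (\<integral>v. \<bar>g1 (u - v) * g2 v\<bar> \<partial>lborel)"
      unfolding conv_def using integral_norm_bound[of lborel "\<lambda>v. g1 (u - v) * g2 v"] by simp
    also have "\<dots> \<le> (\<integral>v. ?D v \<partial>lborel)"
      by (rule integral_mono[OF integrable_abs[OF conv_integrable[OF l1 l2]] iD bnd])
    also have "\<dots> = (2 ^ K * (C1 * I2 + C2 * I1)) / u ^ K"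
      unfolding vD using u0 by (simp add: power_divide field_simps)
    finally show ?thesis .
  qed
  then show "\<exists>C U. 0 \<le> C \<and> 1 \<le> U \<and> (\<forall>v\<ge>U. \<bar>conv g1 g2 v\<bar> \<le> C / v ^ K)"
    using 1 2 I by (intro exI[of _ "2 ^ K * (C1 * I2 + C2 * I1)"] exI[of _ "2 * max U1 U2"]) auto
qed

text \<open>Write v = (v - y) + y, expand the power binomially and integrate over v first.\<close>

lemma mom_conv:
  assumes g1: "rapid g1" and g2: "rapid g2"
  shows "mom (conv g1 g2) j = (\<Sum>i\<le>j. real (j choose i) * mom g1 i * mom g2 (j - i))"
proof -
  note l1 = rapid_loc2[OF g1] and l2 = rapid_loc2[OF g2]
  note [measurable] = loc2_measurable[OF l1] loc2_measurable[OF l2]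
  have expand: "(x + y) ^ j * z = (\<Sum>i\<le>j. (real (j choose i) * y ^ (j - i)) * (x ^ i * z))" for x y z :: real
    unfolding binomial_ring sum_distrib_right by (intro sum.cong refl) (simp add: mult_ac)
  have shift: "(\<integral>v. v ^ j * h (v - y) \<partial>lborel) = (\<Sum>i\<le>j. real (j choose i) * y ^ (j - i) * mom h i)"
    if h: "rapid h" for h y
  proof -
    have "(\<integral>v. v ^ j * h (v - y) \<partial>lborel) = (\<integral>x. (x + y) ^ j * h x \<partial>lborel)"
      using lborel_integral_real_affine[of 1 "\<lambda>v. v ^ j * h (v - y)" y] by (simp add: add.commute)
    also have "\<dots> = (\<integral>x. (\<Sum>i\<le>j. (real (j choose i) * y ^ (j - i)) * (x ^ i * h x)) \<partial>lborel)"
      by (simp only: expand)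
    also have "\<dots> = (\<Sum>i\<le>j. (real (j choose i) * y ^ (j - i)) * mom h i)"
      unfolding mom_def by (subst Bochner_Integration.integral_sum) (auto intro!: rapid_moment_integrable h integrable_mult_right)
    finally show ?thesis by simp
  qed
  have prod: "integrable (lborel \<Otimes>\<^sub>M lborel) (\<lambda>(y, v). v ^ j * g1 (v - y) * g2 y)"
  proof (rule lborel_pair.Fubini_integrable)
    have "(\<integral>v. norm (case (y, v) of (y, v) \<Rightarrow> v ^ j * g1 (v - y) * g2 y) \<partial>lborel)
       = (\<Sum>i\<le>j. (real (j choose i) * mom (\<lambda>v. \<bar>g1 v\<bar>) i) * (y ^ (j - i) * \<bar>g2 y\<bar>))" for y
    proof (cases "y \<le> 0")
      case True
      then show ?thesis by (simp add: loc2_nonpos[OF l2])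
    next
      case False
      have "norm (v ^ j * g1 (v - y) * g2 y) = (v ^ j * \<bar>g1 (v - y)\<bar>) * \<bar>g2 y\<bar>" for v
      proof (cases "v \<le> 0")
        case True
        then show ?thesis using False by (simp add: loc2_nonpos[OF l1])
      qed (simp add: abs_mult)
      then have "(\<integral>v. norm (case (y, v) of (y, v) \<Rightarrow> v ^ j * g1 (v - y) * g2 y) \<partial>lborel) = (\<integral>v. v ^ j * \<bar>g1 (v - y)\<bar> \<partial>lborel) * \<bar>g2 y\<bar>"
        by simp
      also have "\<dots> = (\<Sum>i\<le>j. real (j choose i) * y ^ (j - i) * mom (\<lambda>v. \<bar>g1 v\<bar>) i) * \<bar>g2 y\<bar>"
        using shift[OF rapid_abs[OF g1], of y] by simp
      also have "\<dots> = (\<Sum>i\<le>j. (real (j choose i) * mom (\<lambda>v. \<bar>g1 v\<bar>) i) * (y ^ (j - i) * \<bar>g2 y\<bar>))"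
        unfolding sum_distrib_right by (intro sum.cong refl) (simp add: mult_ac)
      finally show ?thesis .
    qed
    then show "integrable lborel (\<lambda>y. \<integral>v. norm (case (y, v) of (y, v) \<Rightarrow> v ^ j * g1 (v - y) * g2 y) \<partial>lborel)"
      using rapid_moment_integrable[OF rapid_abs[OF g2]] by (simp only:) (intro Bochner_Integration.integrable_sum integrable_mult_right)
    show "AE y in lborel. integrable lborel (\<lambda>v. case (y, v) of (y, v) \<Rightarrow> v ^ j * g1 (v - y) * g2 y)"
    proof (rule AE_I2)
      fix y :: real
      have "integrable lborel (\<lambda>x. \<Sum>i\<le>j. (real (j choose i) * y ^ (j - i)) * (x ^ i * g1 x))"
        by (intro Bochner_Integration.integrable_sum integrable_mult_right rapid_moment_integrable g1)
      then have "integrable lborel (\<lambda>x. (x + y) ^ j * g1 x)"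
        by (simp only: expand)
      from lborel_integrable_real_affine[OF this, of 1 "- y"]
      show "integrable lborel (\<lambda>v. case (y, v) of (y, v) \<Rightarrow> v ^ j * g1 (v - y) * g2 y)" by simp
    qed
  qed measurable
  have "mom (conv g1 g2) j = (\<integral>v. (\<integral>y. v ^ j * g1 (v - y) * g2 y \<partial>lborel) \<partial>lborel)"
    unfolding mom_def conv_def by (simp add: mult.assoc)
  also have "\<dots> = (\<integral>y. (\<integral>v. v ^ j * g1 (v - y) * g2 y \<partial>lborel) \<partial>lborel)"
    by (rule lborel_pair.Fubini_integral[OF prod])
  also have "\<dots> = (\<integral>y. (\<Sum>i\<le>j. (real (j choose i) * mom g1 i) * (y ^ (j - i) * g2 y)) \<partial>lborel)"
  proof (rule Bochner_Integration.integral_cong[OF refl])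
    fix y :: real
    have "(\<integral>v. v ^ j * g1 (v - y) * g2 y \<partial>lborel) = (\<integral>v. v ^ j * g1 (v - y) \<partial>lborel) * g2 y" by simp
    also have "\<dots> = (\<Sum>i\<le>j. (real (j choose i) * mom g1 i) * (y ^ (j - i) * g2 y))"
      unfolding shift[OF g1] sum_distrib_right by (intro sum.cong refl) (simp add: mult_ac)
    finally show "(\<integral>v. v ^ j * g1 (v - y) * g2 y \<partial>lborel) = (\<Sum>i\<le>j. (real (j choose i) * mom g1 i) * (y ^ (j - i) * g2 y))" .
  qed
  also have "\<dots> = (\<Sum>i\<le>j. (real (j choose i) * mom g1 i) * mom g2 (j - i))"
    unfolding mom_def by (subst Bochner_Integration.integral_sum) (auto intro!: rapid_moment_integrable g2 integrable_mult_right)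
  finally show ?thesis .
qed

text \<open>For v \<le> u/2 Taylor's formula for f(u - v) about u; for v > u/2 the decay of g
  outweighs the polynomial size of f and of the Taylor terms. Each derivative gains 1/x against
  growth x^2, so K + 2 terms leave a remainder u^2/u^(K+2) = u^(-K).\<close>

lemma conv_expansion:
  assumes f: "loc2 f" and g: "rapid g"
    and f0: "\<And>x. x > 0 \<Longrightarrow> f x = fd 0 x"
    and der: "\<And>j x. x > 0 \<Longrightarrow> (fd j has_real_derivative fd (Suc j) x) (at x)"
    and bnd: "\<And>j. \<exists>C\<ge>0. \<forall>x\<ge>1. \<bar>fd j x\<bar> \<le> C * x\<^sup>2 / x ^ j"
  shows "\<exists>C U. 0 \<le> C \<and> 1 \<le> U \<and> (\<forall>u\<ge>U. \<bar>conv f g u - (\<Sum>j<K+2. (- 1) ^ j / fact j * fd j u * mom g j)\<bar> \<le> C / u ^ K)"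
proof -
  note l2 = rapid_loc2[OF g]
  note [measurable] = loc2_measurable[OF f] loc2_measurable[OF l2]
  define n where "n = K + 2"
  \<comment> \<open>The integral of |f| over [0, u] is of order u^3, so beyond u/2 the function g
    must supply three powers in addition to K.\<close>
  define L where "L = K + 3"
  obtain B where B: "\<And>j. B j \<ge> 0" "\<And>j x. x \<ge> 1 \<Longrightarrow> \<bar>fd j x\<bar> \<le> B j * x\<^sup>2 / x ^ j"
    using bnd by metis
  obtain G U0 where GU: "0 \<le> G" "1 \<le> U0" "\<And>v. v \<ge> U0 \<Longrightarrow> \<bar>g v\<bar> \<le> G / v ^ L"
    using rapidE[OF g] by blast
  define A where "A = (\<integral>v. \<bar>indicator {..1} v * f v\<bar> \<partial>lborel)"
  define Mm where "Mm = (\<lambda>j. \<integral>v. \<bar>v ^ j * g v\<bar> \<partial>lborel)"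
  have A0: "A \<ge> 0" and M0: "Mm j \<ge> 0" for j by (auto simp: A_def Mm_def)
  have im: "integrable lborel (\<lambda>v. \<bar>v ^ j * g v\<bar>)" for j by (intro integrable_abs rapid_moment_integrable g)
  define C where "C = B n * 2 ^ n * Mm n + G * 2 ^ L * (A + B 0) + (\<Sum>j<n. B j * 2 ^ L * Mm (j + L))"
  have "\<bar>conv f g u - (\<Sum>j<n. (- 1) ^ j / fact j * fd j u * mom g j)\<bar> \<le> C / u ^ K" if u: "u \<ge> 2 * U0" for u
  proof -
    have u1: "u \<ge> 2" "u > 0" "u / 2 \<ge> U0" "u / 2 \<ge> 1" using u GU(2) by auto
    define c where "c = (\<lambda>j. (- 1) ^ j / fact j * fd j u)"
    let ?d = "\<lambda>v. f (u - v) * g v - (\<Sum>j<n. c j * (v ^ j * g v))"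
    have id: "integrable lborel ?d"
      by (intro Bochner_Integration.integrable_diff conv_integrable f l2 Bochner_Integration.integrable_sum integrable_mult_right rapid_moment_integrable g)
    have vd: "conv f g u - (\<Sum>j<n. (- 1) ^ j / fact j * fd j u * mom g j) = (\<integral>v. ?d v \<partial>lborel)"
    proof -
      have "(\<integral>v. (\<Sum>j<n. c j * (v ^ j * g v)) \<partial>lborel) = (\<Sum>j<n. c j * mom g j)"
        unfolding mom_def by (subst Bochner_Integration.integral_sum) (auto intro!: rapid_moment_integrable g integrable_mult_right)
      moreover have "(\<integral>v. ?d v \<partial>lborel) = conv f g u - (\<integral>v. (\<Sum>j<n. c j * (v ^ j * g v)) \<partial>lborel)"
        unfolding conv_def
        by (intro Bochner_Integration.integral_diff conv_integrable f l2 Bochner_Integration.integrable_sum integrable_mult_right rapid_moment_integrable g)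
      ultimately show ?thesis by (simp add: c_def)
    qed
    \<comment> \<open>\<open>a1\<close> bounds the Taylor remainder for v \<le> u/2,
      \<open>a2\<close> the values of g beyond u/2, and \<open>a3 j\<close> the j-th Taylor term
      beyond u/2.\<close>
    define a1 where "a1 = B n * 2 ^ n * u\<^sup>2 / u ^ n"
    define a2 where "a2 = G * 2 ^ L / u ^ L"
    define a3 where "a3 = (\<lambda>j. B j * 2 ^ L * u\<^sup>2 / u ^ L)"
    have a0: "a1 \<ge> 0" "a2 \<ge> 0" "a3 j \<ge> 0" for j using B(1) GU(1) u1 by (auto simp: a1_def a2_def a3_def)
    let ?F = "\<lambda>x. \<bar>indicator {..1} x * f x\<bar> + B 0 * u\<^sup>2 * indicator {0..u} x"
    let ?D = "\<lambda>v. a1 * \<bar>v ^ n * g v\<bar> + a2 * ?F (u + (- 1) * v) + (\<Sum>j<n. a3 j * \<bar>v ^ (j + L) * g v\<bar>)"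
    have iF: "integrable lborel ?F"
      by (intro Bochner_Integration.integrable_add integrable_abs loc2_local_integrable f integrable_mult_right) (simp add: emeasure_lborel_Icc_eq)
    have iF': "integrable lborel (\<lambda>v. ?F (u + (- 1) * v))" by (rule lborel_integrable_real_affine[OF iF]) simp
    have vF: "(\<integral>v. ?F (u + (- 1) * v) \<partial>lborel) = A + B 0 * u\<^sup>2 * u"
    proof -
      have "(\<integral>v. ?F (u + (- 1) * v) \<partial>lborel) = (\<integral>v. ?F v \<partial>lborel)"
        using lborel_integral_real_affine[of "- 1" ?F u] by simp
      also have "\<dots> = A + B 0 * u\<^sup>2 * u"
        unfolding A_def
        by (subst Bochner_Integration.integral_add[OF integrable_abs[OF loc2_local_integrable[OF f]]])
           (use u1 in \<open>auto intro!: integrable_mult_right simp: emeasure_lborel_Icc_eq\<close>)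
      finally show ?thesis .
    qed
    have iD: "integrable lborel ?D"
      by (intro Bochner_Integration.integrable_add integrable_mult_right im iF' Bochner_Integration.integrable_sum)
    have vD: "(\<integral>v. ?D v \<partial>lborel) = a1 * Mm n + a2 * (A + B 0 * u\<^sup>2 * u) + (\<Sum>j<n. a3 j * Mm (j + L))"
    proof -
      have i1: "integrable lborel (\<lambda>v. a1 * \<bar>v ^ n * g v\<bar>)" by (intro integrable_mult_right im)
      have i2: "integrable lborel (\<lambda>v. a2 * ?F (u + (- 1) * v))" by (intro integrable_mult_right iF')
      have i3: "integrable lborel (\<lambda>v. \<Sum>j<n. a3 j * \<bar>v ^ (j + L) * g v\<bar>)"
        by (intro Bochner_Integration.integrable_sum integrable_mult_right im)
      have "(\<integral>v. ?D v \<partial>lborel) = (\<integral>v. a1 * \<bar>v ^ n * g v\<bar> \<partial>lborel) + (\<integral>v. a2 * ?F (u + (- 1) * v) \<partial>lborel) + (\<integral>v. (\<Sum>j<n. a3 j * \<bar>v ^ (j + L) * g v\<bar>) \<partial>lborel)"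
        using Bochner_Integration.integral_add[OF Bochner_Integration.integrable_add[OF i1 i2] i3] Bochner_Integration.integral_add[OF i1 i2] by (simp only:)
      also have "(\<integral>v. (\<Sum>j<n. a3 j * \<bar>v ^ (j + L) * g v\<bar>) \<partial>lborel) = (\<Sum>j<n. a3 j * Mm (j + L))"
        unfolding Mm_def by (subst Bochner_Integration.integral_sum) (auto intro!: integrable_mult_right im)
      also have "(\<integral>v. a2 * ?F (u + (- 1) * v) \<partial>lborel) = a2 * (A + B 0 * u\<^sup>2 * u)"
        using vF by (simp only: integral_mult_right_zero)
      also have "(\<integral>v. a1 * \<bar>v ^ n * g v\<bar> \<partial>lborel) = a1 * Mm n" unfolding Mm_def by (rule integral_mult_right_zero)
      finally show ?thesis .
    qed
    have F0: "0 \<le> ?F x" for x using B(1)[of 0] by simp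
    have Fb: "\<bar>f x\<bar> \<le> ?F x" if "x \<le> u" for x
    proof (cases "x \<le> 1")
      case True
      then show ?thesis using B(1)[of 0] by simp
    next
      case False
      then have "\<bar>f x\<bar> \<le> B 0 * x\<^sup>2 / x ^ 0" using B(2)[of x 0] f0[of x] by simp
      also have "\<dots> \<le> B 0 * u\<^sup>2" using that False B(1)[of 0] by (simp add: mult_left_mono)
      finally show ?thesis using False that by simp
    qed
    have s3: "0 \<le> (\<Sum>j<n. a3 j * \<bar>v ^ (j + L) * g v\<bar>)" for v by (intro sum_nonneg mult_nonneg_nonneg a0) auto
    have main: "\<bar>?d v\<bar> \<le> ?D v" for v
    proof -
      have p1: "0 \<le> a1 * \<bar>v ^ n * g v\<bar>" using a0 by simp
      have p2: "0 \<le> a2 * ?F (u + (- 1) * v)" using a0(2) F0[of "u + (- 1) * v"] by (rule mult_nonneg_nonneg)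
      consider "v \<le> 0" | "0 < v" "v \<le> u / 2" | "v > u / 2" by linarith
      then show ?thesis
      proof cases
        case 1
        then have "?d v = 0" by (simp add: loc2_nonpos[OF l2])
        then show ?thesis using p1 p2 s3[of v] by linarith
      next
        case 2
        have uv: "u - v \<ge> u / 2" using 2 by (simp add: field_simps)
        have "\<exists>t. (if u - v < u then u - v < t \<and> t < u else u < t \<and> t < u - v) \<and>
          fd 0 (u - v) = (\<Sum>m<n. fd m u / fact m * (u - v - u) ^ m) + fd n t / fact n * (u - v - u) ^ n"
        proof (rule Taylor[where a = "u / 2" and b = u])
          show "\<forall>m t. m < n \<and> u / 2 \<le> t \<and> t \<le> u \<longrightarrow> DERIV (fd m) t :> fd (Suc m) t"
            using der u1 by auto
        qed (use 2 uv u1 in \<open>auto simp: n_def\<close>)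
        then obtain t where t: "u - v < t" "t < u"
          and ft: "fd 0 (u - v) = (\<Sum>m<n. fd m u / fact m * (u - v - u) ^ m) + fd n t / fact n * (u - v - u) ^ n"
          using 2 by auto
        have "f (u - v) = fd 0 (u - v)" using f0 uv u1 by simp
        also have "\<dots> = (\<Sum>j<n. c j * v ^ j) + fd n t / fact n * (- v) ^ n"
          unfolding ft c_def by (intro arg_cong2[of _ _ _ _ "(+)"] sum.cong) (auto simp: power_minus[of v] mult_ac)
        finally have fe: "f (u - v) - (\<Sum>j<n. c j * v ^ j) = fd n t / fact n * (- v) ^ n" by simp
        have t2: "t \<ge> u / 2" "t \<ge> 1" using t uv u1 by auto
        have "\<bar>fd n t\<bar> \<le> B n * t\<^sup>2 / t ^ n" by (rule B(2)[OF t2(2)])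
        also have "\<dots> \<le> B n * u\<^sup>2 / (u / 2) ^ n"
          using t t2 u1 B(1)[of n] by (intro frac_le mult_left_mono power_mono mult_nonneg_nonneg zero_less_power) auto
        also have "\<dots> = a1" using u1 by (simp add: a1_def power_divide)
        finally have fb: "\<bar>fd n t\<bar> \<le> a1" .
        have "\<bar>fd n t / fact n\<bar> \<le> a1"
        proof -
          have "\<bar>fd n t / fact n\<bar> = \<bar>fd n t\<bar> / fact n" by simp
          also have "\<dots> \<le> \<bar>fd n t\<bar> / 1" by (intro divide_left_mono) (auto simp: fact_ge_1)
          finally show ?thesis using fb by simp
        qed
        then have "\<bar>fd n t / fact n\<bar> * \<bar>v ^ n * g v\<bar> \<le> a1 * \<bar>v ^ n * g v\<bar>" by (intro mult_right_mono) auto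
        moreover have "?d v = (f (u - v) - (\<Sum>j<n. c j * v ^ j)) * g v" by (simp add: left_diff_distrib sum_distrib_right mult.assoc)
        then have "\<bar>?d v\<bar> = \<bar>fd n t / fact n\<bar> * \<bar>v ^ n * g v\<bar>" unfolding fe by (simp add: abs_mult power_abs)
        ultimately show ?thesis using p2 s3[of v] by linarith
      next
        case 3
        have v0: "v > 0" "v \<ge> U0" using 3 u1 by auto
        have "\<bar>g v\<bar> \<le> G / v ^ L" by (rule GU(3)[OF v0(2)])
        also have "\<dots> \<le> G / (u / 2) ^ L" using 3 u1 v0 GU(1) by (intro divide_left_mono power_mono mult_pos_pos zero_less_power) auto
        also have "\<dots> = a2" using u1 by (simp add: a2_def power_divide)
        finally have gb: "\<bar>g v\<bar> \<le> a2" .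
        have "\<bar>f (u - v)\<bar> * \<bar>g v\<bar> \<le> ?F (u - v) * a2"
          using Fb[of "u - v"] v0 gb F0[of "u - v"] by (intro mult_mono) auto
        then have e1: "\<bar>f (u - v) * g v\<bar> \<le> a2 * ?F (u + (- 1) * v)" by (simp add: abs_mult mult.commute)
        have "\<bar>c j * (v ^ j * g v)\<bar> \<le> a3 j * \<bar>v ^ (j + L) * g v\<bar>" for j
        proof -
          have "\<bar>c j\<bar> \<le> \<bar>fd j u\<bar>" 
          proof -
            have "\<bar>c j\<bar> = \<bar>fd j u\<bar> / fact j" by (simp add: c_def abs_mult power_abs)
            also have "\<dots> \<le> \<bar>fd j u\<bar> / 1" by (intro divide_left_mono) (auto simp: fact_ge_1)
            finally show ?thesis by simp
          qed
          also have "\<dots> \<le> B j * u\<^sup>2 / u ^ j" using u1 by (intro B(2)) auto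
          also have "\<dots> \<le> B j * u\<^sup>2 / 1" using u1 B(1)[of j] by (intro divide_left_mono) (auto simp: one_le_power)
          also have "\<dots> = B j * u\<^sup>2 * 1" by simp
          \<comment> \<open>2v/u \<ge> 1 in this range; inserting its power turns the tail of a
            moment into a higher moment with u^(-L) in front.\<close>
          also have "\<dots> \<le> B j * u\<^sup>2 * (2 * v / u) ^ L"
            using 3 u1 B(1)[of j] by (intro mult_left_mono one_le_power) (auto simp: field_simps)
          also have "\<dots> = a3 j * v ^ L" using u1 by (simp add: a3_def power_divide power_mult_distrib)
          finally have "\<bar>c j\<bar> \<le> a3 j * v ^ L" .
          then have "\<bar>c j\<bar> * \<bar>v ^ j * g v\<bar> \<le> a3 j * v ^ L * \<bar>v ^ j * g v\<bar>" by (intro mult_right_mono) auto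
          also have "\<dots> = a3 j * \<bar>v ^ (j + L) * g v\<bar>" using v0 by (simp add: abs_mult power_add mult_ac)
          finally show ?thesis by (simp only: abs_mult)
        qed
        then have "\<bar>\<Sum>j<n. c j * (v ^ j * g v)\<bar> \<le> (\<Sum>j<n. a3 j * \<bar>v ^ (j + L) * g v\<bar>)"
          by (intro order_trans[OF sum_abs] sum_mono)
        then show ?thesis using e1 p1 by linarith
      qed
    qed
    have "\<bar>\<integral>v. ?d v \<partial>lborel\<bar> \<le> (\<integral>v. \<bar>?d v\<bar> \<partial>lborel)"
      using integral_norm_bound[of lborel ?d] by simp
    also have "\<dots> \<le> (\<integral>v. ?D v \<partial>lborel)" by (rule integral_mono[OF integrable_abs[OF id] iD main])
    also have "\<dots> \<le> C / u ^ K"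
    proof -
      have t1: "a1 * Mm n = (B n * 2 ^ n * Mm n) / u ^ K"
        using u1 by (simp add: a1_def n_def power_add power2_eq_square)
      have uu: "u\<^sup>2 * u / u ^ L = 1 / u ^ K" "u\<^sup>2 / u ^ L = 1 / u ^ K / u"
        using u1 by (simp_all add: L_def power_add power2_eq_square eval_nat_numeral)
      have "a2 * (A + B 0 * u\<^sup>2 * u) \<le> a2 * ((A + B 0) * (u\<^sup>2 * u))"
      proof (intro mult_left_mono a0)
        have "1 * 1 \<le> u\<^sup>2 * u" using u1 by (intro mult_mono) auto
        then have "A * 1 \<le> A * (u\<^sup>2 * u)" using A0 by (intro mult_left_mono) auto
        then show "A + B 0 * u\<^sup>2 * u \<le> (A + B 0) * (u\<^sup>2 * u)" by (simp add: distrib_right mult.assoc)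
      qed
      also have "\<dots> = G * 2 ^ L * (A + B 0) * (u\<^sup>2 * u / u ^ L)" by (simp add: a2_def)
      finally have t2: "a2 * (A + B 0 * u\<^sup>2 * u) \<le> (G * 2 ^ L * (A + B 0)) / u ^ K" unfolding uu by simp
      have "a3 j * Mm (j + L) \<le> (B j * 2 ^ L * Mm (j + L)) / u ^ K" for j
      proof -
        have "a3 j * Mm (j + L) = (B j * 2 ^ L * Mm (j + L)) * (u\<^sup>2 / u ^ L)" by (simp add: a3_def)
        also have "\<dots> = (B j * 2 ^ L * Mm (j + L)) / u ^ K / u" unfolding uu(2) by simp
        also have "\<dots> \<le> (B j * 2 ^ L * Mm (j + L)) / u ^ K / 1" using u1 B(1)[of j] M0 by (intro divide_left_mono) auto
        finally show ?thesis by simp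
      qed
      then have t3: "(\<Sum>j<n. a3 j * Mm (j + L)) \<le> (\<Sum>j<n. (B j * 2 ^ L * Mm (j + L)) / u ^ K)" by (intro sum_mono)
      show ?thesis unfolding vD C_def add_divide_distrib sum_divide_distrib using t1 t2 t3 by linarith
    qed
    finally show ?thesis unfolding vd .
  qed
  moreover have "C \<ge> 0" unfolding C_def using B(1) GU(1) A0 M0 by (intro add_nonneg_nonneg mult_nonneg_nonneg sum_nonneg) auto
  ultimately show ?thesis using GU(2) unfolding n_def
    by (intro exI[of _ C] exI[of _ "2 * U0"]) auto
qed

section \<open>Asymptotics of the triple sum\<close>

text \<open>\<open>dq j\<close>, \<open>dp j\<close> and \<open>p3d i\<close> are the derivatives of the first, second and third convolution
  powers of the main term; the last clause of \<open>p3d\<close> is only meant for \<open>i = 3\<close>.\<close>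

fun dq :: "nat \<Rightarrow> real \<Rightarrow> real" where
  "dq 0 x = ln x + mertens_const"
| "dq (Suc j) x = (- 1) ^ j * fact j / x ^ Suc j"

fun dp :: "nat \<Rightarrow> real \<Rightarrow> real" where
  "dp 0 x = x * ((ln x + mertens_const)\<^sup>2 - 2 * (ln x + mertens_const) + 2 - zeta 2)"
| "dp (Suc 0) x = (ln x + mertens_const)\<^sup>2 - zeta 2"
| "dp (Suc (Suc j)) x = 2 * (- 1) ^ j * fact j * ((ln x + mertens_const - harm j) / x ^ Suc j)"

definition p3d :: "nat \<Rightarrow> real \<Rightarrow> real" where
  "p3d i u = (let l = ln u + mertens_const in
     if i = 0 then p3fun u
     else if i = 1 then u * (l ^ 3 - 3 * l\<^sup>2 + (6 - 3 * zeta 2) * l - 6 + 3 * zeta 2 + 2 * zeta 3)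
     else if i = 2 then l ^ 3 - 3 * zeta 2 * l + 2 * zeta 3
     else (3 * l\<^sup>2 - 3 * zeta 2) / u)"

lemma ell_deriv: "x > 0 \<Longrightarrow> ((\<lambda>x. ln x + mertens_const) has_real_derivative 1 / x) (at x)"
  by (auto intro!: derivative_eq_intros)

lemma inverse_power_deriv:
  assumes "x > (0::real)"
  shows "((\<lambda>x. 1 / x ^ Suc j) has_real_derivative - real (Suc j) / x ^ Suc (Suc j)) (at x)"
proof -
  have "((\<lambda>x. inverse (x ^ Suc j)) has_real_derivative - (inverse (x ^ Suc j) * (real (Suc j) * x ^ j) * inverse (x ^ Suc j))) (at x)"
    using DERIV_pow[of "Suc j" x UNIV] assms by (intro DERIV_inverse') (auto simp del: of_nat_Suc power_Suc)
  moreover have "- (inverse (x ^ Suc j) * (real (Suc j) * x ^ j) * inverse (x ^ Suc j)) = - real (Suc j) / x ^ Suc (Suc j)"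
    using assms by (simp add: field_simps)
  ultimately show ?thesis by (simp only: inverse_eq_divide)
qed

lemma dq_deriv:
  assumes x: "x > 0"
  shows "(dq j has_real_derivative dq (Suc j) x) (at x)"
proof (cases j)
  case 0
  have "(dq 0 has_real_derivative 1 / x) (at x)"
  proof -
    have "dq 0 = (\<lambda>x. ln x + mertens_const)" by (rule ext) simp
    then show ?thesis using ell_deriv[OF x] by (simp only:)
  qed
  then show ?thesis using 0 by simp
next
  case (Suc i)
  have "((\<lambda>x. ((- 1) ^ i * fact i) * (1 / x ^ Suc i)) has_real_derivative ((- 1) ^ i * fact i) * (- real (Suc i) / x ^ Suc (Suc i))) (at x)"
    by (intro DERIV_cmult inverse_power_deriv x)
  moreover have "(\<lambda>x. ((- 1) ^ i * fact i) * (1 / x ^ Suc i)) = dq (Suc i)" by (auto simp: fun_eq_iff)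
  moreover have "((- 1) ^ i * fact i) * (- real (Suc i) / x ^ Suc (Suc i)) = dq (Suc (Suc i)) x"
    by (simp add: algebra_simps)
  ultimately show ?thesis using Suc by (simp only:)
qed

text \<open>Origin of the harmonic numbers: the derivative of (l - H)/x^m is -(m (l - H) -
  1)/x^(m+1), and the 1 is absorbed by raising H by 1/m.\<close>

lemma dp_deriv:
  assumes x: "x > 0"
  shows "(dp j has_real_derivative dp (Suc j) x) (at x)"
proof -
  define l where "l = (\<lambda>x. ln x + mertens_const)"
  have l: "(l has_real_derivative 1 / x) (at x)" unfolding l_def by (rule ell_deriv[OF x])
  consider "j = 0" | "j = 1" | i where "j = Suc (Suc i)" by (metis One_nat_def not0_implies_Suc)
  then show ?thesis
  proof cases
    case 1
    have "((\<lambda>x. x * ((l x)\<^sup>2 - 2 * l x + 2 - zeta 2)) has_real_derivative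
       (1 * ((l x)\<^sup>2 - 2 * l x + 2 - zeta 2) + (2 * l x * (1 / x) - 2 * (1 / x)) * x)) (at x)"
      by (auto intro!: derivative_eq_intros l)
    moreover have "1 * ((l x)\<^sup>2 - 2 * l x + 2 - zeta 2) + (2 * l x * (1 / x) - 2 * (1 / x)) * x = dp (Suc 0) x"
      using x by (simp add: l_def algebra_simps)
    moreover have "(\<lambda>x. x * ((l x)\<^sup>2 - 2 * l x + 2 - zeta 2)) = dp 0" by (auto simp: fun_eq_iff l_def)
    ultimately show ?thesis using 1 by (simp only:)
  next
    case 2
    have "((\<lambda>x. (l x)\<^sup>2 - zeta 2) has_real_derivative 2 * l x * (1 / x)) (at x)"
      by (auto intro!: derivative_eq_intros l)
    moreover have "2 * l x * (1 / x) = dp (Suc (Suc 0)) x" by (simp add: l_def harm_expand)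
    moreover have "(\<lambda>x. (l x)\<^sup>2 - zeta 2) = dp (Suc 0)" by (auto simp: fun_eq_iff l_def)
    ultimately show ?thesis using 2 by (simp only: One_nat_def)
  next
    case (3 i)
    have "((\<lambda>x. 2 * (- 1) ^ i * fact i * ((l x - harm i) * (1 / x ^ Suc i))) has_real_derivative
      2 * (- 1) ^ i * fact i * ((1 / x - 0) * (1 / x ^ Suc i) + (- real (Suc i) / x ^ Suc (Suc i)) * (l x - harm i))) (at x)"
      by (intro DERIV_cmult DERIV_mult DERIV_diff DERIV_const l inverse_power_deriv x)
    moreover have "2 * (- 1) ^ i * fact i * ((1 / x - 0) * (1 / x ^ Suc i) + (- real (Suc i) / x ^ Suc (Suc i)) * (l x - harm i)) = dp (Suc (Suc (Suc i))) x"
    proof -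
      have h: "real (Suc i) * (l x - harm (Suc i)) = real (Suc i) * (l x - harm i) - 1"
        by (simp add: harm_Suc right_diff_distrib distrib_left del: of_nat_Suc)
      have a: "(1 / x - 0) * (1 / x ^ Suc i) + (- real (Suc i) / x ^ Suc (Suc i)) * (l x - harm i) = - (real (Suc i) * (l x - harm i) - 1) / x ^ Suc (Suc i)"
        by (simp add: diff_divide_distrib del: of_nat_Suc)
      show ?thesis unfolding a h[symmetric] by (simp add: l_def algebra_simps del: of_nat_Suc)
    qed
    moreover have "(\<lambda>x. 2 * (- 1) ^ i * fact i * ((l x - harm i) * (1 / x ^ Suc i))) = dp (Suc (Suc i))" by (auto simp: fun_eq_iff l_def)
    ultimately show ?thesis using 3 by (simp only:)
  qed
qed

text \<open>ln x = 2 ln (sqrt x) \<le> 2 sqrt x, so even the squared logarithm grows at most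
  linearly.\<close>

lemma ell_square_le:
  obtains C where "C > 0" "\<And>x. x \<ge> 1 \<Longrightarrow> (ln x + mertens_const)\<^sup>2 \<le> C * x" "\<And>x. x \<ge> 1 \<Longrightarrow> \<bar>ln x + mertens_const\<bar> \<le> C * x"
proof -
  \<comment> \<open>9 = 2 * 4 + 1: the square takes 8, and the last unit serves |y| \<le> 1 +
    y^2.\<close>
  define C where "C = 9 + 2 * mertens_const\<^sup>2"
  have sq: "(ln x + mertens_const)\<^sup>2 \<le> (C - 1) * x" if x: "x \<ge> 1" for x
  proof -
    have "ln x = 2 * ln (sqrt x)" using x by (simp add: ln_sqrt)
    also have "\<dots> \<le> 2 * sqrt x" using ln_bound[of "sqrt x"] x by simp
    finally have "(ln x)\<^sup>2 \<le> (2 * sqrt x)\<^sup>2" using x by (intro power_mono) auto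
    then have "(ln x)\<^sup>2 \<le> 4 * x" using x by (simp add: power_mult_distrib)
    moreover have "(ln x + mertens_const)\<^sup>2 \<le> 2 * (ln x)\<^sup>2 + 2 * mertens_const\<^sup>2"
      using zero_le_power2[of "ln x - mertens_const"] by (simp add: power2_sum power2_diff)
    moreover have "mertens_const\<^sup>2 * 1 \<le> mertens_const\<^sup>2 * x" using x by (intro mult_left_mono) auto
    ultimately show ?thesis by (simp add: C_def distrib_right)
  qed
  have ab: "\<bar>y\<bar> \<le> 1 + y\<^sup>2" for y :: real
  proof -
    have "0 \<le> (\<bar>y\<bar> - 1 / 2)\<^sup>2" by simp
    then show ?thesis by (simp add: power2_diff power_divide)
  qed
  show ?thesis
  proof
    show "C > 0" by (simp add: C_def add_pos_nonneg)
    show "(ln x + mertens_const)\<^sup>2 \<le> C * x" if "x \<ge> 1" for x using sq[OF that] that by (simp add: left_diff_distrib)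
    show "\<bar>ln x + mertens_const\<bar> \<le> C * x" if "x \<ge> 1" for x
      using sq[OF that] ab[of "ln x + mertens_const"] that by (simp add: left_diff_distrib)
  qed
qed

lemma dq_bound: "\<exists>C\<ge>0. \<forall>x\<ge>1. \<bar>dq j x\<bar> \<le> C * x\<^sup>2 / x ^ j"
proof -
  obtain C where C: "C > 0" "\<And>x. x \<ge> 1 \<Longrightarrow> \<bar>ln x + mertens_const\<bar> \<le> C * x" using ell_square_le by metis
  show ?thesis
  proof (cases j)
    case 0
    have "\<bar>dq j x\<bar> \<le> C * x\<^sup>2 / x ^ j" if x: "x \<ge> 1" for x
    proof -
      have "C * x \<le> C * x\<^sup>2" using x C(1) by (simp add: power2_eq_square)
      then show ?thesis using C(2)[OF x] 0 by simp
    qed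
    then show ?thesis using C(1) by (intro exI[of _ C]) auto
  next
    case (Suc i)
    have "\<bar>dq j x\<bar> \<le> fact i * x\<^sup>2 / x ^ j" if x: "x \<ge> 1" for x
    proof -
      have "\<bar>dq j x\<bar> = fact i * 1 / x ^ j" using x Suc by (simp add: abs_mult power_abs)
      also have "\<dots> \<le> fact i * x\<^sup>2 / x ^ j" using x by (intro divide_right_mono mult_left_mono) auto
      finally show ?thesis .
    qed
    then show ?thesis by (intro exI[of _ "fact i"]) auto
  qed
qed

lemma dp_bound: "\<exists>C\<ge>0. \<forall>x\<ge>1. \<bar>dp j x\<bar> \<le> C * x\<^sup>2 / x ^ j"
proof -
  obtain C where C: "C > 0" "\<And>x. x \<ge> 1 \<Longrightarrow> (ln x + mertens_const)\<^sup>2 \<le> C * x" "\<And>x. x \<ge> 1 \<Longrightarrow> \<bar>ln x + mertens_const\<bar> \<le> C * x"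
    using ell_square_le by metis
  define D where "D = 3 * C + 2 + \<bar>zeta 2\<bar>"
  have D: "D \<ge> 0" using C(1) by (simp add: D_def)
  have Dx: "3 * (C * x) + 2 + \<bar>zeta 2\<bar> \<le> D * x" if "x \<ge> 1" for x
  proof -
    have "\<bar>zeta 2\<bar> * 1 \<le> \<bar>zeta 2\<bar> * x" using that by (intro mult_left_mono) auto
    then show ?thesis using that by (simp add: D_def distrib_right)
  qed
  have ar: "a + 2 * b + 2 + z \<le> E" "a + z \<le> E" if "3 * c + 2 + z \<le> E" "a \<le> c" "b \<le> c" "0 \<le> b" for a b c z E :: real
    using that by linarith+
  consider "j = 0" | "j = 1" | i where "j = Suc (Suc i)" by (metis One_nat_def not0_implies_Suc)
  then show ?thesis
  proof cases
    case 1
    have "\<bar>dp j x\<bar> \<le> D * x\<^sup>2 / x ^ j" if x: "x \<ge> 1" for x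
    proof -
      let ?l = "ln x + mertens_const"
      have "\<bar>a - 2 * l + 2 - z\<bar> \<le> a + 2 * \<bar>l\<bar> + 2 + \<bar>z\<bar>" if "0 \<le> a" for a l z :: real using that by linarith
      from this[OF zero_le_power2] have "\<bar>?l\<^sup>2 - 2 * ?l + 2 - zeta 2\<bar> \<le> ?l\<^sup>2 + 2 * \<bar>?l\<bar> + 2 + \<bar>zeta 2\<bar>" .
      also have "\<dots> \<le> D * x" by (rule ar(1)[OF Dx[OF x] C(2)[OF x] C(3)[OF x] abs_ge_zero])
      finally have "x * \<bar>?l\<^sup>2 - 2 * ?l + 2 - zeta 2\<bar> \<le> x * (D * x)" using x by (intro mult_left_mono) auto
      then show ?thesis using 1 x by (simp add: abs_mult power2_eq_square mult_ac)
    qed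
    then show ?thesis using D by blast
  next
    case 2
    have "\<bar>dp j x\<bar> \<le> D * x\<^sup>2 / x ^ j" if x: "x \<ge> 1" for x
    proof -
      let ?l = "ln x + mertens_const"
      have "\<bar>?l\<^sup>2 - zeta 2\<bar> \<le> ?l\<^sup>2 + \<bar>zeta 2\<bar>" using zero_le_power2[of ?l] by linarith
      also have "\<dots> \<le> D * x" by (rule ar(2)[OF Dx[OF x] C(2)[OF x] C(3)[OF x] abs_ge_zero])
      finally show ?thesis using 2 x by (simp add: power2_eq_square)
    qed
    then show ?thesis using D by blast
  next
    case (3 i)
    define E where "E = 2 * fact i * (C + \<bar>harm i\<bar>)"
    have "\<bar>dp j x\<bar> \<le> E * x\<^sup>2 / x ^ j" if x: "x \<ge> 1" for x
    proof -
      let ?l = "ln x + mertens_const"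
      have hx: "\<bar>harm i :: real\<bar> \<le> \<bar>harm i\<bar> * x" using x mult_left_mono[of 1 x "\<bar>harm i\<bar>"] by (simp add: harm_nonneg)
      have "\<bar>l - h\<bar> \<le> c + d" if "\<bar>l\<bar> \<le> c" "\<bar>h\<bar> \<le> d" for l h c d :: real using that by linarith
      from this[OF C(3)[OF x] hx] have "\<bar>?l - harm i\<bar> \<le> (C + \<bar>harm i\<bar>) * x" unfolding distrib_right .
      then have "2 * fact i * (\<bar>?l - harm i\<bar> / x ^ Suc i) \<le> 2 * fact i * ((C + \<bar>harm i\<bar>) * x / x ^ Suc i)"
        using x by (intro mult_left_mono divide_right_mono) auto
      then show ?thesis using 3 x by (simp add: E_def abs_mult power_abs power2_eq_square)
    qed
    moreover have "E \<ge> 0" using C(1) harm_nonneg[of i, where 'a = real] by (simp add: E_def)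
    ultimately show ?thesis by blast
  qed
qed

lemma p3d_deriv:
  assumes x: "x > 0" and i: "i < 3"
  shows "(p3d i has_real_derivative p3d (Suc i) x) (at x)"
proof -
  define l where "l = (\<lambda>x. ln x + mertens_const)"
  have l: "(l has_real_derivative 1 / x) (at x)" unfolding l_def by (rule ell_deriv[OF x])
  consider "i = 0" | "i = 1" | "i = 2" using i by linarith
  then show ?thesis
  proof cases
    case 1
    let ?f = "\<lambda>x. x\<^sup>2 * (l x ^ 3 / 2 - 9 / 4 * (l x)\<^sup>2 + (21 / 4 - 3 / 2 * zeta 2) * l x - 45 / 8 + 9 / 4 * zeta 2 + zeta 3)"
    have "(?f has_real_derivative (2 * x * (l x ^ 3 / 2 - 9 / 4 * (l x)\<^sup>2 + (21 / 4 - 3 / 2 * zeta 2) * l x - 45 / 8 + 9 / 4 * zeta 2 + zeta 3)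
       + (3 * (l x)\<^sup>2 * (1 / x) / 2 - 9 / 4 * (2 * l x * (1 / x)) + (21 / 4 - 3 / 2 * zeta 2) * (1 / x)) * x\<^sup>2)) (at x)"
      by (auto intro!: derivative_eq_intros l)
    moreover have "2 * x * (l x ^ 3 / 2 - 9 / 4 * (l x)\<^sup>2 + (21 / 4 - 3 / 2 * zeta 2) * l x - 45 / 8 + 9 / 4 * zeta 2 + zeta 3)
       + (3 * (l x)\<^sup>2 * (1 / x) / 2 - 9 / 4 * (2 * l x * (1 / x)) + (21 / 4 - 3 / 2 * zeta 2) * (1 / x)) * x\<^sup>2 = p3d 1 x"
      using x by (simp add: p3d_def Let_def l_def[symmetric] l_def field_simps power2_eq_square power3_eq_cube)
    moreover have "?f = p3d 0" by (auto simp: fun_eq_iff p3d_def Let_def l_def p3fun_def)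
    ultimately show ?thesis using 1 by simp
  next
    case 2
    let ?f = "\<lambda>x. x * (l x ^ 3 - 3 * (l x)\<^sup>2 + (6 - 3 * zeta 2) * l x - 6 + 3 * zeta 2 + 2 * zeta 3)"
    have "(?f has_real_derivative (1 * (l x ^ 3 - 3 * (l x)\<^sup>2 + (6 - 3 * zeta 2) * l x - 6 + 3 * zeta 2 + 2 * zeta 3)
       + (3 * (l x)\<^sup>2 * (1 / x) - 3 * (2 * l x * (1 / x)) + (6 - 3 * zeta 2) * (1 / x)) * x)) (at x)"
      by (auto intro!: derivative_eq_intros l)
    moreover have "1 * (l x ^ 3 - 3 * (l x)\<^sup>2 + (6 - 3 * zeta 2) * l x - 6 + 3 * zeta 2 + 2 * zeta 3)
       + (3 * (l x)\<^sup>2 * (1 / x) - 3 * (2 * l x * (1 / x)) + (6 - 3 * zeta 2) * (1 / x)) * x = p3d 2 x"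
      using x by (simp add: p3d_def Let_def l_def field_simps)
    moreover have "?f = p3d 1" by (auto simp: fun_eq_iff p3d_def Let_def l_def)
    ultimately show ?thesis using 2 by (simp add: numeral_2_eq_2)
  next
    case 3
    let ?f = "\<lambda>x. l x ^ 3 - 3 * zeta 2 * l x + 2 * zeta 3"
    have "(?f has_real_derivative (3 * (l x)\<^sup>2 * (1 / x) - 3 * zeta 2 * (1 / x))) (at x)"
      by (auto intro!: derivative_eq_intros l)
    moreover have "3 * (l x)\<^sup>2 * (1 / x) - 3 * zeta 2 * (1 / x) = p3d 3 x"
      by (simp add: p3d_def Let_def l_def diff_divide_distrib)
    moreover have "?f = p3d 2" by (auto simp: fun_eq_iff p3d_def Let_def l_def)
    ultimately show ?thesis using 3 by (simp add: numeral_3_eq_3)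
  qed
qed

text \<open>The second argument counts derivatives in \<open>u\<close>.\<close>

definition M3_approx :: "nat \<Rightarrow> nat \<Rightarrow> real \<Rightarrow> real" where
  "M3_approx n i u = p3d i u + 3 * (\<Sum>j<n. (- 1) ^ j / fact j * dp (j + i) u * mom err j)
     + 3 * (\<Sum>j<n. (- 1) ^ j / fact j * dq (j + i) u * mom (conv err err) j)"

text \<open>Of the four terms of \<open>conv_cube\<close> the first is explicit, the two mixed ones
  are expanded by \<open>conv_expansion\<close>, and the cube of \<open>err\<close> is itself
  rapidly decreasing.\<close>

lemma M3_expansion:
  "\<exists>C U. 0 \<le> C \<and> 1 \<le> U \<and> (\<forall>u\<ge>U. \<bar>M3 u - M3_approx (K + 2) 0 u\<bar> \<le> C / u ^ K)"
proof -
  have ee: "rapid (conv err err)" by (intro rapid_conv rapid_err)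
  have "\<exists>C U. 0 \<le> C \<and> 1 \<le> U \<and> (\<forall>u\<ge>U. \<bar>conv p2fun err u - (\<Sum>j<K+2. (- 1) ^ j / fact j * dp j u * mom err j)\<bar> \<le> C / u ^ K)"
    by (rule conv_expansion[OF loc2_p2fun rapid_err _ dp_deriv dp_bound]) (auto simp: p2fun_def)
  then obtain C1 U1 where 1: "0 \<le> C1" "1 \<le> U1" "\<And>u. u \<ge> U1 \<Longrightarrow> \<bar>conv p2fun err u - (\<Sum>j<K+2. (- 1) ^ j / fact j * dp j u * mom err j)\<bar> \<le> C1 / u ^ K"
    by blast
  have "\<exists>C U. 0 \<le> C \<and> 1 \<le> U \<and> (\<forall>u\<ge>U. \<bar>conv qfun (conv err err) u - (\<Sum>j<K+2. (- 1) ^ j / fact j * dq j u * mom (conv err err) j)\<bar> \<le> C / u ^ K)"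
    by (rule conv_expansion[OF loc2_qfun ee _ dq_deriv dq_bound]) (auto simp: qfun_def)
  then obtain C2 U2 where 2: "0 \<le> C2" "1 \<le> U2" "\<And>u. u \<ge> U2 \<Longrightarrow> \<bar>conv qfun (conv err err) u - (\<Sum>j<K+2. (- 1) ^ j / fact j * dq j u * mom (conv err err) j)\<bar> \<le> C2 / u ^ K"
    by blast
  obtain C3 U3 where 3: "0 \<le> C3" "1 \<le> U3" "\<And>u. u \<ge> U3 \<Longrightarrow> \<bar>conv (conv err err) err u\<bar> \<le> C3 / u ^ K"
    using rapidE[OF rapid_conv[OF ee rapid_err]] by blast
  have "\<bar>M3 u - M3_approx (K + 2) 0 u\<bar> \<le> (3 * C1 + 3 * C2 + C3) / u ^ K" if u: "u \<ge> max U1 (max U2 U3)" for u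
  proof -
    have u0: "u > 0" using u 1(2) by auto
    have "M3 u = conv p2fun qfun u + 3 * conv p2fun err u + 3 * conv qfun (conv err err) u + conv (conv err err) err u"
      unfolding M3_def msum_eq conv_cube[OF loc2_qfun loc2_err] conv_qfun_qfun ..
    moreover have "conv p2fun qfun u = p3d 0 u"
      using conv_commute[of p2fun qfun u] conv_qfun_p2fun[OF u0] by (simp add: p3d_def)
    moreover have ar: "\<bar>(p + 3 * a + 3 * b + c) - (p + 3 * a' + 3 * b')\<bar> \<le> 3 * x + 3 * y + z"
      if "\<bar>a - a'\<bar> \<le> x" "\<bar>b - b'\<bar> \<le> y" "\<bar>c\<bar> \<le> z" for p a b c a' b' x y z :: real using that by linarith
    have u123: "u \<ge> U1" "u \<ge> U2" "u \<ge> U3" using u by auto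
    ultimately show ?thesis
      unfolding M3_approx_def add_divide_distrib using ar[OF 1(3)[OF u123(1)] 2(3)[OF u123(2)] 3(3)[OF u123(3)], of "p3d 0 u"] by simp
  qed
  then show ?thesis using 1 2 3
    by (intro exI[of _ "3 * C1 + 3 * C2 + C3"] exI[of _ "max U1 (max U2 U3)"]) auto
qed

lemma M3_approx_deriv:
  assumes u: "u > 0" and i: "i < 3"
  shows "(M3_approx n i has_real_derivative M3_approx n (Suc i) u) (at u)"
  unfolding M3_approx_def [abs_def] add_Suc_right
  by (intro DERIV_add DERIV_cmult DERIV_sum DERIV_cmult_right p3d_deriv dp_deriv dq_deriv u i)

text \<open>A bounded third derivative makes the error of a second difference of order h^3.\<close>

lemma M3_approx_3_bound: "\<exists>B\<ge>0. \<forall>u\<ge>1. \<bar>M3_approx n 3 u\<bar> \<le> B"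
proof -
  obtain P where P: "\<And>j. P j \<ge> 0" "\<And>j x. x \<ge> 1 \<Longrightarrow> \<bar>dp j x\<bar> \<le> P j * x\<^sup>2 / x ^ j" using dp_bound by metis
  obtain Q where Q: "\<And>j. Q j \<ge> 0" "\<And>j x. x \<ge> 1 \<Longrightarrow> \<bar>dq j x\<bar> \<le> Q j * x\<^sup>2 / x ^ j" using dq_bound by metis
  obtain C where C: "C > 0" "\<And>x. x \<ge> 1 \<Longrightarrow> (ln x + mertens_const)\<^sup>2 \<le> C * x" using ell_square_le by metis
  have drop: "c * x\<^sup>2 / x ^ (j + 3) \<le> c" if "x \<ge> 1" "c \<ge> 0" for c x :: real and j
  proof -
    have "c * x\<^sup>2 / x ^ (j + 3) \<le> c * x ^ (j + 3) / x ^ (j + 3)"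
      using that by (intro divide_right_mono mult_left_mono power_increasing) auto
    then show ?thesis using that by simp
  qed
  have sm: "\<bar>\<Sum>j<n. (- 1) ^ j / fact j * d (j + 3) u * m j\<bar> \<le> (\<Sum>j<n. R (j + 3) * \<bar>m j\<bar>)"
    if "\<And>j x. x \<ge> 1 \<Longrightarrow> \<bar>d j x\<bar> \<le> R j * x\<^sup>2 / x ^ j" "\<And>j. R j \<ge> 0" "u \<ge> 1" for d :: "nat \<Rightarrow> real \<Rightarrow> real" and R m u
  proof (rule order_trans[OF sum_abs], rule sum_mono)
    fix j
    have "\<bar>d (j + 3) u\<bar> \<le> R (j + 3)" using that(1)[OF that(3), of "j + 3"] drop[OF that(3) that(2)] order_trans by blast
    moreover have "\<bar>(- 1) ^ j / fact j :: real\<bar> \<le> 1"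
      using fact_ge_1[of j, where 'a = real] by (simp add: abs_mult power_abs)
    ultimately have "\<bar>(- 1) ^ j / fact j\<bar> * \<bar>d (j + 3) u\<bar> \<le> 1 * R (j + 3)" by (intro mult_mono) auto
    then show "\<bar>(- 1) ^ j / fact j * d (j + 3) u * m j\<bar> \<le> R (j + 3) * \<bar>m j\<bar>"
      unfolding abs_mult by (intro mult_right_mono) auto
  qed
  define B where "B = (3 * C + 3 * \<bar>zeta 2\<bar>) + 3 * (\<Sum>j<n. P (j + 3) * \<bar>mom err j\<bar>) + 3 * (\<Sum>j<n. Q (j + 3) * \<bar>mom (conv err err) j\<bar>)"
  have "\<bar>M3_approx n 3 u\<bar> \<le> B" if u: "u \<ge> 1" for u
  proof -
    have "\<bar>p3d 3 u\<bar> \<le> 3 * C + 3 * \<bar>zeta 2\<bar>"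
    proof -
      define a where "a = (ln u + mertens_const)\<^sup>2"
      have a: "0 \<le> a" "a \<le> C * u" using C(2)[OF u] by (auto simp: a_def)
      have z: "\<bar>zeta 2\<bar> \<le> \<bar>zeta 2\<bar> * u" using mult_left_mono[OF u, of "\<bar>zeta 2\<bar>"] by simp
      have "\<bar>3 * a - 3 * y\<bar> \<le> 3 * c + 3 * d" if "0 \<le> a" "a \<le> c" "\<bar>y\<bar> \<le> d" for a y c d :: real using that by linarith
      from this[OF a z] have "\<bar>3 * a - 3 * zeta 2\<bar> \<le> (3 * C + 3 * \<bar>zeta 2\<bar>) * u" by (simp add: distrib_right)
      then show ?thesis using u by (simp add: p3d_def Let_def a_def pos_divide_le_eq)
    qed
    moreover note sm[OF P(2) P(1) u, of "mom err"] sm[OF Q(2) Q(1) u, of "mom (conv err err)"]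
    moreover have "\<bar>a + 3 * b + 3 * c\<bar> \<le> x + 3 * y + 3 * z" if "\<bar>a\<bar> \<le> x" "\<bar>b\<bar> \<le> y" "\<bar>c\<bar> \<le> z" for a b c x y z :: real
      using that by linarith
    ultimately show ?thesis unfolding M3_approx_def B_def by blast
  qed
  moreover have "B \<ge> 0" unfolding B_def using C(1) P(1) Q(1) by (intro add_nonneg_nonneg mult_nonneg_nonneg sum_nonneg) auto
  ultimately show ?thesis by blast
qed

text \<open>|t| \<le> 2 covers both points of a second difference with step at most 1.\<close>

lemma M3_approx_taylor:
  assumes B: "\<And>u. u \<ge> 1 \<Longrightarrow> \<bar>M3_approx n 3 u\<bar> \<le> B" and u: "u \<ge> 3" and t: "\<bar>t\<bar> \<le> 2"
  shows "\<bar>M3_approx n 0 (u + t) - (M3_approx n 0 u + M3_approx n 1 u * t + M3_approx n 2 u / 2 * t\<^sup>2)\<bar> \<le> B * \<bar>t\<bar> ^ 3"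
proof (cases "t = 0")
  case True
  then show ?thesis by simp
next
  case False
  have "\<exists>s. (if u + t < u then u + t < s \<and> s < u else u < s \<and> s < u + t) \<and>
     M3_approx n 0 (u + t) = (\<Sum>m<3. M3_approx n m u / fact m * (u + t - u) ^ m) + M3_approx n 3 s / fact 3 * (u + t - u) ^ 3"
  proof (rule Taylor[where a = "u - 2" and b = "u + 2"])
    show "\<forall>m s. m < 3 \<and> u - 2 \<le> s \<and> s \<le> u + 2 \<longrightarrow> DERIV (M3_approx n m) s :> M3_approx n (Suc m) s"
      using M3_approx_deriv u by auto
  qed (use False t u in auto)
  then obtain s where s0: "if u + t < u then u + t < s \<and> s < u else u < s \<and> s < u + t" and eq: "M3_approx n 0 (u + t) = (\<Sum>m<3. M3_approx n m u / fact m * (u + t - u) ^ m) + M3_approx n 3 s / fact 3 * (u + t - u) ^ 3"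
    by blast
  have s: "u - 2 \<le> s" using s0 t by (cases "u + t < u") auto
  have "M3_approx n 0 (u + t) - (M3_approx n 0 u + M3_approx n 1 u * t + M3_approx n 2 u / 2 * t\<^sup>2) = M3_approx n 3 s / fact 3 * t ^ 3"
    unfolding eq by (simp add: eval_nat_numeral)
  also have "\<bar>\<dots>\<bar> = \<bar>M3_approx n 3 s\<bar> * (\<bar>t\<bar> ^ 3 / fact 3)" by (simp add: abs_mult power_abs)
  also have "\<dots> \<le> B * \<bar>t\<bar> ^ 3"
  proof (rule mult_mono)
    show "\<bar>M3_approx n 3 s\<bar> \<le> B" using B s u by simp
    then show "0 \<le> B" using abs_ge_zero order_trans by blast
    show "\<bar>t\<bar> ^ 3 / fact 3 \<le> \<bar>t\<bar> ^ 3" using divide_left_mono[of 1 "fact 3" "\<bar>t\<bar> ^ 3"] by (simp add: fact_numeral)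
  qed auto
  finally show ?thesis .
qed

text \<open>The squeeze \<open>S3_M3\<close> is divided by h^2 with h = u^(-N): the Taylor error h^3
  and the expansion error u^(-3N) = h^3 both become h, which dictates 3N + 2 terms. The forward
  difference gives the upper bound, the backward one the lower bound.\<close>

lemma S3_asymp: "\<exists>C U. 1 \<le> U \<and> (\<forall>u\<ge>U. \<bar>S3 u - M3_approx (3 * N + 2) 2 u\<bar> \<le> C / u ^ N)"
proof -
  define K where "K = 3 * N"
  define n where "n = K + 2"
  obtain C U where CU: "0 \<le> C" "1 \<le> U" "\<And>u. u \<ge> U \<Longrightarrow> \<bar>M3 u - M3_approx n 0 u\<bar> \<le> C / u ^ K"
    using M3_expansion[of K] unfolding n_def by blast
  obtain B where B: "B \<ge> 0" "\<And>u. u \<ge> 1 \<Longrightarrow> \<bar>M3_approx n 3 u\<bar> \<le> B" using M3_approx_3_bound[of n] by blast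
  \<comment> \<open>10 = 8 + 2 collects the cubic errors at 2t and at t; 4 = 1 + 2 + 1 are the
    weights of the second difference; 2^K comes from u - 2 \<ge> u/2.\<close>
  define E where "E = 10 * B + 4 * (C * 2 ^ K)"
  have "\<bar>S3 u - M3_approx n 2 u\<bar> \<le> E / u ^ N" if u: "u \<ge> U + 4" for u
  proof -
    define h where "h = 1 / u ^ N"
    have u1: "u \<ge> 1" "u > 0" "u \<ge> 3" "u \<ge> 4" using u CU(2) by auto
    have h: "h > 0" "h \<le> 1" using u1 by (auto simp: h_def one_le_power)
    have h3: "h\<^sup>2 * h = 1 / u ^ K" unfolding h_def K_def by (simp add: power2_eq_square power_mult[of u N 3, unfolded mult.commute[of N 3]] power3_eq_cube power_divide)
    define \<delta> where "\<delta> = C * 2 ^ K * (h\<^sup>2 * h)"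
    have rho: "\<bar>M3 v - M3_approx n 0 v\<bar> \<le> \<delta>" if v: "v \<ge> u - 2" for v
    proof -
      have "v \<ge> U" "v \<ge> u / 2" "v > 0" using v u CU(2) by auto
      then have "\<bar>M3 v - M3_approx n 0 v\<bar> \<le> C / v ^ K" using CU(3) by blast
      also have "\<dots> \<le> C / (u / 2) ^ K" using \<open>v \<ge> u / 2\<close> \<open>v > 0\<close> u1 CU(1) by (intro divide_left_mono power_mono mult_pos_pos zero_less_power) auto
      also have "\<dots> = \<delta>" unfolding \<delta>_def h3 using u1 by (simp add: power_divide)
      finally show ?thesis .
    qed
    have tay: "\<bar>M3_approx n 0 (u + t) - (M3_approx n 0 u + M3_approx n 1 u * t + M3_approx n 2 u / 2 * t\<^sup>2)\<bar> \<le> B * \<bar>t\<bar> ^ 3" if "\<bar>t\<bar> \<le> 2" for t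
      by (rule M3_approx_taylor[OF B(2) u1(3) that])
    have fin: "E / u ^ N * h\<^sup>2 = 10 * (B * h ^ 3) + 4 * \<delta>"
    proof -
      have "E / u ^ N = E * h" by (simp add: h_def)
      then show ?thesis unfolding E_def \<delta>_def by (simp add: power2_eq_square power3_eq_cube algebra_simps)
    qed
    have core: "\<bar>(M3 (u + 2 * t) - 2 * M3 (u + t) + M3 u) - t\<^sup>2 * M3_approx n 2 u\<bar> \<le> E / u ^ N * h\<^sup>2" if t: "\<bar>t\<bar> = h" for t
    proof -
      have t2: "\<bar>2 * t\<bar> \<le> 2" "\<bar>t\<bar> \<le> 2" using t h by (auto simp: abs_mult)
      have b: "\<bar>M3_approx n 0 (u + 2 * t) - (M3_approx n 0 u + M3_approx n 1 u * (2 * t) + M3_approx n 2 u / 2 * (2 * t)\<^sup>2)\<bar> \<le> 8 * (B * h ^ 3)"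
        using tay[OF t2(1)] t by (simp add: abs_mult power_mult_distrib)
      have c: "\<bar>M3_approx n 0 (u + t) - (M3_approx n 0 u + M3_approx n 1 u * t + M3_approx n 2 u / 2 * t\<^sup>2)\<bar> \<le> B * h ^ 3"
        using tay[OF t2(2)] t by simp
      have r: "\<bar>M3 (u + 2 * t) - M3_approx n 0 (u + 2 * t)\<bar> \<le> \<delta>" "\<bar>M3 (u + t) - M3_approx n 0 (u + t)\<bar> \<le> \<delta>" "\<bar>M3 u - M3_approx n 0 u\<bar> \<le> \<delta>"
        using t2 by (auto intro!: rho)
      have "\<bar>(m2 - 2 * m1 + m0) - t\<^sup>2 * z\<bar> \<le> 10 * w + 4 * \<delta>"
        if "\<bar>m2 - x2\<bar> \<le> \<delta>" "\<bar>m1 - x1\<bar> \<le> \<delta>" "\<bar>m0 - x0\<bar> \<le> \<delta>"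
          "\<bar>x2 - (x0 + y * (2 * t) + z / 2 * (2 * t)\<^sup>2)\<bar> \<le> 8 * w" "\<bar>x1 - (x0 + y * t + z / 2 * t\<^sup>2)\<bar> \<le> w" for m0 m1 m2 x0 x1 x2 y z w :: real
      proof -
        have e: "y * (2 * t) = 2 * (y * t)" "z / 2 * (2 * t)\<^sup>2 = 4 * (z / 2 * t\<^sup>2)" "t\<^sup>2 * z = 2 * (z / 2 * t\<^sup>2)"
          by (simp_all add: power_mult_distrib)
        show ?thesis using that unfolding e by linarith
      qed
      from this[OF r b c] show ?thesis unfolding fin .
    qed
    have up: "h\<^sup>2 * S3 u \<le> h\<^sup>2 * M3_approx n 2 u + E / u ^ N * h\<^sup>2"
      using S3_M3(1)[OF h(1), of u] core[of h] h by linarith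
    have dn: "h\<^sup>2 * M3_approx n 2 u - E / u ^ N * h\<^sup>2 \<le> h\<^sup>2 * S3 u"
    proof -
      have "u - 2 * h + 2 * h = u" "u - 2 * h + h = u + - h" "u - 2 * h = u + 2 * - h" by simp_all
      then have "M3 u - 2 * M3 (u + - h) + M3 (u + 2 * - h) \<le> h\<^sup>2 * S3 u"
        using S3_M3(2)[OF h(1), of "u - 2 * h"] by (simp only:)
      then show ?thesis using core[of "- h"] h by simp
    qed
    have "\<bar>h\<^sup>2 * (S3 u - M3_approx n 2 u)\<bar> \<le> h\<^sup>2 * (E / u ^ N)"
      using up dn by (simp add: right_diff_distrib abs_le_iff mult.commute)
    then have "h\<^sup>2 * \<bar>S3 u - M3_approx n 2 u\<bar> \<le> h\<^sup>2 * (E / u ^ N)" by (simp only: abs_mult abs_power2)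
    then show ?thesis by (rule mult_left_le_imp_le) (use h in simp)
  qed
  then show ?thesis using CU(2) unfolding n_def K_def by (intro exI[of _ E] exI[of _ "U + 4"]) auto
qed

text \<open>The signs (-1)^j of the Taylor coefficients cancel those in \<open>dp\<close>; in
  \<open>dq\<close> the sign is one step further on, hence the minus before the last sum.\<close>

lemma M3_approx_2_eq:
  assumes "u > 0"
  shows "M3_approx n 2 u = (ln u + mertens_const) ^ 3 - 3 * zeta 2 * (ln u + mertens_const) + 2 * zeta 3
     + (\<Sum>j<n. 6 * (mom err j * (ln u + mertens_const - harm j)) / u ^ Suc j)
     - (\<Sum>j<n. 3 * (real (Suc j) * mom (conv err err) j) / u ^ Suc (Suc j))"
proof -
  have sg: "(- 1) ^ j * (- 1) ^ j = (1::real)" for j by (simp flip: power_mult_distrib)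
  have A: "3 * ((- 1) ^ j / fact j * dp (j + 2) u * mom err j) = 6 * (mom err j * (ln u + mertens_const - harm j)) / u ^ Suc j" for j
  proof -
    have "3 * ((- 1) ^ j / fact j * dp (j + 2) u * mom err j) = ((- 1) ^ j * (- 1) ^ j) * (6 * (mom err j * (ln u + mertens_const - harm j)) / u ^ Suc j)"
      by (simp add: numeral_2_eq_2)
    then show ?thesis unfolding sg by simp
  qed
  have B: "3 * ((- 1) ^ j / fact j * dq (j + 2) u * mom (conv err err) j) = - (3 * (real (Suc j) * mom (conv err err) j) / u ^ Suc (Suc j))" for j
  proof -
    have "3 * ((- 1) ^ j / fact j * dq (j + 2) u * mom (conv err err) j) = ((- 1) ^ j * (- 1) ^ j) * (- (3 * (real (Suc j) * mom (conv err err) j) / u ^ Suc (Suc j)))"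
      by (simp add: numeral_2_eq_2 del: of_nat_Suc)
    then show ?thesis unfolding sg by simp
  qed
  show ?thesis unfolding M3_approx_def sum_distrib_left A B
    by (simp add: p3d_def Let_def sum_negf)
qed

section \<open>The constants \<open>\<alpha>\<^sub>j\<close> as moments\<close>

text \<open>Partial summation writes the sum of (ln p)^j/p through \<open>msum u\<close> and the
  integral of v^(j-1) \<open>msum\<close>. The share of \<open>qfun\<close> in that integral is
  explicit and cancels against u^j/j, leaving only \<open>err\<close>.\<close>

lemma alpha_finite_identity:
  assumes j: "j > 0" and u: "u > 0"
  shows "1 / real j * (u ^ j / real j - (\<Sum>p\<in>pset u. ln (real p) ^ j / real p))
     = (\<integral>v. indicator {..u} v * (v ^ (j - 1) * err v) \<partial>lborel) - u ^ j * err u / real j"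
proof -
  define l where "l = ln u + mertens_const"
  obtain i where i: "j = Suc i" using j gr0_implies_Suc by blast
  have hm: "has_bochner_integral lborel (\<lambda>v. indicator {..u} v * (v ^ i * msum v)) (\<Sum>p\<in>pset u. 1 / real p * ((u ^ j - ln (real p) ^ j) / real j))"
  proof -
    have "has_bochner_integral lborel (\<lambda>v. \<Sum>p\<in>pset u. 1 / real p * (indicator {ln (real p)..u} v * v ^ i)) (\<Sum>p\<in>pset u. 1 / real p * ((u ^ j - ln (real p) ^ j) / real j))"
    proof (intro has_bochner_integral_sum has_bochner_integral_mult_right has_bochner_integral_of_has_integral)
      fix p assume p: "p \<in> pset u"
      then have lp: "0 < ln (real p)" "ln (real p) \<le> u" using ln_prime_pos by (auto simp: pset_def)
      show "0 \<le> v ^ i" if "v \<in> {ln (real p)..u}" for v using that lp by simp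
      have "((\<lambda>v. v ^ i) has_integral u ^ Suc i / real (Suc i) - ln (real p) ^ Suc i / real (Suc i)) {ln (real p)..u}"
      proof (rule fundamental_theorem_of_calculus[OF lp(2)])
        fix x :: real
        have "((\<lambda>w. w ^ Suc i / real (Suc i)) has_real_derivative (real (Suc i) * x ^ (Suc i - Suc 0)) / real (Suc i)) (at x within {ln (real p)..u})"
          by (intro DERIV_cdivide DERIV_pow)
        then show "((\<lambda>w. w ^ Suc i / real (Suc i)) has_vector_derivative x ^ i) (at x within {ln (real p)..u})"
          by (simp add: has_real_derivative_iff_has_vector_derivative del: of_nat_Suc)
      qed
      then show "((\<lambda>v. v ^ i) has_integral (u ^ j - ln (real p) ^ j) / real j) {ln (real p)..u}"
        by (simp only: i diff_divide_distrib)
    qed auto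
    moreover have "(\<lambda>v. \<Sum>p\<in>pset u. 1 / real p * (indicator {ln (real p)..u} v * v ^ i)) = (\<lambda>v. indicator {..u} v * (v ^ i * msum v))"
    proof
      fix v
      show "(\<Sum>p\<in>pset u. 1 / real p * (indicator {ln (real p)..u} v * v ^ i)) = indicator {..u} v * (v ^ i * msum v)"
      proof (cases "v \<le> u")
        case True
        then show ?thesis using msum_pset[OF True] by (simp add: sum_distrib_left indicator_def mult_ac)
      qed simp
    qed
    ultimately show ?thesis by (simp only:)
  qed
  have hq: "has_bochner_integral lborel (\<lambda>v. indicator {..u} v * (v ^ i * qfun v)) (u ^ j * (l / real j - 1 / real j ^ 2))"
  proof -
    have hb0: "has_bochner_integral lborel (\<lambda>w::real. u ^ i * (l * (indicator {0..1} w * (w ^ i * (- ln w) ^ 0)) - indicator {0..1} w * (w ^ i * (- ln w) ^ 1)))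
       (u ^ i * (l * (fact 0 / real (i + 1) ^ (0 + 1)) - fact 1 / real (i + 1) ^ (1 + 1)))"
      by (intro has_bochner_integral_mult_right has_bochner_integral_diff integral_power_ln)
    have ae0: "AE w in lborel. u ^ i * (l * (indicator {0..1} w * (w ^ i * (- ln w) ^ 0)) - indicator {0..1} w * (w ^ i * (- ln w) ^ 1))
       = indicator {..u} (0 + u * w) * ((0 + u * w) ^ i * qfun (0 + u * w))"
      using AE_lborel_singleton[of "0::real"]
    proof eventually_elim
      case (elim w)
      consider "w < 0" | "0 < w" "w \<le> 1" | "w > 1" using elim by linarith
      then show ?case
      proof cases
        case 1
        then have "\<not> u * w > 0" using u by (simp add: zero_less_mult_iff)
        then show ?thesis using 1 by (simp add: qfun_def)
      next
        case 2
        then have "u * w \<le> u" "u * w > 0" using u by auto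
        then show ?thesis using 2 u by (simp add: qfun_def l_def ln_mult power_mult_distrib algebra_simps)
      next
        case 3
        then have "\<not> u * w \<le> u" using u by simp
        then show ?thesis using 3 by simp
      qed
    qed
    have [measurable]: "qfun \<in> borel_measurable borel" by (rule loc2_measurable[OF loc2_qfun])
    have hb1: "has_bochner_integral lborel (\<lambda>w. indicator {..u} (0 + u * w) * ((0 + u * w) ^ i * qfun (0 + u * w)))
       (u ^ i * (l * (fact 0 / real (i + 1) ^ (0 + 1)) - fact 1 / real (i + 1) ^ (1 + 1)))"
      by (rule has_bochner_integral_cong_AE[THEN iffD1, OF _ _ ae0 hb0]) measurable
    have v: "u ^ i * (l * (fact 0 / real (i + 1) ^ (0 + 1)) - fact 1 / real (i + 1) ^ (1 + 1)) = (u ^ j * (l / real j - 1 / real j ^ 2)) /\<^sub>R \<bar>u\<bar>"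
      using u by (simp add: i power2_eq_square divide_inverse)
    show ?thesis
      using lborel_has_bochner_integral_real_affine_iff[of u "\<lambda>v. indicator {..u} v * (v ^ i * qfun v)" "u ^ j * (l / real j - 1 / real j ^ 2)" 0] hb1 u
      unfolding v by blast
  qed
  have "has_bochner_integral lborel (\<lambda>v. indicator {..u} v * (v ^ i * msum v) - indicator {..u} v * (v ^ i * qfun v))
     ((\<Sum>p\<in>pset u. 1 / real p * ((u ^ j - ln (real p) ^ j) / real j)) - u ^ j * (l / real j - 1 / real j ^ 2))"
    by (rule has_bochner_integral_diff[OF hm hq])
  moreover have "indicator {..u} v * (v ^ i * msum v) - indicator {..u} v * (v ^ i * qfun v) = indicator {..u} v * (v ^ i * err v)" for v
    by (simp add: msum_eq algebra_simps)
  ultimately have I: "(\<integral>v. indicator {..u} v * (v ^ i * err v) \<partial>lborel) = (\<Sum>p\<in>pset u. 1 / real p * ((u ^ j - ln (real p) ^ j) / real j)) - u ^ j * (l / real j - 1 / real j ^ 2)"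
    using has_bochner_integral_integral_eq by (simp only:)
  define S where "S = (\<Sum>p\<in>pset u. ln (real p) ^ j / real p)"
  have "(\<Sum>p\<in>pset u. 1 / real p * ((u ^ j - ln (real p) ^ j) / real j)) = (u ^ j * msum u - S) / real j"
    unfolding S_def msum_def pset_def[symmetric] sum_distrib_left sum_subtractf[symmetric] sum_divide_distrib
    by (intro sum.cong refl) (simp add: diff_divide_distrib mult.commute)
  moreover have "msum u = l + err u" using u by (simp add: err_def l_def)
  ultimately have "(\<integral>v. indicator {..u} v * (v ^ i * err v) \<partial>lborel) = (u ^ j * (l + err u) - S) / real j - u ^ j * (l / real j - 1 / real j ^ 2)"
    unfolding I by simp
  moreover have "1 / real j * (u ^ j / real j - S) = ((u ^ j * (l + err u) - S) / real j - u ^ j * (l / real j - 1 / real j ^ 2)) - u ^ j * err u / real j"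
    using j by (simp add: power2_eq_square field_simps)
  ultimately show ?thesis unfolding S_def i by simp
qed

text \<open>The boundary term of \<open>alpha_finite_identity\<close> vanishes by rapid decay and
  the truncated moments converge. This also shows that the limit exists, which gives meaning to
  \<open>Lim\<close> in \<open>alpha\<close>.\<close>

lemma alpha_eq:
  assumes j: "j > 0"
  shows "alpha j = mom err (j - 1)"
proof -
  let ?J = "\<lambda>u. \<integral>v. indicator {..u} v * (v ^ (j - 1) * err v) \<partial>lborel"
  have J: "(?J \<longlongrightarrow> mom err (j - 1)) at_top"
    unfolding mom_def
  proof (rule integral_dominated_convergence_at_top[where w = "\<lambda>v. \<bar>v ^ (j - 1) * err v\<bar>"])
    show "integrable lborel (\<lambda>v. \<bar>v ^ (j - 1) * err v\<bar>)" by (intro integrable_abs rapid_moment_integrable rapid_err)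
    show "\<forall>\<^sub>F u in at_top. AE v in lborel. norm (indicator {..u} v * (v ^ (j - 1) * err v)) \<le> \<bar>v ^ (j - 1) * err v\<bar>"
      by (intro always_eventually allI AE_I2) (auto simp: indicator_def)
    show "AE v in lborel. ((\<lambda>u. indicator {..u} v * (v ^ (j - 1) * err v)) \<longlongrightarrow> v ^ (j - 1) * err v) at_top"
    proof (rule AE_I2)
      fix v :: real
      have "\<forall>\<^sub>F u in at_top. v ^ (j - 1) * err v = indicator {..u} v * (v ^ (j - 1) * err v)"
        using eventually_ge_at_top[of v] by eventually_elim simp
      then show "((\<lambda>u. indicator {..u} v * (v ^ (j - 1) * err v)) \<longlongrightarrow> v ^ (j - 1) * err v) at_top"
        by (rule Lim_transform_eventually[OF tendsto_const])
    qed
  qed measurable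
  obtain C U where CU: "0 \<le> C" "1 \<le> U" "\<And>v. v \<ge> U \<Longrightarrow> \<bar>err v\<bar> \<le> C / v ^ Suc j"
    using rapidE[OF rapid_err] by blast
  have E: "((\<lambda>u. u ^ j * err u / real j) \<longlongrightarrow> 0) at_top"
  proof (rule Lim_null_comparison)
    show "\<forall>\<^sub>F u in at_top. norm (u ^ j * err u / real j) \<le> C * inverse u"
      using eventually_ge_at_top[of U]
    proof eventually_elim
      case (elim u)
      have u: "u > 0" using elim CU(2) by linarith
      have "norm (u ^ j * err u / real j) \<le> u ^ j * \<bar>err u\<bar> / 1"
        using j u unfolding real_norm_def abs_divide abs_mult by (intro frac_le) auto
      also have "\<dots> \<le> u ^ j * (C / u ^ Suc j)" unfolding div_by_1 by (intro mult_left_mono CU(3)[OF elim]) (use u in simp)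
      also have "\<dots> = C * inverse u" using u by (simp add: field_simps)
      finally show ?case .
    qed
    show "((\<lambda>u. C * inverse u) \<longlongrightarrow> 0) at_top"
      using tendsto_mult[OF tendsto_const tendsto_inverse_0_at_top[OF filterlim_ident], of C] by simp
  qed
  have "((\<lambda>u. ?J u - u ^ j * err u / real j) \<longlongrightarrow> mom err (j - 1) - 0) at_top"
    by (intro tendsto_diff J E)
  from filterlim_compose[OF this ln_at_top]
  have L: "((\<lambda>x. ?J (ln x) - ln x ^ j * err (ln x) / real j) \<longlongrightarrow> mom err (j - 1)) at_top" by simp
  have "\<forall>\<^sub>F x in at_top. ?J (ln x) - ln x ^ j * err (ln x) / real j =
     1 / real j * (ln x ^ j / real j - (\<Sum>p | prime p \<and> real p \<le> x. ln (real p) ^ j / real p))"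
    using eventually_gt_at_top[of 1]
  proof eventually_elim
    case (elim x)
    have "{p. prime p \<and> real p \<le> x} = pset (ln x)"
      unfolding pset_def using elim by (auto simp: prime_gt_0_nat)
    then show ?case using alpha_finite_identity[OF j, of "ln x"] elim by simp
  qed
  from Lim_transform_eventually[OF L this] show ?thesis
    unfolding alpha_def by (intro tendsto_Lim) auto
qed

section \<open>Triples with repeated primes\<close>

lemma power_le_fact_exp:
  fixes x :: real
  assumes "x \<ge> 0"
  shows "x ^ j \<le> fact j * exp x"
proof -
  have s: "(\<lambda>n. x ^ n /\<^sub>R fact n) sums exp x" by (rule exp_converges)
  have "(\<Sum>n\<in>{j}. x ^ n /\<^sub>R fact n) \<le> (\<Sum>n. x ^ n /\<^sub>R fact n)"
    by (rule sum_le_suminf[OF sums_summable[OF s]]) (use assms in auto)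
  also have "(\<Sum>n. x ^ n /\<^sub>R fact n) = exp x" using s by (simp add: sums_iff)
  finally have "x ^ j / fact j \<le> exp x" by (simp add: divide_inverse mult.commute)
  then show ?thesis by (simp add: pos_divide_le_eq mult.commute)
qed

definition wt :: "nat \<Rightarrow> nat \<Rightarrow> real" where
  "wt k n = (if prime n then 1 / real n ^ k else 0)"

lemma wt_nonneg: "wt k n \<ge> 0" by (simp add: wt_def)

text \<open>y^j \<le> j! e^y with y = (ln n)/2 absorbs the logarithms into n^(1/2), against at least
  n^(-2).\<close>

lemma summable_wt_ln:
  assumes "k \<ge> 2"
  shows "summable (\<lambda>n. wt k n * ln (real n) ^ j)"
proof (rule summable_comparison_test[of _ "\<lambda>n. (fact j * 2 ^ j) * real n powr (- (3 / 2))"])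
  have "norm (wt k n * ln (real n) ^ j) \<le> (fact j * 2 ^ j) * real n powr (- (3 / 2))" for n
  proof (cases "prime n")
    case True
    have n: "real n \<ge> 1" using prime_ge_1_nat[OF True] by simp
    have "(ln (real n) / 2) ^ j \<le> fact j * exp (ln (real n) / 2)" using n by (intro power_le_fact_exp) simp
    also have "exp (ln (real n) / 2) = real n powr (1 / 2)" using n by (simp add: powr_def)
    finally have "ln (real n) ^ j \<le> fact j * 2 ^ j * real n powr (1 / 2)" by (simp add: power_divide field_simps)
    then have "(1 / real n ^ k) * ln (real n) ^ j \<le> (1 / real n ^ 2) * (fact j * 2 ^ j * real n powr (1 / 2))"
      using n assms by (intro mult_mono divide_left_mono power_increasing) auto
    also have "\<dots> = (fact j * 2 ^ j) * (real n powr (1 / 2) / real n powr 2)" using n by (simp add: powr_numeral)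
    also have "real n powr (1 / 2) / real n powr 2 = real n powr (- (3 / 2))" by (subst powr_diff[symmetric]) simp
    finally show ?thesis using True n by (simp add: wt_def)
  qed (simp add: wt_def)
  then show "\<exists>N. \<forall>n\<ge>N. norm (wt k n * ln (real n) ^ j) \<le> (fact j * 2 ^ j) * real n powr (- (3 / 2))" by blast
  show "summable (\<lambda>n. (fact j * 2 ^ j) * real n powr (- (3 / 2)))"
    by (intro summable_mult) (simp add: summable_real_powr_iff)
qed

lemma infsum_prime_suminf:
  fixes f :: "nat \<Rightarrow> real"
  assumes sm: "summable (\<lambda>n. if prime n then f n else 0)" and nn: "\<And>n. prime n \<Longrightarrow> f n \<ge> 0"
  shows "(\<Sum>\<^sub>\<infinity>p\<in>{p. prime p}. f p) = (\<Sum>n. if prime n then f n else 0)"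
proof -
  let ?g = "\<lambda>n. if prime n then f n else 0"
  have eq: "norm (?g n) = ?g n" for n using nn by simp
  have "(?g has_sum suminf ?g) UNIV"
    by (rule norm_summable_imp_has_sum) (use sm in \<open>simp_all only: eq summable_sums\<close>)
  then have "suminf ?g = infsum ?g UNIV" by (simp add: infsumI)
  also have "\<dots> = (\<Sum>\<^sub>\<infinity>p\<in>{p. prime p}. f p)" by (rule infsum_cong_neutral) auto
  finally show ?thesis by simp
qed

lemma prime_zeta_eq:
  assumes "k \<ge> 2"
  shows "prime_zeta (real k) = (\<Sum>n. wt k n)"
proof -
  have eq: "(if prime n then real n powr (- real k) else 0) = wt k n" for n
    by (auto simp: wt_def powr_minus powr_realpow prime_gt_0_nat divide_inverse)
  have "summable (wt k)" using summable_wt_ln[OF assms, of 0] by simp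
  then have "(\<Sum>\<^sub>\<infinity>p\<in>{p. prime p}. real p powr (- real k)) = (\<Sum>n. if prime n then real n powr (- real k) else 0)"
    by (intro infsum_prime_suminf) (simp_all add: eq)
  then show ?thesis by (simp add: prime_zeta_def eq)
qed

lemma alpha_pow_eq: "alpha_pow j 2 = (\<Sum>n. wt 2 n * ln (real n) ^ j)"
proof -
  have eq: "(if prime n then ln (real n) ^ j / real n powr 2 else 0) = wt 2 n * ln (real n) ^ j" for n
    by (auto simp: wt_def powr_numeral prime_gt_0_nat)
  have "(\<Sum>\<^sub>\<infinity>p\<in>{p. prime p}. ln (real p) ^ j / real p powr 2) = (\<Sum>n. if prime n then ln (real n) ^ j / real n powr 2 else 0)"
  proof (rule infsum_prime_suminf)
    show "summable (\<lambda>n. if prime n then ln (real n) ^ j / real n powr 2 else 0)" unfolding eq by (rule summable_wt_ln) simp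
    show "0 \<le> ln (real n) ^ j / real n powr 2" if "prime n" for n using ln_prime_pos[OF that] by simp
  qed
  then show ?thesis by (simp add: alpha_pow_def eq)
qed

text \<open>The tail of the series is dominated by a geometric one with ratio at most 1/2, whence
  the factor 2.\<close>

lemma ln_remainder:
  fixes x :: real
  assumes x: "0 \<le> x" "x \<le> 1 / 2" and N: "N \<ge> 1"
  shows "\<bar>ln (1 - x) + (\<Sum>j=1..<N. x ^ j / real j)\<bar> \<le> 2 * x ^ N"
proof -
  have "(\<lambda>n. - ((- (- x)) ^ n) / real n) sums ln (1 + (- x))" by (rule ln_series') (use x in auto)
  from sums_minus[OF this] have s: "(\<lambda>n. x ^ n / real n) sums (- ln (1 - x))" by simp
  have ss: "(\<lambda>i. x ^ (i + N) / real (i + N)) sums (- ln (1 - x) - (\<Sum>i<N. x ^ i / real i))"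
    by (rule sums_split_initial_segment[OF s])
  have g: "(\<lambda>i. x ^ N * x ^ i) sums (x ^ N * (1 / (1 - x)))" by (intro sums_mult geometric_sums) (use x in auto)
  have "- ln (1 - x) - (\<Sum>i<N. x ^ i / real i) \<le> x ^ N * (1 / (1 - x))"
  proof (rule sums_le[OF _ ss g])
    fix i
    have "x ^ (i + N) / real (i + N) \<le> x ^ (i + N) / 1" using x N by (intro divide_left_mono) auto
    then show "x ^ (i + N) / real (i + N) \<le> x ^ N * x ^ i" by (simp add: power_add mult.commute)
  qed
  also have "\<dots> \<le> x ^ N * 2" using x by (intro mult_left_mono) (auto simp: pos_divide_le_eq)
  finally have 1: "- ln (1 - x) - (\<Sum>i<N. x ^ i / real i) \<le> 2 * x ^ N" by simp
  have 2: "0 \<le> - ln (1 - x) - (\<Sum>i<N. x ^ i / real i)" by (rule sums_le[OF _ sums_zero ss]) (use x in auto)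
  have "(\<Sum>i<N. x ^ i / real i) = (\<Sum>j=1..<N. x ^ j / real j)"
    by (rule sum.mono_neutral_right) auto
  then show ?thesis using 1 2 by linarith
qed

text \<open>The sum of 1/(p q^2) over pairs of primes with p q^2 \<le> e^u, the case p = q
  included.\<close>

definition S12 :: "real \<Rightarrow> real" where
  "S12 u = (\<Sum>q\<in>pset u. 1 / real q ^ 2 * msum (u - 2 * ln (real q)))"

text \<open>ln (u - 2 ln q) = ln u + ln (1 - x) with x = 2 (ln q)/u. For x \<le> 1/2 the logarithm
  is expanded; for x > 1/2 crude bounds suffice, paid for with powers of ln q, which the weight
  1/q^2 tolerates.\<close>

lemma S12_asymp:
  assumes N: "N \<ge> 1"
  shows "\<exists>C U. 1 \<le> U \<and> (\<forall>u\<ge>U. \<bar>S12 u - (prime_zeta 2 * (ln u + mertens_const) - (\<Sum>j=1..<N. 2 ^ j * alpha_pow j 2 / (real j * u ^ j)))\<bar> \<le> C / u ^ N)"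
proof -
  obtain E where E: "E > 0" "\<And>u. u \<ge> 4 \<Longrightarrow> \<bar>err u\<bar> \<le> E / u ^ N" using err_bound[of N] by blast
  obtain L where L: "L > 0" "\<And>x. x \<ge> 1 \<Longrightarrow> \<bar>ln x + mertens_const\<bar> \<le> L * x" using ell_square_le by metis
  \<comment> \<open>The terms 2 + E 2^N serve x \<le> 1/2, the last term serves x > 1/2.\<close>
  define D where "D = 2 + E * 2 ^ N + (2 * L + E + real N) * 2 ^ (N + 1)"
  \<comment> \<open>N + 1 and not N: for x > 1/2 the crude bound is of order u, so one more factor
    2x is spent.\<close>
  define W where "W = (\<Sum>n. wt 2 n * (1 + (2 * ln (real n)) ^ (N + 1)))"
  have smW: "summable (\<lambda>n. wt 2 n * (1 + (2 * ln (real n)) ^ (N + 1)))"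
  proof -
    have "summable (\<lambda>n. wt 2 n * ln (real n) ^ 0 + 2 ^ (N + 1) * (wt 2 n * ln (real n) ^ (N + 1)))"
      by (intro summable_add summable_mult summable_wt_ln) auto
    then show ?thesis by (simp add: distrib_left power_mult_distrib mult_ac)
  qed
  have "\<bar>S12 u - (prime_zeta 2 * (ln u + mertens_const) - (\<Sum>j=1..<N. 2 ^ j * alpha_pow j 2 / (real j * u ^ j)))\<bar> \<le> (D * W) / u ^ N"
    if u: "u \<ge> 8" for u
  proof -
    define l where "l = ln u + mertens_const"
    define T where "T = (\<lambda>n. msum (u - 2 * ln (real n)) - (l - (\<Sum>j=1..<N. (2 * ln (real n)) ^ j / (real j * u ^ j))))"
    have u0: "u > 0" by (use u in simp)
    have Tb: "\<bar>T n\<bar> \<le> D * (1 + (2 * ln (real n)) ^ (N + 1)) / u ^ N" if pn: "prime n" for n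
    proof -
      define f where "f = 2 * ln (real n)"
      define x where "x = f / u"
      have f0: "f > 0" using ln_prime_pos[OF pn] by (simp add: f_def)
      have x0: "x > 0" using f0 u0 by (simp add: x_def)
      have sx: "(\<Sum>j=1..<N. f ^ j / (real j * u ^ j)) = (\<Sum>j=1..<N. x ^ j / real j)"
        by (intro sum.cong refl) (simp add: x_def power_divide mult.commute)
      have Teq: "T n = msum (u - f) - (l - (\<Sum>j=1..<N. x ^ j / real j))" unfolding T_def f_def[symmetric] sx ..
      have fN: "f ^ N \<le> 1 + f ^ (N + 1)" "f ^ (N + 1) \<le> 1 + f ^ (N + 1)" "1 \<le> 1 + f ^ (N + 1)"
      proof -
        show "f ^ N \<le> 1 + f ^ (N + 1)"
        proof (cases "f \<le> 1")
          case True
          then have "f ^ N \<le> 1" using f0 by (simp add: power_le_one)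
          then show ?thesis using f0 by (simp add: add_increasing2)
        next
          case False
          then have "f ^ N \<le> f ^ (N + 1)" by (intro power_increasing) auto
          then show ?thesis by simp
        qed
      qed (use f0 in auto)
      show ?thesis
      proof (cases "f \<le> u / 2")
        case True
        define y where "y = u - f"
        have y: "y \<ge> u / 2" "y \<ge> 4" using True u by (auto simp: y_def field_simps)
        have x2: "x \<le> 1 / 2" using True u0 by (simp add: x_def field_simps)
        have "y = u * (1 - x)" using u0 by (simp add: y_def x_def field_simps)
        then have "ln y = ln u + ln (1 - x)" using u0 x2 by (simp add: ln_mult)
        then have "msum y = l + ln (1 - x) + err y" using y by (simp add: err_def l_def)
        then have "T n = (ln (1 - x) + (\<Sum>j=1..<N. x ^ j / real j)) + err y" unfolding Teq y_def[symmetric] by simp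
        then have "\<bar>T n\<bar> \<le> \<bar>ln (1 - x) + (\<Sum>j=1..<N. x ^ j / real j)\<bar> + \<bar>err y\<bar>" using abs_triangle_ineq by simp
        also have "\<dots> \<le> 2 * x ^ N + E / y ^ N" by (intro add_mono ln_remainder E) (use x0 x2 N y in auto)
        also have "E / y ^ N \<le> E / (u / 2) ^ N" using y u0 E by (intro divide_left_mono power_mono mult_pos_pos zero_less_power) auto
        also have "2 * x ^ N + E / (u / 2) ^ N = (2 * f ^ N + (E * 2 ^ N) * 1) / u ^ N"
          by (simp add: x_def power_divide add_divide_distrib)
        also have "\<dots> \<le> (2 * (1 + f ^ (N + 1)) + (E * 2 ^ N) * (1 + f ^ (N + 1))) / u ^ N"
          using fN u0 E by (intro divide_right_mono add_mono mult_left_mono) auto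
        also have "\<dots> = ((2 + E * 2 ^ N) * (1 + f ^ (N + 1))) / u ^ N" by (simp only: distrib_right)
        also have "\<dots> \<le> (D * (1 + f ^ (N + 1))) / u ^ N"
          using fN(3) u0 L(1) E(1) by (intro divide_right_mono mult_right_mono) (auto simp: D_def)
        finally show ?thesis by (simp add: f_def)
      next
        case False
        have x2: "1 \<le> 2 * x" using False u0 by (simp add: x_def field_simps)
        have m: "0 \<le> msum (u - f)" "msum (u - f) \<le> msum u" using f0 by (auto intro: msum_mono msum_nonneg)
        have "msum u = l + err u" using u0 by (simp add: err_def l_def)
        moreover have "\<bar>err u\<bar> \<le> E"
        proof -
          have "E / u ^ N \<le> E / 1" using u E(1) by (intro divide_left_mono) (auto simp: one_le_power)
          then show ?thesis using E(2)[of u] u by simp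
        qed
        moreover have lL: "\<bar>l\<bar> \<le> L * u" using L(2)[of u] u by (simp add: l_def)
        ultimately have mu: "msum u \<le> L * u + E" by linarith
        have sb: "\<bar>\<Sum>j=1..<N. x ^ j / real j\<bar> \<le> real N * (2 * x) ^ (N + 1)"
        proof -
          have "\<bar>\<Sum>j=1..<N. x ^ j / real j\<bar> \<le> (\<Sum>j=1..<N. \<bar>x ^ j / real j\<bar>)" by (rule sum_abs)
          also have "\<dots> \<le> (\<Sum>j=1..<N. (2 * x) ^ (N + 1))"
          proof (rule sum_mono)
            fix j assume j: "j \<in> {1..<N}"
            have "\<bar>x ^ j / real j\<bar> \<le> x ^ j / 1" using x0 j by (simp, intro divide_left_mono[of 1 "real j" "x ^ j", simplified]) auto
            also have "\<dots> \<le> (2 * x) ^ j" using x0 by (simp add: power_mono)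
            also have "\<dots> \<le> (2 * x) ^ (N + 1)" using x2 j by (intro power_increasing) auto
            finally show "\<bar>x ^ j / real j\<bar> \<le> (2 * x) ^ (N + 1)" .
          qed
          also have "\<dots> = real (N - 1) * (2 * x) ^ (N + 1)" by simp
          also have "\<dots> \<le> real N * (2 * x) ^ (N + 1)" using x0 by (intro mult_right_mono) auto
          finally show ?thesis .
        qed
        have p1: "1 \<le> (2 * x) ^ (N + 1)" using x2 by (rule one_le_power)
        have tri: "\<bar>mm - (l - s)\<bar> \<le> a + b + c" if "0 \<le> mm" "mm \<le> a" "\<bar>l\<bar> \<le> b" "\<bar>s\<bar> \<le> c" for mm l s a b c :: real
          using that by linarith
        have "\<bar>T n\<bar> \<le> (L * u + E) + L * u + real N * (2 * x) ^ (N + 1)"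
          unfolding Teq by (rule tri[OF m(1) order_trans[OF m(2) mu] lL sb])
        also have "\<dots> = (2 * L * u + E) * 1 + real N * (2 * x) ^ (N + 1)" by simp
        also have "\<dots> \<le> (2 * L * u + E) * (2 * x) ^ (N + 1) + real N * (2 * x) ^ (N + 1)"
          using p1 L(1) E(1) u0 by (intro add_right_mono mult_left_mono) auto
        also have "\<dots> = (2 * L * u + E + real N) * (2 * x) ^ (N + 1)" by (simp only: distrib_right)
        also have "\<dots> \<le> ((2 * L + E + real N) * u) * (2 * x) ^ (N + 1)"
        proof (rule mult_right_mono)
          have "E * 1 \<le> E * u" "real N * 1 \<le> real N * u" using u E(1) by (intro mult_left_mono; simp)+
          then show "2 * L * u + E + real N \<le> (2 * L + E + real N) * u" by (simp add: distrib_right)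
        qed (use x0 in simp)
        also have "\<dots> = ((2 * L + E + real N) * 2 ^ (N + 1)) * f ^ (N + 1) / u ^ N"
          using u0 by (simp add: x_def power_divide power_mult_distrib)
        also have "\<dots> \<le> D * (1 + f ^ (N + 1)) / u ^ N"
          using fN f0 u0 L(1) E(1) by (intro divide_right_mono mult_mono) (auto simp: D_def)
        finally show ?thesis by (simp add: f_def)
      qed
    qed
    have wT: "\<bar>wt 2 n * T n\<bar> \<le> D / u ^ N * (wt 2 n * (1 + (2 * ln (real n)) ^ (N + 1)))" for n
    proof (cases "prime n")
      case True
      have "wt 2 n * \<bar>T n\<bar> \<le> wt 2 n * (D * (1 + (2 * ln (real n)) ^ (N + 1)) / u ^ N)" by (intro mult_left_mono Tb True wt_nonneg)
      then show ?thesis by (simp add: abs_mult wt_nonneg mult_ac)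
    qed (simp add: wt_def)
    have s1: "(\<lambda>n. wt 2 n * msum (u - 2 * ln (real n))) sums S12 u"
    proof -
      have "(\<lambda>n. wt 2 n * msum (u - 2 * ln (real n))) sums (\<Sum>n\<in>pset u. wt 2 n * msum (u - 2 * ln (real n)))"
      proof (rule sums_finite[OF finite_pset])
        fix n assume n: "n \<notin> pset u"
        show "wt 2 n * msum (u - 2 * ln (real n)) = 0"
        proof (cases "prime n")
          case True
          then have "ln (real n) > u" using n by (auto simp: pset_def)
          then have "u - 2 * ln (real n) \<le> 0" using u0 by linarith
          then show ?thesis by (simp add: msum_nonpos)
        qed (simp add: wt_def)
      qed
      moreover have "(\<Sum>n\<in>pset u. wt 2 n * msum (u - 2 * ln (real n))) = S12 u"
        unfolding S12_def by (intro sum.cong refl) (auto simp: wt_def pset_def)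
      ultimately show ?thesis by simp
    qed
    have s2: "(\<lambda>n. wt 2 n * (l - (\<Sum>j=1..<N. (2 * ln (real n)) ^ j / (real j * u ^ j)))) sums
       (prime_zeta 2 * l - (\<Sum>j=1..<N. 2 ^ j * alpha_pow j 2 / (real j * u ^ j)))"
    proof -
      have a: "(\<lambda>n. wt 2 n * ln (real n) ^ j) sums alpha_pow j 2" for j
        unfolding alpha_pow_eq by (intro summable_sums summable_wt_ln) simp
      have z: "(\<lambda>n. wt 2 n) sums prime_zeta 2"
        using summable_sums[OF summable_wt_ln[of 2 0]] prime_zeta_eq[of 2] by simp
      have "(\<lambda>n. wt 2 n * l - (\<Sum>j=1..<N. (2 ^ j / (real j * u ^ j)) * (wt 2 n * ln (real n) ^ j))) sums
        (prime_zeta 2 * l - (\<Sum>j=1..<N. (2 ^ j / (real j * u ^ j)) * alpha_pow j 2))"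
        by (intro sums_diff sums_mult2 z sums_sum sums_mult a)
      then show ?thesis by (simp add: right_diff_distrib sum_distrib_left power_mult_distrib mult_ac)
    qed
    have sT: "(\<lambda>n. wt 2 n * T n) sums (S12 u - (prime_zeta 2 * l - (\<Sum>j=1..<N. 2 ^ j * alpha_pow j 2 / (real j * u ^ j))))"
      using sums_diff[OF s1 s2] unfolding T_def by (simp only: right_diff_distrib[symmetric])
    have smB: "summable (\<lambda>n. D / u ^ N * (wt 2 n * (1 + (2 * ln (real n)) ^ (N + 1))))" by (intro summable_mult smW)
    have "\<bar>\<Sum>n. wt 2 n * T n\<bar> \<le> (\<Sum>n. \<bar>wt 2 n * T n\<bar>)"
      by (rule summable_rabs[OF summable_rabs_comparison_test[OF _ smB]]) (use wT in blast)
    also have "\<dots> \<le> (\<Sum>n. D / u ^ N * (wt 2 n * (1 + (2 * ln (real n)) ^ (N + 1))))"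
      by (rule suminf_le[OF wT summable_rabs_comparison_test[OF _ smB] smB]) (use wT in auto)
    also have "\<dots> = D / u ^ N * W" unfolding W_def by (rule suminf_mult[OF smW])
    finally show ?thesis using sums_unique[OF sT] by (simp add: l_def)
  qed
  then show ?thesis by (intro exI[of _ "D * W"] exI[of _ 8]) auto
qed

definition S0 :: "real \<Rightarrow> real" where
  "S0 u = (\<Sum>q\<in>pset u. 1 / real q ^ 3 * (if 3 * ln (real q) \<le> u then 1 else 0))"

text \<open>Each omitted prime has 1 \<le> 3 (ln q)/u, so any power of this ratio may be
  inserted.\<close>

lemma S0_asymp: "\<exists>C. \<forall>u\<ge>1. \<bar>S0 u - prime_zeta 3\<bar> \<le> C / u ^ N"
proof -
  define W where "W = (\<Sum>n. 3 ^ N * (wt 3 n * ln (real n) ^ N))"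
  have smW: "summable (\<lambda>n. 3 ^ N * (wt 3 n * ln (real n) ^ N))" by (intro summable_mult summable_wt_ln) simp
  have "\<bar>S0 u - prime_zeta 3\<bar> \<le> W / u ^ N" if u: "u \<ge> 1" for u
  proof -
    define T where "T = (\<lambda>n. (if 3 * ln (real n) \<le> u then 1 else 0) - (1::real))"
    have s1: "(\<lambda>n. wt 3 n * (if 3 * ln (real n) \<le> u then 1 else 0)) sums S0 u"
    proof -
      have "(\<lambda>n. wt 3 n * (if 3 * ln (real n) \<le> u then 1 else 0)) sums (\<Sum>n\<in>pset u. wt 3 n * (if 3 * ln (real n) \<le> u then 1 else 0))"
      proof (rule sums_finite[OF finite_pset])
        fix n assume n: "n \<notin> pset u"
        show "wt 3 n * (if 3 * ln (real n) \<le> u then 1 else 0) = 0"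
        proof (cases "prime n")
          case True
          then have "ln (real n) > u" using n by (auto simp: pset_def)
          then show ?thesis using u by simp
        qed (simp add: wt_def)
      qed
      moreover have "(\<Sum>n\<in>pset u. wt 3 n * (if 3 * ln (real n) \<le> u then 1 else 0)) = S0 u"
        unfolding S0_def by (intro sum.cong refl) (auto simp: wt_def pset_def)
      ultimately show ?thesis by simp
    qed
    have z: "(\<lambda>n. wt 3 n * 1) sums prime_zeta 3"
      using summable_sums[OF summable_wt_ln[of 3 0]] prime_zeta_eq[of 3] by simp
    have sT: "(\<lambda>n. wt 3 n * T n) sums (S0 u - prime_zeta 3)"
      using sums_diff[OF s1 z] unfolding T_def by (simp only: right_diff_distrib[symmetric])
    have wT: "\<bar>wt 3 n * T n\<bar> \<le> 1 / u ^ N * (3 ^ N * (wt 3 n * ln (real n) ^ N))" for n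
    proof (cases "prime n \<and> \<not> 3 * ln (real n) \<le> u")
      case True
      have "1 \<le> 3 * ln (real n) / u" using True u by simp
      then have "1 \<le> (3 * ln (real n) / u) ^ N" by (rule one_le_power)
      then have "wt 3 n * 1 \<le> wt 3 n * (3 * ln (real n) / u) ^ N" by (intro mult_left_mono wt_nonneg)
      then show ?thesis using True by (simp add: T_def wt_nonneg power_divide power_mult_distrib mult_ac)
    next
      case False
      have "0 \<le> 1 / u ^ N * (3 ^ N * (wt 3 n * ln (real n) ^ N))"
        using u ln_prime_pos[of n] wt_nonneg[of 3 n] by (cases "prime n") (auto simp: wt_def)
      moreover have "wt 3 n * T n = 0" using False by (auto simp: wt_def T_def)
      ultimately show ?thesis by (simp only: abs_zero)
    qed
    have smB: "summable (\<lambda>n. 1 / u ^ N * (3 ^ N * (wt 3 n * ln (real n) ^ N)))" by (intro summable_mult smW)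
    have "\<bar>\<Sum>n. wt 3 n * T n\<bar> \<le> (\<Sum>n. \<bar>wt 3 n * T n\<bar>)"
      by (rule summable_rabs[OF summable_rabs_comparison_test[OF _ smB]]) (use wT in blast)
    also have "\<dots> \<le> (\<Sum>n. 1 / u ^ N * (3 ^ N * (wt 3 n * ln (real n) ^ N)))"
      by (rule suminf_le[OF wT summable_rabs_comparison_test[OF _ smB] smB]) (use wT in auto)
    also have "\<dots> = 1 / u ^ N * W" unfolding W_def by (rule suminf_mult[OF smW])
    finally show ?thesis using sums_unique[OF sT] by simp
  qed
  then show ?thesis by blast
qed

section \<open>From ordered triples to integers\<close>

definition T3 :: "nat \<Rightarrow> (nat \<times> nat \<times> nat) set" where
  "T3 n = {(p, q, r). prime p \<and> prime q \<and> prime r \<and> p * q * r = n}"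

text \<open>The second component is the squared prime; p = q is allowed, so cubes occur here as
  well.\<close>

definition T2 :: "nat \<Rightarrow> (nat \<times> nat) set" where
  "T2 n = {(p, q). prime p \<and> prime q \<and> p * q ^ 2 = n}"

definition T1 :: "nat \<Rightarrow> nat set" where
  "T1 n = {p. prime p \<and> p ^ 3 = n}"

lemma prime_factorization_3:
  assumes "prime (p::nat)" "prime q" "prime r"
  shows "prime_factorization (p * q * r) = {#p, q, r#}"
proof -
  have "p \<noteq> 0" "q \<noteq> 0" "r \<noteq> 0" using assms by auto
  then show ?thesis using assms
    by (simp add: prime_factorization_mult prime_factorization_prime)
qed

text \<open>Unique factorisation: the ordered triples with product n are the orderings of one
  multiset, which makes them countable by hand.\<close>

lemma prime_triple_iff:
  fixes n a b c p q r :: nat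
  assumes "n > 0" "prime_factorization n = {#a, b, c#}"
  shows "prime p \<and> prime q \<and> prime r \<and> p * q * r = n \<longleftrightarrow> {#p, q, r#} = {#a, b, c#}"
proof
  assume "prime p \<and> prime q \<and> prime r \<and> p * q * r = n"
  then show "{#p, q, r#} = {#a, b, c#}" using prime_factorization_3[of p q r] assms(2) by auto
next
  assume eq: "{#p, q, r#} = {#a, b, c#}"
  have pr: "prime x" if "x \<in># {#a, b, c#}" for x
    using that unfolding assms(2)[symmetric] by (simp add: in_prime_factors_iff)
  have "p \<in># {#a, b, c#}" "q \<in># {#a, b, c#}" "r \<in># {#a, b, c#}" unfolding eq[symmetric] by auto
  then have "prime p" "prime q" "prime r" using pr by blast+
  moreover have "p * q * r = prod_mset {#p, q, r#}" by (simp add: mult.assoc)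
  then have "p * q * r = prod_mset (prime_factorization n)" unfolding eq assms(2) .
  then have "p * q * r = n" using prod_mset_prime_factorization_nat[of n] assms(1) by simp
  ultimately show "prime p \<and> prime q \<and> prime r \<and> p * q * r = n" by blast
qed

lemma mset3_distinct:
  fixes a b c :: nat
  assumes "a \<noteq> b" "a \<noteq> c" "b \<noteq> c"
  shows "{#p, q, r#} = {#a, b, c#} \<longleftrightarrow> (p, q, r) \<in> {(a, b, c), (a, c, b), (b, a, c), (b, c, a), (c, a, b), (c, b, a)}"
proof
  assume eq: "{#p, q, r#} = {#a, b, c#}"
  have "p \<in># {#a, b, c#}" "q \<in># {#a, b, c#}" "r \<in># {#a, b, c#}" unfolding eq[symmetric] by auto
  moreover have "a \<in># {#p, q, r#}" "b \<in># {#p, q, r#}" "c \<in># {#p, q, r#}" unfolding eq by auto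
  ultimately have "p \<in> {a, b, c}" "q \<in> {a, b, c}" "r \<in> {a, b, c}" "a \<in> {p, q, r}" "b \<in> {p, q, r}" "c \<in> {p, q, r}" by auto
  then show "(p, q, r) \<in> {(a, b, c), (a, c, b), (b, a, c), (b, c, a), (c, a, b), (c, b, a)}" using assms by auto
qed (auto simp: add_mset_commute)

lemma mset3_two:
  fixes a c :: nat
  assumes "a \<noteq> c"
  shows "{#p, q, r#} = {#a, a, c#} \<longleftrightarrow> (p, q, r) \<in> {(a, a, c), (a, c, a), (c, a, a)}"
proof
  assume eq: "{#p, q, r#} = {#a, a, c#}"
  have "p \<in># {#a, a, c#}" "q \<in># {#a, a, c#}" "r \<in># {#a, a, c#}" unfolding eq[symmetric] by auto
  then have m: "p \<in> {a, c}" "q \<in> {a, c}" "r \<in> {a, c}" by auto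
  have "count {#p, q, r#} c = 1" unfolding eq using assms by simp
  then show "(p, q, r) \<in> {(a, a, c), (a, c, a), (c, a, a)}" using m assms by (auto split: if_splits)
qed (auto simp: add_mset_commute)

lemma mset3_one:
  fixes a :: nat
  shows "{#p, q, r#} = {#a, a, a#} \<longleftrightarrow> p = a \<and> q = a \<and> r = a"
proof
  assume eq: "{#p, q, r#} = {#a, a, a#}"
  have "p \<in># {#a, a, a#}" "q \<in># {#a, a, a#}" "r \<in># {#a, a, a#}" unfolding eq[symmetric] by auto
  then show "p = a \<and> q = a \<and> r = a" by auto
qed auto

text \<open>The symmetric function identity integer by integer: 6/6 for three distinct primes, 3/6 +
  1/2 for exactly two equal ones, 1/6 + 1/2 + 1/3 for a cube.\<close>

lemma T_count:
  assumes n: "n > 0" and pf: "prime_factorization n = {#a, b, c#}"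
  shows "real (card (T3 n)) / 6 + real (card (T2 n)) / 2 + real (card (T1 n)) / 3 = 1"
proof -
  have T3e: "T3 n = {(p, q, r). {#p, q, r#} = {#a, b, c#}}"
    unfolding T3_def prime_triple_iff[OF n pf] ..
  have T2e: "T2 n = {(p, q). {#p, q, q#} = {#a, b, c#}}"
    unfolding T2_def using prime_triple_iff[OF n pf, of _ "x" "x" for x] by (auto simp: power2_eq_square mult.assoc)
  have T1e: "T1 n = {p. {#p, p, p#} = {#a, b, c#}}"
    unfolding T1_def using prime_triple_iff[OF n pf, of x x x for x] by (auto simp: power3_eq_cube)
  have two: ?thesis if xy: "x \<noteq> y" and eq: "{#a, b, c#} = {#x, x, y#}" for x y
  proof -
    have "T3 n = {(x, x, y), (x, y, x), (y, x, x)}" unfolding T3e eq mset3_two[OF xy] by auto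
    moreover have "T2 n = {(y, x)}" unfolding T2e eq mset3_two[OF xy] using xy by auto
    moreover have "T1 n = {}" unfolding T1e eq mset3_two[OF xy] using xy by auto
    ultimately show ?thesis using xy by simp
  qed
  consider "a = b" "b = c" | "a = b" "a \<noteq> c" | "a = c" "a \<noteq> b" | "b = c" "a \<noteq> b" | "a \<noteq> b" "a \<noteq> c" "b \<noteq> c" by blast
  then show ?thesis
  proof cases
    case 1
    then have eq: "{#a, b, c#} = {#a, a, a#}" by simp
    have "T3 n = {(a, a, a)}" "T2 n = {(a, a)}" "T1 n = {a}" unfolding T3e T2e T1e eq mset3_one by auto
    then show ?thesis by simp
  next
    case 2
    then show ?thesis by (intro two[of a c]) auto
  next
    case 3
    then show ?thesis by (intro two[of a b]) (auto simp: add_mset_commute)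
  next
    case 4
    then show ?thesis by (intro two[of b a]) (auto simp: add_mset_commute)
  next
    case 5
    have "T3 n = {(a, b, c), (a, c, b), (b, a, c), (b, c, a), (c, a, b), (c, b, a)}"
      unfolding T3e mset3_distinct[OF 5] by auto
    moreover have "T2 n = {}" "T1 n = {}" unfolding T2e T1e mset3_distinct[OF 5] using 5 by auto
    ultimately show ?thesis using 5 by simp
  qed
qed

lemma T_count_total:
  assumes n: "n > 0"
  shows "(if Omega n = 3 then 1 else 0) = real (card (T3 n)) / 6 + real (card (T2 n)) / 2 + real (card (T1 n)) / 3"
proof (cases "Omega n = 3")
  case True
  then have "size (prime_factorization n) = Suc (Suc (Suc 0))" by (simp add: Omega_def)
  then obtain a M where "prime_factorization n = add_mset a M" "size M = Suc (Suc 0)" by (metis size_eq_Suc_imp_eq_union size_add_mset old.nat.inject)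
  moreover from this(2) obtain b M' where "M = add_mset b M'" "size M' = Suc 0" by (metis size_eq_Suc_imp_eq_union size_add_mset old.nat.inject)
  moreover from this(2) obtain c where "M' = {#c#}" by (metis size_1_singleton_mset One_nat_def)
  ultimately have "prime_factorization n = {#a, b, c#}" by simp
  from T_count[OF n this] True show ?thesis by simp
next
  case False
  have "\<not> (prime p \<and> prime q \<and> prime r \<and> p * q * r = n)" for p q r
    using prime_factorization_3[of p q r] False by (auto simp: Omega_def)
  then have "T3 n = {}" "T2 n = {}" "T1 n = {}"
    unfolding T3_def T2_def T1_def by (auto simp: power2_eq_square power3_eq_cube mult.assoc)
  then show ?thesis using False by simp
qed

text \<open>Collects terms by the integer they produce; applied to triples, to pairs and to
  cubes.\<close>

lemma regroup:
  fixes S :: "'a set" and g :: "'a \<Rightarrow> nat"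
  assumes fin: "finite S" and sub: "\<And>t. t \<in> S \<Longrightarrow> g t \<ge> 1 \<and> real (g t) \<le> x"
    and T: "\<And>n. n \<ge> 1 \<Longrightarrow> real n \<le> x \<Longrightarrow> {t \<in> S. g t = n} = T n"
  shows "(\<Sum>t\<in>S. 1 / real (g t)) = (\<Sum>n | n \<ge> 1 \<and> real n \<le> x. 1 / real n * real (card (T n)))"
proof -
  have fN: "finite {n::nat. n \<ge> 1 \<and> real n \<le> x}"
    by (rule finite_subset[of _ "{..nat \<lceil>x\<rceil>}"]) (auto simp: le_nat_iff, linarith)
  have "(\<Sum>t\<in>S. 1 / real (g t)) = (\<Sum>n | n \<ge> 1 \<and> real n \<le> x. \<Sum>t\<in>{t \<in> S. g t = n}. 1 / real (g t))"
    by (rule sum.group[OF fin fN, symmetric]) (use sub in auto)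
  also have "\<dots> = (\<Sum>n | n \<ge> 1 \<and> real n \<le> x. 1 / real n * real (card (T n)))"
  proof (rule sum.cong[OF refl])
    fix n assume n: "n \<in> {n. n \<ge> 1 \<and> real n \<le> x}"
    have "(\<Sum>t\<in>{t \<in> S. g t = n}. 1 / real (g t)) = (\<Sum>t\<in>{t \<in> S. g t = n}. 1 / real n)" by (rule sum.cong) auto
    also have "\<dots> = real (card {t \<in> S. g t = n}) * (1 / real n)" by simp
    also have "\<dots> = 1 / real n * real (card (T n))"
    proof -
      have "{t \<in> S. g t = n} = T n" using T n by simp
      then show ?thesis by (simp only: mult.commute)
    qed
    finally show "(\<Sum>t\<in>{t \<in> S. g t = n}. 1 / real (g t)) = 1 / real n * real (card (T n))" .
  qed
  finally show ?thesis .
qed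

lemma recip_sum_3:
  assumes x: "x > 1"
  shows "recip_sum 3 x = S3 (ln x) / 6 + S12 (ln x) / 2 + S0 (ln x) / 3"
proof -
  define u where "u = ln x"
  have fp: "finite (pset u)" by (rule finite_pset)
  have pU: "prime p \<Longrightarrow> real p \<le> x \<Longrightarrow> p \<in> pset u" for p
    using x prime_gt_0_nat[of p] by (simp add: pset_def u_def)
  have pp: "p \<in> pset u \<Longrightarrow> prime p \<and> p \<ge> 1 \<and> real p > 0" for p
    using prime_ge_1_nat[of p] by (auto simp: pset_def prime_gt_0_nat)
  have le1: "real p \<le> x" if "real (p * m) \<le> x" "m \<ge> 1" for p m
  proof -
    have "p \<le> p * m" using that(2) by simp
    then have "real p \<le> real (p * m)" by (simp only: of_nat_le_iff)
    then show ?thesis using that(1) by (rule order_trans)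
  qed
  have lnx: "ln y \<le> u \<longleftrightarrow> y \<le> x" if "y > 0" for y
    unfolding u_def using x that by simp
  define A3 where "A3 = {t \<in> pset u \<times> pset u \<times> pset u. case t of (p, q, r) \<Rightarrow> real (p * q * r) \<le> x}"
  have "S3 u = (\<Sum>t\<in>pset u \<times> pset u \<times> pset u. case t of (p, q, r) \<Rightarrow> 1 / (real p * real q * real r) * ramp 0 (u - ln (real p) - ln (real q) - ln (real r)))"
    unfolding S3_def by (simp add: sum.cartesian_product)
  also have "\<dots> = (\<Sum>t\<in>A3. 1 / real (case t of (p, q, r) \<Rightarrow> p * q * r))"
  proof (rule sum.mono_neutral_cong_right)
    fix t assume t: "t \<in> A3"
    obtain p q r where tt: "t = (p, q, r)" by (cases t)
    have pos: "real p > 0" "real q > 0" "real r > 0" "real (p * q * r) \<le> x" using t pp by (auto simp: A3_def tt)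
    have "ln (real p * real q * real r) \<le> u" using lnx[of "real p * real q * real r"] pos by simp
    then have "ln (real p) + ln (real q) + ln (real r) \<le> u" using pos by (simp add: ln_mult)
    then have "ramp 0 (u - ln (real p) - ln (real q) - ln (real r)) = 1" by (simp add: ramp_def)
    then show "(case t of (p, q, r) \<Rightarrow> 1 / (real p * real q * real r) * ramp 0 (u - ln (real p) - ln (real q) - ln (real r))) = 1 / real (case t of (p, q, r) \<Rightarrow> p * q * r)"
      by (simp add: tt)
  next
    show "\<forall>t\<in>pset u \<times> pset u \<times> pset u - A3. (case t of (p, q, r) \<Rightarrow> 1 / (real p * real q * real r) * ramp 0 (u - ln (real p) - ln (real q) - ln (real r))) = 0"
    proof
      fix t assume t: "t \<in> pset u \<times> pset u \<times> pset u - A3"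
      obtain p q r where tt: "t = (p, q, r)" by (cases t)
      have pos: "real p > 0" "real q > 0" "real r > 0" "\<not> real (p * q * r) \<le> x" using t pp by (auto simp: A3_def tt)
      have "\<not> ln (real p * real q * real r) \<le> u" using lnx[of "real p * real q * real r"] pos by simp
      then have "\<not> ln (real p) + ln (real q) + ln (real r) \<le> u" using pos by (simp add: ln_mult)
      then have "ramp 0 (u - ln (real p) - ln (real q) - ln (real r)) = 0" by (simp add: ramp_def)
      then show "(case t of (p, q, r) \<Rightarrow> 1 / (real p * real q * real r) * ramp 0 (u - ln (real p) - ln (real q) - ln (real r))) = 0"
        by (simp add: tt)
    qed
  qed (use fp in \<open>auto simp: A3_def\<close>)
  also have "\<dots> = (\<Sum>n | n \<ge> 1 \<and> real n \<le> x. 1 / real n * real (card (T3 n)))"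
  proof (rule regroup)
    show "finite A3" unfolding A3_def using fp by simp
    show "1 \<le> (case t of (p, q, r) \<Rightarrow> p * q * r) \<and> real (case t of (p, q, r) \<Rightarrow> p * q * r) \<le> x" if "t \<in> A3" for t
      using that pp by (auto simp: A3_def Suc_le_eq)
    fix n assume n: "1 \<le> n" "real n \<le> x"
    show "{t \<in> A3. (case t of (p, q, r) \<Rightarrow> p * q * r) = n} = T3 n"
    proof (intro equalityI subsetI)
      fix t assume "t \<in> T3 n"
      then obtain p q r where t: "t = (p, q, r)" "prime p" "prime q" "prime r" "p * q * r = n" by (auto simp: T3_def)
      have g1: "p \<ge> 1" "q \<ge> 1" "r \<ge> 1" using t prime_ge_1_nat by auto
      then have g2: "q * r \<ge> 1" "p * r \<ge> 1" "p * q \<ge> 1" by (simp_all add: Suc_le_eq)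
      have "real (p * (q * r)) \<le> x" "real (q * (p * r)) \<le> x" "real (r * (p * q)) \<le> x" using t(5) n by (simp_all add: mult_ac)
      then have "p \<in> pset u" "q \<in> pset u" "r \<in> pset u" using le1 g2 t pU by blast+
      then show "t \<in> {t \<in> A3. (case t of (p, q, r) \<Rightarrow> p * q * r) = n}" using t n by (simp add: A3_def del: of_nat_mult)
    qed (auto simp: A3_def T3_def pset_def)
  qed
  finally have e3: "S3 u = (\<Sum>n | n \<ge> 1 \<and> real n \<le> x. 1 / real n * real (card (T3 n)))" .
  define A2 where "A2 = {t \<in> pset u \<times> pset u. case t of (q, p) \<Rightarrow> real (p * q ^ 2) \<le> x}"
  have "S12 u = (\<Sum>q\<in>pset u. \<Sum>p\<in>pset u. 1 / real q ^ 2 * (1 / real p * indicator {ln (real p)..} (u - 2 * ln (real q))))"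
    unfolding S12_def
  proof (rule sum.cong[OF refl])
    fix q assume "q \<in> pset u"
    then have "u - 2 * ln (real q) \<le> u" using ln_prime_pos[of q] by (auto simp: pset_def)
    from msum_pset[OF this] show "1 / real q ^ 2 * msum (u - 2 * ln (real q)) = (\<Sum>p\<in>pset u. 1 / real q ^ 2 * (1 / real p * indicator {ln (real p)..} (u - 2 * ln (real q))))"
      by (simp add: sum_distrib_left)
  qed
  also have "\<dots> = (\<Sum>t\<in>pset u \<times> pset u. case t of (q, p) \<Rightarrow> 1 / real q ^ 2 * (1 / real p * indicator {ln (real p)..} (u - 2 * ln (real q))))"
    by (simp add: sum.cartesian_product)
  also have "\<dots> = (\<Sum>t\<in>A2. 1 / real (case t of (q, p) \<Rightarrow> p * q ^ 2))"
  proof (rule sum.mono_neutral_cong_right)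
    fix t assume t: "t \<in> A2"
    obtain q p where tt: "t = (q, p)" by (cases t)
    have pos: "real p > 0" "real q > 0" "real (p * q ^ 2) \<le> x" using t pp by (auto simp: A2_def tt)
    have "ln (real p * real q ^ 2) \<le> u" using lnx[of "real p * real q ^ 2"] pos by simp
    then have "ln (real p) + 2 * ln (real q) \<le> u" using pos by (simp add: ln_mult ln_realpow)
    then show "(case t of (q, p) \<Rightarrow> 1 / real q ^ 2 * (1 / real p * indicator {ln (real p)..} (u - 2 * ln (real q)))) = 1 / real (case t of (q, p) \<Rightarrow> p * q ^ 2)"
      by (simp add: tt)
  next
    show "\<forall>t\<in>pset u \<times> pset u - A2. (case t of (q, p) \<Rightarrow> 1 / real q ^ 2 * (1 / real p * indicator {ln (real p)..} (u - 2 * ln (real q)))) = 0"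
    proof
      fix t assume t: "t \<in> pset u \<times> pset u - A2"
      obtain q p where tt: "t = (q, p)" by (cases t)
      have pos: "real p > 0" "real q > 0" "\<not> real (p * q ^ 2) \<le> x" using t pp by (auto simp: A2_def tt)
      have "\<not> ln (real p * real q ^ 2) \<le> u" using lnx[of "real p * real q ^ 2"] pos by simp
      then have "\<not> ln (real p) + 2 * ln (real q) \<le> u" using pos by (simp add: ln_mult ln_realpow)
      then show "(case t of (q, p) \<Rightarrow> 1 / real q ^ 2 * (1 / real p * indicator {ln (real p)..} (u - 2 * ln (real q)))) = 0"
        by (simp add: tt)
    qed
  qed (use fp in \<open>auto simp: A2_def\<close>)
  \<comment> \<open>\<open>A2\<close> has the squared prime first, following the order of summation
    in \<open>S12\<close>, so \<open>T2\<close> is swapped.\<close>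
  also have "\<dots> = (\<Sum>n | n \<ge> 1 \<and> real n \<le> x. 1 / real n * real (card ((\<lambda>(p, q). (q, p)) ` T2 n)))"
  proof (rule regroup)
    show "finite A2" unfolding A2_def using fp by simp
    show "1 \<le> (case t of (q, p) \<Rightarrow> p * q ^ 2) \<and> real (case t of (q, p) \<Rightarrow> p * q ^ 2) \<le> x" if "t \<in> A2" for t
      using that pp by (auto simp: A2_def Suc_le_eq)
    fix n assume n: "1 \<le> n" "real n \<le> x"
    show "{t \<in> A2. (case t of (q, p) \<Rightarrow> p * q ^ 2) = n} = (\<lambda>(p, q). (q, p)) ` T2 n"
    proof (intro equalityI subsetI)
      fix t assume "t \<in> (\<lambda>(p, q). (q, p)) ` T2 n"
      then obtain p q where t: "t = (q, p)" "prime p" "prime q" "p * q ^ 2 = n" by (auto simp: T2_def)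
      have g1: "p \<ge> 1" "q \<ge> 1" using t prime_ge_1_nat by auto
      then have g2: "q ^ 2 \<ge> 1" "p * q \<ge> 1" by (simp_all add: Suc_le_eq)
      have "real (p * q ^ 2) \<le> x" "real (q * (p * q)) \<le> x" using t(4) n by (simp_all add: mult_ac power2_eq_square)
      then have "p \<in> pset u" "q \<in> pset u" using le1 g2 t pU by blast+
      then show "t \<in> {t \<in> A2. (case t of (q, p) \<Rightarrow> p * q ^ 2) = n}" using t n by (simp add: A2_def del: of_nat_mult of_nat_power)
    qed (auto simp: A2_def T2_def pset_def image_iff)
  qed
  also have "\<dots> = (\<Sum>n | n \<ge> 1 \<and> real n \<le> x. 1 / real n * real (card (T2 n)))"
    by (intro sum.cong refl arg_cong2[of _ _ _ _ "times"] arg_cong[of _ _ real] card_image) (auto simp: inj_on_def)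
  finally have e2: "S12 u = (\<Sum>n | n \<ge> 1 \<and> real n \<le> x. 1 / real n * real (card (T2 n)))" .
  define A1 where "A1 = {q \<in> pset u. real (q ^ 3) \<le> x}"
  have "S0 u = (\<Sum>q\<in>A1. 1 / real (q ^ 3))"
    unfolding S0_def
  proof (rule sum.mono_neutral_cong_right)
    have iff: "3 * ln (real q) \<le> u \<longleftrightarrow> real (q ^ 3) \<le> x" if "q \<in> pset u" for q
      using lnx[of "real q ^ 3"] pp[OF that] by (simp add: ln_realpow)
    show "\<forall>q\<in>pset u - A1. 1 / real q ^ 3 * (if 3 * ln (real q) \<le> u then 1 else 0) = 0" using iff by (auto simp: A1_def)
    show "1 / real q ^ 3 * (if 3 * ln (real q) \<le> u then 1 else 0) = 1 / real (q ^ 3)" if "q \<in> A1" for q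
      using iff that by (auto simp: A1_def)
  qed (use fp in \<open>auto simp: A1_def\<close>)
  also have "\<dots> = (\<Sum>n | n \<ge> 1 \<and> real n \<le> x. 1 / real n * real (card (T1 n)))"
  proof (rule regroup)
    show "finite A1" unfolding A1_def using fp by simp
    show "1 \<le> t ^ 3 \<and> real (t ^ 3) \<le> x" if "t \<in> A1" for t using that pp by (auto simp: A1_def Suc_le_eq)
    fix n assume n: "1 \<le> n" "real n \<le> x"
    show "{t \<in> A1. t ^ 3 = n} = T1 n"
    proof (intro equalityI subsetI)
      fix t assume "t \<in> T1 n"
      then have t: "prime t" "t ^ 3 = n" by (auto simp: T1_def)
      have "t ^ 2 \<ge> 1" using prime_ge_1_nat[OF t(1)] by simp
      moreover have "real (t * t ^ 2) \<le> x" using t(2) n by (simp add: power3_eq_cube power2_eq_square mult_ac)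
      ultimately have "t \<in> pset u" using le1 t pU by blast
      then show "t \<in> {t \<in> A1. t ^ 3 = n}" using t n by (auto simp: A1_def simp del: of_nat_power)
    qed (auto simp: A1_def T1_def pset_def)
  qed
  finally have e1: "S0 u = (\<Sum>n | n \<ge> 1 \<and> real n \<le> x. 1 / real n * real (card (T1 n)))" .
  have fN: "finite {n::nat. n \<ge> 1 \<and> real n \<le> x}"
    by (rule finite_subset[of _ "{..nat \<lceil>x\<rceil>}"]) (auto simp: le_nat_iff, linarith)
  have "recip_sum 3 x = (\<Sum>n | n \<ge> 1 \<and> real n \<le> x. 1 / real n * (if Omega n = 3 then 1 else 0))"
    unfolding recip_sum_def by (rule sum.mono_neutral_cong_left[OF fN]) auto
  also have "\<dots> = (\<Sum>n | n \<ge> 1 \<and> real n \<le> x. (1 / real n * real (card (T3 n))) / 6 + (1 / real n * real (card (T2 n))) / 2 + (1 / real n * real (card (T1 n))) / 3)"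
    by (intro sum.cong refl) (subst T_count_total, auto simp: distrib_left)
  also have "\<dots> = S3 u / 6 + S12 u / 2 + S0 u / 3"
    unfolding e3 e2 e1 by (simp add: sum.distrib sum_divide_distrib)
  finally show ?thesis by (simp add: u_def)
qed

section \<open>The expansion\<close>

text \<open>The \<alpha>'s are moments of \<open>err\<close> with the index shifted by one, and k
  C(k-1, i) = (i+1) C(k, i+1) turns the binomial formula of \<open>mom_conv\<close> into the shape
  of \<open>r_coeff\<close>. At \<open>k = 0\<close> the truncated \<open>k - 1\<close> is harmless
  because both sides vanish.\<close>

lemma mom_err_conv_eq:
  "real k * mom (conv err err) (k - 1) = (\<Sum>i=1..k. real i * real (k choose i) * (alpha i * alpha (Suc k - i)))"
proof (cases k)
  case 0
  then show ?thesis by simp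
next
  case (Suc m)
  have "real k * mom (conv err err) (k - 1) = (\<Sum>i\<le>m. real (Suc m) * (real (m choose i) * mom err i * mom err (m - i)))"
    using mom_conv[OF rapid_err rapid_err, of m] Suc by (simp add: sum_distrib_left)
  also have "\<dots> = (\<Sum>i\<le>m. real (Suc i) * real (Suc m choose Suc i) * (alpha (Suc i) * alpha (Suc k - Suc i)))"
  proof (rule sum.cong[OF refl])
    fix i assume "i \<in> {..m}"
    then have i: "i \<le> m" by simp
    have "real (Suc i * (Suc m choose Suc i)) = real (Suc m * (m choose i))" by (simp only: Suc_times_binomial)
    then have b: "real (Suc i) * real (Suc m choose Suc i) = real (Suc m) * real (m choose i)" by (simp only: of_nat_mult)
    have "alpha (Suc i) = mom err i" "alpha (Suc k - Suc i) = mom err (m - i)"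
      using i Suc by (simp_all add: alpha_eq Suc_diff_le)
    then show "real (Suc m) * (real (m choose i) * mom err i * mom err (m - i)) = real (Suc i) * real (Suc m choose Suc i) * (alpha (Suc i) * alpha (Suc k - Suc i))"
      unfolding b by simp
  qed
  also have "\<dots> = (\<Sum>i=Suc 0..Suc m. real i * real (Suc m choose i) * (alpha i * alpha (Suc k - i)))"
    unfolding atMost_atLeast0 sum.shift_bounds_cl_Suc_ivl ..
  finally show ?thesis using Suc by simp
qed

text \<open>The three sources of the coefficient: prime squares from \<open>S12\<close>, harmonic
  numbers from the derivatives of \<open>p2fun\<close>, and the convolution square of
  \<open>err\<close>.\<close>

lemma r_coeff_eq:
  "r_coeff (Suc k) = 2 ^ k * alpha_pow (Suc k) 2 / real (Suc k) + mom err k * harm k + real k * mom (conv err err) (k - 1) / 2"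
proof -
  have "(\<Sum>i=1..k. alpha (Suc k) / real i) = mom err k * harm k"
    by (simp add: harm_def sum_distrib_left alpha_eq divide_inverse)
  moreover have "(\<Sum>i=1..k. real i * real (k choose i) * (alpha i * alpha (Suc k - i) / 2)) = real k * mom (conv err err) (k - 1) / 2"
    unfolding mom_err_conv_eq sum_divide_distrib by simp
  ultimately show ?thesis unfolding r_coeff_def by (simp add: sum.distrib)
qed

text \<open>By \<open>r_coeff_eq\<close> everything with index below M cancels. The surplus up to n,
  forced by the precision that the second difference demands, is what stands on the right.\<close>

lemma main_sum_identity:
  fixes u l :: real
  assumes "M \<le> n"
  shows "(\<Sum>k<n. mom err k * (l - harm k) / u ^ Suc k) - (\<Sum>k<Suc n. real k * mom (conv err err) (k - 1) / 2 / u ^ Suc k)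
       - (\<Sum>j=1..<Suc M. 2 ^ j * alpha_pow j 2 / (real j * u ^ j)) / 2
       - (\<Sum>j=1..<Suc M. (alpha j * l - r_coeff j) / u ^ j)
     = (\<Sum>k=M..<n. mom err k * (l - harm k) / u ^ Suc k) - (\<Sum>k=M..<Suc n. real k * mom (conv err err) (k - 1) / 2 / u ^ Suc k)"
proof -
  have split: "(\<Sum>k<m. f k) = (\<Sum>k<M. f k) + (\<Sum>k=M..<m. f k)" if "M \<le> m" for f :: "nat \<Rightarrow> real" and m
    unfolding lessThan_atLeast0 using that by (simp add: sum.atLeastLessThan_concat)
  have a: "(\<Sum>j=1..<Suc M. 2 ^ j * alpha_pow j 2 / (real j * u ^ j)) / 2 = (\<Sum>k<M. 2 ^ k * alpha_pow (Suc k) 2 / real (Suc k) / u ^ Suc k)"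
    unfolding One_nat_def sum.shift_bounds_Suc_ivl lessThan_atLeast0 sum_divide_distrib by (intro sum.cong refl) simp
  have b: "(\<Sum>j=1..<Suc M. (alpha j * l - r_coeff j) / u ^ j) =
     (\<Sum>k<M. mom err k * (l - harm k) / u ^ Suc k) - (\<Sum>k<M. real k * mom (conv err err) (k - 1) / 2 / u ^ Suc k) - (\<Sum>k<M. 2 ^ k * alpha_pow (Suc k) 2 / real (Suc k) / u ^ Suc k)"
    unfolding One_nat_def sum.shift_bounds_Suc_ivl lessThan_atLeast0 sum_subtractf[symmetric]
    by (intro sum.cong refl) (simp add: r_coeff_eq alpha_eq diff_divide_distrib add_divide_distrib right_diff_distrib del: of_nat_Suc power_Suc)
  show ?thesis unfolding a b using split[of n "\<lambda>k. mom err k * (l - harm k) / u ^ Suc k"]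
      split[of "Suc n" "\<lambda>k. real k * mom (conv err err) (k - 1) / 2 / u ^ Suc k"] assms by linarith
qed

text \<open>The sum with \<open>conv err err\<close> is reindexed so that both sums run over
  u^(k+1); the added term at k = 0 is zero.\<close>

lemma M3_approx_2_sixth:
  assumes "u > 0"
  shows "M3_approx n 2 u / 6 = (ln u + mertens_const) ^ 3 / 6 - zeta 2 / 2 * (ln u + mertens_const) + zeta 3 / 3
     + (\<Sum>k<n. mom err k * (ln u + mertens_const - harm k) / u ^ Suc k)
     - (\<Sum>k<Suc n. real k * mom (conv err err) (k - 1) / 2 / u ^ Suc k)"
proof -
  have 1: "(\<Sum>j<n. 6 * (mom err j * (ln u + mertens_const - harm j)) / u ^ Suc j) / 6 = (\<Sum>k<n. mom err k * (ln u + mertens_const - harm k) / u ^ Suc k)"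
    unfolding sum_divide_distrib by (intro sum.cong refl) simp
  have 2: "(\<Sum>j<n. 3 * (real (Suc j) * mom (conv err err) j) / u ^ Suc (Suc j)) / 6 = (\<Sum>k<Suc n. real k * mom (conv err err) (k - 1) / 2 / u ^ Suc k)"
    unfolding sum.lessThan_Suc_shift sum_divide_distrib by (simp del: of_nat_Suc power_Suc)
  show ?thesis unfolding M3_approx_2_eq[OF assms] add_divide_distrib diff_divide_distrib 1 2 by simp
qed

lemma tail_bound:
  fixes u :: real and f :: "nat \<Rightarrow> real"
  assumes "u \<ge> 1"
  shows "\<bar>\<Sum>k=M..<n. f k / u ^ Suc k\<bar> \<le> (\<Sum>k=M..<n. \<bar>f k\<bar>) / u ^ Suc M"
proof -
  have "\<bar>\<Sum>k=M..<n. f k / u ^ Suc k\<bar> \<le> (\<Sum>k=M..<n. \<bar>f k / u ^ Suc k\<bar>)" by (rule sum_abs)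
  also have "\<dots> \<le> (\<Sum>k=M..<n. \<bar>f k\<bar> / u ^ Suc M)"
  proof (rule sum_mono)
    fix k assume "k \<in> {M..<n}"
    then have "u ^ Suc M \<le> u ^ Suc k" using assms by (intro power_increasing) auto
    then have "\<bar>f k\<bar> / u ^ Suc k \<le> \<bar>f k\<bar> / u ^ Suc M" using assms by (intro divide_left_mono mult_pos_pos zero_less_power) auto
    then show "\<bar>f k / u ^ Suc k\<bar> \<le> \<bar>f k\<bar> / u ^ Suc M" using assms by simp
  qed
  finally show ?thesis by (simp only: sum_divide_distrib)
qed

text \<open>The surplus terms of the first sum carry the factor ln ln x + beta, and this is the
  origin of the double logarithm in the error term.\<close>

lemma recip_sum_estimate:
  "\<exists>A B U. 1 \<le> U \<and> 0 \<le> A \<and> (\<forall>x>1. ln x \<ge> U \<longrightarrow>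
     \<bar>recip_sum 3 x - ((ln (ln x) + mertens_const) ^ 3 / 6
             + (prime_zeta 2 - zeta 2) / 2 * (ln (ln x) + mertens_const)
             + (prime_zeta 3 + zeta 3) / 3
             + (\<Sum>j = 1..<Suc M. (alpha j * (ln (ln x) + mertens_const) - r_coeff j) / ln x ^ j))\<bar>
     \<le> (A * \<bar>ln (ln x) + mertens_const\<bar> + B) / ln x ^ Suc M)"
proof -
  define N where "N = Suc M"
  define n where "n = 3 * N + 2"
  obtain C1 U1 where 1: "1 \<le> U1" "\<And>u. u \<ge> U1 \<Longrightarrow> \<bar>S3 u - M3_approx n 2 u\<bar> \<le> C1 / u ^ N"
    using S3_asymp[of N] unfolding n_def by blast
  obtain C2 U2 where 2: "1 \<le> U2" "\<And>u. u \<ge> U2 \<Longrightarrow> \<bar>S12 u - (prime_zeta 2 * (ln u + mertens_const) - (\<Sum>j=1..<N. 2 ^ j * alpha_pow j 2 / (real j * u ^ j)))\<bar> \<le> C2 / u ^ N"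
    using S12_asymp[of N] unfolding N_def by auto
  obtain C3 where 3: "\<And>u. u \<ge> 1 \<Longrightarrow> \<bar>S0 u - prime_zeta 3\<bar> \<le> C3 / u ^ N" using S0_asymp[of N] by blast
  define A where "A = (\<Sum>k=M..<n. \<bar>mom err k\<bar>)"
  define B1 where "B1 = (\<Sum>k=M..<n. \<bar>mom err k\<bar> * harm k)"
  define B2 where "B2 = (\<Sum>k=M..<Suc n. \<bar>real k * mom (conv err err) (k - 1) / 2\<bar>)"
  have main: "\<bar>recip_sum 3 x - ((ln (ln x) + mertens_const) ^ 3 / 6
             + (prime_zeta 2 - zeta 2) / 2 * (ln (ln x) + mertens_const)
             + (prime_zeta 3 + zeta 3) / 3
             + (\<Sum>j = 1..<Suc M. (alpha j * (ln (ln x) + mertens_const) - r_coeff j) / ln x ^ j))\<bar>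
     \<le> (A * \<bar>ln (ln x) + mertens_const\<bar> + (C1 / 6 + C2 / 2 + C3 / 3 + B1 + B2)) / ln x ^ Suc M"
    if x1: "x > 1" and xu: "ln x \<ge> max U1 U2" for x
  proof -
    define u where "u = ln x"
    define l where "l = ln u + mertens_const"
    have u: "u \<ge> U1" "u \<ge> U2" "u \<ge> 1" "u > 0" using xu 1(1) by (auto simp: u_def)
    have rs: "recip_sum 3 x = S3 u / 6 + S12 u / 2 + S0 u / 3" using recip_sum_3[OF x1] by (simp add: u_def)
    let ?s1 = "\<Sum>k=M..<n. mom err k * (l - harm k) / u ^ Suc k"
    let ?s2 = "\<Sum>k=M..<Suc n. real k * mom (conv err err) (k - 1) / 2 / u ^ Suc k"
    have t1: "\<bar>?s1\<bar> \<le> (A * \<bar>l\<bar> + B1) / u ^ Suc M"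
    proof -
      have "\<bar>?s1\<bar> \<le> (\<Sum>k=M..<n. \<bar>mom err k * (l - harm k)\<bar>) / u ^ Suc M" by (rule tail_bound[OF u(3)])
      also have "\<dots> \<le> (\<Sum>k=M..<n. \<bar>mom err k\<bar> * \<bar>l\<bar> + \<bar>mom err k\<bar> * harm k) / u ^ Suc M"
      proof (intro divide_right_mono sum_mono)
        fix k
        have "\<bar>l - h\<bar> \<le> \<bar>l\<bar> + h" if "0 \<le> h" for h using that by linarith
        from mult_left_mono[OF this[OF harm_nonneg], of "\<bar>mom err k\<bar>" k]
        show "\<bar>mom err k * (l - harm k)\<bar> \<le> \<bar>mom err k\<bar> * \<bar>l\<bar> + \<bar>mom err k\<bar> * harm k" by (simp add: abs_mult distrib_left)
      qed (use u in simp)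
      also have "(\<Sum>k=M..<n. \<bar>mom err k\<bar> * \<bar>l\<bar> + \<bar>mom err k\<bar> * harm k) = A * \<bar>l\<bar> + B1"
        unfolding A_def B1_def by (simp add: sum.distrib sum_distrib_right)
      finally show ?thesis .
    qed
    have t2: "\<bar>?s2\<bar> \<le> B2 / u ^ Suc M" unfolding B2_def by (rule tail_bound[OF u(3)])
    have Mn: "M \<le> n" by (simp add: n_def N_def)
    note id = main_sum_identity[OF Mn, of l u] and x6 = M3_approx_2_sixth[OF u(4), of n, folded l_def]
    have z: "(prime_zeta 2 - zeta 2) / 2 * l = prime_zeta 2 * l / 2 - zeta 2 / 2 * l" "(prime_zeta 3 + zeta 3) / 3 = prime_zeta 3 / 3 + zeta 3 / 3"
      by (simp_all add: left_diff_distrib diff_divide_distrib add_divide_distrib)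
    \<comment> \<open>Once every nonlinear quantity has a name, combining the three asymptotics with
      the two exact identities is linear arithmetic.\<close>
    have ar: "\<bar>(s3 / 6 + s12 / 2 + s0 / 3) - (l3 + (pl / 2 - zl) + (p3 / 3 + z3) + sj)\<bar> \<le> (d1 / 6 + d2 / 2 + d3 / 3) + e1 + e2"
      if "\<bar>s3 - xx\<bar> \<le> d1" "\<bar>s12 - (pl - sa)\<bar> \<le> d2" "\<bar>s0 - p3\<bar> \<le> d3" "xx / 6 = l3 - zl + z3 + f1 - f2"
        "f1 - f2 - sa / 2 - sj = r1 - r2" "\<bar>r1\<bar> \<le> e1" "\<bar>r2\<bar> \<le> e2"
      for s3 s12 s0 l3 pl zl p3 z3 sj d1 d2 d3 e1 e2 xx sa f1 f2 r1 r2 :: real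
      using that by linarith
    have "\<bar>recip_sum 3 x - (l ^ 3 / 6 + (prime_zeta 2 - zeta 2) / 2 * l + (prime_zeta 3 + zeta 3) / 3 + (\<Sum>j = 1..<Suc M. (alpha j * l - r_coeff j) / u ^ j))\<bar>
       \<le> (C1 / u ^ N / 6 + C2 / u ^ N / 2 + C3 / u ^ N / 3) + (A * \<bar>l\<bar> + B1) / u ^ Suc M + B2 / u ^ Suc M"
      unfolding rs z
      by (rule ar[OF 1(2)[OF u(1)] 2(2)[OF u(2), folded l_def] 3[OF u(3)] x6 _ t1 t2]) (unfold N_def, rule id)
    also have "\<dots> = (A * \<bar>l\<bar> + (C1 / 6 + C2 / 2 + C3 / 3 + B1 + B2)) / u ^ Suc M"
      by (simp add: N_def add_divide_distrib)
    finally show ?thesis by (simp only: l_def u_def)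
  qed
  moreover have "A \<ge> 0" by (simp add: A_def sum_nonneg)
  ultimately show ?thesis using 1(1)
    by (intro exI[of _ A] exI[of _ "C1 / 6 + C2 / 2 + C3 / 3 + B1 + B2"] exI[of _ "max U1 U2"]) auto
qed

theorem theorem1p2:
  fixes N :: nat
  assumes "N > 0"
  shows "(\<lambda>x::real. recip_sum 3 x -
            ((ln (ln x) + mertens_const) ^ 3 / 6
             + (prime_zeta 2 - zeta 2) / 2 * (ln (ln x) + mertens_const)
             + (prime_zeta 3 + zeta 3) / 3
             + (\<Sum>j = 1..<N. (alpha j * (ln (ln x) + mertens_const) - r_coeff j) / ln x ^ j)))
         \<in> O[at_top](\<lambda>x. ln (ln x) / ln x ^ N)"
proof -
  obtain M where M: "N = Suc M" using assms gr0_implies_Suc by blast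
  obtain A B U where U: "1 \<le> U" "0 \<le> A" and est: "\<And>x. x > 1 \<Longrightarrow> ln x \<ge> U \<Longrightarrow>
     \<bar>recip_sum 3 x - ((ln (ln x) + mertens_const) ^ 3 / 6
             + (prime_zeta 2 - zeta 2) / 2 * (ln (ln x) + mertens_const)
             + (prime_zeta 3 + zeta 3) / 3
             + (\<Sum>j = 1..<N. (alpha j * (ln (ln x) + mertens_const) - r_coeff j) / ln x ^ j))\<bar>
     \<le> (A * \<bar>ln (ln x) + mertens_const\<bar> + B) / ln x ^ N"
    using recip_sum_estimate[of M] unfolding M by blast
  define c where "c = A * (1 + \<bar>mertens_const\<bar>) + \<bar>B\<bar>"
  \<comment> \<open>ln x \<ge> e gives ln (ln x) \<ge> 1, so that the constants can be absorbed into
    the double logarithm.\<close>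
  have "\<forall>\<^sub>F x in at_top. ln x \<ge> max U (exp 1)"
    by (rule filterlim_at_top[THEN iffD1, OF ln_at_top, rule_format])
  with eventually_gt_at_top[of "1::real"] show ?thesis
  proof (intro bigoI[where c = c], eventually_elim)
    case (elim x)
    define u where "u = ln x"
    have x1: "x > 1" using elim by auto
    have u: "u \<ge> U" "u \<ge> exp 1" "u > 0" using elim U(1) by (auto simp: u_def)
    have "ln (exp 1) \<le> ln u" using u by (subst ln_le_cancel_iff) auto
    then have l1: "1 \<le> ln u" by simp
    have "A * \<bar>ln u + mertens_const\<bar> + B \<le> A * ((1 + \<bar>mertens_const\<bar>) * ln u) + \<bar>B\<bar> * ln u"
    proof (intro add_mono mult_left_mono U(2))
      have "\<bar>mertens_const\<bar> * 1 \<le> \<bar>mertens_const\<bar> * ln u" by (intro mult_left_mono l1) simp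
      moreover have "\<bar>ln u + mertens_const\<bar> \<le> ln u + \<bar>mertens_const\<bar>" using l1 by linarith
      ultimately show "\<bar>ln u + mertens_const\<bar> \<le> (1 + \<bar>mertens_const\<bar>) * ln u" by (simp add: distrib_right)
      have "\<bar>B\<bar> * 1 \<le> \<bar>B\<bar> * ln u" by (intro mult_left_mono l1) simp
      then show "B \<le> \<bar>B\<bar> * ln u" by linarith
    qed
    then have "A * \<bar>ln u + mertens_const\<bar> + B \<le> c * ln u" by (simp add: c_def distrib_right mult.assoc)
    then have "(A * \<bar>ln u + mertens_const\<bar> + B) / u ^ N \<le> c * ln u / u ^ N" using u by (intro divide_right_mono) auto
    moreover have "norm (ln (ln x) / ln x ^ N) = ln u / u ^ N" using u l1 by (simp add: u_def[symmetric])
    ultimately show ?case using est[of x] x1 u unfolding real_norm_def u_def[symmetric] by simp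
  qed
qed

end
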